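(* Let $X$ be a spectrally negative Lévy process, let $e_r$ be an exponential random variable with rate $r$ independent of $X$, and let $$T^-(r):=\sup\{0<t\le e_r: X_t>0\},\qquad \sup\emptyset:=0 .$$ For any $p,q,r,\theta>0$ and $x\in\mathbb{R}$ we have $$\mathbb{E}_x\Big[e^{-pT^-(r)+\theta X_{T^-(r)}-q\int_0^{T^-(r)}1_{\{X_s\ge0\}}\,ds};\,T^-(r)<e_r\Big]=\frac1q\big(\Phi(p+q+r)-\Phi(p+r)\big)Z^{(p+q+r)}(x,\Phi(p+r))\left(\frac{p+q+r-\psi(\theta+\Phi(r))}{\Phi(p+q+r)-\theta-\Phi(r)}-\frac{p+q+r-\psi(\theta)}{\Phi(p+q+r)-\theta}\right)+Z^{(p+q+r)}(x,\theta)-Z^{(p+q+r)}(x,\theta+\Phi(r))$$ and $$\mathbb{E}_x\Big[e^{-pT^-(r)-q\int_0^{T^-(r)}1_{\{X_s\ge0\}}\,ds-\theta X_{T^-(r)}};\,T^-(r)=e_r\Big]=\frac rq\cdot\frac{\Phi(p+q+r)-\Phi(p+r)}{\theta+\Phi(p+q+r)}\,Z^{(p+q+r)}(x,\Phi(p+r))-r\int_0^x e^{-\theta y}W^{(p+q+r)}(x-y)\,dy,$$ where the last integral is read as $0$ for $x<0$, and where a quotient whose denominator vanishes (at $\theta=\Phi(p+q+r)$ or $\theta+\Phi(r)=\Phi(p+q+r)$) is understood as its limit.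
   Context: A spectrally negative Lévy process $X$ is a real-valued Lévy process with right-continuous sample paths and no positive jumps; processes with monotone decreasing paths (negatives of subordinators, including the zero process and negative deterministic drift) are excluded. Under $\mathbb{P}_x$ (expectation $\mathbb{E}_x$) the process starts at $X_0=x$; $\mathbb{E}=\mathbb{E}_0$. For an event $A$ and a random variable $Y$, $\mathbb{E}_x[Y;A]:=\mathbb{E}_x[Y1_A]$. Laplace exponent: $\frac1t\log\mathbb{E}e^{\lambda X_t}=\psi(\lambda)$ for $t>0$, $\lambda\ge0$, with $\psi(\lambda)=a\lambda+\frac12\sigma^2\lambda^2+\int_{-\infty}^0(e^{\lambda x}-1-\lambda x1_{\{x>-1\}})\,\Pi(dx)$, where $\Pi$ is a $\sigma$-finite measure on $(-\infty,0)$ with $\int_{-\infty}^0(x^2\wedge1)\,\Pi(dx)<\infty$. $\Phi:[0,\infty)\to[0,\infty)$ is the (right) inverse of $\psi$: $\Phi(q)=\sup\{\lambda\ge0:\psi(\lambda)=q\}$. Scale functions: for $q\ge0$, $W^{(q)}$ is the nonnegative increasing function on $[0,\infty)$ (continuous on $(0,\infty)$, right-continuous at $0$) with $\int_0^\infty e^{-\lambda x}W^{(q)}(x)\,dx=\frac{1}{\psi(\lambda)-q}$ for $\lambda>\Phi(q)$, and $W^{(q)}(x):=0$ for $x<0$. Further, $Z^{(q)}(x,\theta):=e^{\theta x}\Big(1+(q-\psi(\theta))\int_0^x e^{-\theta y}W^{(q)}(y)\,dy\Big)$ for $x\ge0$, and $Z^{(q)}(x,\theta):=e^{\theta x}$ for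 $x<0$. *)

theory Defs
  imports "HOL-Probability.Probability"
begin

section \<open>Spectrally negative Levy processes\<close>

text \<open>Processes are indexed by \<^typ>\<open>real\<close>; only the times \<open>t \<ge> 0\<close> matter.\<close>

definition path_sigma :: "'a measure \<Rightarrow> (real \<Rightarrow> 'a \<Rightarrow> real) \<Rightarrow> real set \<Rightarrow> 'a set set" where
  "path_sigma M X I =
     sets (vimage_algebra (space M) (\<lambda>\<omega>. \<lambda>t\<in>I. X t \<omega>) (PiM I (\<lambda>_. borel)))"

definition var_sigma :: "'a measure \<Rightarrow> ('a \<Rightarrow> real) \<Rightarrow> 'a set set" where
  "var_sigma M Y = sets (vimage_algebra (space M) Y borel)"

text \<open>The process is taken under \<open>P = P\<^sub>0\<close>; the law under \<open>P\<^sub>x\<close> is that of \<open>x + X\<close>.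
  In \<open>paths_no_pos_jumps\<close> the left limit \<open>l\<close> at \<open>t\<close> satisfies \<open>X t \<omega> \<le> l\<close>.\<close>

locale spectrally_negative_levy = prob_space M
  for M :: "'a measure" and X :: "real \<Rightarrow> 'a \<Rightarrow> real" +
  assumes rv: "0 \<le> t \<Longrightarrow> X t \<in> borel_measurable M"
    and start: "AE \<omega> in M. X 0 \<omega> = 0"
    and indep_increments:
      "0 \<le> s \<Longrightarrow> s \<le> t \<Longrightarrow>
         indep_set (var_sigma M (\<lambda>\<omega>. X t \<omega> - X s \<omega>)) (path_sigma M X {0..s})"
    and stationary_increments:
      "0 \<le> s \<Longrightarrow> s \<le> t \<Longrightarrow>
         distr M borel (\<lambda>\<omega>. X t \<omega> - X s \<omega>) = distr M borel (X (t - s))"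
    and paths_right_continuous:
      "\<omega> \<in> space M \<Longrightarrow> 0 \<le> t \<Longrightarrow> continuous (at_right t) (\<lambda>s. X s \<omega>)"
    and paths_no_pos_jumps:
      "\<omega> \<in> space M \<Longrightarrow> 0 < t \<Longrightarrow>
         \<exists>l. ((\<lambda>s. X s \<omega>) \<longlongrightarrow> l) (at_left t) \<and> X t \<omega> \<le> l"
    and not_decreasing:
      "\<not> (AE \<omega> in M. \<forall>s t. 0 \<le> s \<longrightarrow> s \<le> t \<longrightarrow> X t \<omega> \<le> X s \<omega>)"

text \<open>By stationarity and independence of the increments,
  \<open>(1/t) log E exp (\<beta> X\<^sub>t)\<close> does not depend on \<open>t > 0\<close>; we take \<open>t = 1\<close>.\<close>

definition laplace_exponent :: "'a measure \<Rightarrow> (real \<Rightarrow> 'a \<Rightarrow> real) \<Rightarrow> real \<Rightarrow> real" where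
  "laplace_exponent M X \<beta> = ln (LINT \<omega>|M. exp (\<beta> * X 1 \<omega>))"

definition right_inverse :: "(real \<Rightarrow> real) \<Rightarrow> real \<Rightarrow> real" where
  "right_inverse \<psi> q = Sup {\<beta>. 0 \<le> \<beta> \<and> \<psi> \<beta> = q}"


section \<open>Scale functions\<close>

text \<open>\<open>is_scale_function \<psi> q w\<close> says that \<open>w\<close> is the \<open>q\<close>-scale function \<open>W\<^sup>(\<^sup>q\<^sup>)\<close>;
  these conditions determine \<open>w\<close> on all of \<open>\<real>\<close>.\<close>

definition is_scale_function :: "(real \<Rightarrow> real) \<Rightarrow> real \<Rightarrow> (real \<Rightarrow> real) \<Rightarrow> bool" where
  "is_scale_function \<psi> q w \<longleftrightarrow>
     (\<forall>x<0. w x = 0) \<and>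
     (\<forall>x\<ge>0. 0 \<le> w x) \<and>
     mono_on {0..} w \<and>
     continuous_on {0<..} w \<and>
     continuous (at_right 0) w \<and>
     (\<forall>\<beta>>right_inverse \<psi> q.
        set_integrable lborel {0..} (\<lambda>x. exp (- \<beta> * x) * w x) \<and>
        (LBINT x:{0..}. exp (- \<beta> * x) * w x) = 1 / (\<psi> \<beta> - q))"

definition scale_Z ::
    "(real \<Rightarrow> real) \<Rightarrow> (real \<Rightarrow> real \<Rightarrow> real) \<Rightarrow> real \<Rightarrow> real \<Rightarrow> real \<Rightarrow> real" where
  "scale_Z \<psi> W q x \<theta> =
     (if 0 \<le> x
      then exp (\<theta> * x) * (1 + (q - \<psi> \<theta>) * (LBINT y:{0..x}. exp (- \<theta> * y) * W q y))
      else exp (\<theta> * x))"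

text \<open>The quotient \<open>(q - \<psi> \<eta>) / (\<Phi> q - \<eta>)\<close>, read as its limit at \<open>\<eta> = \<Phi> q\<close>.\<close>

definition exponent_quotient :: "(real \<Rightarrow> real) \<Rightarrow> real \<Rightarrow> real \<Rightarrow> real" where
  "exponent_quotient \<psi> q \<eta> =
     (let b = right_inverse \<psi> q; f = (\<lambda>z. (q - \<psi> z) / (b - z))
      in if \<eta> = b then Lim (at b) f else f \<eta>)"


section \<open>Path functionals\<close>

definition last_positive_time :: "(real \<Rightarrow> real) \<Rightarrow> real \<Rightarrow> real" where
  "last_positive_time \<xi> T =
     (let S = {t. 0 < t \<and> t \<le> T \<and> \<xi> t > 0} in if S = {} then 0 else Sup S)"

definition occupation_time :: "(real \<Rightarrow> real) \<Rightarrow> real \<Rightarrow> real" where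
  "occupation_time \<xi> T = (LBINT s:{0..T}. indicator {0..} (\<xi> s))"

end

theory Submission
  imports Defs
begin

text \<open>Write \<open>\<psi>\<close> for the Laplace exponent, \<open>\<Phi>\<close> for its right inverse, \<open>A\<^sub>t\<close> for the time spent in \<open>[0,\<infinity>)\<close> up
to \<open>t\<close>, \<open>T\<^sub>u\<close> for the last time before \<open>u\<close> at which the path is positive, and \<open>R\<close> for the resolvent
\<open>R \<phi> x = E\<^sub>x \<integral> exp (- (p + r) t - q A\<^sub>t) \<phi> (X\<^sub>t) dt\<close>.

Since the clock \<open>e\<close> is exponential and independent, both expectations are time integrals with the extra
weight \<open>r exp (- r u)\<close>. The event \<open>T = e\<close> is, up to null sets, the event \<open>X\<^sub>e \<ge> 0\<close>, so the second expectation
is \<open>r\<close> times \<open>R\<close> applied to \<open>y \<mapsto> exp (- \<theta> y)\<close> on \<open>[0,\<infinity>)\<close>. On \<open>T < e\<close> the path has left \<open>(0,\<infinity>)\<close> for good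
before the clock rings. The time \<open>T\<^sub>u\<close> is not a stopping time, but whether \<open>t\<close> lies in a window
\<open>T\<^sub>t < t \<le> T\<^sub>t + 1/n\<close> is decided by the path up to \<open>t\<close>. Put
\<open>J\<^sub>n b = n E\<^sub>x \<integral> exp (- (p + r) t - q A\<^sub>t + b X\<^sub>t) dt\<close>, the integral running over the \<open>t\<close> in such windows. By the
Markov property at \<open>t\<close>, what follows the window is the process killed when it becomes positive, whose
resolvent at rate \<open>a\<close> maps \<open>y \<mapsto> exp (\<alpha> y)\<close> on \<open>(-\<infinity>,0)\<close> to
\<open>(exp (\<alpha> x) - exp (\<Phi> a x)) / (a - \<psi> \<alpha>)\<close> for \<open>x \<le> 0\<close> (lemma \<open>unhit_exp\<close>). With \<open>a = r\<close> and \<open>\<alpha> = 0\<close> this shows that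
\<open>J\<^sub>n \<theta> - J\<^sub>n (\<theta> + \<Phi> r)\<close> tends to the first expectation. With \<open>a = p + r\<close> the same argument shows that
\<open>J\<^sub>n \<alpha> - J\<^sub>n (\<Phi> (p + r))\<close> tends to \<open>G \<alpha>\<close>, which is \<open>p + r - \<psi> \<alpha>\<close> times \<open>R\<close> applied to \<open>y \<mapsto> exp (\<alpha> y)\<close> on
\<open>(-\<infinity>,0)\<close>. Hence the first expectation is \<open>G \<theta> - G (\<theta> + \<Phi> r)\<close> (theorem \<open>last_exit_potential\<close>); only differences
of \<open>J\<^sub>n\<close> are used, because the path may leave \<open>(0,\<infinity>)\<close> infinitely often and \<open>J\<^sub>n b\<close> itself can diverge as \<open>n\<close> grows.

It remains to compute \<open>R\<close>. Below \<open>0\<close> the occupation time does not grow, so \<open>R \<phi>\<close> is determined there by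
\<open>R \<phi> 0\<close> through the first passage above \<open>0\<close>; above \<open>0\<close> it is expressed through the undisturbed resolvent at rate
\<open>p + q + r\<close> by first-order perturbation; matching the two descriptions at \<open>0\<close> determines \<open>R \<phi> 0\<close>
(theorems \<open>occ_potential_neg_exp\<close> and \<open>occ_potential_pos_exp\<close>).

The undisturbed resolvent measure at rate \<open>q\<close> is found as follows. Without positive jumps the process is
exactly at \<open>0\<close> when it first passes above \<open>0\<close>, so the strong Markov property there makes the resolvent measure an
exponential distribution with some rate \<open>kappa q\<close>, up to a constant \<open>c\<close>, on the positive half-line. This gives
finite exponential moments and identifies \<open>kappa q\<close> with \<open>\<Phi> q\<close>. On the negative half-line its Laplace transform
is \<open>1 / (q - \<psi> a) + c / (a - \<Phi> q)\<close> (theorem \<open>mu_neg_eq\<close>), and uniqueness of Laplace transforms shows that its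
reflection has density \<open>c exp (\<Phi> q y) - W y\<close> with \<open>W\<close> the \<open>q\<close>-scale function (theorem \<open>mu_scale_function\<close>).\<close>

section \<open>Additive functions, window averages and time changes\<close>

text \<open>After subtracting \<open>t * \<phi> 1\<close> the function vanishes at all multiples of a small \<open>1 / m\<close>, so by additivity it
inherits on \<open>[0,\<infinity>)\<close> the lower bound that it has near \<open>0\<close>. Multiplying the argument by large integers shows that it
is nonnegative, and it cannot be positive at \<open>t\<close> because its values at \<open>t\<close> and \<open>n - t\<close> add up to \<open>0\<close>.\<close>

lemma additive_bounded_below_imp_linear:
  fixes \<phi> :: "real \<Rightarrow> real"
  assumes add: "\<And>s t. 0 \<le> s \<Longrightarrow> 0 \<le> t \<Longrightarrow> \<phi> (s + t) = \<phi> s + \<phi> t"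
    and \<delta>: "0 < \<delta>" and below: "\<And>t. 0 \<le> t \<Longrightarrow> t \<le> \<delta> \<Longrightarrow> - C \<le> \<phi> t"
    and t: "0 \<le> t"
  shows "\<phi> t = t * \<phi> 1"
proof -
  define D where "D t = \<phi> t - t * \<phi> 1" for t
  have D_add: "D (s + t) = D s + D t" if "0 \<le> s" "0 \<le> t" for s t
    using add[OF that] by (simp add: D_def algebra_simps)
  have D_mult: "D (real n * t) = real n * D t" if "0 \<le> t" for n t
  proof (induction n)
    case 0 show ?case using D_add[of 0 0] by simp
  next
    case (Suc n)
    have "D (real n * t + t) = D (real n * t) + D t" using that by (intro D_add) auto
    then show ?case using Suc by (simp add: algebra_simps)
  qed
  have D_nat: "D (real n) = 0" for n
    using D_mult[of 1 n] by (simp add: D_def)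
  \<comment> \<open>a mesh fine enough for the remainder of the division of \<open>s\<close> by \<open>1 / m\<close> to lie in \<open>[0, \<delta>]\<close>\<close>
  obtain m :: nat where m: "0 < m" "1 / real m \<le> \<delta>"
    using \<delta> by (metis inverse_eq_divide less_eq_real_def real_arch_inverse not_gr_zero of_nat_0 inverse_zero)
  have D_ratio: "D (real k / real m) = 0" for k
  proof -
    have "real m * D (real k / real m) = D (real k)"
      using D_mult[of "real k / real m" m] m by simp
    then show ?thesis using D_nat m by simp
  qed
  have D_ge: "- C - \<delta> * \<bar>\<phi> 1\<bar> \<le> D s" if s: "0 \<le> s" for s
  proof -
    \<comment> \<open>the largest multiple of \<open>1 / m\<close> not exceeding \<open>s\<close>\<close>
    define k where "k = nat \<lfloor>s * m\<rfloor>"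
    have k: "real k = of_int \<lfloor>s * m\<rfloor>" using s by (simp add: k_def)
    have "real k \<le> s * m" "s * m \<le> real k + 1" unfolding k by linarith+
    then have r: "0 \<le> s - real k / m" "s - real k / m \<le> 1 / m"
      using m by (simp_all add: pos_divide_le_eq diff_le_eq add_divide_distrib[symmetric] pos_le_divide_eq)
    have "D s = D (real k / m + (s - real k / m))" by simp
    also have "\<dots> = D (s - real k / m)" using r m D_ratio by (subst D_add) auto
    finally have eq: "D s = D (s - real k / m)" .
    have le: "s - real k / m \<le> \<delta>" using r m by linarith
    have "(s - real k / m) * \<phi> 1 \<le> (s - real k / m) * \<bar>\<phi> 1\<bar>" using r by (intro mult_left_mono) auto
    also have "\<dots> \<le> \<delta> * \<bar>\<phi> 1\<bar>" using le by (intro mult_right_mono) auto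
    finally show ?thesis unfolding eq using below[OF r(1) le] by (simp add: D_def)
  qed
  have D_nonneg: "0 \<le> D s" if s: "0 \<le> s" for s
  proof (rule ccontr)
    assume neg: "\<not> 0 \<le> D s"
    obtain n :: nat where "real n * (- D s) > C + \<delta> * \<bar>\<phi> 1\<bar>"
      using neg ex_less_of_nat_mult[of "- D s"] by auto
    moreover have "- C - \<delta> * \<bar>\<phi> 1\<bar> \<le> real n * D s"
      using D_ge[of "real n * s"] s by (simp add: D_mult)
    ultimately show False by simp
  qed
  obtain n :: nat where n: "t \<le> real n" using real_arch_simple by blast
  have "D t + D (real n - t) = 0"
    using D_add[of t "real n - t"] t n D_nat[of n] by simp
  then have "D t = 0" using D_nonneg[of t] D_nonneg[of "real n - t"] t n by linarith
  then show ?thesis by (simp add: D_def)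
qed

text \<open>The substitution \<open>t = a + v / (n + 1)\<close> turns the shrinking windows into a fixed interval, where dominated
convergence applies.\<close>

lemma window_average_tendsto:
  fixes \<phi> :: "real \<Rightarrow> ennreal"
  assumes [measurable]: "\<phi> \<in> borel_measurable borel"
    and bound: "\<And>t. \<phi> t \<le> ennreal B" and lim: "(\<phi> \<longlongrightarrow> l) (at_right a)"
  shows "(\<lambda>n. \<integral>\<^sup>+t. ennreal (real (Suc n)) * \<phi> t * indicator {a<..a + 1 / real (Suc n)} t \<partial>lborel)
           \<longlonglongrightarrow> l"
proof -
  have eq: "(\<integral>\<^sup>+t. ennreal (real (Suc n)) * \<phi> t * indicator {a<..a + 1 / real (Suc n)} t \<partial>lborel)
      = (\<integral>\<^sup>+v. \<phi> (a + 1 / real (Suc n) * v) * indicator {0<..1} v \<partial>lborel)" for n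
  proof -
    have ind: "indicator {a<..a + 1 / real (Suc n)} (a + 1 / real (Suc n) * v)
        = (indicator {0<..1} v :: ennreal)" for v
    proof -
      define c where "c = 1 / real (Suc n)"
      have "0 < c" by (simp add: c_def)
      then have "c * v \<le> c \<longleftrightarrow> v \<le> 1" "0 < c * v \<longleftrightarrow> 0 < v"
        by (simp_all add: mult_le_cancel_left1 zero_less_mult_iff)
      then show ?thesis unfolding c_def[symmetric] by (auto simp: indicator_def)
    qed
    have "(\<integral>\<^sup>+t. ennreal (real (Suc n)) * \<phi> t * indicator {a<..a + 1 / real (Suc n)} t \<partial>lborel)
      = ennreal (1 / real (Suc n)) * (\<integral>\<^sup>+v. ennreal (real (Suc n)) *
           (\<phi> (a + 1 / real (Suc n) * v) * indicator {0<..1} v) \<partial>lborel)"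
      by (subst nn_integral_real_affine[where c="1 / real (Suc n)" and t=a])
         (simp_all add: ind mult.assoc del: of_nat_Suc times_divide_eq_left)
    also have "\<dots> = ennreal (1 / real (Suc n)) * (ennreal (real (Suc n)) * (\<integral>\<^sup>+v.
           \<phi> (a + 1 / real (Suc n) * v) * indicator {0<..1} v \<partial>lborel))"
      by (subst nn_integral_cmult) auto
    also have "\<dots> = (\<integral>\<^sup>+v. \<phi> (a + 1 / real (Suc n) * v) * indicator {0<..1} v \<partial>lborel)"
      by (subst mult.assoc[symmetric], subst ennreal_mult[symmetric]) auto
    finally show ?thesis .
  qed
  have "(\<lambda>n. \<integral>\<^sup>+v. \<phi> (a + 1 / real (Suc n) * v) * indicator {0<..1} v \<partial>lborel)
      \<longlonglongrightarrow> (\<integral>\<^sup>+v. l * indicator {0<..1} (v::real) \<partial>lborel)"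
  proof (rule nn_integral_dominated_convergence[where w="\<lambda>v. ennreal B * indicator {0<..1} v"])
    show "(\<integral>\<^sup>+v. ennreal B * indicator {0<..1} (v::real) \<partial>lborel) < \<infinity>"
      by (subst nn_integral_cmult) (auto simp: ennreal_mult_less_top)
    show "AE v in lborel. (\<lambda>n. \<phi> (a + 1 / real (Suc n) * v) * indicator {0<..1} v)
        \<longlonglongrightarrow> l * indicator {0<..1} v"
    proof (intro AE_I2)
      fix v :: real
      show "(\<lambda>n. \<phi> (a + 1 / real (Suc n) * v) * indicator {0<..1} v) \<longlonglongrightarrow> l * indicator {0<..1} v"
      proof (cases "v \<in> {0<..1}")
        case True
        have "((\<lambda>n. 1 / real (Suc n)) \<longlongrightarrow> 0) sequentially"
          using LIMSEQ_inverse_real_of_nat by (simp add: inverse_eq_divide)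
        then have "((\<lambda>n. a + 1 / real (Suc n) * v) \<longlongrightarrow> a + 0 * v) sequentially"
          by (intro tendsto_intros)
        then have "filterlim (\<lambda>n. a + 1 / real (Suc n) * v) (at_right a) sequentially"
          using True by (auto simp: filterlim_at intro!: always_eventually)
        from filterlim_compose[OF lim this] show ?thesis using True by simp
      qed auto
    qed
  qed (auto simp: indicator_def bound)
  then show ?thesis unfolding eq by (simp add: nn_integral_cmult)
qed

lemma set_integrable_bounded_Icc:
  fixes D :: "real \<Rightarrow> real"
  assumes [measurable]: "D \<in> borel_measurable borel" and bd: "\<And>t. 0 \<le> D t" "\<And>t. D t \<le> C"
  shows "set_integrable lborel {a..b} D"
proof -
  have "set_integrable lborel {a..b} (\<lambda>_. C)" 
    by (intro borel_integrable_atLeastAtMost') auto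
  then show ?thesis
    by (rule set_integrable_bound) (use bd in \<open>auto simp: set_borel_measurable_def order_trans[OF bd(1) bd(2)] intro!: AE_I2\<close>)
qed

lemma
  fixes D :: "real \<Rightarrow> real"
  assumes [measurable]: "D \<in> borel_measurable borel" and bd: "\<And>t. 0 \<le> D t" "\<And>t. D t \<le> C"
    and "0 \<le> s" "s \<le> t"
  shows LBINT_Icc_split: "(LBINT r:{0..t}. D r) = (LBINT r:{0..s}. D r) + (LBINT r:{s..t}. D r)"
    and LBINT_Icc_bounds: "0 \<le> (LBINT r:{s..t}. D r)" "(LBINT r:{s..t}. D r) \<le> C * (t - s)"
    and LBINT_Icc_ennreal: "ennreal (LBINT r:{s..t}. D r) = (\<integral>\<^sup>+r. ennreal (D r) * indicator {s..t} r \<partial>lborel)"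
proof -
  note int = set_integrable_bounded_Icc[of D C, OF _ bd]
  have eq: "{0..t} = {0..s} \<union> {s..t}" using assms by auto
  show "(LBINT r:{0..t}. D r) = (LBINT r:{0..s}. D r) + (LBINT r:{s..t}. D r)"
    unfolding eq
  proof (rule set_integral_Un_AE)
    show "AE r in lborel. \<not> (r \<in> {0..s} \<and> r \<in> {s..t})"
      using AE_lborel_singleton[of s] by eventually_elim auto
  qed (simp_all add: int)
  show "0 \<le> (LBINT r:{s..t}. D r)"
    unfolding set_lebesgue_integral_def by (auto intro!: integral_nonneg_AE simp: bd)
  have "(LBINT r:{s..t}. D r) \<le> (LBINT r:{s..t}. C)"
    by (intro set_integral_mono int borel_integrable_atLeastAtMost') (auto simp: bd)
  also have "\<dots> = C * (t - s)" using assms by (simp add: set_lebesgue_integral_def)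
  finally show "(LBINT r:{s..t}. D r) \<le> C * (t - s)" .
  show "ennreal (LBINT r:{s..t}. D r) = (\<integral>\<^sup>+r. ennreal (D r) * indicator {s..t} r \<partial>lborel)"
    unfolding set_lebesgue_integral_def using int[of s t]
    by (subst nn_integral_eq_integral[symmetric])
       (auto simp: bd set_integrable_def indicator_def intro!: nn_integral_cong)
qed

text \<open>For bounded \<open>D\<close> the clock \<open>\<Theta>\<close> is Lipschitz but may be constant on intervals and need not be differentiable.
The claim is therefore proved as an equality of image measures, which is checked on half-lines \<open>{b<..}\<close>: their
preimage starts at the last time at which \<open>\<Theta>\<close> equals \<open>b\<close>.\<close>

lemma nn_integral_time_change:
  fixes D :: "real \<Rightarrow> real" and g :: "real \<Rightarrow> ennreal"
  assumes D[measurable]: "D \<in> borel_measurable borel" and bd: "\<And>t. 0 \<le> D t" "\<And>t. D t \<le> C"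
    and u: "0 \<le> u" and [measurable]: "g \<in> borel_measurable borel"
  defines "\<Theta> \<equiv> \<lambda>t. LBINT r:{0..t}. D r"
  shows "(\<integral>\<^sup>+t. ennreal (D t) * g (\<Theta> t) * indicator {0..u} t \<partial>lborel)
       = (\<integral>\<^sup>+v. g v * indicator {0..\<Theta> u} v \<partial>lborel)"
proof -
  note split = LBINT_Icc_split[OF D bd] and bounds = LBINT_Icc_bounds[OF D bd]
  have C: "0 \<le> C" using bd[of 0] by linarith
  have neg: "\<Theta> t = 0" if "t < 0" for t using that by (simp add: \<Theta>_def set_lebesgue_integral_def)
  have lip: "\<Theta> s \<le> \<Theta> t \<and> \<Theta> t \<le> \<Theta> s + C * (t - s)" if "s \<le> t" for s t
  proof (cases "0 \<le> s")
    case True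
    with split[OF True that] bounds[OF True that] show ?thesis by (simp add: \<Theta>_def)
  next
    case False
    show ?thesis
    proof (cases "0 \<le> t")
      case True
      have "C * t \<le> C * (t - s)" using False C by (intro mult_left_mono) auto
      with bounds[OF order_refl True] False show ?thesis using neg[of s] by (simp add: \<Theta>_def)
    qed (use False neg[of s] neg[of t] C that in auto)
  qed
  then have mono: "mono \<Theta>" by (auto simp: mono_def)
  have [measurable]: "\<Theta> \<in> borel_measurable borel" using mono by (rule borel_measurable_mono)
  have "C-lipschitz_on UNIV \<Theta>"
  proof (rule lipschitz_onI)
    fix s t :: real
    show "dist (\<Theta> s) (\<Theta> t) \<le> C * dist s t"
      using lip[of s t] lip[of t s] by (cases "s \<le> t") (auto simp: dist_real_def)
  qed (rule C)
  then have cont: "continuous_on UNIV \<Theta>" by (rule lipschitz_on_continuous_on)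
  have \<Theta>0: "\<Theta> 0 = 0"
    using lip[of "-1" 0] lip[of "-1" "0"] neg[of "-1"] bounds[of 0 0] by (simp add: \<Theta>_def)
  have mass: "(\<integral>\<^sup>+r. ennreal (D r) * indicator {s..u} r \<partial>lborel) = ennreal (\<Theta> u - \<Theta> s)" 
    if "0 \<le> s" "s \<le> u" for s
    using split[OF that] LBINT_Icc_ennreal[OF D bd that] by (simp add: \<Theta>_def)
  have "distr (density lborel (\<lambda>t. ennreal (D t) * indicator {0..u} t)) borel \<Theta>
      = density lborel (indicator {0..\<Theta> u})" (is "?A = ?B")
  proof (rule measure_eqI_lessThan)
    have A: "emeasure ?A {b<..} = (\<integral>\<^sup>+t. ennreal (D t) * indicator {0..u} t * indicator {b<..} (\<Theta> t) \<partial>lborel)" for b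
    proof -
      have "emeasure ?A {b<..} = (\<integral>\<^sup>+v. indicator {b<..} v \<partial>?A)" by simp
      also have "\<dots> = (\<integral>\<^sup>+t. indicator {b<..} (\<Theta> t) \<partial>density lborel (\<lambda>t. ennreal (D t) * indicator {0..u} t))"
        by (rule nn_integral_distr) auto
      also have "\<dots> = (\<integral>\<^sup>+t. ennreal (D t) * indicator {0..u} t * indicator {b<..} (\<Theta> t) \<partial>lborel)"
        by (rule nn_integral_density) auto
      finally show ?thesis .
    qed
    have B: "emeasure ?B {b<..} = ennreal (\<Theta> u - max 0 b)" for b
    proof -
      have "\<Theta> u \<ge> 0" using lip[of 0 u] \<Theta>0 u by simp
      have "emeasure ?B {b<..} = emeasure lborel ({0..\<Theta> u} \<inter> {b<..})"
        by (subst emeasure_density) (auto simp flip: indicator_inter_arith)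
      also have "{0..\<Theta> u} \<inter> {b<..} = (if b < 0 then {0..\<Theta> u} else {b<..\<Theta> u})" by auto
      also have "emeasure lborel \<dots> = ennreal (\<Theta> u - max 0 b)"
        using \<open>\<Theta> u \<ge> 0\<close> by (cases "b \<le> \<Theta> u") (auto simp: ennreal_neg max_def)
      finally show ?thesis .
    qed
    fix b
    show eq: "emeasure ?A {b<..} = emeasure ?B {b<..}"
    proof -
      consider "b < 0" | "0 \<le> b" "b < \<Theta> u" | "\<Theta> u \<le> b" by linarith
      then show ?thesis
      proof cases
        case 1
        have "indicator {b<..} (\<Theta> t) = (1::ennreal)" if "0 \<le> t" for t
          using lip[OF that] 1 \<Theta>0 by simp
        then have "emeasure ?A {b<..} = (\<integral>\<^sup>+t. ennreal (D t) * indicator {0..u} t \<partial>lborel)"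
          unfolding A by (intro nn_integral_cong) (auto simp: indicator_def)
        then show ?thesis unfolding B using mass[OF order_refl u] 1 by (simp add: \<Theta>0)
      next
        case 3
        have "emeasure ?A {b<..} = 0"
          unfolding A using lip[of _ u] 3
          by (subst nn_integral_0_iff_AE) (force simp: indicator_def intro!: AE_I2)+
        then show ?thesis unfolding B using 3 by (simp add: ennreal_neg)
      next
        case 2
        \<comment> \<open>its maximum is the last time in \<open>{0..u}\<close> at which \<open>\<Theta>\<close> is at most \<open>b\<close>\<close>
        define S where "S = {0..u} \<inter> \<Theta> -` {..b}"
        have "compact S" unfolding S_def
          using continuous_closed_vimage[OF closed_atMost] cont 
          by (intro compact_Int_closed) (auto simp: continuous_on_eq_continuous_at)
        moreover have "0 \<in> S" using u 2 \<Theta>0 by (auto simp: S_def)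
        ultimately obtain s where s: "s \<in> S" "\<And>t. t \<in> S \<Longrightarrow> t \<le> s"
          using compact_attains_sup[of S] by auto
        have su: "0 \<le> s" "s \<le> u" "\<Theta> s \<le> b" using s by (auto simp: S_def)
        have "\<Theta> s = b"
        proof -
          obtain t where t: "s \<le> t" "t \<le> u" "\<Theta> t = b"
            using IVT'[of \<Theta> s b u] su 2 cont continuous_on_subset[OF cont, of "{s..u}"] by auto
          then have "t \<in> S" using su by (auto simp: S_def)
          then show ?thesis using t s(2)[of t] by simp
        qed
        have ind: "indicator {0..u} t * indicator {b<..} (\<Theta> t) = (indicator {s<..u} t :: ennreal)" for t
        proof (cases "t \<in> {0..u}")
          case True
          have "\<Theta> t > b \<longleftrightarrow> s < t"
            using s(2)[of t] True lip[of t s] \<open>\<Theta> s = b\<close> by (force simp: S_def)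
          then show ?thesis using True by (auto simp: indicator_def)
        qed (use su in \<open>auto simp: indicator_def\<close>)
        have "emeasure ?A {b<..} = (\<integral>\<^sup>+t. ennreal (D t) * indicator {s<..u} t \<partial>lborel)"
          unfolding A mult.assoc ind ..
        also have "\<dots> = (\<integral>\<^sup>+t. ennreal (D t) * indicator {s..u} t \<partial>lborel)"
        proof (rule nn_integral_cong_AE)
          show "AE t in lborel. ennreal (D t) * indicator {s<..u} t = ennreal (D t) * indicator {s..u} t"
            using AE_lborel_singleton[of s] by eventually_elim (auto simp: indicator_def)
        qed
        also have "\<dots> = ennreal (\<Theta> u - b)" using mass su \<open>\<Theta> s = b\<close> by simp
        finally show ?thesis unfolding B using 2 by simp
      qed
    qed
    show "emeasure ?A {b<..} < \<infinity>" unfolding eq B by simp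
  qed auto
  then have "(\<integral>\<^sup>+v. g v \<partial>?A) = (\<integral>\<^sup>+v. g v \<partial>?B)" by simp
  then show ?thesis
    by (simp add: nn_integral_distr nn_integral_density mult_ac)
qed

section \<open>Paths without positive jumps\<close>

text \<open>Right-continuous paths without positive jumps. Paths are functions on all of \<open>\<real>\<close>, frozen at negative times, so
that equality of paths is equality of functions and no restriction to \<open>[0,\<infinity>)\<close> is carried along.\<close>

definition path_set :: "(real \<Rightarrow> real) set" where
  "path_set = {f. (\<forall>t. (f \<longlongrightarrow> f t) (at_right t)) \<and> (\<forall>t\<le>0. f t = f 0) \<and>
     (\<forall>t>0. \<exists>l. (f \<longlongrightarrow> l) (at_left t) \<and> f t \<le> l)}"

definition path_space :: "(real \<Rightarrow> real) measure" where
  "path_space = restrict_space (PiM UNIV (\<lambda>_. borel)) path_set"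

text \<open>The truncations keep the shifted path frozen at negative times, hence in \<open>path_set\<close>.\<close>

definition shift_path :: "real \<Rightarrow> (real \<Rightarrow> real) \<Rightarrow> real \<Rightarrow> real" where
  "shift_path s f = (\<lambda>t. f (max 0 s + max 0 t))"

definition stop_path :: "real \<Rightarrow> (real \<Rightarrow> real) \<Rightarrow> real \<Rightarrow> real" where
  "stop_path s f = (\<lambda>t. f (min s t))"

lemma path_setD:
  assumes "f \<in> path_set"
  shows "(f \<longlongrightarrow> f t) (at_right t)" "t \<le> 0 \<Longrightarrow> f t = f 0"
    "0 < t \<Longrightarrow> \<exists>l. (f \<longlongrightarrow> l) (at_left t) \<and> f t \<le> l"
  using assms unfolding path_set_def by blast+

lemma space_path_space [simp]: "space path_space = path_set"
  by (simp add: path_space_def space_restrict_space space_PiM)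

lemma measurable_path_spaceI:
  assumes "\<And>x. x \<in> space M \<Longrightarrow> h x \<in> path_set"
    and "\<And>t. (\<lambda>x. h x t) \<in> borel_measurable M"
  shows "h \<in> measurable M path_space"
  unfolding path_space_def
proof (rule measurable_restrict_space2)
  show "h \<in> space M \<rightarrow> path_set" using assms(1) by auto
  show "h \<in> measurable M (PiM UNIV (\<lambda>_. borel))"
    by (rule measurable_PiM_single') (auto simp: assms(2))
qed

lemma measurable_path_component: "(\<lambda>f. f t) \<in> borel_measurable path_space"
  unfolding path_space_def by (rule measurable_restrict_space1, rule measurable_component_singleton) simp

text \<open>By right continuity the value at \<open>g x\<close> is the limit of values at grid points lying strictly to the right of
\<open>g x\<close>; this makes evaluation jointly measurable in path and time.\<close>

lemma measurable_path_eval [measurable (raw)]: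
  assumes h: "h \<in> measurable M path_space" and [measurable]: "g \<in> borel_measurable M"
  shows "(\<lambda>x. h x (g x)) \<in> borel_measurable M"
proof (rule borel_measurable_LIMSEQ_real)
  fix x assume "x \<in> space M"
  then have "h x \<in> path_set" using h by (auto dest: measurable_space)
  define \<rho> where "\<rho> n = (of_int \<lfloor>real (Suc n) * g x\<rfloor> + 1) / real (Suc n)" for n
  have \<rho>: "g x < \<rho> n" "\<rho> n \<le> g x + 1 / real (Suc n)" for n
  proof -
    have "real (Suc n) * g x < of_int \<lfloor>real (Suc n) * g x\<rfloor> + 1"
      "of_int \<lfloor>real (Suc n) * g x\<rfloor> + 1 \<le> real (Suc n) * g x + 1" by linarith+
    then have "g x < \<rho> n" "\<rho> n \<le> (real (Suc n) * g x + 1) / real (Suc n)"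
      unfolding \<rho>_def by (auto simp: pos_less_divide_eq mult.commute intro!: divide_right_mono)
    then show "g x < \<rho> n" "\<rho> n \<le> g x + 1 / real (Suc n)"
      by (simp_all add: add_divide_distrib del: of_nat_Suc)
  qed
  have "((\<lambda>n. g x + 1 / real (Suc n)) \<longlongrightarrow> g x + 0) sequentially"
    using LIMSEQ_inverse_real_of_nat by (intro tendsto_intros) (simp add: inverse_eq_divide)
  then have "\<rho> \<longlonglongrightarrow> g x"
    using \<rho> by (intro tendsto_sandwich[of "\<lambda>_. g x" \<rho> sequentially "\<lambda>n. g x + 1 / real (Suc n)"])
      (auto simp: less_imp_le simp del: of_nat_Suc)
  then have "filterlim \<rho> (at_right (g x)) sequentially"
    unfolding filterlim_at using \<rho>(1) by (simp add: less_imp_neq[OF \<rho>(1), symmetric])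
  from filterlim_compose[OF path_setD(1)[OF \<open>h x \<in> path_set\<close>] this]
  show "(\<lambda>n. h x (\<rho> n)) \<longlonglongrightarrow> h x (g x)" .
next
  fix n
  have "(\<lambda>x. h x ((of_int i + 1) / real (Suc n))) \<in> borel_measurable M" for i :: int
    using measurable_compose[OF h measurable_path_component] .
  then show "(\<lambda>x. h x ((of_int \<lfloor>real (Suc n) * g x\<rfloor> + 1) / real (Suc n))) \<in> borel_measurable M"
    by (rule measurable_compose_countable) measurable
qed

lemma path_measurable: "f \<in> path_set \<Longrightarrow> f \<in> borel_measurable borel"
  using measurable_path_eval[of "\<lambda>_. f" borel "\<lambda>t. t"] by simp

lemma shift_path_in_path_set:
  assumes f: "f \<in> path_set" shows "shift_path s f \<in> path_set"
proof -
  define a where "a = max 0 s"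
  have "0 \<le> a" by (simp add: a_def)
  have R: "((\<lambda>t. f (a + max 0 t)) \<longlongrightarrow> f (a + max 0 t)) (at_right t)" for t
  proof (cases "t < 0")
    case True
    then have "\<forall>\<^sub>F u in at_right t. f (a + max 0 t) = f (a + max 0 u)"
      by (auto simp: eventually_at_right[OF True] max_def intro!: exI[of _ 0])
    then show ?thesis by (rule Lim_transform_eventually[OF tendsto_const])
  next
    case False
    have "((\<lambda>u. f (a + u)) \<longlongrightarrow> f (a + t)) (at_right t)"
    proof (rule filterlim_compose[OF path_setD(1)[OF f, of "a + t"]])
      show "filterlim (\<lambda>u. a + u) (at_right (a + t)) (at_right t)"
        by (auto simp: filterlim_at eventually_at_filter intro!: tendsto_eq_intros)
    qed
    moreover have "\<forall>\<^sub>F u in at_right t. f (a + u) = f (a + max 0 u)"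
      using False by (auto simp: eventually_at_filter)
    ultimately show ?thesis using False by (auto intro: Lim_transform_eventually)
  qed
  have L: "\<exists>l. ((\<lambda>u. f (a + max 0 u)) \<longlongrightarrow> l) (at_left t) \<and> f (a + max 0 t) \<le> l" if t: "0 < t" for t
  proof -
    obtain l where l: "(f \<longlongrightarrow> l) (at_left (a + t))" "f (a + t) \<le> l"
      using path_setD(3)[OF f add_nonneg_pos[OF \<open>0 \<le> a\<close> t]] by auto
    have "((\<lambda>u. f (a + u)) \<longlongrightarrow> l) (at_left t)"
    proof (rule filterlim_compose[OF l(1)])
      show "filterlim (\<lambda>u. a + u) (at_left (a + t)) (at_left t)"
        by (auto simp: filterlim_at eventually_at_filter intro!: tendsto_eq_intros)
    qed
    moreover have "\<forall>\<^sub>F u in at_left t. f (a + u) = f (a + max 0 u)"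
      using t by (auto simp: eventually_at_left[OF t] max_def intro!: exI[of _ 0])
    ultimately show ?thesis using l(2) t by (auto intro: Lim_transform_eventually)
  qed
  show ?thesis
    using R L unfolding path_set_def shift_path_def a_def by simp
qed

lemma stop_path_in_path_set:
  assumes f: "f \<in> path_set" shows "stop_path s f \<in> path_set"
proof -
  have R: "((\<lambda>t. f (min s t)) \<longlongrightarrow> f (min s t)) (at_right t)" for t
  proof (cases "t < s")
    case True
    then have "\<forall>\<^sub>F u in at_right t. f u = f (min s u)"
      by (auto simp: eventually_at_right[OF True] intro!: exI[of _ s])
    with path_setD(1)[OF f, of t] show ?thesis using True by (auto intro: Lim_transform_eventually)
  next
    case False
    have "\<forall>\<^sub>F u in at_right t. f (min s t) = f (min s u)"
      using False by (auto simp: eventually_at_filter)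
    then show ?thesis by (rule Lim_transform_eventually[OF tendsto_const])
  qed
  have L: "\<exists>l. ((\<lambda>u. f (min s u)) \<longlongrightarrow> l) (at_left t) \<and> f (min s t) \<le> l" if t: "0 < t" for t
  proof (cases "t \<le> s")
    case True
    obtain l where l: "(f \<longlongrightarrow> l) (at_left t)" "f t \<le> l"
      using path_setD(3)[OF f t] by auto
    have "\<forall>\<^sub>F u in at_left t. f u = f (min s u)"
      using True by (auto simp: eventually_at_filter)
    then show ?thesis using l True by (auto intro: Lim_transform_eventually)
  next
    case False
    then have "\<forall>\<^sub>F u in at_left t. f (min s t) = f (min s u)"
      by (auto simp: eventually_at_left[of s t] intro!: exI[of _ s])
    then show ?thesis by (auto intro: Lim_transform_eventually[OF tendsto_const])
  qed
  have C: "f (min s t) = f (min s 0)" if "t \<le> 0" for t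
    using that path_setD(2)[OF f, of "min s t"] path_setD(2)[OF f, of "min s 0"] by simp
  show ?thesis using R L C unfolding path_set_def stop_path_def by blast
qed

lemma translate_in_path_set:
  assumes f: "f \<in> path_set" shows "(\<lambda>t. y + f t) \<in> path_set"
proof -
  have "\<exists>l. ((\<lambda>t. y + f t) \<longlongrightarrow> l) (at_left t) \<and> y + f t \<le> l" if t: "0 < t" for t
  proof -
    obtain l where "(f \<longlongrightarrow> l) (at_left t)" "f t \<le> l" using path_setD(3)[OF f t] by auto
    then show ?thesis by (intro exI[of _ "y + l"]) (auto intro: tendsto_intros)
  qed
  moreover have "((\<lambda>t. y + f t) \<longlongrightarrow> y + f t) (at_right t)" for t
    by (intro tendsto_intros path_setD(1)[OF f])
  moreover have "y + f t = y + f 0" if "t \<le> 0" for t using path_setD(2)[OF f that] by simp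
  ultimately show ?thesis unfolding path_set_def by blast
qed

lemma measurable_shift_path [measurable (raw)]:
  assumes [measurable]: "h \<in> measurable M path_space" "g \<in> borel_measurable M"
  shows "(\<lambda>x. shift_path (g x) (h x)) \<in> measurable M path_space"
proof (rule measurable_path_spaceI)
  show "x \<in> space M \<Longrightarrow> shift_path (g x) (h x) \<in> path_set" for x
    using measurable_space[OF assms(1)] by (auto intro: shift_path_in_path_set)
qed (simp add: shift_path_def)

lemma measurable_stop_path [measurable (raw)]:
  assumes [measurable]: "h \<in> measurable M path_space" "g \<in> borel_measurable M"
  shows "(\<lambda>x. stop_path (g x) (h x)) \<in> measurable M path_space"
proof (rule measurable_path_spaceI)
  show "x \<in> space M \<Longrightarrow> stop_path (g x) (h x) \<in> path_set" for x
    using measurable_space[OF assms(1)] by (auto intro: stop_path_in_path_set)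
qed (simp add: stop_path_def)

lemma measurable_translate_path [measurable (raw)]:
  assumes [measurable]: "h \<in> measurable M path_space" "g \<in> borel_measurable M"
  shows "(\<lambda>x t. g x + h x t) \<in> measurable M path_space"
proof (rule measurable_path_spaceI)
  show "x \<in> space M \<Longrightarrow> (\<lambda>t. g x + h x t) \<in> path_set" for x
    using measurable_space[OF assms(1)] by (auto intro: translate_in_path_set)
qed simp

text \<open>The inequality \<open>s < t\<close> is strict so that, on paths started at or below \<open>0\<close>, the times \<open>t\<close> with
\<open>hits f t\<close> are exactly those after the first passage time.\<close>

definition hits :: "(real \<Rightarrow> real) \<Rightarrow> real \<Rightarrow> bool" where
  "hits f t \<longleftrightarrow> (\<exists>s. 0 \<le> s \<and> s < t \<and> 0 < f s)"

text \<open>Right continuity keeps the path positive just after a positive time, which reduces statements about passages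
above \<open>0\<close> to countably many times.\<close>

lemma path_positive_rational:
  assumes f: "f \<in> path_set" and "0 < f s" "s < t"
  obtains r :: rat where "s < of_rat r" "of_rat r < t" "0 < f (of_rat r)"
proof -
  have "\<forall>\<^sub>F u in at_right s. 0 < f u" using path_setD(1)[OF f] \<open>0 < f s\<close> by (rule order_tendstoD)
  then obtain b where b: "s < b" "\<And>u. s < u \<Longrightarrow> u < b \<Longrightarrow> 0 < f u"
    using eventually_at_right[OF \<open>s < t\<close>] by auto
  obtain r :: rat where "s < of_rat r" "of_rat r < min b t"
    using of_rat_dense[of s "min b t"] b \<open>s < t\<close> by auto
  with b show thesis by (intro that[of r]) auto
qed

lemma measurable_hits [measurable (raw)]:
  assumes h: "h \<in> measurable M path_space" and [measurable]: "g \<in> borel_measurable M"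
  shows "Measurable.pred M (\<lambda>x. hits (h x) (g x))"
proof -
  note [measurable] = h
  have "hits (h x) (g x) \<longleftrightarrow> (\<exists>r::rat. 0 \<le> real_of_rat r \<and> real_of_rat r < g x \<and> 0 < h x (real_of_rat r))"
    if "x \<in> space M" for x
  proof
    assume "hits (h x) (g x)"
    then obtain s where s: "0 \<le> s" "s < g x" "0 < h x s" by (auto simp: hits_def)
    moreover have "h x \<in> path_set" using measurable_space[OF h that] by simp
    ultimately show "\<exists>r::rat. 0 \<le> real_of_rat r \<and> real_of_rat r < g x \<and> 0 < h x (real_of_rat r)"
      by (metis less_eq_real_def order.strict_trans1 path_positive_rational)
  next
    assume "\<exists>r::rat. 0 \<le> real_of_rat r \<and> real_of_rat r < g x \<and> 0 < h x (real_of_rat r)"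
    then show "hits (h x) (g x)" unfolding hits_def by blast
  qed
  then show ?thesis by (subst measurable_cong) measurable
qed

lemma last_positive_time_bounds:
  assumes "0 \<le> u" shows "0 \<le> last_positive_time f u" "last_positive_time f u \<le> u"
proof -
  define S where "S = {t. 0 < t \<and> t \<le> u \<and> f t > 0}"
  have eq: "last_positive_time f u = (if S = {} then 0 else Sup S)"
    unfolding last_positive_time_def S_def Let_def ..
  have "0 \<le> (if S = {} then 0 else Sup S) \<and> (if S = {} then 0 else Sup S) \<le> u"
  proof (cases "S = {}")
    case False
    then obtain t where t: "t \<in> S" by auto
    have "bdd_above S" by (auto simp: S_def bdd_above_def)
    then have "t \<le> Sup S" using t by (intro cSup_upper)
    moreover have "0 < t" using t by (simp add: S_def)
    moreover have "Sup S \<le> u" using False by (rule cSup_least) (simp add: S_def)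
    ultimately show ?thesis using False by simp
  qed (simp add: assms)
  then show "0 \<le> last_positive_time f u" "last_positive_time f u \<le> u" unfolding eq by blast+
qed

text \<open>Comparison with a constant turns the supremum into a statement about the single values of the path; it is
the form in which the last positive time is used throughout.\<close>

lemma last_positive_time_le_iff:
  assumes "0 \<le> c"
  shows "last_positive_time f u \<le> c \<longleftrightarrow> (\<forall>s. c < s \<longrightarrow> s \<le> u \<longrightarrow> f s \<le> 0)"
proof -
  define S where "S = {t. 0 < t \<and> t \<le> u \<and> f t > 0}"
  have eq: "last_positive_time f u = (if S = {} then 0 else Sup S)"
    unfolding last_positive_time_def S_def Let_def ..
  have bdd: "bdd_above S" by (auto simp: S_def bdd_above_def)
  have "last_positive_time f u \<le> c \<longleftrightarrow> (\<forall>s\<in>S. s \<le> c)"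
    using assms cSup_le_iff[OF _ bdd, of c] unfolding eq by auto
  also have "\<dots> \<longleftrightarrow> (\<forall>s. c < s \<longrightarrow> s \<le> u \<longrightarrow> f s \<le> 0)"
  proof (intro iffI allI impI ballI)
    fix s assume *: "\<forall>s\<in>S. s \<le> c" and s: "c < s" "s \<le> u"
    then have "s \<notin> S" by auto
    then show "f s \<le> 0" using s assms by (simp add: S_def)
  next
    fix s assume *: "\<forall>s. c < s \<longrightarrow> s \<le> u \<longrightarrow> f s \<le> 0" and s: "s \<in> S"
    then have "s \<le> u" "0 < f s" by (auto simp: S_def)
    then show "s \<le> c" using * by (metis not_le)
  qed
  finally show ?thesis .
qed

lemma last_positive_time_nonneg: "0 \<le> last_positive_time f u"
proof (cases "0 \<le> u")
  case False
  then have eq: "{t. 0 < t \<and> t \<le> u \<and> f t > 0} = {}" by auto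
  show ?thesis unfolding last_positive_time_def Let_def eq by simp
qed (rule last_positive_time_bounds(1))

lemma nonpos_after_last_positive_time:
  assumes "last_positive_time f u < s" "s \<le> u" shows "f s \<le> 0"
proof -
  have "\<forall>s. last_positive_time f u < s \<longrightarrow> s \<le> u \<longrightarrow> f s \<le> 0"
    using order_refl[of "last_positive_time f u"]
    unfolding last_positive_time_le_iff[OF last_positive_time_nonneg[of f u], of f u] .
  with assms show ?thesis by simp
qed

lemma measurable_last_positive_time [measurable (raw)]:
  assumes h: "h \<in> measurable M path_space" and [measurable]: "g \<in> borel_measurable M"
  shows "(\<lambda>x. last_positive_time (h x) (g x)) \<in> borel_measurable M"
proof (rule borel_measurableI_le)
  note [measurable] = h
  fix c :: real
  show "{x \<in> space M. last_positive_time (h x) (g x) \<le> c} \<in> sets M"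
  proof (cases "c < 0")
    case True
    then have "\<not> last_positive_time (h x) (g x) \<le> c" for x
      using last_positive_time_nonneg[of "h x" "g x"] by linarith
    then show ?thesis by simp
  next
    case False
    have iff: "last_positive_time (h x) (g x) \<le> c \<longleftrightarrow> g x \<le> c \<or> (h x (g x) \<le> 0 \<and>
        (\<forall>r::rat. c < real_of_rat r \<longrightarrow> real_of_rat r < g x \<longrightarrow> h x (real_of_rat r) \<le> 0))"
      if "x \<in> space M" for x
    proof -
      have hx: "h x \<in> path_set" using measurable_space[OF h that] by simp
      have iff: "last_positive_time (h x) (g x) \<le> c \<longleftrightarrow> (\<forall>s. c < s \<longrightarrow> s \<le> g x \<longrightarrow> h x s \<le> 0)"
        using False by (intro last_positive_time_le_iff) simp
      show ?thesis unfolding iff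
      proof (intro iffI allI impI)
        fix s assume *: "g x \<le> c \<or> (h x (g x) \<le> 0 \<and>
          (\<forall>r::rat. c < real_of_rat r \<longrightarrow> real_of_rat r < g x \<longrightarrow> h x (real_of_rat r) \<le> 0))"
          and s: "c < s" "s \<le> g x"
        show "h x s \<le> 0"
        proof (rule ccontr)
          assume "\<not> h x s \<le> 0"
          moreover then have "s < g x" using * s by (cases "s = g x") auto
          ultimately obtain r :: rat where "s < of_rat r" "of_rat r < g x" "0 < h x (of_rat r)"
            using path_positive_rational[OF hx, of s "g x"] by auto
          then show False using * s by force
        qed
      next
        assume "\<forall>s. c < s \<longrightarrow> s \<le> g x \<longrightarrow> h x s \<le> 0"
        then show "g x \<le> c \<or> (h x (g x) \<le> 0 \<and>
          (\<forall>r::rat. c < real_of_rat r \<longrightarrow> real_of_rat r < g x \<longrightarrow> h x (real_of_rat r) \<le> 0))"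
          by (cases "g x \<le> c") auto
      qed
    qed
    have eq: "{x \<in> space M. last_positive_time (h x) (g x) \<le> c} = {x \<in> space M. g x \<le> c \<or> (h x (g x) \<le> 0 \<and>
        (\<forall>r::rat. c < real_of_rat r \<longrightarrow> real_of_rat r < g x \<longrightarrow> h x (real_of_rat r) \<le> 0))}"
      by (intro Collect_cong conj_cong refl iff)
    show ?thesis unfolding eq by measurable
  qed
qed

text \<open>The probability of surviving up to \<open>t\<close> when killing occurs at rate \<open>\<omega> (f s)\<close> at time \<open>s\<close>.\<close>

definition kill :: "(real \<Rightarrow> real) \<Rightarrow> real \<Rightarrow> (real \<Rightarrow> real) \<Rightarrow> real" where
  "kill \<omega> t f = exp (- (LBINT s:{0..t}. \<omega> (f s)))"

lemma measurable_kill [measurable (raw)]: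
  assumes [measurable]: "h \<in> measurable M path_space" "g \<in> borel_measurable M" "\<omega> \<in> borel_measurable borel"
  shows "(\<lambda>x. kill \<omega> (g x) (h x)) \<in> borel_measurable M"
proof -
  have [measurable]: "(\<lambda>(x, s). indicator {0..g x} s *\<^sub>R \<omega> (h x s)) \<in> borel_measurable (M \<Otimes>\<^sub>M lborel)"
  proof -
    have [measurable]: "(\<lambda>z. h (fst z) (snd z)) \<in> borel_measurable (M \<Otimes>\<^sub>M lborel)"
      by (rule measurable_path_eval) measurable
    show ?thesis unfolding indicator_def atLeastAtMost_iff split_beta' by measurable
  qed
  show ?thesis unfolding kill_def set_lebesgue_integral_def by measurable
qed

lemma stop_path_eq: "s \<le> t \<Longrightarrow> stop_path t f s = f s"
  by (simp add: stop_path_def)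

lemma shift_path_eq: "0 \<le> t \<Longrightarrow> 0 \<le> s \<Longrightarrow> shift_path t f s = f (t + s)"
  by (simp add: shift_path_def)

lemma hits_stop_path: assumes "s \<le> t" shows "hits (stop_path t f) s = hits f s"
proof -
  have "stop_path t f v = f v" if "v < s" for v using that assms by (simp add: stop_path_eq)
  then show ?thesis unfolding hits_def by metis
qed

lemma last_positive_time_stop_path: "last_positive_time (stop_path t f) t = last_positive_time f t"
proof -
  have "{s. 0 < s \<and> s \<le> t \<and> stop_path t f s > 0} = {s. 0 < s \<and> s \<le> t \<and> f s > 0}"
    by (auto simp: stop_path_eq)
  then show ?thesis by (simp only: last_positive_time_def)
qed

lemma kill_stop_path: "kill \<omega> t (stop_path t f) = kill \<omega> t f"
proof -
  have "(LBINT s:{0..t}. \<omega> (stop_path t f s)) = (LBINT s:{0..t}. \<omega> (f s))"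
    by (rule set_lebesgue_integral_cong) (auto simp: stop_path_eq)
  then show ?thesis by (simp add: kill_def)
qed

lemma hits_shift_path:
  assumes "0 \<le> t" "t \<le> u"
  shows "hits f u \<longleftrightarrow> hits f t \<or> hits (shift_path t f) (u - t)"
proof
  assume "hits f u"
  then obtain s where s: "0 \<le> s" "s < u" "0 < f s" by (auto simp: hits_def)
  show "hits f t \<or> hits (shift_path t f) (u - t)"
  proof (cases "s < t")
    case False
    then have "hits (shift_path t f) (u - t)" unfolding hits_def
      using s assms by (intro exI[of _ "s - t"]) (auto simp: shift_path_eq)
    then show ?thesis ..
  qed (use s in \<open>auto simp: hits_def\<close>)
next
  assume "hits f t \<or> hits (shift_path t f) (u - t)"
  then show "hits f u"
  proof
    assume "hits (shift_path t f) (u - t)"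
    then obtain s where "0 \<le> s" "s < u - t" "0 < f (t + s)" using assms by (auto simp: hits_def shift_path_eq)
    then show ?thesis unfolding hits_def using assms by (intro exI[of _ "t + s"]) auto
  qed (use assms in \<open>auto simp: hits_def\<close>)
qed

text \<open>Additivity of the integral of the rate: discounting is a multiplicative functional of the path.\<close>

lemma kill_shift_path:
  assumes f: "f \<in> path_set" and \<omega>[measurable]: "\<omega> \<in> borel_measurable borel"
    and bd: "\<And>y. 0 \<le> \<omega> y" "\<And>y. \<omega> y \<le> C" and t: "0 \<le> t" "t \<le> u"
  shows "kill \<omega> u f = kill \<omega> t f * kill \<omega> (u - t) (shift_path t f)"
proof -
  have [measurable]: "(\<lambda>s. \<omega> (f s)) \<in> borel_measurable borel"
    using path_measurable[OF f] by measurable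
  have "(LBINT s:{0..u}. \<omega> (f s)) = (LBINT s:{0..t}. \<omega> (f s)) + (LBINT s:{t..u}. \<omega> (f s))"
    by (rule LBINT_Icc_split) (use bd t in auto)
  moreover have "(LBINT s:{t..u}. \<omega> (f s)) = (LBINT s:{0..u - t}. \<omega> (shift_path t f s))"
  proof -
    have "(LBINT s:{t..u}. \<omega> (f s)) = (\<integral>s. indicator {t..u} (t + s) *\<^sub>R \<omega> (f (t + s)) \<partial>lborel)"
      unfolding set_lebesgue_integral_def
      by (subst lborel_integral_real_affine[where c=1 and t=t]) auto
    also have "\<dots> = (LBINT s:{0..u - t}. \<omega> (shift_path t f s))"
      unfolding set_lebesgue_integral_def
      using t by (intro Bochner_Integration.integral_cong) (auto simp: indicator_def shift_path_eq)
    finally show ?thesis .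
  qed
  ultimately show ?thesis by (simp only: kill_def minus_add_distrib exp_add)
qed

lemma last_positive_time_cong:
  assumes "\<And>t. 0 \<le> t \<Longrightarrow> f t = g t" shows "last_positive_time f u = last_positive_time g u"
proof -
  have "{t. 0 < t \<and> t \<le> u \<and> f t > 0} = {t. 0 < t \<and> t \<le> u \<and> g t > 0}" using assms by auto
  then show ?thesis unfolding last_positive_time_def by (simp only:)
qed

lemma kill_cong:
  assumes "\<And>t. 0 \<le> t \<Longrightarrow> f t = g t" shows "kill \<omega> u f = kill \<omega> u g"
proof -
  have "(LBINT s:{0..u}. \<omega> (f s)) = (LBINT s:{0..u}. \<omega> (g s))"
    by (rule set_lebesgue_integral_cong) (auto simp: assms)
  then show ?thesis by (simp add: kill_def)
qed

section \<open>The law of the path and the Markov property\<close>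

lemma measurable_case_prod_comp:
  assumes "case_prod m \<in> measurable (A \<Otimes>\<^sub>M B) C" "g \<in> measurable M A" "h \<in> measurable M B"
  shows "(\<lambda>x. m (g x) (h x)) \<in> measurable M C"
  using measurable_compose[OF measurable_Pair[OF assms(2,3)] assms(1)] by simp

lemma measurable_indicator_Icc [measurable (raw)]:
  fixes a b t :: "'z \<Rightarrow> real"
  assumes [measurable]: "a \<in> borel_measurable N" "b \<in> borel_measurable N" "t \<in> borel_measurable N"
  shows "(\<lambda>z. indicator {a z..b z} (t z) :: ennreal) \<in> borel_measurable N"
  unfolding indicator_def atLeastAtMost_iff by measurable

context spectrally_negative_levy
begin

definition increments :: "real \<Rightarrow> 'a \<Rightarrow> real \<Rightarrow> real" where
  "increments s \<omega> = (\<lambda>t. X (s + max 0 t) \<omega> - X s \<omega>)"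

definition path_law :: "real \<Rightarrow> (real \<Rightarrow> real) measure" where
  "path_law x = distr M path_space (\<lambda>\<omega> t. x + increments 0 \<omega> t)"

definition hist :: "real \<Rightarrow> 'a measure" where
  "hist s = vimage_algebra (space M) (\<lambda>\<omega>. \<lambda>t\<in>{0..s}. X t \<omega>) (PiM {0..s} (\<lambda>_. borel))"

lemma increments_in_path_set:
  assumes \<omega>: "\<omega> \<in> space M" and s: "0 \<le> s"
  shows "increments s \<omega> \<in> path_set"
proof -
  define f where "f = (\<lambda>t. X (max 0 t) \<omega>)"
  have R: "(f \<longlongrightarrow> f t) (at_right t)" for t
  proof (cases "t < 0")
    case True
    then have "\<forall>\<^sub>F u in at_right t. f t = f u"
      by (auto simp: eventually_at_right[OF True] f_def intro!: exI[of _ 0])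
    then show ?thesis by (rule Lim_transform_eventually[OF tendsto_const])
  next
    case False
    then have "((\<lambda>u. X u \<omega>) \<longlongrightarrow> X t \<omega>) (at_right t)"
      using paths_right_continuous[OF \<omega>, of t] by (simp add: continuous_within)
    moreover have "\<forall>\<^sub>F u in at_right t. X u \<omega> = f u"
      using False by (auto simp: eventually_at_filter f_def)
    ultimately show ?thesis using False by (auto simp: f_def intro: Lim_transform_eventually)
  qed
  have L: "\<exists>l. (f \<longlongrightarrow> l) (at_left t) \<and> f t \<le> l" if t: "0 < t" for t
  proof -
    obtain l where l: "((\<lambda>u. X u \<omega>) \<longlongrightarrow> l) (at_left t)" "X t \<omega> \<le> l"
      using paths_no_pos_jumps[OF \<omega> t] by auto
    have "\<forall>\<^sub>F u in at_left t. X u \<omega> = f u"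
      using t by (auto simp: eventually_at_left[OF t] f_def intro!: exI[of _ 0])
    then show ?thesis using l t by (auto simp: f_def intro: Lim_transform_eventually)
  qed
  have C: "f t = f 0" if "t \<le> 0" for t using that by (simp add: f_def)
  have "f \<in> path_set" unfolding path_set_def using R L C by blast
  then have "(\<lambda>t. - X s \<omega> + shift_path s f t) \<in> path_set"
    by (intro translate_in_path_set shift_path_in_path_set)
  also have "(\<lambda>t. - X s \<omega> + shift_path s f t) = increments s \<omega>"
    using s by (auto simp: increments_def shift_path_def f_def fun_eq_iff)
  finally show ?thesis .
qed

lemma increments_measurable [measurable]:
  assumes "0 \<le> s" shows "increments s \<in> measurable M path_space"
proof (rule measurable_path_spaceI)
  have [measurable]: "X (s + max 0 t) \<in> borel_measurable M" "X s \<in> borel_measurable M" for t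
    using assms by (intro rv; simp)+
  show "(\<lambda>\<omega>. increments s \<omega> t) \<in> borel_measurable M" for t
    unfolding increments_def by measurable
qed (rule increments_in_path_set[OF _ assms])

lemma path_map_measurable [measurable]:
  "(\<lambda>\<omega> t. x + increments 0 \<omega> t) \<in> measurable M path_space"
  by (rule measurable_translate_path) auto

lemma sets_path_law [measurable_cong, simp]: "sets (path_law x) = sets path_space"
  by (simp add: path_law_def)

lemma space_path_law [simp]: "space (path_law x) = path_set"
  by (simp add: path_law_def)

lemma prob_space_path_law: "prob_space (path_law x)"
  unfolding path_law_def by (rule prob_space_distr) measurable

lemma path_law_translate: "path_law x = distr (path_law 0) path_space (\<lambda>f t. x + f t)"
  unfolding path_law_def by (subst distr_distr) (auto simp: comp_def)

lemma nn_integral_path_law: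
  assumes [measurable]: "h \<in> borel_measurable path_space"
  shows "(\<integral>\<^sup>+f. h f \<partial>path_law x) = (\<integral>\<^sup>+f. h (\<lambda>t. x + f t) \<partial>path_law 0)"
  by (subst path_law_translate) (simp add: nn_integral_distr)

lemma AE_path_law_start: "AE f in path_law x. f 0 = x"
proof -
  note measurable_path_component[measurable]
  have "{f \<in> space path_space. f 0 = x} \<in> sets path_space" by measurable
  then show ?thesis unfolding path_law_def
    by (subst AE_distr_iff[OF path_map_measurable]) (auto simp: increments_def)
qed

lemma measurable_path_law_integral [measurable (raw)]:
  assumes h: "(\<lambda>(z, f). h z f) \<in> borel_measurable (N \<Otimes>\<^sub>M path_space)" and [measurable]: "k \<in> borel_measurable N"
  shows "(\<lambda>z. \<integral>\<^sup>+f. h z f \<partial>path_law (k z)) \<in> borel_measurable N"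
proof -
  note [measurable (raw)] = measurable_case_prod_comp[OF h]
  interpret P: prob_space "path_law 0" by (rule prob_space_path_law)
  have "(\<lambda>z. \<integral>\<^sup>+f. h z (\<lambda>t. k z + f t) \<partial>path_law 0) \<in> borel_measurable N"
    by measurable
  moreover have "(\<integral>\<^sup>+f. h z f \<partial>path_law (k z)) = (\<integral>\<^sup>+f. h z (\<lambda>t. k z + f t) \<partial>path_law 0)"
    if "z \<in> space N" for z
    using that by (intro nn_integral_path_law) measurable
  ultimately show ?thesis by (simp cong: measurable_cong)
qed

lemma space_hist [simp]: "space (hist s) = space M"
  by (simp add: hist_def)

lemma sets_hist: "sets (hist s) = path_sigma M X {0..s}"
  by (simp add: hist_def path_sigma_def)

lemma measurable_hist_component: "0 \<le> t \<Longrightarrow> t \<le> s \<Longrightarrow> X t \<in> borel_measurable (hist s)"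
proof -
  assume t: "0 \<le> t" "t \<le> s"
  have "(\<lambda>\<omega>. \<lambda>t\<in>{0..s}. X t \<omega>) \<in> measurable (hist s) (PiM {0..s} (\<lambda>_. borel))"
    unfolding hist_def by (rule measurable_vimage_algebra1) (auto simp: space_PiM)
  from measurable_compose[OF this measurable_component_singleton[of t]]
  show ?thesis using t by simp
qed

lemma id_measurable_hist: "(\<lambda>\<omega>. \<omega>) \<in> measurable M (hist s)"
proof -
  have "(\<lambda>\<omega>. \<lambda>t\<in>{0..s}. X t \<omega>) \<in> measurable M (PiM {0..s} (\<lambda>_. borel))"
    by (rule measurable_restrict) (auto intro: rv)
  then show ?thesis unfolding hist_def by (intro measurable_vimage_algebra2) auto
qed

lemma sets_hist_subset: "A \<in> sets (hist s) \<Longrightarrow> A \<in> sets M"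
  using measurable_sets[OF id_measurable_hist, of A s] sets.sets_into_space[of A "hist s"]
  by (simp add: Int_absorb2)

text \<open>Independence makes the joint law of history and increment a product measure, and stationarity identifies the
second factor.\<close>

lemma nn_integral_hist_increment:
  assumes st: "0 \<le> s" "s \<le> t"
    and \<Psi>: "case_prod \<Psi> \<in> borel_measurable (hist s \<Otimes>\<^sub>M borel)"
  shows "(\<integral>\<^sup>+\<omega>. \<Psi> \<omega> (X t \<omega> - X s \<omega>) \<partial>M) = (\<integral>\<^sup>+\<omega>. \<integral>\<^sup>+y. \<Psi> \<omega> y \<partial>distr M borel (X (t - s)) \<partial>M)"
proof -
  define Y where "Y = (\<lambda>\<omega>. X t \<omega> - X s \<omega>)"
  have Y[measurable]: "Y \<in> borel_measurable M"
    unfolding Y_def using st by (intro borel_measurable_diff rv) auto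
  note id_measurable_hist[of s, measurable]
  interpret H: prob_space "distr M (hist s) (\<lambda>\<omega>. \<omega>)" by (rule prob_space_distr) measurable
  interpret L: prob_space "distr M borel Y" by (rule prob_space_distr) measurable
  have law: "distr M borel Y = distr M borel (X (t - s))"
    unfolding Y_def using stationary_increments[OF st] .
  have joint: "distr M (hist s) (\<lambda>\<omega>. \<omega>) \<Otimes>\<^sub>M distr M borel Y = distr M (hist s \<Otimes>\<^sub>M borel) (\<lambda>\<omega>. (\<omega>, Y \<omega>))"
  proof (rule pair_measure_eqI)
    fix A B assume "A \<in> sets (distr M (hist s) (\<lambda>\<omega>. \<omega>))" "B \<in> sets (distr M borel Y)"
    then have A: "A \<in> sets (hist s)" and B[measurable]: "B \<in> sets borel" by auto
    have AM[measurable]: "A \<in> sets M" using A by (rule sets_hist_subset)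
    have "Y -` B \<inter> space M \<in> var_sigma M Y"
      unfolding var_sigma_def using B by (intro in_vimage_algebra)
    moreover have "A \<in> path_sigma M X {0..s}" using A by (simp add: sets_hist)
    ultimately have "prob ((Y -` B \<inter> space M) \<inter> A) = prob (Y -` B \<inter> space M) * prob A"
      using indep_increments[OF st] unfolding Y_def by (intro indep_setD)
    then have "emeasure M (A \<inter> (Y -` B \<inter> space M)) = emeasure M A * emeasure M (Y -` B \<inter> space M)"
      by (simp add: emeasure_eq_measure ennreal_mult[symmetric] Int_commute mult.commute)
    moreover have "emeasure (distr M (hist s \<Otimes>\<^sub>M borel) (\<lambda>\<omega>. (\<omega>, Y \<omega>))) (A \<times> B) = emeasure M (A \<inter> (Y -` B \<inter> space M))"
      using A B by (subst emeasure_distr) (auto intro!: arg_cong[where f="emeasure M"])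
    ultimately show "emeasure (distr M (hist s) (\<lambda>\<omega>. \<omega>)) A * emeasure (distr M borel Y) B
      = emeasure (distr M (hist s \<Otimes>\<^sub>M borel) (\<lambda>\<omega>. (\<omega>, Y \<omega>))) (A \<times> B)"
      using A B sets.sets_into_space[OF AM] by (simp add: emeasure_distr Int_absorb2)
  qed (auto intro: H.sigma_finite_measure_axioms L.sigma_finite_measure_axioms)
  have "(\<integral>\<^sup>+\<omega>. \<Psi> \<omega> (Y \<omega>) \<partial>M) = (\<integral>\<^sup>+z. case_prod \<Psi> z \<partial>distr M (hist s \<Otimes>\<^sub>M borel) (\<lambda>\<omega>. (\<omega>, Y \<omega>)))"
    using \<Psi> by (subst nn_integral_distr) auto
  also have "\<dots> = (\<integral>\<^sup>+\<omega>. \<integral>\<^sup>+y. \<Psi> \<omega> y \<partial>distr M borel Y \<partial>distr M (hist s) (\<lambda>\<omega>. \<omega>))"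
    unfolding joint[symmetric] using \<Psi> by (subst L.nn_integral_fst[symmetric]) (auto cong: measurable_cong_sets)
  also have "\<dots> = (\<integral>\<^sup>+\<omega>. \<integral>\<^sup>+y. \<Psi> \<omega> y \<partial>distr M borel Y \<partial>M)"
    using \<Psi> by (subst nn_integral_distr)
      (auto intro!: L.borel_measurable_nn_integral cong: measurable_cong_sets)
  finally show ?thesis unfolding law by (simp add: Y_def)
qed

text \<open>Integrating out the increment after the last but one of finitely many time points removes the last point and
modifies the factor at the one before it.\<close>

lemma cylinder_step:
  assumes s: "0 \<le> s" and A: "A \<in> sets (hist s)" and J: "finite J" "J \<noteq> {}" and b: "\<And>j. j \<in> J \<Longrightarrow> j < b"
    and \<phi>[measurable]: "\<And>j. \<phi> j \<in> borel_measurable borel"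
  defines "a \<equiv> Max J"
  shows "(\<integral>\<^sup>+\<omega>. indicator A \<omega> * (\<Prod>j\<in>insert b J. \<phi> j (increments s \<omega> j)) \<partial>M)
    = (\<integral>\<^sup>+\<omega>. indicator A \<omega> * (\<Prod>j\<in>J. (\<phi>(a := \<lambda>z. \<phi> a z * (\<integral>\<^sup>+y. \<phi> b (z + y) \<partial>distr M borel (X (max 0 b - max 0 a))))) j
        (increments s \<omega> j)) \<partial>M)"
proof -
  define u where "u = max 0 b"
  define v where "v = max 0 a"
  have a: "a \<in> J" "\<And>j. j \<in> J \<Longrightarrow> j \<le> a" unfolding a_def using J by auto
  have uv: "0 \<le> v" "v \<le> u" using b[OF a(1)] by (auto simp: u_def v_def)
  have j_v: "j \<in> J \<Longrightarrow> max 0 j \<le> v" for j using a(2)[of j] by (auto simp: v_def)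
  have "b \<notin> J" using b by auto
  define g where "g z = (\<integral>\<^sup>+y. \<phi> b (z + y) \<partial>distr M borel (X (u - v)))" for z
  interpret L: prob_space "distr M borel (X (u - v))" using uv by (intro prob_space_distr rv) simp
  have comp: "X (s + max 0 j) \<in> borel_measurable (hist (s + v))" if "j \<in> J" for j
    using j_v[OF that] s by (intro measurable_hist_component) auto
  have comps: "X s \<in> borel_measurable (hist (s + v))" "X (s + v) \<in> borel_measurable (hist (s + v))"
    using s uv by (auto intro!: measurable_hist_component)
  have [measurable]: "A \<in> sets (hist (s + v))"
  proof -
    have "(\<lambda>\<omega>. \<lambda>t\<in>{0..s}. X t \<omega>) \<in> measurable (hist (s + v)) (PiM {0..s} (\<lambda>_. borel))"
      using uv by (intro measurable_restrict measurable_hist_component) auto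
    then have "(\<lambda>\<omega>. \<omega>) \<in> measurable (hist (s + v)) (hist s)"
      unfolding hist_def[of s] by (intro measurable_vimage_algebra2) auto
    from measurable_sets[OF this A] show ?thesis
      using sets.sets_into_space[OF A] by (simp add: Int_absorb2)
  qed
  note [measurable] = comps
  have [measurable]: "(\<lambda>\<omega>. \<phi> j (X (s + max 0 j) \<omega> - X s \<omega>)) \<in> borel_measurable (hist (s + v))" if "j \<in> J" for j
    using comp[OF that] by measurable
  define \<Psi> where "\<Psi> \<omega> y = indicator A \<omega> * (\<Prod>j\<in>J. \<phi> j (X (s + max 0 j) \<omega> - X s \<omega>)) * \<phi> b (X (s + v) \<omega> - X s \<omega> + y)" for \<omega> y
  have [measurable]: "(\<lambda>\<omega>. \<Prod>j\<in>J. \<phi> j (X (s + max 0 j) \<omega> - X s \<omega>)) \<in> borel_measurable (hist (s + v))"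
    by (rule borel_measurable_prod_ennreal) measurable
  have "(\<integral>\<^sup>+\<omega>. indicator A \<omega> * (\<Prod>j\<in>insert b J. \<phi> j (increments s \<omega> j)) \<partial>M)
      = (\<integral>\<^sup>+\<omega>. \<Psi> \<omega> (X (s + u) \<omega> - X (s + v) \<omega>) \<partial>M)"
    using \<open>b \<notin> J\<close> J by (simp add: \<Psi>_def increments_def u_def mult_ac)
  also have "\<dots> = (\<integral>\<^sup>+\<omega>. \<integral>\<^sup>+y. \<Psi> \<omega> y \<partial>distr M borel (X (u - v)) \<partial>M)"
    using s uv by (subst nn_integral_hist_increment[of "s + v" "s + u" \<Psi>]) (auto simp: \<Psi>_def[abs_def])
  also have "\<dots> = (\<integral>\<^sup>+\<omega>. indicator A \<omega> * (\<Prod>j\<in>J. \<phi> j (increments s \<omega> j)) * g (increments s \<omega> a) \<partial>M)"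
    unfolding \<Psi>_def g_def
    by (subst nn_integral_cmult) (auto simp: increments_def v_def)
  also have "\<dots> = (\<integral>\<^sup>+\<omega>. indicator A \<omega> * (\<Prod>j\<in>J. (\<phi>(a := \<lambda>z. \<phi> a z * g z)) j (increments s \<omega> j)) \<partial>M)"
  proof (rule nn_integral_cong)
    fix \<omega>
    have "(\<Prod>j\<in>J. (\<phi>(a := \<lambda>z. \<phi> a z * g z)) j (increments s \<omega> j))
        = \<phi> a (increments s \<omega> a) * g (increments s \<omega> a) * (\<Prod>j\<in>J - {a}. \<phi> j (increments s \<omega> j))"
      using a J by (subst prod.remove[of _ a]) (auto intro!: arg_cong2[where f=times] prod.cong)
    also have "\<dots> = (\<Prod>j\<in>J. \<phi> j (increments s \<omega> j)) * g (increments s \<omega> a)"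
      using a J by (subst (2) prod.remove[of _ a]) (auto simp: mult_ac)
    finally show "indicator A \<omega> * (\<Prod>j\<in>J. \<phi> j (increments s \<omega> j)) * g (increments s \<omega> a)
      = indicator A \<omega> * (\<Prod>j\<in>J. (\<phi>(a := \<lambda>z. \<phi> a z * g z)) j (increments s \<omega> j))"
      by (simp add: mult_ac)
  qed
  finally show ?thesis unfolding g_def u_def v_def .
qed

text \<open>Removing the time points one after the other shows that the finite-dimensional distributions after time \<open>s\<close>
do not depend on the history and agree with those after time \<open>0\<close>.\<close>

lemma cylinder_indep:
  assumes "finite J" "0 \<le> s" "A \<in> sets (hist s)"
    and \<phi>: "\<And>j. \<phi> j \<in> borel_measurable borel"
  shows "(\<integral>\<^sup>+\<omega>. indicator A \<omega> * (\<Prod>j\<in>J. \<phi> j (increments s \<omega> j)) \<partial>M)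
    = emeasure M A * (\<integral>\<^sup>+\<omega>. indicator (space M) \<omega> * (\<Prod>j\<in>J. \<phi> j (increments 0 \<omega> j)) \<partial>M)"
  using assms(1) \<phi>
proof (induction J arbitrary: \<phi> rule: finite_linorder_max_induct)
  case empty
  then show ?case using sets_hist_subset[OF assms(3)] by (simp add: emeasure_space_1)
next
  case (insert b J)
  note [measurable] = insert.prems
  show ?case
  proof (cases "J = {}")
    case True
    define c where "c = (\<integral>\<^sup>+y. \<phi> b y \<partial>distr M borel (X (max 0 b)))"
    have "(\<integral>\<^sup>+\<omega>. indicator A \<omega> * \<phi> b (increments s \<omega> b) \<partial>M) = emeasure M A * c"
      if [measurable]: "A \<in> sets (hist s)" and s: "0 \<le> s" for A s
    proof -
      have "(\<integral>\<^sup>+\<omega>. indicator A \<omega> * \<phi> b (increments s \<omega> b) \<partial>M)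
        = (\<integral>\<^sup>+\<omega>. \<integral>\<^sup>+y. indicator A \<omega> * \<phi> b y \<partial>distr M borel (X (max 0 b)) \<partial>M)"
        using s nn_integral_hist_increment[of s "s + max 0 b" "\<lambda>\<omega> y. indicator A \<omega> * \<phi> b y"]
        by (simp add: increments_def)
      also have "\<dots> = (\<integral>\<^sup>+\<omega>. c * indicator A \<omega> \<partial>M)"
        by (simp add: c_def nn_integral_cmult mult.commute)
      also have "\<dots> = emeasure M A * c"
        using sets_hist_subset[OF that(1)] by (simp add: nn_integral_cmult_indicator mult.commute)
      finally show ?thesis .
    qed
    from this[OF assms(3,2)] this[of "space M" 0] show ?thesis
      using sets.top[of "hist 0"] by (simp add: True emeasure_space_1)
  next
    case False
    define a where "a = Max J"
    define \<phi>' where "\<phi>' = \<phi>(a := \<lambda>z. \<phi> a z * (\<integral>\<^sup>+y. \<phi> b (z + y) \<partial>distr M borel (X (max 0 b - max 0 a))))"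
    have ba: "a < b" using insert.hyps False by (simp add: a_def)
    interpret L: prob_space "distr M borel (X (max 0 b - max 0 a))" 
      using ba by (intro prob_space_distr rv) simp
    have \<phi>': "\<phi>' j \<in> borel_measurable borel" for j
      unfolding \<phi>'_def by (cases "j = a") auto
    have step: "(\<integral>\<^sup>+\<omega>. indicator A \<omega> * (\<Prod>j\<in>insert b J. \<phi> j (increments s \<omega> j)) \<partial>M)
      = (\<integral>\<^sup>+\<omega>. indicator A \<omega> * (\<Prod>j\<in>J. \<phi>' j (increments s \<omega> j)) \<partial>M)"
      if "A \<in> sets (hist s)" "0 \<le> s" for A s
      unfolding \<phi>'_def a_def using insert.hyps False that insert.prems by (intro cylinder_step) auto
    have "space M \<in> sets (hist 0)" using sets.top[of "hist 0"] by simp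
    with step[OF assms(3,2)] step[of "space M" 0] insert.IH[OF \<phi>'] show ?thesis by simp
  qed
qed

text \<open>Both sides are finite measures in \<open>C\<close>, so equality on cylinder sets suffices.\<close>

lemma emeasure_hist_increments:
  assumes s: "0 \<le> s" and A: "A \<in> sets (hist s)" and C: "C \<in> sets path_space"
  shows "emeasure M (A \<inter> (increments s -` C \<inter> space M)) = emeasure M A * emeasure (path_law 0) C"
proof -
  let ?N = "PiM UNIV (\<lambda>_. borel) :: (real \<Rightarrow> real) measure"
  have [measurable]: "A \<in> sets M" using A by (rule sets_hist_subset)
  have inc[measurable]: "increments s \<in> measurable M ?N" if "0 \<le> s" for s
    using increments_measurable[OF that] unfolding path_space_def measurable_restrict_space2_iff by simp
  have [measurable]: "increments 0 \<in> measurable M ?N" by (rule inc) simp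
  note [measurable] = inc[OF s]
  have eq: "distr (density M (indicator A)) ?N (increments s) = scale_measure (emeasure M A) (distr M ?N (increments 0))"
    (is "?P = ?Q")
  proof (rule measure_eqI_PiM_infinite)
    fix B :: "real \<Rightarrow> real set" and J :: "real set"
    assume J: "finite J" and B: "\<And>i. i \<in> J \<Longrightarrow> B i \<in> sets borel"
    define \<phi> where "\<phi> j = (if j \<in> J then indicator (B j) else (\<lambda>_. 1) :: real \<Rightarrow> ennreal)" for j
    have \<phi>: "\<phi> j \<in> borel_measurable borel" for j using B by (auto simp: \<phi>_def)
    let ?E = "prod_emb UNIV (\<lambda>_. borel) J (Pi\<^sub>E J B) :: (real \<Rightarrow> real) set"
    have E[measurable]: "?E \<in> sets ?N" using J B by (intro sets_PiM_I) auto
    have ind: "indicator ?E f = (\<Prod>j\<in>J. \<phi> j (f j))" for f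
    proof -
      have "f \<in> ?E \<longleftrightarrow> (\<forall>j\<in>J. f j \<in> B j)" by (auto simp: prod_emb_def space_PiM)
      then have "indicator ?E f = (if \<forall>j\<in>J. f j \<in> B j then 1 else 0 :: ennreal)" by (simp add: indicator_def)
      also have "\<dots> = (\<Prod>j\<in>J. \<phi> j (f j))"
      proof (cases "\<forall>j\<in>J. f j \<in> B j")
        case True then show ?thesis by (simp add: \<phi>_def)
      next
        case False
        then obtain j where "j \<in> J" "f j \<notin> B j" by blast
        then have "\<exists>j\<in>J. \<phi> j (f j) = 0" by (intro bexI[of _ j]) (simp_all add: \<phi>_def)
        then have z: "(\<Prod>j\<in>J. \<phi> j (f j)) = 0" using J by (intro prod_zero) auto
        show ?thesis by (simp only: z False if_False)
      qed
      finally show ?thesis .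
    qed
    have "emeasure ?P ?E = (\<integral>\<^sup>+f. indicator ?E f \<partial>?P)" by simp
    also have "\<dots> = (\<integral>\<^sup>+\<omega>. indicator ?E (increments s \<omega>) \<partial>density M (indicator A))"
      by (rule nn_integral_distr) auto
    also have "\<dots> = (\<integral>\<^sup>+\<omega>. indicator A \<omega> * indicator ?E (increments s \<omega>) \<partial>M)"
      by (rule nn_integral_density) auto
    also have "\<dots> = emeasure M A * (\<integral>\<^sup>+\<omega>. indicator (space M) \<omega> * (\<Prod>j\<in>J. \<phi> j (increments 0 \<omega> j)) \<partial>M)"
      unfolding ind using J s A \<phi> by (rule cylinder_indep)
    also have "(\<integral>\<^sup>+\<omega>. indicator (space M) \<omega> * (\<Prod>j\<in>J. \<phi> j (increments 0 \<omega> j)) \<partial>M)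
        = (\<integral>\<^sup>+\<omega>. indicator ?E (increments 0 \<omega>) \<partial>M)"
      unfolding ind by (intro nn_integral_cong) simp
    also have "\<dots> = (\<integral>\<^sup>+f. indicator ?E f \<partial>distr M ?N (increments 0))"
      by (rule nn_integral_distr[symmetric]) auto
    also have "\<dots> = emeasure (distr M ?N (increments 0)) ?E" by simp
    finally show "emeasure ?P ?E = emeasure ?Q ?E" by simp
  next
    show "finite_measure ?P"
    proof
      have "emeasure ?P (space ?P) = emeasure (density M (indicator A)) (increments s -` space ?N \<inter> space M)"
        by (subst emeasure_distr) auto
      also have "increments s -` space ?N \<inter> space M = space M" by (simp add: space_PiM)
      also have "emeasure (density M (indicator A)) (space M) = emeasure M A"
        by (simp add: emeasure_density)
      finally show "emeasure ?P (space ?P) \<noteq> \<infinity>" by simp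
    qed
  qed auto
  obtain B where B[measurable]: "B \<in> sets ?N" and CB: "C = B \<inter> path_set"
    using C unfolding path_space_def by (auto simp: sets_restrict_space)
  have pre: "increments s -` C \<inter> space M = increments s -` B \<inter> space M" if "0 \<le> s" for s
    using increments_in_path_set[OF _ that] unfolding CB by auto
  have "emeasure ?P B = (\<integral>\<^sup>+\<omega>. indicator A \<omega> * indicator (increments s -` B \<inter> space M) \<omega> \<partial>M)"
    by (simp add: emeasure_distr emeasure_density)
  also have "\<dots> = emeasure M (A \<inter> (increments s -` B \<inter> space M))"
    by (simp flip: indicator_inter_arith)
  finally have 1: "emeasure ?P B = emeasure M (A \<inter> (increments s -` C \<inter> space M))" using pre[OF s] by simp
  have "emeasure (path_law 0) C = emeasure M (increments 0 -` C \<inter> space M)"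
    unfolding path_law_def using C increments_measurable[of 0] by (simp add: emeasure_distr)
  also have "\<dots> = emeasure (distr M ?N (increments 0)) B"
    using pre[of 0] by (simp add: emeasure_distr)
  finally show ?thesis using 1 unfolding eq by simp
qed

lemma nn_integral_hist_increments:
  assumes s: "0 \<le> s" and K: "case_prod K \<in> borel_measurable (hist s \<Otimes>\<^sub>M path_space)"
  shows "(\<integral>\<^sup>+\<omega>. K \<omega> (increments s \<omega>) \<partial>M) = (\<integral>\<^sup>+\<omega>. \<integral>\<^sup>+g. K \<omega> g \<partial>path_law 0 \<partial>M)"
proof -
  note id_measurable_hist[of s, measurable]
  note [measurable] = increments_measurable[OF s]
  interpret H: prob_space "distr M (hist s) (\<lambda>\<omega>. \<omega>)" by (rule prob_space_distr) measurable
  interpret L: prob_space "path_law 0" by (rule prob_space_path_law)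
  have joint: "distr M (hist s) (\<lambda>\<omega>. \<omega>) \<Otimes>\<^sub>M path_law 0 = distr M (hist s \<Otimes>\<^sub>M path_space) (\<lambda>\<omega>. (\<omega>, increments s \<omega>))"
  proof (rule pair_measure_eqI)
    fix A B assume "A \<in> sets (distr M (hist s) (\<lambda>\<omega>. \<omega>))" "B \<in> sets (path_law 0)"
    then have A: "A \<in> sets (hist s)" and B[measurable]: "B \<in> sets path_space" by auto
    have AM[measurable]: "A \<in> sets M" using A by (rule sets_hist_subset)
    have "emeasure (distr M (hist s \<Otimes>\<^sub>M path_space) (\<lambda>\<omega>. (\<omega>, increments s \<omega>))) (A \<times> B)
        = emeasure M (A \<inter> (increments s -` B \<inter> space M))"
      using A B by (subst emeasure_distr) (auto intro!: arg_cong[where f="emeasure M"])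
    then show "emeasure (distr M (hist s) (\<lambda>\<omega>. \<omega>)) A * emeasure (path_law 0) B
      = emeasure (distr M (hist s \<Otimes>\<^sub>M path_space) (\<lambda>\<omega>. (\<omega>, increments s \<omega>))) (A \<times> B)"
      using A B sets.sets_into_space[OF AM] emeasure_hist_increments[OF s A B]
      by (simp add: emeasure_distr Int_absorb2)
  qed (auto intro: H.sigma_finite_measure_axioms L.sigma_finite_measure_axioms)
  have "(\<integral>\<^sup>+\<omega>. K \<omega> (increments s \<omega>) \<partial>M) = (\<integral>\<^sup>+z. case_prod K z \<partial>distr M (hist s \<Otimes>\<^sub>M path_space) (\<lambda>\<omega>. (\<omega>, increments s \<omega>)))"
    using K by (subst nn_integral_distr) auto
  also have "\<dots> = (\<integral>\<^sup>+\<omega>. \<integral>\<^sup>+g. K \<omega> g \<partial>path_law 0 \<partial>distr M (hist s) (\<lambda>\<omega>. \<omega>))"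
    unfolding joint[symmetric] using K by (subst L.nn_integral_fst[symmetric]) (auto cong: measurable_cong_sets)
  also have "\<dots> = (\<integral>\<^sup>+\<omega>. \<integral>\<^sup>+g. K \<omega> g \<partial>path_law 0 \<partial>M)"
    using K by (subst nn_integral_distr)
      (auto intro!: L.borel_measurable_nn_integral cong: measurable_cong_sets)
  finally show ?thesis .
qed

text \<open>The functional is split into what depends on the path up to \<open>s\<close>, through the stopped path, and what depends on
the path after \<open>s\<close>, through the shifted path. Given the history, the latter is a fresh path started at \<open>f s\<close>.\<close>

theorem markov_property:
  assumes s: "0 \<le> s" and H: "case_prod H \<in> borel_measurable (path_space \<Otimes>\<^sub>M path_space)"
  shows "(\<integral>\<^sup>+f. H (stop_path s f) (shift_path s f) \<partial>path_law x)
    = (\<integral>\<^sup>+f. \<integral>\<^sup>+g. H (stop_path s f) g \<partial>path_law (f s) \<partial>path_law x)"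
proof -
  note [measurable (raw)] = measurable_case_prod_comp[OF H]
  define Y where "Y \<omega> = (\<lambda>t. x + increments 0 \<omega> t)" for \<omega>
  have Y[measurable]: "Y \<in> measurable M path_space" unfolding Y_def by measurable
  have Y_path: "\<omega> \<in> space M \<Longrightarrow> Y \<omega> \<in> path_set" for \<omega>
    using measurable_space[OF Y] by simp
  have [measurable]: "(\<lambda>\<omega>. Y \<omega> s) \<in> borel_measurable (hist s)"
    unfolding Y_def increments_def using s
    by (intro borel_measurable_add borel_measurable_diff measurable_hist_component) auto
  have [measurable]: "(\<lambda>\<omega>. stop_path s (Y \<omega>)) \<in> measurable (hist s) path_space"
  proof (rule measurable_path_spaceI)
    fix t
    show "(\<lambda>\<omega>. stop_path s (Y \<omega>) t) \<in> borel_measurable (hist s)"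
      unfolding Y_def increments_def stop_path_def using s
      by (intro borel_measurable_add borel_measurable_diff measurable_hist_component) auto
  qed (simp add: Y_path stop_path_in_path_set)
  have shift: "shift_path s (Y \<omega>) = (\<lambda>t. Y \<omega> s + increments s \<omega> t)" for \<omega>
    using s by (auto simp: shift_path_def Y_def increments_def fun_eq_iff max_def)
  define K where "K \<omega> g = H (stop_path s (Y \<omega>)) (\<lambda>t. Y \<omega> s + g t)" for \<omega> g
  have K: "case_prod K \<in> borel_measurable (hist s \<Otimes>\<^sub>M path_space)"
    unfolding K_def[abs_def] by measurable
  have "(\<integral>\<^sup>+f. H (stop_path s f) (shift_path s f) \<partial>path_law x) = (\<integral>\<^sup>+\<omega>. H (stop_path s (Y \<omega>)) (shift_path s (Y \<omega>)) \<partial>M)"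
    unfolding path_law_def Y_def[symmetric] by (rule nn_integral_distr) measurable
  also have "\<dots> = (\<integral>\<^sup>+\<omega>. K \<omega> (increments s \<omega>) \<partial>M)" by (simp add: K_def shift)
  also have "\<dots> = (\<integral>\<^sup>+\<omega>. \<integral>\<^sup>+g. K \<omega> g \<partial>path_law 0 \<partial>M)"
    by (rule nn_integral_hist_increments[OF s K])
  also have "\<dots> = (\<integral>\<^sup>+\<omega>. \<integral>\<^sup>+g. H (stop_path s (Y \<omega>)) g \<partial>path_law (Y \<omega> s) \<partial>M)"
    unfolding K_def
    by (intro nn_integral_cong nn_integral_path_law[symmetric] measurable_case_prod_comp[OF H])
       (auto intro: Y_path stop_path_in_path_set)
  also have "\<dots> = (\<integral>\<^sup>+f. \<integral>\<^sup>+g. H (stop_path s f) g \<partial>path_law (f s) \<partial>path_law x)"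
    unfolding path_law_def[of x] Y_def[symmetric] by (rule nn_integral_distr[symmetric]) measurable
  finally show ?thesis .
qed

text \<open>The Markov property at every time \<open>t\<close>, followed by the change of variables \<open>u = t + v\<close>. The double time integral
on the right lets pathwise identities between \<open>t\<close> and \<open>u\<close> be used.\<close>

lemma markov_integrated:
  fixes \<Psi> \<Gamma> :: "real \<Rightarrow> (real \<Rightarrow> real) \<Rightarrow> ennreal"
  assumes \<Psi>: "case_prod \<Psi> \<in> borel_measurable (borel \<Otimes>\<^sub>M path_space)"
    and \<Gamma>: "case_prod \<Gamma> \<in> borel_measurable (borel \<Otimes>\<^sub>M path_space)"
    and adapted: "\<And>t f. 0 \<le> t \<Longrightarrow> f \<in> path_set \<Longrightarrow> \<Psi> t (stop_path t f) = \<Psi> t f"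
  shows "(\<integral>\<^sup>+f. (\<integral>\<^sup>+t\<in>{0..}. \<Psi> t f * (\<integral>\<^sup>+g. (\<integral>\<^sup>+v\<in>{0..}. \<Gamma> v g \<partial>lborel) \<partial>path_law (f t)) \<partial>lborel) \<partial>path_law x)
    = (\<integral>\<^sup>+f. (\<integral>\<^sup>+u\<in>{0..}. (\<integral>\<^sup>+t\<in>{0..u}. \<Psi> t f * \<Gamma> (u - t) (shift_path t f) \<partial>lborel) \<partial>lborel) \<partial>path_law x)"
proof -
  note [measurable (raw)] = measurable_case_prod_comp[OF \<Psi>] measurable_case_prod_comp[OF \<Gamma>]
  interpret P: prob_space "path_law x" by (rule prob_space_path_law)
  interpret PL: pair_sigma_finite "path_law x" lborel ..
  define G where "G g = (\<integral>\<^sup>+v\<in>{0..}. \<Gamma> v g \<partial>lborel)" for g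
  have [measurable]: "G \<in> borel_measurable path_space" unfolding G_def by measurable
  have "(\<integral>\<^sup>+f. (\<integral>\<^sup>+t\<in>{0..}. \<Psi> t f * (\<integral>\<^sup>+g. G g \<partial>path_law (f t)) \<partial>lborel) \<partial>path_law x)
      = (\<integral>\<^sup>+t. \<integral>\<^sup>+f. \<Psi> t f * (\<integral>\<^sup>+g. G g \<partial>path_law (f t)) * indicator {0..} t \<partial>path_law x \<partial>lborel)"
    by (rule PL.Fubini'[symmetric]) measurable
  also have "\<dots> = (\<integral>\<^sup>+t. \<integral>\<^sup>+f. \<Psi> t f * G (shift_path t f) * indicator {0..} t \<partial>path_law x \<partial>lborel)"
  proof (rule nn_integral_cong)
    fix t :: real
    show "(\<integral>\<^sup>+f. \<Psi> t f * (\<integral>\<^sup>+g. G g \<partial>path_law (f t)) * indicator {0..} t \<partial>path_law x)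
        = (\<integral>\<^sup>+f. \<Psi> t f * G (shift_path t f) * indicator {0..} t \<partial>path_law x)"
    proof (cases "0 \<le> t")
      case True
      have "(\<integral>\<^sup>+f. \<Psi> t (stop_path t f) * G (shift_path t f) \<partial>path_law x)
        = (\<integral>\<^sup>+f. \<integral>\<^sup>+g. \<Psi> t (stop_path t f) * G g \<partial>path_law (f t) \<partial>path_law x)"
        by (rule markov_property[OF True, of "\<lambda>f g. \<Psi> t f * G g"]) measurable
      also have "\<dots> = (\<integral>\<^sup>+f. \<Psi> t (stop_path t f) * (\<integral>\<^sup>+g. G g \<partial>path_law (f t)) \<partial>path_law x)"
        by (intro nn_integral_cong nn_integral_cmult) measurable
      finally have eq: "(\<integral>\<^sup>+f. \<Psi> t (stop_path t f) * G (shift_path t f) \<partial>path_law x)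
        = (\<integral>\<^sup>+f. \<Psi> t (stop_path t f) * (\<integral>\<^sup>+g. G g \<partial>path_law (f t)) \<partial>path_law x)" .
      have "(\<integral>\<^sup>+f. \<Psi> t f * (\<integral>\<^sup>+g. G g \<partial>path_law (f t)) * indicator {0..} t \<partial>path_law x)
        = (\<integral>\<^sup>+f. \<Psi> t (stop_path t f) * (\<integral>\<^sup>+g. G g \<partial>path_law (f t)) \<partial>path_law x)"
        using True by (intro nn_integral_cong) (simp add: adapted)
      also have "\<dots> = (\<integral>\<^sup>+f. \<Psi> t f * G (shift_path t f) * indicator {0..} t \<partial>path_law x)"
        unfolding eq[symmetric] using True by (intro nn_integral_cong) (simp add: adapted)
      finally show ?thesis .
    qed simp
  qed
  also have "\<dots> = (\<integral>\<^sup>+f. \<integral>\<^sup>+t. \<Psi> t f * G (shift_path t f) * indicator {0..} t \<partial>lborel \<partial>path_law x)"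
    by (rule PL.Fubini') measurable
  also have "\<dots> = (\<integral>\<^sup>+f. (\<integral>\<^sup>+u\<in>{0..}. (\<integral>\<^sup>+t\<in>{0..u}. \<Psi> t f * \<Gamma> (u - t) (shift_path t f) \<partial>lborel) \<partial>lborel) \<partial>path_law x)"
  proof (rule nn_integral_cong)
    fix f assume "f \<in> space (path_law x)"
    then have f: "f \<in> path_set" by simp
    then have [measurable (raw)]: "(\<lambda>_. f) \<in> measurable N path_space" for N :: "real measure" by simp
    have "(\<integral>\<^sup>+t. \<Psi> t f * G (shift_path t f) * indicator {0..} t \<partial>lborel)
       = (\<integral>\<^sup>+t. \<integral>\<^sup>+u. \<Psi> t f * \<Gamma> (u - t) (shift_path t f) * indicator {0..} t * indicator {t..} u \<partial>lborel \<partial>lborel)"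
    proof (rule nn_integral_cong)
      fix t :: real
      have [measurable (raw)]: "(\<lambda>_. shift_path t f) \<in> measurable N path_space" for N :: "real measure"
        using f by (simp add: shift_path_in_path_set)
      have "G (shift_path t f) = (\<integral>\<^sup>+u. \<Gamma> (u - t) (shift_path t f) * indicator {t..} u \<partial>lborel)"
        unfolding G_def
        by (subst nn_integral_real_affine[where c=1 and t="-t"]) (auto intro!: nn_integral_cong simp: indicator_def)
      then show "\<Psi> t f * G (shift_path t f) * indicator {0..} t
        = (\<integral>\<^sup>+u. \<Psi> t f * \<Gamma> (u - t) (shift_path t f) * indicator {0..} t * indicator {t..} u \<partial>lborel)"
        by (simp add: nn_integral_cmult[symmetric] mult_ac)
    qed
    also have "\<dots> = (\<integral>\<^sup>+u. \<integral>\<^sup>+t. \<Psi> t f * \<Gamma> (u - t) (shift_path t f) * indicator {0..} t * indicator {t..} u \<partial>lborel \<partial>lborel)"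
    proof (rule lborel_pair.Fubini')
      have c: "(\<lambda>_. f) \<in> measurable (lborel \<Otimes>\<^sub>M lborel) path_space" using f by simp
      have [measurable]: "(\<lambda>z. \<Psi> (snd z) f) \<in> borel_measurable (lborel \<Otimes>\<^sub>M lborel)"
        by (rule measurable_case_prod_comp[OF \<Psi> _ c]) measurable
      have [measurable]: "(\<lambda>z. \<Gamma> (fst z - snd z) (shift_path (snd z) f)) \<in> borel_measurable (lborel \<Otimes>\<^sub>M lborel)"
        by (rule measurable_case_prod_comp[OF \<Gamma> _ measurable_shift_path[OF c]]) measurable
      show "(\<lambda>(u, t). \<Psi> t f * \<Gamma> (u - t) (shift_path t f) * indicator {0..} t * indicator {t..} u)
        \<in> borel_measurable (lborel \<Otimes>\<^sub>M lborel)"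
        unfolding indicator_def atLeast_iff split_beta' by measurable
    qed
    also have "\<dots> = (\<integral>\<^sup>+u\<in>{0..}. (\<integral>\<^sup>+t\<in>{0..u}. \<Psi> t f * \<Gamma> (u - t) (shift_path t f) \<partial>lborel) \<partial>lborel)"
      by (subst nn_integral_multc[symmetric]; (intro nn_integral_cong)?) (auto simp: indicator_def)
    finally show "(\<integral>\<^sup>+t. \<Psi> t f * G (shift_path t f) * indicator {0..} t \<partial>lborel)
      = (\<integral>\<^sup>+u\<in>{0..}. (\<integral>\<^sup>+t\<in>{0..u}. \<Psi> t f * \<Gamma> (u - t) (shift_path t f) \<partial>lborel) \<partial>lborel)" .
  qed
  finally show ?thesis unfolding G_def .
qed

text \<open>Expected discounted occupation, with the discount given by an arbitrary nonnegative functional of the path. All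
resolvents below (free, killed at first passage, discounted by occupation time, restricted to windows after the
last positive time) are instances.\<close>

definition potential :: "(real \<Rightarrow> (real \<Rightarrow> real) \<Rightarrow> ennreal) \<Rightarrow> (real \<Rightarrow> ennreal) \<Rightarrow> real \<Rightarrow> ennreal" where
  "potential m \<phi> x = (\<integral>\<^sup>+f. (\<integral>\<^sup>+t\<in>{0..}. m t f * \<phi> (f t) \<partial>lborel) \<partial>path_law x)"

lemma measurable_potential [measurable (raw)]:
  assumes m: "case_prod m \<in> borel_measurable (borel \<Otimes>\<^sub>M path_space)"
    and [measurable]: "\<phi> \<in> borel_measurable borel" "k \<in> borel_measurable N"
  shows "(\<lambda>z. potential m \<phi> (k z)) \<in> borel_measurable N"
proof -
  note [measurable (raw)] = measurable_case_prod_comp[OF m]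
  show ?thesis unfolding potential_def by measurable
qed

text \<open>A pathwise Duhamel formula between two discounts becomes a resolvent equation: the Markov property at the
intermediate time turns the second discount into a potential.\<close>

lemma potential_perturbation:
  assumes m2: "case_prod m2 \<in> borel_measurable (borel \<Otimes>\<^sub>M path_space)"
    and ma: "case_prod ma \<in> borel_measurable (borel \<Otimes>\<^sub>M path_space)"
    and mb: "case_prod mb \<in> borel_measurable (borel \<Otimes>\<^sub>M path_space)"
    and [measurable]: "D \<in> borel_measurable borel" "\<phi> \<in> borel_measurable borel"
    and adapted: "\<And>t f. 0 \<le> t \<Longrightarrow> f \<in> path_set \<Longrightarrow> ma t (stop_path t f) = ma t f"
    and eq: "\<And>u f. 0 \<le> u \<Longrightarrow> f \<in> path_set \<Longrightarrow>
      m1 u f = m2 u f + (\<integral>\<^sup>+t\<in>{0..u}. ma t f * D (f t) * mb (u - t) (shift_path t f) \<partial>lborel)"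
  shows "potential m1 \<phi> x = potential m2 \<phi> x + potential ma (\<lambda>y. D y * potential mb \<phi> y) x"
proof -
  note [measurable (raw)] = measurable_case_prod_comp[OF m2] measurable_case_prod_comp[OF ma] measurable_case_prod_comp[OF mb]
  have stop_at: "stop_path t f t = f t" for t f by (simp add: stop_path_def)
  have "potential ma (\<lambda>y. D y * potential mb \<phi> y) x = (\<integral>\<^sup>+f. (\<integral>\<^sup>+t\<in>{0..}. (ma t f * D (f t)) *
      (\<integral>\<^sup>+g. (\<integral>\<^sup>+v\<in>{0..}. mb v g * \<phi> (g v) \<partial>lborel) \<partial>path_law (f t)) \<partial>lborel) \<partial>path_law x)"
    by (simp add: potential_def mult.assoc)
  also have "\<dots> = (\<integral>\<^sup>+f. (\<integral>\<^sup>+u\<in>{0..}. (\<integral>\<^sup>+t\<in>{0..u}. (ma t f * D (f t)) *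
      (mb (u - t) (shift_path t f) * \<phi> (shift_path t f (u - t))) \<partial>lborel) \<partial>lborel) \<partial>path_law x)"
    by (rule markov_integrated) (measurable, simp add: adapted stop_at)
  also have "\<dots> = (\<integral>\<^sup>+f. (\<integral>\<^sup>+u\<in>{0..}. (\<integral>\<^sup>+t\<in>{0..u}. ma t f * D (f t) * mb (u - t) (shift_path t f) \<partial>lborel) * \<phi> (f u)
      \<partial>lborel) \<partial>path_law x)"
  proof (intro nn_integral_cong)
    fix f u assume "f \<in> space (path_law x)"
    then have f: "f \<in> path_set" by simp
    then have [measurable (raw)]: "(\<lambda>_. f) \<in> measurable N path_space" for N :: "real measure" by simp
    have [measurable]: "f \<in> borel_measurable borel" using f by (rule path_measurable)
    have const: "(\<lambda>_. f) \<in> measurable borel path_space" using f by simp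
    have m1: "(\<lambda>t. ma t f) \<in> borel_measurable borel"
      by (rule measurable_case_prod_comp[OF ma _ const]) simp
    have m2: "(\<lambda>t. mb (u - t) (shift_path t f)) \<in> borel_measurable borel"
      by (rule measurable_case_prod_comp[OF mb _ measurable_shift_path[OF const]]) simp_all
    have m3: "(\<lambda>t. D (f t)) \<in> borel_measurable borel"
      by (rule measurable_compose[OF path_measurable[OF f]]) simp
    have m: "(\<lambda>t. ma t f * D (f t) * mb (u - t) (shift_path t f) * indicator {0..u} t) \<in> borel_measurable lborel"
      using m1 m2 m3 by simp
    have "(\<integral>\<^sup>+t\<in>{0..u}. (ma t f * D (f t)) * (mb (u - t) (shift_path t f) * \<phi> (shift_path t f (u - t))) \<partial>lborel)
      = (\<integral>\<^sup>+t. (ma t f * D (f t) * mb (u - t) (shift_path t f) * indicator {0..u} t) * \<phi> (f u) \<partial>lborel)"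
      by (intro nn_integral_cong) (auto simp: indicator_def shift_path_eq mult_ac)
    also have "\<dots> = (\<integral>\<^sup>+t\<in>{0..u}. ma t f * D (f t) * mb (u - t) (shift_path t f) \<partial>lborel) * \<phi> (f u)"
      by (rule nn_integral_multc[OF m])
    finally show "(\<integral>\<^sup>+t\<in>{0..u}. (ma t f * D (f t)) * (mb (u - t) (shift_path t f) * \<phi> (shift_path t f (u - t))) \<partial>lborel) * indicator {0..} u
      = (\<integral>\<^sup>+t\<in>{0..u}. ma t f * D (f t) * mb (u - t) (shift_path t f) \<partial>lborel) * \<phi> (f u) * indicator {0..} u"
      by simp
  qed
  finally have P: "potential ma (\<lambda>y. D y * potential mb \<phi> y) x = \<dots>" .
  define I where "I f u = (\<integral>\<^sup>+t\<in>{0..u}. ma t f * D (f t) * mb (u - t) (shift_path t f) \<partial>lborel)" for f u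
  have I: "(\<lambda>z. I (fst z) (snd z) * \<phi> (fst z (snd z)) * indicator {0..} (snd z)) \<in> borel_measurable (path_space \<Otimes>\<^sub>M lborel)"
    unfolding I_def by measurable
  have m: "(\<lambda>z. m2 (snd z) (fst z) * \<phi> (fst z (snd z)) * indicator {0..} (snd z)) \<in> borel_measurable (path_space \<Otimes>\<^sub>M lborel)"
    by measurable
  have split: "(\<integral>\<^sup>+t\<in>{0..}. m1 t f * \<phi> (f t) \<partial>lborel)
      = (\<integral>\<^sup>+t\<in>{0..}. m2 t f * \<phi> (f t) \<partial>lborel) + (\<integral>\<^sup>+u\<in>{0..}. I f u * \<phi> (f u) \<partial>lborel)"
    if "f \<in> path_set" for f
  proof -
    have "(\<integral>\<^sup>+t\<in>{0..}. m1 t f * \<phi> (f t) \<partial>lborel)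
        = (\<integral>\<^sup>+t. m2 t f * \<phi> (f t) * indicator {0..} t + I f t * \<phi> (f t) * indicator {0..} t \<partial>lborel)"
      using that by (intro nn_integral_cong) (auto simp: eq I_def indicator_def distrib_right)
    then show ?thesis
      using that measurable_Pair2[OF I, of f] measurable_Pair2[OF m, of f] by (simp add: nn_integral_add)
  qed
  have "potential m1 \<phi> x = (\<integral>\<^sup>+f. (\<integral>\<^sup>+t\<in>{0..}. m2 t f * \<phi> (f t) \<partial>lborel) + (\<integral>\<^sup>+u\<in>{0..}. I f u * \<phi> (f u) \<partial>lborel) \<partial>path_law x)"
    unfolding potential_def by (intro nn_integral_cong) (simp add: split)
  also have "\<dots> = (\<integral>\<^sup>+f. (\<integral>\<^sup>+t\<in>{0..}. m2 t f * \<phi> (f t) \<partial>lborel) \<partial>path_law x)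
      + (\<integral>\<^sup>+f. (\<integral>\<^sup>+u\<in>{0..}. I f u * \<phi> (f u) \<partial>lborel) \<partial>path_law x)"
  proof (rule nn_integral_add)
    show "(\<lambda>f. (\<integral>\<^sup>+t\<in>{0..}. m2 t f * \<phi> (f t) \<partial>lborel)) \<in> borel_measurable (path_law x)"
      by measurable
    show "(\<lambda>f. (\<integral>\<^sup>+u\<in>{0..}. I f u * \<phi> (f u) \<partial>lborel)) \<in> borel_measurable (path_law x)"
      unfolding I_def by measurable
  qed
  finally show ?thesis unfolding P unfolding potential_def I_def .
qed

end

section \<open>Discounted potentials and the first passage above zero\<close>

lemma nn_integral_exp_atLeast:
  fixes q :: real assumes "0 < q"
  shows "(\<integral>\<^sup>+t\<in>{a..}. ennreal (exp (- q * t)) \<partial>lborel) = ennreal (exp (- q * a) / q)"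
proof -
  have lim: "((\<lambda>t. - exp (- q * t) / q) \<longlongrightarrow> 0) at_top"
    using assms by real_asymp
  have "(\<integral>\<^sup>+t\<in>{a..}. ennreal (exp (- q * t)) \<partial>lborel) = ennreal (0 - (- exp (- q * a) / q))"
    using assms by (intro nn_integral_FTC_atLeast[OF _ _ _ lim]) (auto intro!: derivative_eq_intros)
  then show ?thesis by simp
qed

lemma nn_integral_exp_greaterThan:
  fixes q :: real assumes "0 < q"
  shows "(\<integral>\<^sup>+t\<in>{a<..}. ennreal (exp (- q * t)) \<partial>lborel) = ennreal (exp (- q * a) / q)"
proof -
  have "(\<integral>\<^sup>+t\<in>{a<..}. ennreal (exp (- q * t)) \<partial>lborel) = (\<integral>\<^sup>+t\<in>{a..}. ennreal (exp (- q * t)) \<partial>lborel)"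
  proof (rule nn_integral_cong_AE)
    show "AE t in lborel. ennreal (exp (- q * t)) * indicator {a<..} t = ennreal (exp (- q * t)) * indicator {a..} t"
      using AE_lborel_singleton[of a] by eventually_elim (auto simp: indicator_def)
  qed
  then show ?thesis unfolding nn_integral_exp_atLeast[OF assms] .
qed

definition first_positive :: "(real \<Rightarrow> real) \<Rightarrow> real" where
  "first_positive f = Inf {s. 0 \<le> s \<and> 0 < f s}"

text \<open>The absence of positive jumps enters here: the path does not jump over \<open>0\<close>, so it equals \<open>0\<close> at the first
passage time.\<close>

lemma first_positive:
  assumes f: "f \<in> path_set" "f 0 \<le> 0" and hit: "hits f t0"
  shows "0 \<le> first_positive f" "f (first_positive f) = 0" "hits f t \<longleftrightarrow> first_positive f < t"
proof -
  define S where "S = {s. 0 \<le> s \<and> 0 < f s}"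
  define \<tau> where "\<tau> = Inf S"
  have \<tau>: "first_positive f = \<tau>" by (simp add: first_positive_def \<tau>_def S_def)
  have ne: "S \<noteq> {}" using hit by (auto simp: hits_def S_def)
  have bdd: "bdd_below S" by (auto simp: S_def bdd_below_def)
  have nonneg: "0 \<le> \<tau>" unfolding \<tau>_def using ne by (rule cInf_greatest) (simp add: S_def)
  show "0 \<le> first_positive f" using nonneg \<tau> by simp
  have iff: "hits f t \<longleftrightarrow> \<tau> < t" for t
    using cInf_less_iff[OF ne bdd, of t] unfolding \<tau>_def by (auto simp: hits_def S_def)
  show "hits f t \<longleftrightarrow> first_positive f < t" using iff \<tau> by simp
  have before: "f s \<le> 0" if "0 \<le> s" "s < \<tau>" for s
    using cInf_lower[OF _ bdd, of s] that unfolding \<tau>_def by (force simp: S_def)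
  have ge: "0 \<le> f \<tau>"
  proof (rule ccontr)
    assume "\<not> 0 \<le> f \<tau>"
    then have "\<forall>\<^sub>F u in at_right \<tau>. f u < 0"
      using path_setD(1)[OF f(1), of \<tau>] by (intro order_tendstoD) auto
    then obtain b where b: "\<tau> < b" "\<And>u. \<tau> < u \<Longrightarrow> u < b \<Longrightarrow> f u < 0"
      using eventually_at_right[of \<tau> "\<tau> + 1"] by auto
    then obtain s where "0 \<le> s" "s < b" "0 < f s" using iff[of b] by (auto simp: hits_def)
    moreover have "\<tau> \<le> s" using before[of s] calculation by (meson not_le)
    ultimately show False using b(2)[of s] \<open>\<not> 0 \<le> f \<tau>\<close> by (cases "s = \<tau>") auto
  qed
  have le: "f \<tau> \<le> 0"
  proof (cases "\<tau> = 0")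
    case False
    then have "0 < \<tau>" using nonneg by simp
    then obtain l where l: "(f \<longlongrightarrow> l) (at_left \<tau>)" "f \<tau> \<le> l"
      using path_setD(3)[OF f(1)] by blast
    have "\<forall>\<^sub>F u in at_left \<tau>. f u \<le> 0"
      unfolding eventually_at_left[OF \<open>0 < \<tau>\<close>] using before \<open>0 < \<tau>\<close> by (intro exI[of _ 0]) auto
    then have "l \<le> 0" by (rule tendsto_upperbound[OF l(1)]) (simp add: trivial_limit_at_left_real)
    then show ?thesis using l by simp
  qed (use f in simp)
  show "f (first_positive f) = 0" using ge le \<tau> by simp
qed

lemma measurable_first_positive [measurable (raw)]:
  assumes h: "h \<in> measurable M path_space"
  shows "(\<lambda>x. first_positive (h x)) \<in> borel_measurable M"
proof (rule borel_measurableI_less)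
  note [measurable] = h
  fix c :: real
  have ever: "(\<exists>t. hits f t) \<longleftrightarrow> (\<exists>n. hits f (real n))" for f
    by (meson hits_def less_trans reals_Archimedean2)
  have "first_positive f < c \<longleftrightarrow> (if \<exists>n. hits f (real n) then hits f c else Inf {} < c)" for f
  proof -
    define S where "S = {s. 0 \<le> s \<and> 0 < f s}"
    have S: "S \<noteq> {} \<longleftrightarrow> (\<exists>t. hits f t)" unfolding S_def hits_def using gt_ex by blast
    have "bdd_below S" by (auto simp: S_def bdd_below_def)
    then have "S \<noteq> {} \<Longrightarrow> Inf S < c \<longleftrightarrow> hits f c"
      by (subst cInf_less_iff) (auto simp: S_def hits_def)
    then show ?thesis using S ever unfolding first_positive_def S_def[symmetric] by auto
  qed
  then show "{x \<in> space M. first_positive (h x) < c} \<in> sets M" by simp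
qed

definition free_weight :: "real \<Rightarrow> real \<Rightarrow> (real \<Rightarrow> real) \<Rightarrow> ennreal" where
  "free_weight q t f = ennreal (exp (- q * t))"

definition hit_weight :: "real \<Rightarrow> real \<Rightarrow> (real \<Rightarrow> real) \<Rightarrow> ennreal" where
  "hit_weight q t f = (if hits f t then ennreal (exp (- q * t)) else 0)"

definition unhit_weight :: "real \<Rightarrow> real \<Rightarrow> (real \<Rightarrow> real) \<Rightarrow> ennreal" where
  "unhit_weight q t f = (if hits f t then 0 else ennreal (exp (- q * t)))"

lemma weights_measurable:
  "case_prod (free_weight q) \<in> borel_measurable (borel \<Otimes>\<^sub>M path_space)"
  "case_prod (hit_weight q) \<in> borel_measurable (borel \<Otimes>\<^sub>M path_space)"
  "case_prod (unhit_weight q) \<in> borel_measurable (borel \<Otimes>\<^sub>M path_space)"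
  unfolding free_weight_def[abs_def] hit_weight_def[abs_def] unhit_weight_def[abs_def] split_beta'
  by measurable

lemmas weights_measurable_raw [measurable (raw)] = weights_measurable[THEN measurable_case_prod_comp]

text \<open>Of two exceptional times the later one would be preceded by the earlier one, at which the path is positive; so
there is at most one.\<close>

lemma hits_unique_time:
  assumes "f \<in> path_set"
  shows "AE t in lborel. \<not> (0 \<le> t \<and> 0 < f t \<and> \<not> hits f t)"
proof (cases "\<exists>t\<ge>0. 0 < f t \<and> \<not> hits f t")
  case True
  then obtain t where t: "0 \<le> t" "0 < f t" "\<not> hits f t" by blast
  have "s = t" if "0 \<le> s \<and> 0 < f s \<and> \<not> hits f s" for s
    using that t by (metis hits_def linorder_neqE_linordered_idom)
  then show ?thesis using AE_lborel_singleton[of t] by (auto elim: eventually_mono)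
qed auto

context spectrally_negative_levy
begin

text \<open>Representing the potential as integration against a measure makes linearity, limit theorems and uniqueness
arguments for measures available.\<close>

definition potential_measure :: "(real \<Rightarrow> (real \<Rightarrow> real) \<Rightarrow> ennreal) \<Rightarrow> real \<Rightarrow> real measure" where
  "potential_measure m x = distr (density (path_law x \<Otimes>\<^sub>M lborel) (\<lambda>(f, t). m t f * indicator {0..} t))
     borel (\<lambda>(f, t). f t)"

lemma sets_potential_measure [measurable_cong, simp]: "sets (potential_measure m x) = sets borel"
  by (simp add: potential_measure_def)

lemma space_potential_measure [simp]: "space (potential_measure m x) = UNIV"
  by (simp add: potential_measure_def)

lemma measurable_potential_measure [simp]: "measurable (potential_measure m x) N = measurable borel N"
  by (rule measurable_cong_sets) simp_all

lemma nn_integral_potential_measure: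
  assumes m: "case_prod m \<in> borel_measurable (borel \<Otimes>\<^sub>M path_space)"
    and [measurable]: "\<phi> \<in> borel_measurable borel"
  shows "(\<integral>\<^sup>+z. \<phi> z \<partial>potential_measure m x) = potential m \<phi> x"
proof -
  have e[measurable]: "(\<lambda>z. fst z (snd z)) \<in> borel_measurable (path_law x \<Otimes>\<^sub>M lborel)"
    by measurable
  have mm[measurable]: "(\<lambda>z. m (snd z) (fst z)) \<in> borel_measurable (path_law x \<Otimes>\<^sub>M lborel)"
    by (rule measurable_case_prod_comp[OF m]) measurable
  have "(\<integral>\<^sup>+z. \<phi> z \<partial>potential_measure m x)
    = (\<integral>\<^sup>+z. \<phi> (fst z (snd z)) \<partial>density (path_law x \<Otimes>\<^sub>M lborel) (\<lambda>z. m (snd z) (fst z) * indicator {0..} (snd z)))"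
    unfolding potential_measure_def split_beta' by (rule nn_integral_distr) (simp_all add: e)
  also have "\<dots> = (\<integral>\<^sup>+z. m (snd z) (fst z) * indicator {0..} (snd z) * \<phi> (fst z (snd z)) \<partial>(path_law x \<Otimes>\<^sub>M lborel))"
    by (rule nn_integral_density) measurable
  also have "\<dots> = (\<integral>\<^sup>+f. \<integral>\<^sup>+t. m t f * indicator {0..} t * \<phi> (f t) \<partial>lborel \<partial>path_law x)"
  proof -
    have "(\<lambda>z. m (snd z) (fst z) * indicator {0..} (snd z) * \<phi> (fst z (snd z))) \<in> borel_measurable (path_law x \<Otimes>\<^sub>M lborel)"
      by measurable
    from lborel.nn_integral_fst[OF this] show ?thesis by simp
  qed
  also have "\<dots> = potential m \<phi> x"
    unfolding potential_def by (intro nn_integral_cong) (simp add: mult_ac)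
  finally show ?thesis .
qed

text \<open>The resolvent measure of the process started at \<open>0\<close>; by translation invariance it determines the resolvent from
every starting point.\<close>

abbreviation "mu q \<equiv> potential_measure (free_weight q) 0"

lemma free_potential_eq:
  assumes [measurable]: "\<phi> \<in> borel_measurable borel"
  shows "potential (free_weight q) \<phi> x = (\<integral>\<^sup>+z. \<phi> (x + z) \<partial>mu q)"
proof -
  have "potential (free_weight q) \<phi> x = potential (free_weight q) (\<lambda>z. \<phi> (x + z)) 0"
    unfolding potential_def by (subst nn_integral_path_law) (simp_all add: free_weight_def)
  then show ?thesis by (simp add: nn_integral_potential_measure[OF weights_measurable(1)])
qed

lemma potential_mono:
  "(\<And>t f. 0 \<le> t \<Longrightarrow> f \<in> path_set \<Longrightarrow> m t f * \<phi> (f t) \<le> m' t f * \<phi>' (f t)) \<Longrightarrow> potential m \<phi> x \<le> potential m' \<phi>' x"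
  unfolding potential_def by (intro nn_integral_mono) (auto simp: indicator_def)

lemma free_potential_one:
  assumes "0 < q"
  shows "potential (free_weight q) (\<lambda>_. ennreal B) x = ennreal B * ennreal (1 / q)"
proof -
  interpret P: prob_space "path_law x" by (rule prob_space_path_law)
  have "potential (free_weight q) (\<lambda>_. ennreal B) x
     = (\<integral>\<^sup>+f. ennreal B * (\<integral>\<^sup>+t\<in>{0..}. ennreal (exp (- q * t)) \<partial>lborel) \<partial>path_law x)"
    unfolding potential_def free_weight_def
    by (intro nn_integral_cong, subst nn_integral_cmult[symmetric]) (simp_all add: mult_ac)
  also have "\<dots> = ennreal B * ennreal (1 / q)"
    unfolding nn_integral_exp_atLeast[OF assms] by (simp add: P.emeasure_space_1[simplified])
  finally show ?thesis .
qed

lemma emeasure_mu_UNIV: "0 < q \<Longrightarrow> emeasure (mu q) UNIV = ennreal (1 / q)"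
  using free_potential_one[of q 1 0] nn_integral_potential_measure[OF weights_measurable(1), of "\<lambda>_. 1" q 0]
  by simp

lemma finite_measure_mu: "0 < q \<Longrightarrow> finite_measure (mu q)"
  by (rule finite_measureI) (simp add: emeasure_mu_UNIV)

lemma hit_le_free: "hit_weight q t f \<le> free_weight q t f"
  and unhit_le_free: "unhit_weight q t f \<le> free_weight q t f"
  by (auto simp: hit_weight_def free_weight_def unhit_weight_def)

lemma free_potential_split:
  assumes [measurable]: "\<phi> \<in> borel_measurable borel"
  shows "potential (free_weight q) \<phi> x = potential (unhit_weight q) \<phi> x + potential (hit_weight q) \<phi> x"
proof -
  have m: "(\<lambda>z. m (snd z) (fst z) * \<phi> (fst z (snd z)) * indicator {0..} (snd z)) \<in> borel_measurable (path_space \<Otimes>\<^sub>M lborel)"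
    if m: "case_prod m \<in> borel_measurable (borel \<Otimes>\<^sub>M path_space)" for m
  proof -
    note [measurable (raw)] = measurable_case_prod_comp[OF m]
    show ?thesis by measurable
  qed
  have "potential (free_weight q) \<phi> x = (\<integral>\<^sup>+f. (\<integral>\<^sup>+t\<in>{0..}. unhit_weight q t f * \<phi> (f t) \<partial>lborel)
      + (\<integral>\<^sup>+t\<in>{0..}. hit_weight q t f * \<phi> (f t) \<partial>lborel) \<partial>path_law x)"
    unfolding potential_def
  proof (rule nn_integral_cong)
    fix f assume "f \<in> space (path_law x)"
    then have f: "f \<in> space path_space" by simp
    show "(\<integral>\<^sup>+t\<in>{0..}. free_weight q t f * \<phi> (f t) \<partial>lborel) = (\<integral>\<^sup>+t\<in>{0..}. unhit_weight q t f * \<phi> (f t) \<partial>lborel)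
      + (\<integral>\<^sup>+t\<in>{0..}. hit_weight q t f * \<phi> (f t) \<partial>lborel)"
      using measurable_Pair2[OF m[OF weights_measurable(2)] f] measurable_Pair2[OF m[OF weights_measurable(3)] f]
      by (subst nn_integral_add[symmetric])
        (auto intro!: nn_integral_cong simp: free_weight_def hit_weight_def unhit_weight_def)
  qed
  also have "\<dots> = potential (unhit_weight q) \<phi> x + potential (hit_weight q) \<phi> x"
    unfolding potential_def by (rule nn_integral_add) measurable
  finally show ?thesis .
qed

lemma unhit_potential_positive:
  assumes "\<And>y. y \<le> 0 \<Longrightarrow> \<phi> y = 0"
  shows "potential (unhit_weight q) \<phi> x = 0"
proof -
  have "(\<integral>\<^sup>+t\<in>{0..}. unhit_weight q t f * \<phi> (f t) \<partial>lborel) = 0" if "f \<in> path_set" for f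
  proof -
    have "(\<integral>\<^sup>+t\<in>{0..}. unhit_weight q t f * \<phi> (f t) \<partial>lborel) = (\<integral>\<^sup>+t. 0 \<partial>(lborel :: real measure))"
      using hits_unique_time[OF that]
      by (intro nn_integral_cong_AE) (auto elim!: eventually_mono simp: unhit_weight_def indicator_def assms not_less)
    then show ?thesis by simp
  qed
  then have "potential (unhit_weight q) \<phi> x = (\<integral>\<^sup>+f. 0 \<partial>path_law x)"
    unfolding potential_def by (intro nn_integral_cong) simp
  then show ?thesis by simp
qed

definition passage :: "real \<Rightarrow> real \<Rightarrow> ennreal" where
  "passage q x = (\<integral>\<^sup>+f. (if \<exists>t. hits f t then ennreal (exp (- q * first_positive f)) else 0) \<partial>path_law x)"

lemma isCont_free_potential:
  assumes q: "0 < q" and \<phi>: "continuous_on UNIV \<phi>" and bd: "\<And>y. 0 \<le> \<phi> y" "\<And>y. \<phi> y \<le> B"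
  shows "isCont (\<lambda>y. potential (free_weight q) (\<lambda>z. ennreal (\<phi> z)) y) x"
  unfolding continuous_at_sequentially
proof (intro allI impI)
  have [measurable]: "\<phi> \<in> borel_measurable borel" using \<phi> by (rule borel_measurable_continuous_onI)
  fix X assume X: "X \<longlonglongrightarrow> x"
  have "(\<lambda>n. \<integral>\<^sup>+z. ennreal (\<phi> (X n + z)) \<partial>mu q) \<longlonglongrightarrow> (\<integral>\<^sup>+z. ennreal (\<phi> (x + z)) \<partial>mu q)"
  proof (rule nn_integral_dominated_convergence[where w="\<lambda>_. ennreal B"])
    show "(\<integral>\<^sup>+z. ennreal B \<partial>mu q) < \<infinity>" using q by (simp add: emeasure_mu_UNIV ennreal_mult_less_top)
    show "AE z in mu q. (\<lambda>n. ennreal (\<phi> (X n + z))) \<longlonglongrightarrow> ennreal (\<phi> (x + z))"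
    proof (intro AE_I2)
      fix z
      have "isCont \<phi> (x + z)" using \<phi> by (simp add: continuous_on_eq_continuous_at)
      then show "(\<lambda>n. ennreal (\<phi> (X n + z))) \<longlonglongrightarrow> ennreal (\<phi> (x + z))"
        using X by (intro tendsto_ennrealI isCont_tendsto_compose[of "x + z" \<phi>] tendsto_intros)
    qed
    show "AE z in mu q. ennreal (\<phi> (X n + z)) \<le> ennreal B" for n by (intro AE_I2 ennreal_leI bd)
    have m: "(\<lambda>z. ennreal (\<phi> (y + z))) \<in> borel_measurable borel" for y by measurable
    show "(\<lambda>z. ennreal (\<phi> (X n + z))) \<in> borel_measurable (mu q)" for n using m by simp
    show "(\<lambda>z. ennreal (\<phi> (x + z))) \<in> borel_measurable (mu q)" using m by simp
  qed simp
  then show "((\<lambda>y. potential (free_weight q) (\<lambda>z. ennreal (\<phi> z)) y) \<circ> X) \<longlonglongrightarrow> potential (free_weight q) (\<lambda>z. ennreal (\<phi> z)) x"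
    by (simp add: free_potential_eq comp_def)
qed

text \<open>Two nested applications of dominated convergence, along a path and over paths.\<close>

lemma path_time_dominated_convergence:
  assumes q: "0 < q"
    and u: "\<And>n. case_prod (u n) \<in> borel_measurable (path_space \<Otimes>\<^sub>M borel)"
    and v: "case_prod v \<in> borel_measurable (path_space \<Otimes>\<^sub>M borel)"
    and bound: "AE f in path_law x. \<forall>n. AE t in lborel. 0 \<le> t \<longrightarrow> u n f t \<le> ennreal (B * exp (- q * t))"
    and conv: "AE f in path_law x. AE t in lborel. 0 \<le> t \<longrightarrow> (\<lambda>n. u n f t) \<longlonglongrightarrow> v f t"
  shows "(\<lambda>n. \<integral>\<^sup>+f. (\<integral>\<^sup>+t\<in>{0..}. u n f t \<partial>lborel) \<partial>path_law x) \<longlonglongrightarrow> (\<integral>\<^sup>+f. (\<integral>\<^sup>+t\<in>{0..}. v f t \<partial>lborel) \<partial>path_law x)"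
proof -
  interpret P: prob_space "path_law x" by (rule prob_space_path_law)
  note [measurable (raw)] = measurable_case_prod_comp[OF u] measurable_case_prod_comp[OF v]
  have sec: "(\<lambda>t. w f t * indicator {0..} t) \<in> borel_measurable lborel"
    if "f \<in> path_set" "case_prod w \<in> borel_measurable (path_space \<Otimes>\<^sub>M borel)"
    for f and w :: "(real \<Rightarrow> real) \<Rightarrow> real \<Rightarrow> ennreal"
  proof -
    have [measurable]: "w f \<in> borel_measurable borel" using measurable_Pair2[OF that(2), of f] that(1) by simp
    then show ?thesis by (intro borel_measurable_times_ennreal) simp_all
  qed
  have tot: "(\<integral>\<^sup>+t\<in>{0..}. ennreal (B * exp (- q * t)) \<partial>lborel) = ennreal B * ennreal (1 / q)"
  proof -
    have "(\<integral>\<^sup>+t\<in>{0..}. ennreal (B * exp (- q * t)) \<partial>lborel) = (\<integral>\<^sup>+t. ennreal B * (ennreal (exp (- q * t)) * indicator {0..} t) \<partial>lborel)"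
      by (intro nn_integral_cong) (simp add: ennreal_mult'' mult_ac)
    also have "\<dots> = ennreal B * ennreal (1 / q)"
      by (subst nn_integral_cmult) (simp_all only: nn_integral_exp_atLeast[OF q], simp_all)
    finally show ?thesis .
  qed
  show ?thesis
  proof (rule nn_integral_dominated_convergence[where w="\<lambda>_. ennreal B * ennreal (1 / q)"])
    show "AE f in path_law x. (\<integral>\<^sup>+t\<in>{0..}. u n f t \<partial>lborel) \<le> ennreal B * ennreal (1 / q)" for n
      using bound
    proof eventually_elim
      case (elim f)
      then have "AE t in lborel. u n f t * indicator {0..} t \<le> ennreal (B * exp (- q * t)) * indicator {0..} t"
        by (elim allE[of _ n] eventually_mono) (auto simp: indicator_def)
      then show ?case unfolding tot[symmetric] by (rule nn_integral_mono_AE)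
    qed
    show "(\<integral>\<^sup>+f. ennreal B * ennreal (1 / q) \<partial>path_law x) < \<infinity>"
      by (simp add: P.emeasure_space_1[simplified] ennreal_mult_less_top)
    show "AE f in path_law x. (\<lambda>n. (\<integral>\<^sup>+t\<in>{0..}. u n f t \<partial>lborel)) \<longlonglongrightarrow> (\<integral>\<^sup>+t\<in>{0..}. v f t \<partial>lborel)"
      using conv bound AE_space[of "path_law x"]
    proof eventually_elim
      case (elim f)
      then have f: "f \<in> path_set" by simp
      show ?case
      proof (rule nn_integral_dominated_convergence[where w="\<lambda>t. ennreal (B * exp (- q * t)) * indicator {0..} t"])
        show "AE t in lborel. u n f t * indicator {0..} t \<le> ennreal (B * exp (- q * t)) * indicator {0..} t" for n
          using elim(2) by (elim allE[of _ n] eventually_mono) (auto simp: indicator_def)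
        show "(\<integral>\<^sup>+t\<in>{0..}. ennreal (B * exp (- q * t)) \<partial>lborel) < \<infinity>"
          unfolding tot by (simp add: ennreal_mult_less_top)
        show "AE t in lborel. (\<lambda>n. u n f t * indicator {0..} t) \<longlonglongrightarrow> v f t * indicator {0..} t"
          using elim(1) by (elim eventually_mono) (auto simp: indicator_def)
      qed (use sec[OF f u] sec[OF f v] in simp_all)
    qed
  qed measurable
qed

text \<open>The strong Markov property at the first passage, derived from the simple one. The first passage time \<open>\<tau>\<close> is
replaced by a uniform time in the window \<open>(\<tau>, \<tau> + 1 / n]\<close>, that is, the times \<open>t\<close> with \<open>hits f t\<close> but not
\<open>hits f (t - 1 / n)\<close>, a condition on the path up to \<open>t\<close>. The resolvent of the position at
such times is averaged over the window. Right continuity of the path and continuity of the resolvent in the starting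
point make the averages converge to the right side; rewriting them by the Markov property at the times \<open>t\<close> and
letting \<open>n\<close> grow gives the left side.\<close>

lemma first_passage_decomposition_continuous:
  assumes q: "0 < q" and x: "x \<le> 0"
    and \<phi>: "continuous_on UNIV \<phi>" and bd: "\<And>y. 0 \<le> \<phi> y" "\<And>y. \<phi> y \<le> B"
  shows "potential (hit_weight q) (\<lambda>y. ennreal (\<phi> y)) x = passage q x * potential (free_weight q) (\<lambda>y. ennreal (\<phi> y)) 0"
proof -
  have [measurable]: "\<phi> \<in> borel_measurable borel" using \<phi> by (rule borel_measurable_continuous_onI)
  interpret P: prob_space "path_law x" by (rule prob_space_path_law)
  have B: "0 \<le> B" using bd[of 0] by linarith
  define U where "U y = potential (free_weight q) (\<lambda>z. ennreal (\<phi> z)) y" for y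
  have U[measurable]: "U \<in> borel_measurable borel" unfolding U_def by (intro measurable_potential weights_measurable) auto
  have U_bd: "U y \<le> ennreal (B / q)" for y
  proof -
    have "U y \<le> potential (free_weight q) (\<lambda>_. ennreal B) y"
      unfolding U_def by (rule potential_mono) (auto intro!: mult_left_mono ennreal_leI bd)
    then show ?thesis using B q by (simp add: free_potential_one ennreal_mult[symmetric])
  qed
  define \<epsilon> where "\<epsilon> n = 1 / real (Suc n)" for n
  define win where "win n f t \<longleftrightarrow> hits f t \<and> \<not> hits f (t - \<epsilon> n)" for n f t
  define \<Psi> where "\<Psi> n t f = (if win n f t then ennreal (real (Suc n)) * ennreal (exp (- q * t)) else 0)" for n t f
  have \<Psi>: "case_prod (\<Psi> n) \<in> borel_measurable (borel \<Otimes>\<^sub>M path_space)" for n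
    unfolding \<Psi>_def win_def split_beta' by measurable
  note [measurable (raw)] = measurable_case_prod_comp[OF \<Psi>]
  define E where "E n = (\<integral>\<^sup>+f. (\<integral>\<^sup>+t\<in>{0..}. \<Psi> n t f * U (f t) \<partial>lborel) \<partial>path_law x)" for n
  define Q where "Q f \<longleftrightarrow> f \<in> path_set \<and> f 0 \<le> 0" for f :: "real \<Rightarrow> real"
  have Q: "AE f in path_law x. Q f"
    using AE_path_law_start[of x] AE_space[of "path_law x"] by eventually_elim (use x in \<open>simp add: Q_def\<close>)
  have win_iff: "win n f t \<longleftrightarrow> t \<in> {first_positive f<..first_positive f + \<epsilon> n}" if "Q f" "hits f t0" for n f t t0
  proof -
    have h: "hits f s \<longleftrightarrow> first_positive f < s" for s
      using that by (intro first_positive(3)[of f t0]) (simp_all add: Q_def)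
    show ?thesis unfolding win_def h by auto
  qed
  have hits_nonneg: "hits f t \<Longrightarrow> 0 \<le> t" for f t by (auto simp: hits_def)
  have window: "(\<integral>\<^sup>+t. ennreal (real (Suc n)) * indicator {a<..a + \<epsilon> n} t \<partial>lborel) = 1" for n and a :: real
    by (subst nn_integral_cmult) (simp_all add: \<epsilon>_def ennreal_mult[symmetric] del: of_nat_Suc)
  define l where "l f = (if \<exists>t. hits f t then ennreal (exp (- q * first_positive f)) * U 0 else 0)" for f
  have ever: "(\<exists>t. hits f t) \<longleftrightarrow> (\<exists>n. hits f (real n))" for f
    by (meson hits_def less_trans reals_Archimedean2)
  have ever_meas[measurable]: "Measurable.pred path_space (\<lambda>f. \<exists>t. hits f t)"
    unfolding ever by measurable
  have lim1: "E \<longlonglongrightarrow> (\<integral>\<^sup>+f. l f \<partial>path_law x)"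
    unfolding E_def
  proof (rule nn_integral_dominated_convergence[where w="\<lambda>_. ennreal (B / q)"])
    show "AE f in path_law x. (\<integral>\<^sup>+t\<in>{0..}. \<Psi> n t f * U (f t) \<partial>lborel) \<le> ennreal (B / q)" for n
      using Q
    proof eventually_elim
      case (elim f)
      show ?case
      proof (cases "\<exists>t. hits f t")
        case True
        then obtain t0 where t0: "hits f t0" ..
        have "(\<integral>\<^sup>+t\<in>{0..}. \<Psi> n t f * U (f t) \<partial>lborel)
          \<le> (\<integral>\<^sup>+t. ennreal (B / q) * (ennreal (real (Suc n)) * indicator {first_positive f<..first_positive f + \<epsilon> n} t) \<partial>lborel)"
        proof (rule nn_integral_mono)
          fix t
          have "ennreal (exp (- q * t)) * U (f t) \<le> 1 * ennreal (B / q)" if "0 \<le> t"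
            using that q U_bd[of "f t"] by (intro mult_mono) (auto simp: ennreal_le_1)
          from mult_left_mono[OF this, of "ennreal (real (Suc n))"]
          show "\<Psi> n t f * U (f t) * indicator {0..} t
            \<le> ennreal (B / q) * (ennreal (real (Suc n)) * indicator {first_positive f<..first_positive f + \<epsilon> n} t)"
            using win_iff[OF elim t0, of n t] by (auto simp: \<Psi>_def indicator_def mult_ac simp del: of_nat_Suc)
        qed
        also have "\<dots> = ennreal (B / q)" by (subst nn_integral_cmult) (simp_all add: window del: of_nat_Suc)
        finally show ?thesis .
      qed (simp add: \<Psi>_def win_def)
    qed
    show "(\<integral>\<^sup>+f. ennreal (B / q) \<partial>path_law x) < \<infinity>" by (simp add: P.emeasure_space_1[simplified])
    show "AE f in path_law x. (\<lambda>n. (\<integral>\<^sup>+t\<in>{0..}. \<Psi> n t f * U (f t) \<partial>lborel)) \<longlonglongrightarrow> l f"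
      using Q
    proof eventually_elim
      case (elim f)
      show ?case
      proof (cases "\<exists>t. hits f t")
        case True
        then obtain t0 where t0: "hits f t0" ..
        define \<tau> where "\<tau> = first_positive f"
        have f: "f \<in> path_set" "f 0 \<le> 0" using elim by (auto simp: Q_def)
        note fp = first_positive[OF f t0, folded \<tau>_def]
        have [measurable]: "f \<in> borel_measurable borel" using f(1) by (rule path_measurable)
        define \<phi>' where "\<phi>' t = ennreal (exp (- q * t)) * U (f t) * indicator {0..} t" for t
        have "(\<lambda>n. \<integral>\<^sup>+t. ennreal (real (Suc n)) * \<phi>' t * indicator {\<tau><..\<tau> + 1 / real (Suc n)} t \<partial>lborel)
           \<longlonglongrightarrow> ennreal (exp (- q * \<tau>)) * U 0"
        proof (rule window_average_tendsto)
          show "\<phi>' \<in> borel_measurable borel" unfolding \<phi>'_def by measurable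
          show "\<phi>' t \<le> ennreal (B / q)" for t
          proof (cases "0 \<le> t")
            case True
            then have "ennreal (exp (- q * t)) * U (f t) \<le> 1 * ennreal (B / q)"
              using q U_bd[of "f t"] by (intro mult_mono) (auto simp: ennreal_le_1)
            then show ?thesis using True by (simp add: \<phi>'_def)
          qed (simp add: \<phi>'_def)
          have "isCont U (f \<tau>)" unfolding U_def by (rule isCont_free_potential[OF q \<phi> bd])
          then have "((\<lambda>t. U (f t)) \<longlongrightarrow> U (f \<tau>)) (at_right \<tau>)"
            using path_setD(1)[OF f(1)] by (rule isCont_tendsto_compose)
          moreover have "((\<lambda>t. exp (- q * t)) \<longlongrightarrow> exp (- q * \<tau>)) (at_right \<tau>)"
            by (intro tendsto_intros)
          moreover have "U 0 \<noteq> top" using U_bd[of 0] by (auto simp: top_unique)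
          ultimately have "((\<lambda>t. ennreal (exp (- q * t)) * U (f t)) \<longlongrightarrow> ennreal (exp (- q * \<tau>)) * U 0) (at_right \<tau>)"
            unfolding fp(2) by (intro tendsto_mult_ennreal tendsto_ennrealI) auto
          moreover have "\<forall>\<^sub>F t in at_right \<tau>. ennreal (exp (- q * t)) * U (f t) = \<phi>' t"
            using fp(1) by (auto simp: eventually_at_filter \<phi>'_def)
          ultimately show "(\<phi>' \<longlongrightarrow> ennreal (exp (- q * \<tau>)) * U 0) (at_right \<tau>)"
            by (rule Lim_transform_eventually)
        qed
        moreover have "(\<integral>\<^sup>+t\<in>{0..}. \<Psi> n t f * U (f t) \<partial>lborel)
          = (\<integral>\<^sup>+t. ennreal (real (Suc n)) * \<phi>' t * indicator {\<tau><..\<tau> + 1 / real (Suc n)} t \<partial>lborel)" for n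
          using win_iff[OF elim t0, of n, folded \<tau>_def]
          by (intro nn_integral_cong) (auto simp: \<Psi>_def \<phi>'_def \<epsilon>_def indicator_def mult_ac simp del: of_nat_Suc)
        ultimately show ?thesis using True by (simp add: l_def \<tau>_def del: of_nat_Suc)
      qed (simp add: \<Psi>_def win_def l_def)
    qed
    show "l \<in> borel_measurable (path_law x)" unfolding l_def by measurable
  qed measurable
  define w where "w n f u = (\<integral>\<^sup>+t\<in>{0..u}. \<Psi> n t f * (free_weight q (u - t) (shift_path t f) * ennreal (\<phi> (shift_path t f (u - t)))) \<partial>lborel)" for n f u
  have w: "case_prod (w n) \<in> borel_measurable (path_space \<Otimes>\<^sub>M borel)" for n
    unfolding w_def split_beta' by measurable
  have E_eq: "E n = (\<integral>\<^sup>+f. (\<integral>\<^sup>+u\<in>{0..}. w n f u \<partial>lborel) \<partial>path_law x)" for n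
    unfolding E_def w_def U_def potential_def
  proof (rule markov_integrated)
    show "\<Psi> n t (stop_path t f) = \<Psi> n t f" for t f
      by (simp add: \<Psi>_def win_def hits_stop_path \<epsilon>_def)
    show "(\<lambda>(v, g). free_weight q v g * ennreal (\<phi> (g v))) \<in> borel_measurable (borel \<Otimes>\<^sub>M path_space)"
      unfolding split_beta' by measurable
  qed (rule \<Psi>)
  have w_eq: "w n f u = ennreal (\<phi> (f u) * exp (- q * u)) * (\<integral>\<^sup>+t. ennreal (real (Suc n)) * indicator {0..u} t *
      indicator {first_positive f<..first_positive f + 1 / real (Suc n)} t \<partial>lborel)"
    if "Q f" "hits f t0" for n f u t0
  proof -
    have "w n f u = (\<integral>\<^sup>+t. ennreal (\<phi> (f u) * exp (- q * u)) * (ennreal (real (Suc n)) * indicator {0..u} t *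
      indicator {first_positive f<..first_positive f + 1 / real (Suc n)} t) \<partial>lborel)"
      unfolding w_def
    proof (rule nn_integral_cong)
      fix t
      have "exp (- q * t) * exp (- q * (u - t)) = exp (- q * u)"
        by (simp add: exp_add[symmetric] algebra_simps)
      then have "ennreal (exp (- q * t)) * (ennreal (exp (- q * (u - t))) * ennreal (\<phi> (f u))) = ennreal (\<phi> (f u) * exp (- q * u))"
        using bd by (simp add: ennreal_mult[symmetric] mult_ac)
      then show "\<Psi> n t f * (free_weight q (u - t) (shift_path t f) * ennreal (\<phi> (shift_path t f (u - t)))) * indicator {0..u} t
        = ennreal (\<phi> (f u) * exp (- q * u)) * (ennreal (real (Suc n)) * indicator {0..u} t *
            indicator {first_positive f<..first_positive f + 1 / real (Suc n)} t)"
        using win_iff[OF that, of n t]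
        by (auto simp: \<Psi>_def free_weight_def indicator_def shift_path_eq \<epsilon>_def mult_ac simp del: of_nat_Suc)
    qed
    then show ?thesis by (simp add: nn_integral_cmult)
  qed
  have lim2: "E \<longlonglongrightarrow> (\<integral>\<^sup>+f. (\<integral>\<^sup>+u\<in>{0..}. hit_weight q u f * ennreal (\<phi> (f u)) \<partial>lborel) \<partial>path_law x)"
    unfolding E_eq
  proof (rule path_time_dominated_convergence[OF q w])
    show "(\<lambda>(f, u). hit_weight q u f * ennreal (\<phi> (f u))) \<in> borel_measurable (path_space \<Otimes>\<^sub>M borel)"
      unfolding split_beta' by measurable
    show "AE f in path_law x. \<forall>n. AE u in lborel. 0 \<le> u \<longrightarrow> w n f u \<le> ennreal (B * exp (- q * u))"
      using Q
    proof eventually_elim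
      case (elim f)
      show ?case
      proof (cases "\<exists>t. hits f t")
        case True
        then obtain t0 where t0: "hits f t0" ..
        show ?thesis
        proof (intro allI AE_I2 impI)
          fix n u
          have "(\<integral>\<^sup>+t. ennreal (real (Suc n)) * indicator {0..u} t * indicator {first_positive f<..first_positive f + 1 / real (Suc n)} t \<partial>lborel)
            \<le> (\<integral>\<^sup>+t. ennreal (real (Suc n)) * indicator {first_positive f<..first_positive f + \<epsilon> n} t \<partial>lborel)"
            by (intro nn_integral_mono) (auto simp: indicator_def \<epsilon>_def)
          then have "w n f u \<le> ennreal (\<phi> (f u) * exp (- q * u)) * 1"
            unfolding w_eq[OF elim t0] window by (rule mult_left_mono) simp
          also have "\<dots> \<le> ennreal (B * exp (- q * u))"
            using bd by (auto intro!: ennreal_leI mult_right_mono)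
          finally show "w n f u \<le> ennreal (B * exp (- q * u))" .
        qed
      qed (simp add: w_def \<Psi>_def win_def)
    qed
    show "AE f in path_law x. AE u in lborel. 0 \<le> u \<longrightarrow> (\<lambda>n. w n f u) \<longlonglongrightarrow> hit_weight q u f * ennreal (\<phi> (f u))"
      using Q
    proof eventually_elim
      case (elim f)
      show ?case
      proof (cases "\<exists>t. hits f t")
        case True
        then obtain t0 where t0: "hits f t0" ..
        define \<tau> where "\<tau> = first_positive f"
        have f: "f \<in> path_set" "f 0 \<le> 0" using elim by (auto simp: Q_def)
        note fp = first_positive[OF f t0, folded \<tau>_def]
        show ?thesis
        proof (intro AE_I2 impI)
          fix u :: real assume u: "0 \<le> u"
          have "(\<lambda>n. \<integral>\<^sup>+t. ennreal (real (Suc n)) * indicator {0..u} t * indicator {\<tau><..\<tau> + 1 / real (Suc n)} t \<partial>lborel)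
            \<longlonglongrightarrow> (if \<tau> < u then 1 else 0)"
          proof (rule window_average_tendsto[where B=1])
            have "\<forall>\<^sub>F t in at_right \<tau>. (if \<tau> < u then 1 else 0) = (indicator {0..u} t :: ennreal)"
            proof (cases "\<tau> < u")
              case True
              then show ?thesis using fp(1)
                unfolding eventually_at_right[OF True] by (intro exI[of _ u]) (auto simp: indicator_def)
            next
              case False
              then show ?thesis by (auto simp: eventually_at_filter indicator_def)
            qed
            then show "(indicator {0..u} \<longlongrightarrow> (if \<tau> < u then 1 else 0 :: ennreal)) (at_right \<tau>)"
              by (rule Lim_transform_eventually[OF tendsto_const])
          qed (auto simp: indicator_def)
          then have "(\<lambda>n. w n f u) \<longlonglongrightarrow> ennreal (\<phi> (f u) * exp (- q * u)) * (if \<tau> < u then 1 else 0)"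
            unfolding w_eq[OF elim t0] \<tau>_def[symmetric] by (intro tendsto_mult_ennreal tendsto_const) auto
          also have "ennreal (\<phi> (f u) * exp (- q * u)) * (if \<tau> < u then 1 else 0) = hit_weight q u f * ennreal (\<phi> (f u))"
            using fp(3)[of u] bd by (simp add: hit_weight_def ennreal_mult mult.commute)
          finally show "(\<lambda>n. w n f u) \<longlonglongrightarrow> hit_weight q u f * ennreal (\<phi> (f u))" .
        qed
      qed (simp add: w_def \<Psi>_def win_def hit_weight_def)
    qed
  qed
  have "potential (hit_weight q) (\<lambda>y. ennreal (\<phi> y)) x = (\<integral>\<^sup>+f. l f \<partial>path_law x)"
    unfolding potential_def by (rule LIMSEQ_unique[OF lim2 lim1])
  also have "\<dots> = (\<integral>\<^sup>+f. (if \<exists>t. hits f t then ennreal (exp (- q * first_positive f)) else 0) * U 0 \<partial>path_law x)"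
    by (intro nn_integral_cong) (simp add: l_def)
  also have "\<dots> = passage q x * U 0"
    unfolding passage_def by (rule nn_integral_multc) measurable
  finally show ?thesis by (simp add: U_def)
qed

lemma passage_le_1: "passage q x \<le> 1" if "0 < q"
proof -
  interpret P: prob_space "path_law x" by (rule prob_space_path_law)
  have "passage q x \<le> (\<integral>\<^sup>+f. 1 \<partial>path_law x)"
    unfolding passage_def
  proof (rule nn_integral_mono)
    fix f :: "real \<Rightarrow> real"
    have "0 \<le> first_positive f" if "hits f t" for t
      unfolding first_positive_def by (rule cInf_greatest) (use that in \<open>auto simp: hits_def\<close>)
    then show "(if \<exists>t. hits f t then ennreal (exp (- q * first_positive f)) else 0) \<le> 1"
      using \<open>0 < q\<close> by (auto simp: ennreal_le_1)
  qed
  then show ?thesis by (simp add: P.emeasure_space_1[simplified])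
qed

text \<open>Both sides are integrals of \<open>\<phi>\<close> against finite measures, and indicators of half-lines are limits of continuous
functions.\<close>

theorem first_passage_decomposition:
  assumes q: "0 < q" and x: "x \<le> 0" and [measurable]: "\<phi> \<in> borel_measurable borel"
  shows "potential (hit_weight q) \<phi> x = passage q x * potential (free_weight q) \<phi> 0"
proof -
  let ?A = "potential_measure (hit_weight q) x"
  let ?B = "scale_measure (passage q x) (mu q)"
  have fin: "emeasure ?A S < \<infinity>" for S
  proof -
    have "emeasure ?A S \<le> emeasure ?A (space ?A)" by (rule emeasure_space)
    also have "\<dots> = potential (hit_weight q) (\<lambda>_. 1) x"
      using nn_integral_potential_measure[OF weights_measurable(2), of "\<lambda>_. 1" q x] by simp
    also have "\<dots> \<le> potential (free_weight q) (\<lambda>_. ennreal 1) x"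
      by (rule potential_mono) (simp add: hit_le_free)
    also have "\<dots> < \<infinity>" using q by (simp only: free_potential_one) simp
    finally show ?thesis .
  qed
  have "?A = ?B"
  proof (rule measure_eqI_lessThan)
    fix b :: real
    \<comment> \<open>continuous approximations from below of the indicator of \<open>{b<..}\<close>\<close>
    define g where "g n y = min 1 (max 0 (real n * (y - b)))" for n y
    have g: "continuous_on UNIV (g n)" "0 \<le> g n y" "g n y \<le> 1" for n y
      unfolding g_def by (auto intro!: continuous_intros)
    have [measurable]: "g n \<in> borel_measurable borel" for n using g(1) by (rule borel_measurable_continuous_onI)
    have conv: "(\<lambda>n. ennreal (g n y)) \<longlonglongrightarrow> indicator {b<..} y" for y
    proof (cases "b < y")
      case True
      obtain N :: nat where N: "1 < real N * (y - b)" using True ex_less_of_nat_mult[of "y - b" 1] by auto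
      have "\<forall>\<^sub>F n in sequentially. ennreal (g n y) = 1"
      proof (rule eventually_sequentiallyI)
        fix n assume "N \<le> n"
        then have "real N * (y - b) \<le> real n * (y - b)" using True by (intro mult_right_mono) auto
        then show "ennreal (g n y) = 1" using N by (simp add: g_def)
      qed
      then show ?thesis using True by (simp add: tendsto_eventually)
    next
      case False
      then have "g n y = 0" for n by (simp add: g_def mult_nonneg_nonpos)
      then show ?thesis using False by simp
    qed
    have lim: "(\<lambda>n. \<integral>\<^sup>+y. ennreal (g n y) \<partial>N) \<longlonglongrightarrow> (\<integral>\<^sup>+y. indicator {b<..} y \<partial>N)"
      if N: "sets N = sets borel" "emeasure N (space N) < \<infinity>" for N
    proof (rule nn_integral_dominated_convergence[where w="\<lambda>_. 1"])
      have [simp]: "measurable N (borel :: ennreal measure) = measurable borel borel"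
        by (rule measurable_cong_sets) (simp_all add: N)
      show "(\<lambda>y. ennreal (g n y)) \<in> borel_measurable N" for n by simp
      show "(indicator {b<..} :: real \<Rightarrow> ennreal) \<in> borel_measurable N" by simp
      show "(\<lambda>_. 1 :: ennreal) \<in> borel_measurable N" by simp
      show "(\<integral>\<^sup>+y. 1 \<partial>N) < \<infinity>" using N by simp
      show "AE y in N. ennreal (g n y) \<le> 1" for n using g(3) by (intro AE_I2) (simp add: ennreal_le_1)
      show "AE y in N. (\<lambda>n. ennreal (g n y)) \<longlonglongrightarrow> indicator {b<..} y" using conv by (intro AE_I2)
    qed
    have eq: "(\<integral>\<^sup>+y. ennreal (g n y) \<partial>?A) = passage q x * (\<integral>\<^sup>+y. ennreal (g n y) \<partial>mu q)" for n
      using first_passage_decomposition_continuous[OF q x g]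
      by (simp add: nn_integral_potential_measure weights_measurable)
    have l1: "(\<lambda>n. passage q x * (\<integral>\<^sup>+y. ennreal (g n y) \<partial>mu q)) \<longlonglongrightarrow> passage q x * (\<integral>\<^sup>+y. indicator {b<..} y \<partial>mu q)"
    proof (rule ennreal_tendsto_cmult)
      show "passage q x < top" using passage_le_1[OF q, of x] by (simp add: le_less_trans)
      show "(\<lambda>n. \<integral>\<^sup>+y. ennreal (g n y) \<partial>mu q) \<longlonglongrightarrow> (\<integral>\<^sup>+y. indicator {b<..} y \<partial>mu q)"
        by (rule lim) (simp_all add: emeasure_mu_UNIV[OF q])
    qed
    have l2: "(\<lambda>n. \<integral>\<^sup>+y. ennreal (g n y) \<partial>?A) \<longlonglongrightarrow> (\<integral>\<^sup>+y. indicator {b<..} y \<partial>?A)"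
      by (rule lim) (simp_all add: fin[simplified])
    have "(\<integral>\<^sup>+y. indicator {b<..} y \<partial>?A) = passage q x * (\<integral>\<^sup>+y. indicator {b<..} y \<partial>mu q)"
      using LIMSEQ_unique[OF l2[unfolded eq] l1] .
    then show "emeasure ?A {b<..} = emeasure ?B {b<..}" by simp
  qed (simp_all add: fin[simplified])
  then have "(\<integral>\<^sup>+y. \<phi> y \<partial>?A) = (\<integral>\<^sup>+y. \<phi> y \<partial>?B)" by simp
  then show ?thesis
    by (simp add: nn_integral_potential_measure weights_measurable nn_integral_scale_measure)
qed

text \<open>Started from \<open>- a\<close>, the process has to pass above \<open>0\<close> before it can be above \<open>b\<close>.\<close>

lemma mu_tail_shift:
  assumes q: "0 < q" and ab: "0 \<le> a" "0 \<le> b"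
  shows "emeasure (mu q) {a + b<..} = passage q (- a) * emeasure (mu q) {b<..}"
proof -
  have "emeasure (mu q) {a + b<..} = (\<integral>\<^sup>+z. indicator {a + b<..} z \<partial>mu q)" by simp
  also have "\<dots> = (\<integral>\<^sup>+z. indicator {b<..} (- a + z) \<partial>mu q)"
    by (intro nn_integral_cong) (auto simp: indicator_def)
  also have "\<dots> = potential (free_weight q) (indicator {b<..}) (- a)"
    by (simp add: free_potential_eq)
  also have "\<dots> = potential (hit_weight q) (indicator {b<..}) (- a)"
    using ab by (subst free_potential_split) (simp_all add: unhit_potential_positive)
  also have "\<dots> = passage q (- a) * emeasure (mu q) {b<..}"
    using ab by (simp add: first_passage_decomposition[OF q] nn_integral_potential_measure[OF weights_measurable(1), symmetric])
  finally show ?thesis .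
qed

text \<open>Otherwise the process would never be positive, its increments would all be nonpositive and the paths would be
decreasing, which is excluded.\<close>

lemma mu_charges_positive:
  assumes q: "0 < q" shows "0 < emeasure (mu q) {0<..}"
proof (rule ccontr)
  assume "\<not> 0 < emeasure (mu q) {0<..}"
  then have "potential (free_weight q) (indicator {0<..}) 0 = 0"
    by (simp add: nn_integral_potential_measure[OF weights_measurable(1), symmetric])
  then have "AE f in path_law 0. (\<integral>\<^sup>+t\<in>{0..}. free_weight q t f * indicator {0<..} (f t) \<partial>lborel) = 0"
    unfolding potential_def by (subst (asm) nn_integral_0_iff_AE) measurable
  then have neg: "AE f in path_law 0. \<forall>t\<ge>0. f t \<le> 0"
    using AE_space[of "path_law 0"]
  proof eventually_elim
    case (elim f)
    then have f: "f \<in> path_set" by simp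
    have [measurable]: "f \<in> borel_measurable borel" using f by (rule path_measurable)
    have "(\<lambda>t. indicator {0<..} (f t) :: ennreal) \<in> borel_measurable borel"
      by (rule measurable_compose[OF path_measurable[OF f]]) simp
    then have "(\<lambda>t. free_weight q t f * indicator {0<..} (f t) * indicator {0..} t) \<in> borel_measurable lborel"
      unfolding free_weight_def by simp
    then have ae: "AE t in lborel. free_weight q t f * indicator {0<..} (f t) * indicator {0..} t = 0"
      using elim(1) by (simp add: nn_integral_0_iff_AE)
    show ?case
    proof (intro allI impI, rule ccontr)
      fix t :: real assume t: "0 \<le> t" "\<not> f t \<le> 0"
      have "\<forall>\<^sub>F u in at_right t. 0 < f u" using path_setD(1)[OF f, of t] t by (intro order_tendstoD) auto
      then obtain b where b: "t < b" "\<And>u. t < u \<Longrightarrow> u < b \<Longrightarrow> 0 < f u"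
        using eventually_at_right[of t "t + 1"] by auto
      have "AE u in lborel. \<not> (t < u \<and> u < b)"
        using ae by eventually_elim (use b(2) t in \<open>auto simp: free_weight_def indicator_def\<close>)
      then have "emeasure lborel {u \<in> space lborel. t < u \<and> u < b} = 0" by (rule emeasure_eq_0_AE)
      moreover have "{u \<in> space lborel. t < u \<and> u < b} = {t<..<b}" by auto
      ultimately show False using b(1) by simp
    qed
  qed
  \<comment> \<open>by stationarity this property of the position passes to all increments\<close>
  have neg_at: "AE \<omega> in M. X u \<omega> \<le> 0" if "0 \<le> u" for u
  proof -
    have "AE \<omega> in M. \<forall>t\<ge>0. 0 + increments 0 \<omega> t \<le> 0"
      using AE_distrD[OF path_map_measurable neg[unfolded path_law_def]] .
    then show ?thesis using start by eventually_elim (use that in \<open>auto simp: increments_def dest!: spec[of _ u]\<close>)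
  qed
  have incr: "AE \<omega> in M. X t \<omega> - X s \<omega> \<le> 0" if st: "0 \<le> s" "s \<le> t" for s t
  proof -
    have [measurable]: "X s \<in> borel_measurable M" "X t \<in> borel_measurable M" "X (t - s) \<in> borel_measurable M"
      using st by (auto intro!: rv)
    have "AE y in distr M borel (X (t - s)). y \<le> 0"
      using neg_at[of "t - s"] st by (subst AE_distr_iff) auto
    then have "AE y in distr M borel (\<lambda>\<omega>. X t \<omega> - X s \<omega>). y \<le> 0"
      unfolding stationary_increments[OF st] .
    then show ?thesis by (subst (asm) AE_distr_iff) auto
  qed
  have "AE \<omega> in M. \<forall>r s :: rat. 0 \<le> r \<longrightarrow> r \<le> s \<longrightarrow> X (of_rat s) \<omega> - X (of_rat r) \<omega> \<le> 0"
    unfolding AE_all_countable using incr by (auto simp: of_rat_less_eq)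
  then have "AE \<omega> in M. \<forall>s t. 0 \<le> s \<longrightarrow> s \<le> t \<longrightarrow> X t \<omega> \<le> X s \<omega>"
    using AE_space
  proof eventually_elim
    case (elim \<omega>)
    show ?case
    proof (intro allI impI, rule ccontr)
      fix s t :: real assume st: "0 \<le> s" "s \<le> t" "\<not> X t \<omega> \<le> X s \<omega>"
      define c where "c = (X s \<omega> + X t \<omega>) / 2"
      have c: "X s \<omega> < c" "c < X t \<omega>" using st by (auto simp: c_def)
      have lt: "s < t" using st by (cases "s = t") auto
      have "((\<lambda>u. X u \<omega>) \<longlongrightarrow> X s \<omega>) (at_right s)" "((\<lambda>u. X u \<omega>) \<longlongrightarrow> X t \<omega>) (at_right t)"
        using paths_right_continuous[OF elim(2)] st by (auto simp: continuous_within)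
      then have ev: "\<forall>\<^sub>F u in at_right s. X u \<omega> < c" "\<forall>\<^sub>F u in at_right t. c < X u \<omega>"
        using c by (auto elim: order_tendstoD)
      obtain b1 where b1: "s < b1" "\<And>u. s < u \<Longrightarrow> u < b1 \<Longrightarrow> X u \<omega> < c"
        using ev(1) eventually_at_right[OF lt] by auto
      obtain b2 where b2: "t < b2" "\<And>u. t < u \<Longrightarrow> u < b2 \<Longrightarrow> c < X u \<omega>"
        using ev(2) eventually_at_right[of t "t + 1"] by auto
      obtain r1 :: rat where r1: "s < of_rat r1" "of_rat r1 < min t b1"
        using of_rat_dense[of s "min t b1"] lt b1 by auto
      obtain r2 :: rat where r2: "t < of_rat r2" "of_rat r2 < b2"
        using of_rat_dense[of t b2] b2 by auto
      have "0 \<le> r1" using r1 st by (metis less_le_trans le_less_trans less_imp_le zero_le_of_rat_iff)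
      moreover have "(of_rat r1 :: real) \<le> of_rat r2" using r1 r2 by linarith
      then have "r1 \<le> r2" by (simp add: of_rat_less_eq)
      ultimately have "X (of_rat r2) \<omega> - X (of_rat r1) \<omega> \<le> 0" using elim(1) by blast
      moreover have "X (of_rat r1) \<omega> < c" using b1 r1 by simp
      moreover have "c < X (of_rat r2) \<omega>" using b2 r2 by simp
      ultimately show False by linarith
    qed
  qed
  with not_decreasing show False by blast
qed

text \<open>The exponential rate of the passage probabilities; it turns out to be the value at \<open>q\<close> of the right inverse
of the Laplace exponent.\<close>

definition kappa :: "real \<Rightarrow> real" where
  "kappa q = - ln (enn2real (passage q (- 1)))"

text \<open>The quotients of the tails of the resolvent measure make the passage probability multiplicative in the
height, hence exponential. It is not constantly \<open>1\<close>, because the tails of a finite measure vanish at infinity.\<close>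

lemma
  assumes q: "0 < q"
  shows passage_eq_exp: "\<And>a. 0 \<le> a \<Longrightarrow> passage q (- a) = ennreal (exp (- kappa q * a))"
    and kappa_pos: "0 < kappa q"
proof -
  interpret mu: finite_measure "mu q" using q by (rule finite_measure_mu)
  define T where "T b = measure (mu q) {b<..}" for b
  define P where "P a = enn2real (passage q (- a))" for a
  have P_e: "passage q (- a) = ennreal (P a)" for a
    using passage_le_1[OF q, of "- a"] unfolding P_def by (intro ennreal_enn2real[symmetric]) (simp add: le_less_trans)
  have P01: "0 \<le> P a" "P a \<le> 1" for a
  proof -
    show "0 \<le> P a" unfolding P_def by (rule enn2real_nonneg)
    show "P a \<le> 1" using passage_le_1[OF q, of "- a", unfolded P_e] by (simp only: ennreal_le_1)
  qed
  have T_P: "T (a + b) = P a * T b" if "0 \<le> a" "0 \<le> b" for a b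
  proof -
    have "ennreal (T (a + b)) = ennreal (P a) * ennreal (T b)"
      using mu_tail_shift[OF q that] unfolding P_e T_def by (simp add: mu.emeasure_eq_measure)
    then show ?thesis using P01 by (simp add: T_def ennreal_mult[symmetric])
  qed
  have T0: "0 < T 0" using mu_charges_positive[OF q] unfolding T_def by (simp add: mu.emeasure_eq_measure)
  have T_mono: "T b \<le> T a" if "a \<le> b" for a b
    unfolding T_def using that by (intro mu.finite_measure_mono) auto
  have P_T: "P a = T a / T 0" if "0 \<le> a" for a using T_P[OF that order_refl] T0 by simp
  have P_add: "P (a + b) = P a * P b" if "0 \<le> a" "0 \<le> b" for a b
    using T_P[OF that] that T0 by (simp add: P_T)
  \<comment> \<open>some of the mass lies beyond a positive level, so the passage probabilities are positive at small heights\<close>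
  obtain \<delta> where \<delta>: "0 < \<delta>" "0 < T \<delta>"
  proof (rule ccontr)
    assume *: "\<not> thesis"
    have "{1 / real (Suc n)<..} \<in> null_sets (mu q)" for n
    proof
      have "\<not> 0 < T (1 / real (Suc n))" using * that[of "1 / real (Suc n)"] by auto
      then show "emeasure (mu q) {1 / real (Suc n)<..} = 0"
        using measure_nonneg[of "mu q" "{1 / real (Suc n)<..}"]
        unfolding T_def by (simp add: mu.emeasure_eq_measure del: of_nat_Suc)
    qed simp
    then have "(\<Union>n. {1 / real (Suc n)<..}) \<in> null_sets (mu q)" by (rule null_sets_UN)
    moreover have "(\<Union>n. {1 / real (Suc n)<..}) = {0::real<..}"
    proof (intro equalityI subsetI)
      fix y :: real assume "y \<in> {0<..}"
      then obtain n where "inverse (real (Suc n)) < y" using reals_Archimedean by auto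
      then show "y \<in> (\<Union>n. {1 / real (Suc n)<..})" by (auto simp: inverse_eq_divide)
    next
      fix y :: real assume "y \<in> (\<Union>n. {1 / real (Suc n)<..})"
      then obtain n where "1 / real (Suc n) < y" by auto
      moreover have "0 < 1 / real (Suc n)" by simp
      ultimately have "0 < y" by linarith
      then show "y \<in> {0<..}" by simp
    qed
    ultimately show False using mu_charges_positive[OF q] by auto
  qed
  have P_small: "0 < P a" if "0 \<le> a" "a \<le> \<delta>" for a
    using that T0 \<delta> T_mono[of a \<delta>] by (simp add: P_T)
  have P_pow: "P (real n * a) = P a ^ n" if "0 \<le> a" for n a
  proof (induction n)
    case 0 show ?case using T0 by (simp add: P_T)
  next
    case (Suc n)
    have "P (real (Suc n) * a) = P (a + real n * a)" by (simp add: algebra_simps)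
    also have "\<dots> = P a * P (real n * a)" using that by (intro P_add) auto
    finally show ?case using Suc by simp
  qed
  have P_pos: "0 < P a" if "0 \<le> a" for a
  proof -
    obtain n :: nat where n: "a < real n * \<delta>" using ex_less_of_nat_mult[OF \<delta>(1)] by auto
    then have "0 < n" using that by (cases n) auto
    then have "P a = P (a / real n) ^ n" using P_pow[of "a / real n" n] that by simp
    moreover have "0 < P (a / real n)"
      using that n \<open>0 < n\<close> by (intro P_small) (auto simp: divide_le_eq mult.commute)
    ultimately show ?thesis by simp
  qed
  have lin: "- ln (P a) = a * - ln (P 1)" if "0 \<le> a" for a
  proof (rule additive_bounded_below_imp_linear[where \<phi>="\<lambda>a. - ln (P a)" and \<delta>=1 and C=0])
    show "- ln (P (s + t)) = - ln (P s) + - ln (P t)" if "0 \<le> s" "0 \<le> t" for s t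
      using that P_pos by (simp add: P_add ln_mult_pos)
    show "- 0 \<le> - ln (P t)" if "0 \<le> t" for t
      using P_pos[OF that] P01(2)[of t] by (simp add: ln_le_zero_iff)
  qed (use that in auto)
  have k: "kappa q = - ln (P 1)" by (simp add: kappa_def P_def)
  have P_exp: "P a = exp (- kappa q * a)" if "0 \<le> a" for a
  proof -
    have "P a = exp (ln (P a))" using P_pos[OF that] by simp
    also have "ln (P a) = - kappa q * a" using lin[OF that] unfolding k by (simp add: mult.commute)
    finally show ?thesis .
  qed
  show "passage q (- a) = ennreal (exp (- kappa q * a))" if "0 \<le> a" for a
    using P_e P_exp[OF that] by simp
  have "kappa q \<ge> 0" unfolding k using P_pos[of 1] P01(2)[of 1] by (simp add: ln_le_zero_iff)
  moreover have "kappa q \<noteq> 0"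
  proof
    assume "kappa q = 0"
    then have "T (real n) = T 0" for n using P_exp[of "real n"] P_T[of "real n"] T0 by simp
    then have l1: "(\<lambda>n. T (real n)) \<longlonglongrightarrow> T 0" by (simp only: tendsto_const)
    have l2: "(\<lambda>n. measure (mu q) {real n<..}) \<longlonglongrightarrow> measure (mu q) (\<Inter>n. {real n<..})"
      by (rule mu.finite_Lim_measure_decseq) (auto simp: decseq_def)
    have e: "(\<Inter>n. {real n<..}) = {}"
    proof -
      have "y \<notin> (\<Inter>n. {real n<..})" for y
      proof -
        obtain n where "y \<le> real n" using real_arch_simple by blast
        then have "y \<notin> {real n<..}" by simp
        then show ?thesis by blast
      qed
      then show ?thesis by blast
    qed
    have "T 0 = 0" using LIMSEQ_unique[OF l1[unfolded T_def] l2[unfolded e]] by (simp add: T_def)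
    with T0 show False by simp
  qed
  ultimately show "0 < kappa q" by simp
qed

text \<open>The density of the resolvent measure at \<open>0+\<close>.\<close>

definition mu_const :: "real \<Rightarrow> real" where
  "mu_const q = kappa q * measure (mu q) {0<..}"

lemma mu_const_pos: "0 < q \<Longrightarrow> 0 < mu_const q"
proof -
  assume q: "0 < q"
  interpret mu: finite_measure "mu q" using q by (rule finite_measure_mu)
  show ?thesis using mu_charges_positive[OF q] kappa_pos[OF q]
    by (simp add: mu_const_def mu.emeasure_eq_measure)
qed

text \<open>The tails of the two measures agree by the exponential form of the passage probabilities.\<close>

lemma nn_integral_mu_positive:
  assumes q: "0 < q" and [measurable]: "\<phi> \<in> borel_measurable borel"
  shows "(\<integral>\<^sup>+z\<in>{0<..}. \<phi> z \<partial>mu q) = (\<integral>\<^sup>+z\<in>{0<..}. ennreal (mu_const q * exp (- kappa q * z)) * \<phi> z \<partial>lborel)"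
proof -
  interpret mu: finite_measure "mu q" using q by (rule finite_measure_mu)
  let ?A = "density (mu q) (indicator {0<..})"
  let ?B = "density lborel (\<lambda>z. ennreal (mu_const q * exp (- kappa q * z)) * indicator {0<..} z)"
  note k = kappa_pos[OF q] and c = mu_const_pos[OF q]
  have "?A = ?B"
  proof (rule measure_eqI_lessThan)
    fix b :: real
    define m where "m = max 0 b"
    have m: "0 \<le> m" by (simp add: m_def)
    have ind: "indicator {0<..} z * indicator {b<..} z = (indicator {m<..} z :: ennreal)" for z
      by (auto simp: indicator_def m_def)
    have "emeasure ?A {b<..} = (\<integral>\<^sup>+z. indicator {0<..} z * indicator {b<..} z \<partial>mu q)"
      by (simp add: emeasure_density)
    also have "\<dots> = emeasure (mu q) {m + 0<..}" unfolding ind by simp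
    also have "\<dots> = ennreal (exp (- kappa q * m)) * emeasure (mu q) {0<..}"
      using mu_tail_shift[OF q m order_refl] passage_eq_exp[OF q m] by simp
    finally have A: "emeasure ?A {b<..} = ennreal (exp (- kappa q * m) * measure (mu q) {0<..})"
      by (simp add: mu.emeasure_eq_measure ennreal_mult)
    have "emeasure ?B {b<..} = (\<integral>\<^sup>+z. ennreal (mu_const q * exp (- kappa q * z)) * (indicator {0<..} z * indicator {b<..} z) \<partial>lborel)"
      by (simp add: emeasure_density mult.assoc)
    also have "\<dots> = (\<integral>\<^sup>+z. ennreal (mu_const q) * (ennreal (exp (- kappa q * z)) * indicator {m<..} z) \<partial>lborel)"
      unfolding ind using c by (intro nn_integral_cong) (simp add: ennreal_mult mult.assoc)
    also have "\<dots> = ennreal (mu_const q) * ennreal (exp (- kappa q * m) / kappa q)"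
      unfolding nn_integral_exp_greaterThan[OF k, symmetric] by (rule nn_integral_cmult) simp
    also have "\<dots> = ennreal (exp (- kappa q * m) * measure (mu q) {0<..})"
      using k c by (subst ennreal_mult[symmetric]) (auto simp: mu_const_def)
    finally show "emeasure ?A {b<..} = emeasure ?B {b<..}" using A by simp
    show "emeasure ?A {b<..} < \<infinity>" unfolding A by simp
  qed simp_all
  then have "(\<integral>\<^sup>+z. \<phi> z \<partial>?A) = (\<integral>\<^sup>+z. \<phi> z \<partial>?B)" by simp
  then show ?thesis by (simp add: nn_integral_density mult_ac)
qed

end

section \<open>The Laplace exponent and its right inverse\<close>

lemma measurable_ever_hits [measurable (raw)]:
  assumes h: "h \<in> measurable M path_space"
  shows "Measurable.pred M (\<lambda>x. \<exists>t. hits (h x) t)"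
proof -
  note [measurable] = h
  have ever: "(\<exists>t. hits f t) \<longleftrightarrow> (\<exists>n. hits f (real n))" for f
    by (meson hits_def less_trans reals_Archimedean2)
  show ?thesis unfolding ever by measurable
qed

lemma path_set_isCont_0:
  assumes f: "f \<in> path_set" shows "isCont f 0"
proof -
  have "\<forall>\<^sub>F t in at_left 0. f 0 = f t"
    unfolding eventually_at_filter using path_setD(2)[OF f] by (intro always_eventually) (metis lessThan_iff less_imp_le)
  then have "(f \<longlongrightarrow> f 0) (at_left 0)" by (rule Lim_transform_eventually[OF tendsto_const])
  with path_setD(1)[OF f, of 0] show ?thesis
    unfolding isCont_def by (intro filterlim_split_at)
qed

context spectrally_negative_levy
begin

text \<open>As the discount rate grows, the discounted probability of rising by \<open>1\<close> tends to \<open>0\<close>, since the passage takes a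
positive amount of time.\<close>

lemma kappa_unbounded: "\<exists>q>0. \<beta> < kappa q"
proof -
  interpret P: prob_space "path_law (- 1)" by (rule prob_space_path_law)
  have "(\<lambda>n. passage (real (Suc n)) (- 1)) \<longlonglongrightarrow> (\<integral>\<^sup>+f. 0 \<partial>path_law (- 1))"
    unfolding passage_def
  proof (rule nn_integral_dominated_convergence[where w="\<lambda>_. 1"])
    have nonneg: "0 \<le> first_positive f" if "hits f t" for f t
      unfolding first_positive_def by (rule cInf_greatest) (use that in \<open>auto simp: hits_def\<close>)
    show "AE f in path_law (- 1). (if \<exists>t. hits f t then ennreal (exp (- real (Suc n) * first_positive f)) else 0) \<le> 1" for n
    proof (rule AE_I2)
      fix f
      show "(if \<exists>t. hits f t then ennreal (exp (- real (Suc n) * first_positive f)) else 0) \<le> 1"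
      proof (cases "\<exists>t. hits f t")
        case True
        then have "- real (Suc n) * first_positive f \<le> 0" using nonneg by (auto intro!: mult_nonpos_nonneg)
        then have "exp (- real (Suc n) * first_positive f) \<le> 1" by (simp del: of_nat_Suc)
        then show ?thesis using True by (simp only: if_True ennreal_le_1)
      qed simp
    qed
    show "(\<integral>\<^sup>+f. 1 \<partial>path_law (- 1)) < \<infinity>" by (simp add: P.emeasure_space_1[simplified])
    show "AE f in path_law (- 1). (\<lambda>n. if \<exists>t. hits f t then ennreal (exp (- real (Suc n) * first_positive f)) else 0) \<longlonglongrightarrow> 0"
      using AE_path_law_start[of "- 1"] AE_space[of "path_law (- 1)"]
    proof eventually_elim
      case (elim f)
      show ?case
      proof (cases "\<exists>t. hits f t")
        case True
        then obtain t where t: "hits f t" ..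
        have f: "f \<in> path_set" "f 0 \<le> 0" using elim by auto
        have "first_positive f \<noteq> 0" using first_positive(2)[OF f t] elim by auto
        then have pos: "0 < first_positive f" using first_positive(1)[OF f t] by simp
        have "(\<lambda>n. exp (- real (Suc n) * c)) \<longlonglongrightarrow> 0" if "0 < c" for c :: real
          using that by real_asymp
        from this[OF pos] have "(\<lambda>n. exp (- real (Suc n) * first_positive f)) \<longlonglongrightarrow> 0" .
        then have "(\<lambda>n. ennreal (exp (- real (Suc n) * first_positive f))) \<longlonglongrightarrow> ennreal 0"
          by (rule tendsto_ennrealI)
        then show ?thesis using True by simp
      qed simp
    qed
  qed measurable
  then have "(\<lambda>n. passage (real (Suc n)) (- 1)) \<longlonglongrightarrow> 0" by simp
  then have "\<forall>\<^sub>F n in sequentially. passage (real (Suc n)) (- 1) < ennreal (exp (- \<beta>))"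
    by (rule order_tendstoD) simp
  then obtain n where n: "passage (real (Suc n)) (- 1) < ennreal (exp (- \<beta>))"
    using eventually_happens'[OF sequentially_bot] by blast
  have "ennreal (exp (- kappa (real (Suc n)))) < ennreal (exp (- \<beta>))"
    using n passage_eq_exp[of "real (Suc n)" 1] by (simp del: of_nat_Suc)
  then have "\<beta> < kappa (real (Suc n))" by (simp add: ennreal_less_iff)
  then show ?thesis by (intro exI[of _ "real (Suc n)"]) simp
qed

lemma path_exp_measurable: "(\<lambda>f. ennreal (exp (\<beta> * f t))) \<in> borel_measurable path_space"
  by (rule measurable_compose[OF measurable_path_component]) simp

lemma measurable_path_law [simp]: "measurable (path_law x) N = measurable path_space N"
  by (rule measurable_cong_sets) simp_all

text \<open>An extended nonnegative value, because finiteness is not known in advance.\<close>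

definition mgf :: "real \<Rightarrow> real \<Rightarrow> ennreal" where
  "mgf t \<beta> = (\<integral>\<^sup>+f. ennreal (exp (\<beta> * f t)) \<partial>path_law 0)"

lemma measurable_mgf: "(\<lambda>t. mgf t \<beta>) \<in> borel_measurable borel"
proof -
  interpret P: prob_space "path_law 0" by (rule prob_space_path_law)
  show ?thesis unfolding mgf_def by measurable
qed

lemma mu_exp_eq_mgf:
  "(\<integral>\<^sup>+z. ennreal (exp (\<beta> * z)) \<partial>mu q) = (\<integral>\<^sup>+t\<in>{0..}. ennreal (exp (- q * t)) * mgf t \<beta> \<partial>lborel)"
proof -
  interpret P: prob_space "path_law 0" by (rule prob_space_path_law)
  interpret PL: pair_sigma_finite "path_law 0" lborel ..
  have "(\<integral>\<^sup>+z. ennreal (exp (\<beta> * z)) \<partial>mu q)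
    = (\<integral>\<^sup>+f. \<integral>\<^sup>+t. ennreal (exp (- q * t)) * ennreal (exp (\<beta> * f t)) * indicator {0..} t \<partial>lborel \<partial>path_law 0)"
    by (simp add: nn_integral_potential_measure weights_measurable potential_def free_weight_def)
  also have "\<dots> = (\<integral>\<^sup>+t. \<integral>\<^sup>+f. ennreal (exp (- q * t)) * ennreal (exp (\<beta> * f t)) * indicator {0..} t \<partial>path_law 0 \<partial>lborel)"
    by (rule PL.Fubini'[symmetric]) measurable
  also have "\<dots> = (\<integral>\<^sup>+t\<in>{0..}. ennreal (exp (- q * t)) * mgf t \<beta> \<partial>lborel)"
  proof (rule nn_integral_cong)
    fix t :: real
    have "(\<lambda>f. ennreal (exp (\<beta> * f t))) \<in> borel_measurable (path_law 0)"
      by (simp add: path_exp_measurable)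
    then show "(\<integral>\<^sup>+f. ennreal (exp (- q * t)) * ennreal (exp (\<beta> * f t)) * indicator {0..} t \<partial>path_law 0)
      = ennreal (exp (- q * t)) * mgf t \<beta> * indicator {0..} t"
      by (simp add: nn_integral_multc nn_integral_cmult mgf_def)
  qed
  finally show ?thesis .
qed

lemma mu_negative_le:
  assumes "0 < q" "0 \<le> \<beta>"
  shows "(\<integral>\<^sup>+z\<in>{..0}. ennreal (exp (\<beta> * z)) \<partial>mu q) \<le> ennreal (1 / q)"
proof -
  have "(\<integral>\<^sup>+z\<in>{..0}. ennreal (exp (\<beta> * z)) \<partial>mu q) \<le> (\<integral>\<^sup>+z. 1 \<partial>mu q)"
    using assms by (intro nn_integral_mono) (auto simp: indicator_def ennreal_le_1 mult_nonneg_nonpos)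
  then show ?thesis using assms by (simp add: emeasure_mu_UNIV)
qed

lemma mu_split_at_0:
  assumes [measurable]: "\<phi> \<in> borel_measurable borel"
  shows "(\<integral>\<^sup>+z. \<phi> z \<partial>mu q) = (\<integral>\<^sup>+z\<in>{..0}. \<phi> z \<partial>mu q) + (\<integral>\<^sup>+z\<in>{0<..}. \<phi> z \<partial>mu q)"
  by (subst nn_integral_add[symmetric]) (auto intro!: nn_integral_cong simp: indicator_def)

lemma mu_positive_exp:
  assumes q: "0 < q" and \<beta>: "\<beta> < kappa q"
  shows "(\<integral>\<^sup>+z\<in>{0<..}. ennreal (exp (\<beta> * z)) \<partial>mu q) = ennreal (mu_const q / (kappa q - \<beta>))"
proof -
  have "(\<integral>\<^sup>+z\<in>{0<..}. ennreal (exp (\<beta> * z)) \<partial>mu q)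
    = (\<integral>\<^sup>+z. ennreal (mu_const q) * (ennreal (exp (- (kappa q - \<beta>) * z)) * indicator {0<..} z) \<partial>lborel)"
    unfolding nn_integral_mu_positive[OF q, of "\<lambda>z. ennreal (exp (\<beta> * z))", simplified]
    using mu_const_pos[OF q]
    by (intro nn_integral_cong)
       (auto simp: ennreal_mult[symmetric] indicator_def exp_add[symmetric] algebra_simps)
  also have "\<dots> = ennreal (mu_const q) * ennreal (exp (- (kappa q - \<beta>) * 0) / (kappa q - \<beta>))"
    using \<beta> by (subst nn_integral_exp_greaterThan[symmetric]) (auto intro!: nn_integral_cmult)
  also have "\<dots> = ennreal (mu_const q / (kappa q - \<beta>))"
    using \<beta> mu_const_pos[OF q] by (subst ennreal_mult[symmetric]) auto
  finally show ?thesis .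
qed

text \<open>Only the exponential density on the positive half-line matters for finiteness.\<close>

lemma mu_exp_finite_iff:
  assumes q: "0 < q" and \<beta>: "0 \<le> \<beta>"
  shows "(\<integral>\<^sup>+z. ennreal (exp (\<beta> * z)) \<partial>mu q) < top \<longleftrightarrow> \<beta> < kappa q"
proof -
  have split: "(\<integral>\<^sup>+z. ennreal (exp (\<beta> * z)) \<partial>mu q)
    = (\<integral>\<^sup>+z\<in>{..0}. ennreal (exp (\<beta> * z)) \<partial>mu q) + (\<integral>\<^sup>+z\<in>{0<..}. ennreal (exp (\<beta> * z)) \<partial>mu q)"
    by (rule mu_split_at_0) simp
  have neg: "(\<integral>\<^sup>+z\<in>{..0}. ennreal (exp (\<beta> * z)) \<partial>mu q) < top"
    using mu_negative_le[OF assms] by (auto simp: less_top[symmetric] top_unique)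
  have "(\<integral>\<^sup>+z\<in>{0<..}. ennreal (exp (\<beta> * z)) \<partial>mu q) = top" if "kappa q \<le> \<beta>"
  proof -
    have "(\<integral>\<^sup>+z\<in>{0<..}. ennreal (mu_const q) \<partial>(lborel :: real measure)) \<le> (\<integral>\<^sup>+z\<in>{0<..}. ennreal (exp (\<beta> * z)) \<partial>mu q)"
      unfolding nn_integral_mu_positive[OF q, of "\<lambda>z. ennreal (exp (\<beta> * z))", simplified]
    proof (rule nn_integral_mono)
      fix z :: real
      have "mu_const q * 1 \<le> mu_const q * exp ((\<beta> - kappa q) * z)" if "0 < z"
        using mu_const_pos[OF q] that \<open>kappa q \<le> \<beta>\<close> by (intro mult_left_mono) auto
      then show "ennreal (mu_const q) * indicator {0<..} z \<le> ennreal (mu_const q * exp (- (kappa q * z))) * ennreal (exp (\<beta> * z)) * indicator {0<..} z"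
        using mu_const_pos[OF q]
        by (auto simp: indicator_def ennreal_mult[symmetric] mult.assoc exp_add[symmetric] algebra_simps intro!: ennreal_leI)
    qed
    moreover have "(\<integral>\<^sup>+z\<in>{0<..}. ennreal (mu_const q) \<partial>(lborel :: real measure)) = top"
    proof -
      have "emeasure lborel {0::real<..} = top"
      proof (rule ccontr)
        assume "emeasure lborel {0::real<..} \<noteq> top"
        then obtain r where r: "emeasure lborel {0::real<..} = ennreal r" "0 \<le> r" by (cases "emeasure lborel {0::real<..}") auto
        have "emeasure lborel {0::real<..r + 1} \<le> emeasure lborel {0::real<..}" by (rule emeasure_mono) auto
        then show False using r by simp
      qed
      then show ?thesis using mu_const_pos[OF q] by (simp add: nn_integral_cmult_indicator ennreal_mult_top)
    qed
    ultimately show ?thesis by (simp add: top_unique)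
  qed
  then show ?thesis
    using neg mu_positive_exp[OF q, of \<beta>] unfolding split by (cases "\<beta> < kappa q") auto
qed

lemma mgf_add:
  assumes "0 \<le> s" "0 \<le> t" shows "mgf (s + t) \<beta> = mgf s \<beta> * mgf t \<beta>"
proof -
  note measurable_path_component[measurable]
  have "mgf (s + t) \<beta> = (\<integral>\<^sup>+f. ennreal (exp (\<beta> * shift_path s f t)) \<partial>path_law 0)"
    using assms by (simp add: mgf_def shift_path_eq)
  also have "\<dots> = (\<integral>\<^sup>+f. \<integral>\<^sup>+g. ennreal (exp (\<beta> * g t)) \<partial>path_law (f s) \<partial>path_law 0)"
    by (rule markov_property[OF assms(1), of "\<lambda>_ g. ennreal (exp (\<beta> * g t))"]) (unfold split_beta', measurable)
  also have "\<dots> = (\<integral>\<^sup>+f. ennreal (exp (\<beta> * f s)) * mgf t \<beta> \<partial>path_law 0)"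
  proof (rule nn_integral_cong)
    fix f :: "real \<Rightarrow> real"
    have "(\<lambda>g. ennreal (exp (\<beta> * g t))) \<in> borel_measurable path_space"
      by (rule measurable_compose[OF measurable_path_component]) simp
    then have "(\<integral>\<^sup>+g. ennreal (exp (\<beta> * g t)) \<partial>path_law (f s)) = (\<integral>\<^sup>+g. ennreal (exp (\<beta> * f s)) * ennreal (exp (\<beta> * g t)) \<partial>path_law 0)"
      by (subst nn_integral_path_law) (simp_all add: distrib_left exp_add ennreal_mult)
    also have "\<dots> = ennreal (exp (\<beta> * f s)) * mgf t \<beta>"
      unfolding mgf_def
      by (rule nn_integral_cmult) (simp add: path_exp_measurable)
    finally show "(\<integral>\<^sup>+g. ennreal (exp (\<beta> * g t)) \<partial>path_law (f s)) = ennreal (exp (\<beta> * f s)) * mgf t \<beta>" .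
  qed
  also have "\<dots> = mgf s \<beta> * mgf t \<beta>"
    unfolding mgf_def
    by (rule nn_integral_multc) (simp add: path_exp_measurable)
  finally show ?thesis .
qed

lemma mgf_pos: "0 < mgf t \<beta>"
proof (rule ccontr)
  interpret P: prob_space "path_law 0" by (rule prob_space_path_law)
  assume "\<not> 0 < mgf t \<beta>"
  then have "AE f in path_law 0. ennreal (exp (\<beta> * f t)) = 0"
    unfolding mgf_def
    by (subst nn_integral_0_iff_AE[symmetric])
      (simp_all add: path_exp_measurable)
  then have "AE f in path_law 0. False" by eventually_elim simp
  then show False by (simp add: P.AE_False)
qed

text \<open>For large \<open>q\<close> the Laplace transform in time of the moment generating function is finite, so the function is
finite at almost every time, in particular at some time after \<open>t\<close>; the semigroup property then gives
finiteness at \<open>t\<close>.\<close>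

lemma mgf_finite:
  assumes t: "0 \<le> t" and \<beta>: "0 \<le> \<beta>" shows "mgf t \<beta> < top"
proof -
  obtain q where q: "0 < q" "\<beta> < kappa q" using kappa_unbounded by blast
  have "(\<integral>\<^sup>+t\<in>{0..}. ennreal (exp (- q * t)) * mgf t \<beta> \<partial>lborel) \<noteq> \<infinity>"
    using mu_exp_finite_iff[OF q(1) \<beta>] q(2) unfolding mu_exp_eq_mgf by simp
  then have "AE t in lborel. ennreal (exp (- q * t)) * mgf t \<beta> * indicator {0..} t \<noteq> \<infinity>"
    using measurable_mgf[of \<beta>] by (intro nn_integral_PInf_AE) auto
  then have ae: "AE t in lborel. 0 \<le> t \<longrightarrow> mgf t \<beta> < top"
  proof eventually_elim
    case (elim t)
    show ?case
    proof (intro impI, rule ccontr)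
      assume "0 \<le> t" "\<not> mgf t \<beta> < top"
      then have "mgf t \<beta> = top" by (simp add: not_less top_unique)
      then show False using elim \<open>0 \<le> t\<close> by (simp add: ennreal_mult_eq_top_iff)
    qed
  qed
  have "\<exists>s>t. mgf s \<beta> < top"
  proof (rule ccontr)
    assume no: "\<not> (\<exists>s>t. mgf s \<beta> < top)"
    have "AE s in lborel. \<not> (t < s \<and> s < t + 1)" using ae by eventually_elim (use t no in auto)
    then have "emeasure lborel {s \<in> space lborel. t < s \<and> s < t + 1} = 0" by (rule emeasure_eq_0_AE)
    moreover have "{s \<in> space lborel. t < s \<and> s < t + 1} = {t<..<t + 1}" by auto
    ultimately show False by simp
  qed
  then obtain s where s: "t < s" "mgf s \<beta> < top" by blast
  have "mgf s \<beta> = mgf t \<beta> * mgf (s - t) \<beta>" using mgf_add[of t "s - t" \<beta>] t s by simp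
  then show ?thesis using s mgf_pos[of "s - t" \<beta>] by (auto simp: ennreal_mult_less_top)
qed

abbreviation "psi \<equiv> laplace_exponent M X"

lemma mgf_one:
  "ln (enn2real (mgf 1 \<beta>)) = psi \<beta>"
proof -
  have [measurable]: "X 1 \<in> borel_measurable M" by (rule rv) simp
  have "mgf 1 \<beta> = (\<integral>\<^sup>+\<omega>. ennreal (exp (\<beta> * (0 + increments 0 \<omega> 1))) \<partial>M)"
    unfolding mgf_def path_law_def
    by (rule nn_integral_distr[OF path_map_measurable])
       (simp add: path_exp_measurable)
  also have "\<dots> = (\<integral>\<^sup>+\<omega>. ennreal (exp (\<beta> * X 1 \<omega>)) \<partial>M)"
    by (rule nn_integral_cong_AE) (use start in \<open>eventually_elim, simp add: increments_def\<close>)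
  finally have "enn2real (mgf 1 \<beta>) = (LINT \<omega>|M. exp (\<beta> * X 1 \<omega>))"
    by (subst integral_eq_nn_integral) auto
  then show ?thesis by (simp add: laplace_exponent_def)
qed

text \<open>The logarithm of the moment generating function is additive in time. Fatou's lemma and continuity of the path
at \<open>0\<close> bound it from below near \<open>0\<close>, so it is linear.\<close>

theorem mgf_eq_exp:
  assumes t: "0 \<le> t" and \<beta>: "0 \<le> \<beta>"
  shows "mgf t \<beta> = ennreal (exp (t * psi \<beta>))"
proof -
  interpret P: prob_space "path_law 0" by (rule prob_space_path_law)
  define m where "m t = enn2real (mgf t \<beta>)" for t
  have m_e: "mgf t \<beta> = ennreal (m t)" if "0 \<le> t" for t
    unfolding m_def using mgf_finite[OF that \<beta>] by (intro ennreal_enn2real[symmetric]) 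
  have m_pos: "0 < m t" if "0 \<le> t" for t
    using mgf_pos[of t \<beta>] m_e[OF that] by simp
  have m_add: "m (s + t) = m s * m t" if "0 \<le> s" "0 \<le> t" for s t
  proof -
    have "ennreal (m (s + t)) = ennreal (m s * m t)"
      using mgf_add[OF that, of \<beta>] that m_pos[OF that(1)] m_pos[OF that(2)] by (simp add: m_e ennreal_mult)
    then show ?thesis using that m_pos[of "s + t"] m_pos[OF that(1)] m_pos[OF that(2)] by simp
  qed
  \<comment> \<open>any bound in \<open>(0, 1)\<close> would do, since \<open>m 0 = 1\<close>\<close>
  have "\<exists>\<delta>>0. \<forall>t. 0 \<le> t \<and> t \<le> \<delta> \<longrightarrow> exp (- 1) \<le> m t"
  proof (rule ccontr)
    assume neg: "\<not> ?thesis"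
    have "\<exists>t. 0 \<le> t \<and> t \<le> 1 / real (Suc n) \<and> m t < exp (- 1)" for n
    proof -
      have "0 < 1 / real (Suc n)" by simp
      then show ?thesis using neg by (meson not_le)
    qed
    then obtain T where T: "\<And>n. 0 \<le> T n" "\<And>n. T n \<le> 1 / real (Suc n)" "\<And>n. m (T n) < exp (- 1)" by metis
    have T0: "T \<longlonglongrightarrow> 0"
    proof (rule tendsto_sandwich[of "\<lambda>_. 0" T sequentially "\<lambda>n. 1 / real (Suc n)"])
      show "(\<lambda>n. 1 / real (Suc n)) \<longlonglongrightarrow> 0" using LIMSEQ_inverse_real_of_nat by (simp add: inverse_eq_divide)
    qed (use T in \<open>auto simp del: of_nat_Suc\<close>)
    have "(\<integral>\<^sup>+f. liminf (\<lambda>n. ennreal (exp (\<beta> * f (T n)))) \<partial>path_law 0) \<le> liminf (\<lambda>n. mgf (T n) \<beta>)"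
      unfolding mgf_def
      by (rule nn_integral_liminf)
        (simp add: path_exp_measurable)
    also have "(\<integral>\<^sup>+f. liminf (\<lambda>n. ennreal (exp (\<beta> * f (T n)))) \<partial>path_law 0) = (\<integral>\<^sup>+f. 1 \<partial>path_law 0)"
    proof (rule nn_integral_cong_AE)
      show "AE f in path_law 0. liminf (\<lambda>n. ennreal (exp (\<beta> * f (T n)))) = 1"
        using AE_path_law_start[of 0] AE_space[of "path_law 0"]
      proof eventually_elim
        case (elim f)
        then have "isCont f 0" by (intro path_set_isCont_0) simp
        then have "(\<lambda>n. f (T n)) \<longlonglongrightarrow> f 0" using T0 by (rule isCont_tendsto_compose)
        then have "(\<lambda>n. ennreal (exp (\<beta> * f (T n)))) \<longlonglongrightarrow> ennreal (exp (\<beta> * f 0))"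
          by (intro tendsto_ennrealI tendsto_intros)
        then show ?case using elim by (simp add: lim_imp_Liminf)
      qed
    qed
    also have "(\<integral>\<^sup>+f. 1 \<partial>path_law 0) = 1" by (simp add: P.emeasure_space_1[simplified])
    also have "liminf (\<lambda>n. mgf (T n) \<beta>) \<le> liminf (\<lambda>n. ennreal (exp (- 1)))"
      using T by (intro Liminf_mono always_eventually allI) (simp add: m_e ennreal_leI less_imp_le)
    also have "\<dots> = ennreal (exp (- 1))" by (simp add: Liminf_const)
    finally show False by (simp add: ennreal_ge_1)
  qed
  then obtain \<delta> where \<delta>: "0 < \<delta>" "\<And>t. 0 \<le> t \<Longrightarrow> t \<le> \<delta> \<Longrightarrow> exp (- 1) \<le> m t" by auto
  have "ln (m t) = t * ln (m 1)"
  proof (rule additive_bounded_below_imp_linear[where \<phi>="\<lambda>t. ln (m t)" and \<delta>=\<delta> and C=1])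
    show "ln (m (s + t)) = ln (m s) + ln (m t)" if "0 \<le> s" "0 \<le> t" for s t
      using that m_pos by (simp add: m_add ln_mult_pos)
    show "- 1 \<le> ln (m t)" if "0 \<le> t" "t \<le> \<delta>" for t
      using \<delta>(2)[OF that] m_pos[OF that(1)] by (simp add: ln_ge_iff)
  qed (use \<delta> t in auto)
  then have "ln (m t) = t * psi \<beta>" using mgf_one[of \<beta>] by (simp add: m_def)
  then have "m t = exp (t * psi \<beta>)" using m_pos[OF t] by (metis exp_ln)
  then show ?thesis using m_e[OF t] by simp
qed

lemma psi_0: "psi 0 = 0"
  by (simp add: laplace_exponent_def prob_space)

text \<open>Fubini's theorem, with the exponential form of the moment generating function.\<close>

lemma mu_exp_eq:
  assumes q: "0 < q" and \<beta>: "0 \<le> \<beta>"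
  shows "(\<integral>\<^sup>+z. ennreal (exp (\<beta> * z)) \<partial>mu q) = (if psi \<beta> < q then ennreal (1 / (q - psi \<beta>)) else top)"
proof -
  have "(\<integral>\<^sup>+z. ennreal (exp (\<beta> * z)) \<partial>mu q) = (\<integral>\<^sup>+t\<in>{0..}. ennreal (exp (- (q - psi \<beta>) * t)) \<partial>lborel)"
    unfolding mu_exp_eq_mgf
    by (intro nn_integral_cong)
       (auto simp: indicator_def mgf_eq_exp \<beta> ennreal_mult[symmetric] exp_add[symmetric] algebra_simps)
  also have "\<dots> = (if psi \<beta> < q then ennreal (1 / (q - psi \<beta>)) else top)"
  proof (cases "psi \<beta> < q")
    case True
    then show ?thesis using nn_integral_exp_atLeast[of "q - psi \<beta>" 0] by simp
  next
    case False
    have "emeasure lborel {0::real..} = top"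
    proof (rule ccontr)
      assume "emeasure lborel {0::real..} \<noteq> top"
      then obtain r where r: "emeasure lborel {0::real..} = ennreal r" "0 \<le> r" by (cases "emeasure lborel {0::real..}") auto
      have "emeasure lborel {0::real..r + 1} \<le> emeasure lborel {0::real..}" by (rule emeasure_mono) auto
      then show False using r by simp
    qed
    then have "top = (\<integral>\<^sup>+t. indicator {0..} t \<partial>(lborel :: real measure))" by simp
    also have "\<dots> \<le> (\<integral>\<^sup>+t\<in>{0..}. ennreal (exp (- (q - psi \<beta>) * t)) \<partial>lborel)"
      using False by (intro nn_integral_mono) (auto simp: indicator_def ennreal_ge_1 mult_nonneg_nonneg  simp flip: mult_minus_left)
    finally show ?thesis using False by (simp add: top_unique)
  qed
  finally show ?thesis .
qed

lemma psi_less_iff: "0 < q \<Longrightarrow> 0 \<le> \<beta> \<Longrightarrow> psi \<beta> < q \<longleftrightarrow> \<beta> < kappa q"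
  using mu_exp_eq[of q \<beta>] mu_exp_finite_iff[of q \<beta>] by (auto split: if_splits)

text \<open>Hoelder's inequality in the form of convexity of the exponential function, normalised by \<open>exp (- psi a)\<close> and
\<open>exp (- psi b)\<close>.\<close>

lemma convex_on_psi: "convex_on {0..} psi"
proof (rule convex_onI)
  interpret P: prob_space "path_law 0" by (rule prob_space_path_law)
  fix u a b :: real assume u: "0 < u" "u < 1" and ab: "a \<in> {0..}" "b \<in> {0..}"
  define s where "s = (1 - u) * a + u * b"
  define k where "k = (1 - u) * psi a + u * psi b"
  have s: "0 \<le> s" using u ab by (simp add: s_def)
  have m: "(\<lambda>f. ennreal (exp (\<beta> * f 1))) \<in> borel_measurable (path_law 0)" for \<beta>
    by (simp add: path_exp_measurable)
  have "ennreal (exp (- k)) * mgf 1 s \<le> ennreal ((1 - u) * exp (- psi a)) * mgf 1 a + ennreal (u * exp (- psi b)) * mgf 1 b"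
    unfolding mgf_def
  proof (subst (1 2 3) nn_integral_cmult[symmetric, OF m], subst nn_integral_add[symmetric])
    show "(\<integral>\<^sup>+f. ennreal (exp (- k)) * ennreal (exp (s * f 1)) \<partial>path_law 0)
      \<le> (\<integral>\<^sup>+f. ennreal ((1 - u) * exp (- psi a)) * ennreal (exp (a * f 1)) + ennreal (u * exp (- psi b)) * ennreal (exp (b * f 1)) \<partial>path_law 0)"
    proof (rule nn_integral_mono)
      fix f :: "real \<Rightarrow> real"
      have "exp ((1 - u) *\<^sub>R (a * f 1 - psi a) + u *\<^sub>R (b * f 1 - psi b)) \<le> (1 - u) * exp (a * f 1 - psi a) + u * exp (b * f 1 - psi b)"
        using u exp_convex by (intro convex_onD) auto
      also have "(1 - u) *\<^sub>R (a * f 1 - psi a) + u *\<^sub>R (b * f 1 - psi b) = - k + s * f 1"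
        by (simp add: s_def k_def algebra_simps)
      finally have "exp (- k) * exp (s * f 1) \<le> (1 - u) * exp (- psi a) * exp (a * f 1) + u * exp (- psi b) * exp (b * f 1)"
        by (simp add: exp_add exp_diff exp_minus field_simps)
      then show "ennreal (exp (- k)) * ennreal (exp (s * f 1)) \<le> ennreal ((1 - u) * exp (- psi a)) * ennreal (exp (a * f 1)) + ennreal (u * exp (- psi b)) * ennreal (exp (b * f 1))"
        using u by (simp add: ennreal_mult[symmetric] ennreal_plus[symmetric] ennreal_leI del: ennreal_plus)
    qed
  qed (use m in \<open>auto intro!: borel_measurable_times_ennreal\<close>)
  also have "\<dots> = ennreal ((1 - u) + u)"
  proof -
    have "exp (- c) * exp c = 1" for c :: real by (simp add: exp_add[symmetric])
    then show ?thesis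
      using u ab by (simp add: mgf_eq_exp ennreal_mult[symmetric] ennreal_plus[symmetric] mult.assoc del: ennreal_plus)
  qed
  finally have "exp (- k) * exp (psi s) \<le> 1"
    using s by (simp add: mgf_eq_exp ennreal_mult[symmetric] ennreal_le_1)
  then have "exp (psi s - k) \<le> exp 0" by (simp add: exp_diff exp_minus field_simps)
  then have "psi s \<le> k" by (subst (asm) exp_le_cancel_iff) simp
  then show "psi ((1 - u) *\<^sub>R a + u *\<^sub>R b) \<le> (1 - u) * psi a + u * psi b" by (simp add: s_def k_def)
qed simp

lemma isCont_psi: "0 < \<beta> \<Longrightarrow> isCont psi \<beta>"
proof -
  assume \<beta>: "0 < \<beta>"
  have "convex_on {0<..} psi" by (rule convex_on_subset[OF convex_on_psi]) auto
  then have "continuous_on {0<..} psi" by (intro convex_on_continuous) auto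
  then show ?thesis using \<beta> by (simp add: continuous_on_eq_continuous_at)
qed

lemma psi_kappa: assumes q: "0 < q" shows "psi (kappa q) = q"
proof (rule antisym)
  note k = kappa_pos[OF q]
  show "q \<le> psi (kappa q)" using psi_less_iff[OF q, of "kappa q"] k by simp
  have "(psi \<longlongrightarrow> psi (kappa q)) (at_left (kappa q))"
    using isCont_psi[OF k] by (simp add: isCont_def filterlim_at_split)
  moreover have "\<forall>\<^sub>F b in at_left (kappa q). psi b \<le> q"
    unfolding eventually_at_left[OF k] using psi_less_iff[OF q] k by (intro exI[of _ 0]) (auto simp: less_imp_le)
  ultimately show "psi (kappa q) \<le> q" by (rule tendsto_upperbound) simp
qed

text \<open>A convex function that vanishes at \<open>0\<close> and equals \<open>q > 0\<close> at \<open>kappa q\<close> exceeds \<open>q\<close> afterwards.\<close>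

lemma psi_greater:
  assumes q: "0 < q" and \<beta>: "kappa q < \<beta>" shows "q < psi \<beta>"
proof (rule ccontr)
  assume "\<not> q < psi \<beta>"
  note k = kappa_pos[OF q]
  define u where "u = kappa q / \<beta>"
  have u: "0 < u" "u < 1" using k \<beta> by (auto simp: u_def)
  have "psi ((1 - u) *\<^sub>R 0 + u *\<^sub>R \<beta>) \<le> (1 - u) * psi 0 + u * psi \<beta>"
    using u k \<beta> by (intro convex_onD[OF convex_on_psi]) auto
  then have "q \<le> u * psi \<beta>" using k \<beta> by (simp add: u_def psi_kappa[OF q] psi_0)
  also have "\<dots> \<le> u * q" using \<open>\<not> q < psi \<beta>\<close> u by (intro mult_left_mono) auto
  also have "\<dots> < q" using u q by simp
  finally show False by simp
qed

theorem right_inverse_psi: assumes q: "0 < q" shows "right_inverse psi q = kappa q"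
  unfolding right_inverse_def
proof (rule cSup_eq_maximum)
  show "kappa q \<in> {\<beta>. 0 \<le> \<beta> \<and> psi \<beta> = q}" using psi_kappa[OF q] kappa_pos[OF q] by simp
  show "\<beta> \<le> kappa q" if "\<beta> \<in> {\<beta>. 0 \<le> \<beta> \<and> psi \<beta> = q}" for \<beta>
    using that psi_greater[OF q, of \<beta>] by force
qed

end

section \<open>Moments, and the resolvent on the negative half-line\<close>

lemma nn_integral_exp_Icc:
  fixes k :: real assumes "k \<noteq> 0" "a \<le> b"
  shows "(\<integral>\<^sup>+z\<in>{a..b}. ennreal (exp (k * z)) \<partial>lborel) = ennreal ((exp (k * b) - exp (k * a)) / k)"
proof -
  have "(\<integral>\<^sup>+z\<in>{a..b}. ennreal (exp (k * z)) \<partial>lborel) = ennreal (exp (k * b) / k - exp (k * a) / k)"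
    using assms by (intro nn_integral_FTC_Icc) (auto intro!: derivative_eq_intros)
  then show ?thesis by (simp add: diff_divide_distrib)
qed

lemma integrable_continuous_unit_interval:
  fixes T :: "'b \<Rightarrow> real" and h :: "real \<Rightarrow> real"
  assumes N: "finite_measure N" and [measurable]: "T \<in> borel_measurable N" and T: "AE x in N. T x \<in> {0..1}"
    and h: "continuous_on UNIV h"
  shows "integrable N (\<lambda>x. h (T x))"
proof -
  have "compact (h ` {0..1})" using h continuous_on_subset by (intro compact_continuous_image) auto
  then obtain B where B: "\<And>v. v \<in> {0..1} \<Longrightarrow> norm (h v) \<le> B"
    using compact_imp_bounded bounded_iff by (metis imageI)
  have [measurable]: "h \<in> borel_measurable borel" using h by (rule borel_measurable_continuous_onI)
  have "AE x in N. norm (h (T x)) \<le> B" using T by eventually_elim (rule B)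
  then show ?thesis by (intro finite_measure.integrable_const_bound[OF N, where B=B]) auto
qed

text \<open>The error estimate for replacing a function by a polynomial approximation.\<close>

lemma integral_close_unit_interval:
  fixes T :: "'b \<Rightarrow> real" and g h :: "real \<Rightarrow> real"
  assumes N: "finite_measure N" "T \<in> borel_measurable N" "AE x in N. T x \<in> {0..1}"
    and gh: "continuous_on UNIV g" "continuous_on UNIV h" "\<And>v. v \<in> {0..1} \<Longrightarrow> \<bar>g v - h v\<bar> < \<epsilon>"
  shows "\<bar>(\<integral>x. g (T x) \<partial>N) - (\<integral>x. h (T x) \<partial>N)\<bar> \<le> \<epsilon> * measure N (space N)"
proof -
  interpret finite_measure N by fact
  note int = integrable_continuous_unit_interval[OF N gh(1)] integrable_continuous_unit_interval[OF N gh(2)]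
  have "\<bar>(\<integral>x. g (T x) \<partial>N) - (\<integral>x. h (T x) \<partial>N)\<bar> = \<bar>\<integral>x. g (T x) - h (T x) \<partial>N\<bar>"
    using int by simp
  also have "\<dots> \<le> (\<integral>x. \<bar>g (T x) - h (T x)\<bar> \<partial>N)" by (rule integral_abs_bound)
  also have "\<dots> \<le> (\<integral>x. \<epsilon> \<partial>N)"
  proof (rule integral_mono_AE)
    show "AE x in N. \<bar>g (T x) - h (T x)\<bar> \<le> \<epsilon>"
      using N(3) by eventually_elim (rule less_imp_le[OF gh(3)])
  qed (use int in auto)
  finally show ?thesis by (simp add: mult.commute)
qed

text \<open>Measures carried by the unit interval are determined by their moments, by the Weierstrass theorem. The
measures are given on arbitrary spaces with maps to the interval, and the combination of three of them is the one in
which the scale function appears.\<close>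

lemma integral_continuous_eq_of_moments:
  fixes T1 :: "'b \<Rightarrow> real" and T2 :: "'c \<Rightarrow> real" and T3 :: "'d \<Rightarrow> real"
  assumes N1: "finite_measure N1" "T1 \<in> borel_measurable N1" "AE x in N1. T1 x \<in> {0..1}"
    and N2: "finite_measure N2" "T2 \<in> borel_measurable N2" "AE x in N2. T2 x \<in> {0..1}"
    and N3: "finite_measure N3" "T3 \<in> borel_measurable N3" "AE x in N3. T3 x \<in> {0..1}"
    and moments: "\<And>n. (\<integral>x. T1 x ^ n \<partial>N1) + (\<integral>x. T2 x ^ n \<partial>N2) = (\<integral>x. T3 x ^ n \<partial>N3)"
    and g: "continuous_on UNIV (g :: real \<Rightarrow> real)"
  shows "(\<integral>x. g (T1 x) \<partial>N1) + (\<integral>x. g (T2 x) \<partial>N2) = (\<integral>x. g (T3 x) \<partial>N3)"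
proof -
  define d where "d = (\<integral>x. g (T1 x) \<partial>N1) + (\<integral>x. g (T2 x) \<partial>N2) - (\<integral>x. g (T3 x) \<partial>N3)"
  define m where "m = measure N1 (space N1) + measure N2 (space N2) + measure N3 (space N3)"
  have bound: "\<bar>d\<bar> \<le> \<epsilon> * m" if eps: "0 < \<epsilon>" for \<epsilon>
  proof -
    obtain h where h: "real_polynomial_function h" "\<And>v. v \<in> {0..1} \<Longrightarrow> \<bar>g v - h v\<bar> < \<epsilon>"
      by (rule Stone_Weierstrass_real_polynomial_function[OF compact_Icc continuous_on_subset[OF g subset_UNIV] eps]) blast
    then obtain a n where hp: "h = (\<lambda>v. \<Sum>i\<le>n. a i * v ^ i)"
      by (auto simp: real_polynomial_function_iff_sum)
    have hc: "continuous_on UNIV h" unfolding hp by (intro continuous_intros)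
    have pc: "continuous_on UNIV (\<lambda>v :: real. v ^ i)" for i by (intro continuous_intros)
    have I: "(\<integral>x. h (T1 x) \<partial>N1) = (\<Sum>i\<le>n. a i * (\<integral>x. T1 x ^ i \<partial>N1))"
       "(\<integral>x. h (T2 x) \<partial>N2) = (\<Sum>i\<le>n. a i * (\<integral>x. T2 x ^ i \<partial>N2))"
       "(\<integral>x. h (T3 x) \<partial>N3) = (\<Sum>i\<le>n. a i * (\<integral>x. T3 x ^ i \<partial>N3))"
      unfolding hp
      using integrable_continuous_unit_interval[OF N1 pc] integrable_continuous_unit_interval[OF N2 pc]
        integrable_continuous_unit_interval[OF N3 pc]
      by (simp_all add: Bochner_Integration.integral_sum)
    have "(\<integral>x. h (T1 x) \<partial>N1) + (\<integral>x. h (T2 x) \<partial>N2) = (\<integral>x. h (T3 x) \<partial>N3)"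
      unfolding I moments[symmetric] by (simp add: sum.distrib[symmetric] distrib_left)
    moreover note integral_close_unit_interval[OF N1 g hc h(2)] integral_close_unit_interval[OF N2 g hc h(2)]
      integral_close_unit_interval[OF N3 g hc h(2)]
    ultimately show ?thesis unfolding d_def m_def distrib_left by linarith
  qed
  have "0 \<le> m" by (simp add: m_def)
  have "d = 0"
  proof (rule ccontr)
    assume "d \<noteq> 0"
    then have "\<bar>d\<bar> \<le> (\<bar>d\<bar> / (2 * (m + 1))) * m" using \<open>0 \<le> m\<close> by (intro bound) simp
    also have "\<dots> < \<bar>d\<bar>" using \<open>0 \<le> m\<close> \<open>d \<noteq> 0\<close> by (simp add: divide_less_eq)
    finally show False by simp
  qed
  then show ?thesis by (simp add: d_def)
qed

lemma integral_pointwise_limit_unit_interval: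
  fixes T :: "'b \<Rightarrow> real" and G :: "real \<Rightarrow> real"
  assumes N: "finite_measure N" and [measurable]: "T \<in> borel_measurable N" and T: "AE x in N. T x \<in> {0..1}"
    and g: "\<And>k. continuous_on UNIV (g k)" "\<And>k v. v \<in> {0..1} \<Longrightarrow> \<bar>g k v\<bar> \<le> B"
    and lim: "\<And>v. (\<lambda>k. g k v) \<longlonglongrightarrow> G v"
  shows "(\<lambda>k. \<integral>x. g k (T x) \<partial>N) \<longlonglongrightarrow> (\<integral>x. G (T x) \<partial>N)"
proof (rule integral_dominated_convergence[where w="\<lambda>_. B"])
  have [measurable]: "g k \<in> borel_measurable borel" for k using g(1) by (rule borel_measurable_continuous_onI)
  have [measurable]: "G \<in> borel_measurable borel" by (rule borel_measurable_LIMSEQ_real[OF lim]) measurable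
  show "(\<lambda>x. G (T x)) \<in> borel_measurable N" by measurable
  show "(\<lambda>x. g k (T x)) \<in> borel_measurable N" for k by measurable
  show "integrable N (\<lambda>_. B)" by (rule finite_measure.integrable_const[OF N])
  show "AE x in N. (\<lambda>k. g k (T x)) \<longlonglongrightarrow> G (T x)" using lim by (intro AE_I2)
  show "AE x in N. norm (g k (T x)) \<le> B" for k using T by eventually_elim (simp add: g(2))
qed

text \<open>Truncated exponentials are discontinuous, so the identity is needed for bounded limits of continuous functions.\<close>

lemma integral_limit_eq_of_moments:
  fixes T1 :: "'b \<Rightarrow> real" and T2 :: "'c \<Rightarrow> real" and T3 :: "'d \<Rightarrow> real" and G :: "real \<Rightarrow> real"
  assumes N1: "finite_measure N1" "T1 \<in> borel_measurable N1" "AE x in N1. T1 x \<in> {0..1}"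
    and N2: "finite_measure N2" "T2 \<in> borel_measurable N2" "AE x in N2. T2 x \<in> {0..1}"
    and N3: "finite_measure N3" "T3 \<in> borel_measurable N3" "AE x in N3. T3 x \<in> {0..1}"
    and moments: "\<And>n. (\<integral>x. T1 x ^ n \<partial>N1) + (\<integral>x. T2 x ^ n \<partial>N2) = (\<integral>x. T3 x ^ n \<partial>N3)"
    and g: "\<And>k. continuous_on UNIV (g k)" "\<And>k v. v \<in> {0..1} \<Longrightarrow> \<bar>g k v\<bar> \<le> B"
    and lim: "\<And>v. (\<lambda>k. g k v) \<longlonglongrightarrow> G v"
  shows "(\<integral>x. G (T1 x) \<partial>N1) + (\<integral>x. G (T2 x) \<partial>N2) = (\<integral>x. G (T3 x) \<partial>N3)"
proof (rule LIMSEQ_unique)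
  show "(\<lambda>k. (\<integral>x. g k (T1 x) \<partial>N1) + (\<integral>x. g k (T2 x) \<partial>N2)) \<longlonglongrightarrow> (\<integral>x. G (T1 x) \<partial>N1) + (\<integral>x. G (T2 x) \<partial>N2)"
    by (intro tendsto_add integral_pointwise_limit_unit_interval[OF N1 g lim] integral_pointwise_limit_unit_interval[OF N2 g lim])
  show "(\<lambda>k. (\<integral>x. g k (T1 x) \<partial>N1) + (\<integral>x. g k (T2 x) \<partial>N2)) \<longlonglongrightarrow> (\<integral>x. G (T3 x) \<partial>N3)"
    unfolding integral_continuous_eq_of_moments[OF N1 N2 N3 moments g(1)]
    by (rule integral_pointwise_limit_unit_interval[OF N3 g lim])
qed

context spectrally_negative_levy
begin

lemma potential_add:
  assumes m: "case_prod m \<in> borel_measurable (borel \<Otimes>\<^sub>M path_space)"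
    and [measurable]: "\<phi> \<in> borel_measurable borel" "\<phi>' \<in> borel_measurable borel"
  shows "potential m (\<lambda>y. \<phi> y + \<phi>' y) x = potential m \<phi> x + potential m \<phi>' x"
  by (subst (1 2 3) nn_integral_potential_measure[OF m, symmetric]) (simp_all add: nn_integral_add)

lemma potential_cmult:
  assumes m: "case_prod m \<in> borel_measurable (borel \<Otimes>\<^sub>M path_space)"
    and [measurable]: "\<phi> \<in> borel_measurable borel"
  shows "potential m (\<lambda>y. c * \<phi> y) x = c * potential m \<phi> x"
  by (subst (1 2) nn_integral_potential_measure[OF m, symmetric]) (simp_all add: nn_integral_cmult)

text \<open>Before the first passage the path is at or below \<open>0\<close>, except possibly at one time.\<close>

lemma unhit_potential_cong:
  assumes eq: "\<And>y. y \<le> 0 \<Longrightarrow> \<phi> y = \<phi>' y"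
  shows "potential (unhit_weight q) \<phi> x = potential (unhit_weight q) \<phi>' x"
  unfolding potential_def
proof (rule nn_integral_cong)
  fix f assume "f \<in> space (path_law x)"
  then have "AE t in lborel. \<not> (0 \<le> t \<and> 0 < f t \<and> \<not> hits f t)" by (intro hits_unique_time) simp
  then show "(\<integral>\<^sup>+t\<in>{0..}. unhit_weight q t f * \<phi> (f t) \<partial>lborel) = (\<integral>\<^sup>+t\<in>{0..}. unhit_weight q t f * \<phi>' (f t) \<partial>lborel)"
    by (intro nn_integral_cong_AE) (auto elim!: eventually_mono simp: unhit_weight_def indicator_def eq not_less)
qed

lemma passage_eq: "0 < q \<Longrightarrow> x \<le> 0 \<Longrightarrow> passage q x = ennreal (exp (kappa q * x))"
  using passage_eq_exp[of q "- x"] by simp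

lemma free_potential_first_passage:
  assumes q: "0 < q" and x: "x \<le> 0" and [measurable]: "\<phi> \<in> borel_measurable borel"
  shows "potential (free_weight q) \<phi> x
    = potential (unhit_weight q) \<phi> x + ennreal (exp (kappa q * x)) * potential (free_weight q) \<phi> 0"
  by (subst free_potential_split) (simp_all add: first_passage_decomposition[OF q x] passage_eq[OF q x])

lemma mu_positive_null:
  assumes q: "0 < q" and z: "0 < z" shows "emeasure (mu q) {z} = 0"
proof -
  have "emeasure (mu q) {z} = (\<integral>\<^sup>+y. indicator {z} y \<partial>mu q)" by simp
  also have "\<dots> = (\<integral>\<^sup>+y\<in>{0<..}. indicator {z} y \<partial>mu q)"
    using z by (intro nn_integral_cong) (auto simp: indicator_def)
  also have "\<dots> = (\<integral>\<^sup>+y. 0 \<partial>(lborel :: real measure))"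
  proof (subst nn_integral_mu_positive[OF q])
    show "(\<integral>\<^sup>+y\<in>{0<..}. ennreal (mu_const q * exp (- kappa q * y)) * indicator {z} y \<partial>lborel) = (\<integral>\<^sup>+y. 0 \<partial>(lborel :: real measure))"
    proof (rule nn_integral_cong_AE)
      show "AE y in lborel. ennreal (mu_const q * exp (- kappa q * y)) * indicator {z} y * indicator {0<..} y = 0"
        using AE_lborel_singleton[of z] by eventually_elim simp
    qed
  qed simp
  finally show ?thesis by simp
qed

text \<open>Away from \<open>x = 0\<close> the resolvent has no atom at \<open>- x > 0\<close>, having a density there. At \<open>x = 0\<close> the passage probability
is \<open>1\<close>, so that the killed resolvent of this set vanishes after cancellation.\<close>

lemma unhit_potential_zero_null:
  assumes q: "0 < q" and x: "x \<le> 0"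
  shows "potential (unhit_weight q) (indicator {0}) x = 0"
proof (cases "x = 0")
  case False
  have "potential (unhit_weight q) (indicator {0}) x \<le> potential (free_weight q) (indicator {0}) x"
    by (rule potential_mono) (intro mult_right_mono unhit_le_free, simp)
  also have "\<dots> = (\<integral>\<^sup>+z. indicator {0} (x + z) \<partial>mu q)" by (simp add: free_potential_eq)
  also have "\<dots> = (\<integral>\<^sup>+z. indicator {- x} z \<partial>mu q)"
    by (intro nn_integral_cong) (auto simp: indicator_def)
  also have "\<dots> = emeasure (mu q) {- x}" by simp
  also have "\<dots> = 0" using False x by (intro mu_positive_null[OF q]) simp
  finally show ?thesis by simp
next
  case True
  have "potential (free_weight q) (indicator {0}) 0 \<le> potential (free_weight q) (\<lambda>_. ennreal 1) 0"
    by (rule potential_mono) (auto simp: indicator_def)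
  then have "potential (free_weight q) (indicator {0}) 0 \<noteq> top"
    using q by (simp only: free_potential_one) (auto simp: top_unique)
  moreover have "potential (free_weight q) (indicator {0}) 0
    = potential (unhit_weight q) (indicator {0}) 0 + potential (free_weight q) (indicator {0}) 0"
    using free_potential_first_passage[OF q order_refl, of "indicator {0}"] by simp
  ultimately have "potential (free_weight q) (indicator {0}) 0 + 0
      = potential (free_weight q) (indicator {0}) 0 + potential (unhit_weight q) (indicator {0}) 0"
    and "potential (free_weight q) (indicator {0}) 0 \<noteq> top"
    by (simp_all add: add.commute)
  then have "0 = potential (unhit_weight q) (indicator {0}) 0"
    unfolding ennreal_add_left_cancel by simp
  then show ?thesis using True by simp
qed

lemma unhit_potential_indicator:
  assumes q: "0 < q" and x: "x \<le> 0" and [measurable]: "\<phi> \<in> borel_measurable borel"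
  shows "potential (unhit_weight q) (\<lambda>y. \<phi> y * indicator {..<0} y) x = potential (unhit_weight q) \<phi> x"
proof -
  have "potential (unhit_weight q) \<phi> x = potential (unhit_weight q) (\<lambda>y. \<phi> y * indicator {..<0} y + \<phi> 0 * indicator {0} y) x"
    by (rule unhit_potential_cong) (auto simp: indicator_def)
  also have "\<dots> = potential (unhit_weight q) (\<lambda>y. \<phi> y * indicator {..<0} y) x + \<phi> 0 * potential (unhit_weight q) (indicator {0}) x"
    by (simp add: potential_add potential_cmult weights_measurable)
  finally show ?thesis by (simp add: unhit_potential_zero_null[OF q x])
qed

text \<open>Here the exponential is integrable for the resolvent, which multiplies it by \<open>1 / (q - psi a)\<close>; subtracting the
contribution after first passage leaves the claim.\<close>

lemma unhit_exp_small:
  assumes q: "0 < q" and a: "0 \<le> a" "a < kappa q" and x: "x \<le> 0"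
  shows "potential (unhit_weight q) (\<lambda>z. ennreal (exp (a * z))) x = ennreal ((exp (a * x) - exp (kappa q * x)) / (q - psi a))"
proof -
  have lt: "psi a < q" using psi_less_iff[OF q a(1)] a by simp
  have U: "potential (free_weight q) (\<lambda>z. ennreal (exp (a * z))) y = ennreal (exp (a * y) / (q - psi a))" for y
  proof -
    have "potential (free_weight q) (\<lambda>z. ennreal (exp (a * z))) y = (\<integral>\<^sup>+z. ennreal (exp (a * y)) * ennreal (exp (a * z)) \<partial>mu q)"
      by (subst free_potential_eq) (auto simp: distrib_left exp_add ennreal_mult)
    also have "\<dots> = ennreal (exp (a * y) / (q - psi a))"
      using lt by (subst nn_integral_cmult) (auto simp: mu_exp_eq[OF q a(1)] ennreal_mult[symmetric])
    finally show ?thesis .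
  qed
  have "ennreal (exp (a * x) / (q - psi a)) = potential (unhit_weight q) (\<lambda>z. ennreal (exp (a * z))) x + ennreal (exp (kappa q * x) / (q - psi a))"
    using free_potential_first_passage[OF q x, of "\<lambda>z. ennreal (exp (a * z))"] lt by (simp add: U ennreal_mult[symmetric])
  then have "potential (unhit_weight q) (\<lambda>z. ennreal (exp (a * z))) x = ennreal (exp (a * x) / (q - psi a)) - ennreal (exp (kappa q * x) / (q - psi a))"
    by simp
  also have "\<dots> = ennreal ((exp (a * x) - exp (kappa q * x)) / (q - psi a))"
    using lt by (subst ennreal_minus) (auto simp: diff_divide_distrib)
  finally show ?thesis .
qed

text \<open>The resolvent equation for the process killed at its first passage.\<close>

lemma unhit_resolvent:
  assumes q: "0 < q" "q < q2" and [measurable]: "\<phi> \<in> borel_measurable borel"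
  shows "potential (unhit_weight q) \<phi> x
    = potential (unhit_weight q2) \<phi> x + potential (unhit_weight q2) (\<lambda>y. ennreal (q2 - q) * potential (unhit_weight q) \<phi> y) x"
proof (rule potential_perturbation)
  show "unhit_weight q2 t (stop_path t f) = unhit_weight q2 t f" for t f
    by (simp add: unhit_weight_def hits_stop_path)
  fix u :: real and f assume u: "0 \<le> u" and f: "f \<in> path_set"
  show "unhit_weight q u f = unhit_weight q2 u f
    + (\<integral>\<^sup>+t\<in>{0..u}. unhit_weight q2 t f * ennreal (q2 - q) * unhit_weight q (u - t) (shift_path t f) \<partial>lborel)"
  proof (cases "hits f u")
    case True
    have "(\<integral>\<^sup>+t\<in>{0..u}. unhit_weight q2 t f * ennreal (q2 - q) * unhit_weight q (u - t) (shift_path t f) \<partial>lborel) = (\<integral>\<^sup>+t. 0 \<partial>(lborel :: real measure))"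
      using True hits_shift_path[of _ u f] by (intro nn_integral_cong) (auto simp: unhit_weight_def indicator_def)
    then show ?thesis using True by (simp add: unhit_weight_def)
  next
    case False
    have "(\<integral>\<^sup>+t\<in>{0..u}. unhit_weight q2 t f * ennreal (q2 - q) * unhit_weight q (u - t) (shift_path t f) \<partial>lborel)
      = (\<integral>\<^sup>+t. ennreal ((q2 - q) * exp (- q * u)) * (ennreal (exp (- (q2 - q) * t)) * indicator {0..u} t) \<partial>lborel)"
    proof (rule nn_integral_cong)
      fix t :: real
      have "exp (- q2 * t) * exp (- q * (u - t)) = exp (- q * u) * exp (- (q2 - q) * t)"
        by (simp add: exp_add[symmetric] algebra_simps)
      then show "unhit_weight q2 t f * ennreal (q2 - q) * unhit_weight q (u - t) (shift_path t f) * indicator {0..u} t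
        = ennreal ((q2 - q) * exp (- q * u)) * (ennreal (exp (- (q2 - q) * t)) * indicator {0..u} t)"
        using False hits_shift_path[of t u f] q
        by (auto simp: unhit_weight_def indicator_def ennreal_mult[symmetric] mult_ac)
    qed
    also have "\<dots> = ennreal ((q2 - q) * exp (- q * u)) * ennreal ((exp (- (q2 - q) * u) - exp (- (q2 - q) * 0)) / (- (q2 - q)))"
      using q u by (subst nn_integral_exp_Icc[symmetric]) (auto intro!: nn_integral_cmult)
    also have "\<dots> = ennreal (exp (- q * u) - exp (- q2 * u))"
    proof -
      have "(q2 - q) * exp (- q * u) * ((exp (- (q2 - q) * u) - exp (- (q2 - q) * 0)) / (- (q2 - q))) = exp (- q * u) * (1 - exp (- (q2 - q) * u))"
        using q by (simp add: field_simps)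
      also have "\<dots> = exp (- q * u) - exp (- q2 * u)"
        by (simp add: right_diff_distrib exp_add[symmetric] algebra_simps)
      finally show ?thesis using q u by (subst ennreal_mult[symmetric]) (auto intro!: divide_nonpos_neg mult_nonpos_nonneg)
    qed
    also have "unhit_weight q2 u f + ennreal (exp (- q * u) - exp (- q2 * u)) = unhit_weight q u f"
      using False q u by (simp add: unhit_weight_def ennreal_plus[symmetric] mult_right_mono del: ennreal_plus)
    finally show ?thesis by simp
  qed
qed (simp_all add: weights_measurable)

text \<open>Finite for all \<open>a \<ge> 0\<close>, unlike the transform over the whole line.\<close>

definition mu_neg :: "real \<Rightarrow> real \<Rightarrow> real" where
  "mu_neg q a = enn2real (\<integral>\<^sup>+z\<in>{..0}. ennreal (exp (a * z)) \<partial>mu q)"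

lemma mu_neg: "0 < q \<Longrightarrow> 0 \<le> a \<Longrightarrow> (\<integral>\<^sup>+z\<in>{..0}. ennreal (exp (a * z)) \<partial>mu q) = ennreal (mu_neg q a)"
  unfolding mu_neg_def using mu_negative_le[of q a]
  by (intro ennreal_enn2real[symmetric]) (auto simp: less_top[symmetric] top_unique)

lemma mu_neg_bounds: "0 < q \<Longrightarrow> 0 \<le> a \<Longrightarrow> 0 \<le> mu_neg q a \<and> mu_neg q a \<le> 1 / q"
proof -
  assume qa: "0 < q" "0 \<le> a"
  have "ennreal (mu_neg q a) \<le> ennreal (1 / q)" using mu_negative_le[OF qa] unfolding mu_neg[OF qa] .
  then have "mu_neg q a \<le> 1 / q" using qa by (subst (asm) ennreal_le_iff) auto
  moreover have "0 \<le> mu_neg q a" unfolding mu_neg_def by (rule enn2real_nonneg)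
  ultimately show ?thesis by blast
qed

text \<open>The resolvent measure on \<open>{..0}\<close> contributes the first term, its exponential density on \<open>{0..- x}\<close> the second.\<close>

lemma free_exp_below:
  assumes q: "0 < q" and a: "0 \<le> a" "a \<noteq> kappa q" and x: "x \<le> 0"
  shows "potential (free_weight q) (\<lambda>z. ennreal (exp (a * z)) * indicator {..0} z) x
    = ennreal (exp (a * x) * mu_neg q a + mu_const q * (exp (kappa q * x) - exp (a * x)) / (a - kappa q))"
proof -
  define k where "k = a - kappa q"
  have k: "k \<noteq> 0" using a by (simp add: k_def)
  have c: "0 < mu_const q" by (rule mu_const_pos[OF q])
  define P where "P = (exp (k * (- x)) - exp (k * 0)) / k"
  have mono: "0 \<le> P"
  proof (cases "0 < k")
    case True then show ?thesis unfolding P_def using x by (simp add: mult_nonneg_nonpos)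
  next
    case False then show ?thesis unfolding P_def using x k by (intro divide_nonpos_neg) (auto simp: mult_nonpos_nonpos)
  qed
  have "potential (free_weight q) (\<lambda>z. ennreal (exp (a * z)) * indicator {..0} z) x
    = (\<integral>\<^sup>+z. ennreal (exp (a * x)) * (ennreal (exp (a * z)) * indicator {..- x} z) \<partial>mu q)"
    by (subst free_potential_eq) (auto simp: distrib_left exp_add ennreal_mult indicator_def mult.assoc intro!: nn_integral_cong)
  also have "\<dots> = ennreal (exp (a * x)) * (\<integral>\<^sup>+z. ennreal (exp (a * z)) * indicator {..- x} z \<partial>mu q)"
    by (rule nn_integral_cmult) simp
  also have "(\<integral>\<^sup>+z. ennreal (exp (a * z)) * indicator {..- x} z \<partial>mu q)
    = (\<integral>\<^sup>+z\<in>{..0}. ennreal (exp (a * z)) \<partial>mu q) + (\<integral>\<^sup>+z\<in>{0<..}. ennreal (exp (a * z)) * indicator {..- x} z \<partial>mu q)"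
    using x by (subst mu_split_at_0) (auto intro!: nn_integral_cong arg_cong2[where f="(+)"] simp: indicator_def)
  also have "(\<integral>\<^sup>+z\<in>{0<..}. ennreal (exp (a * z)) * indicator {..- x} z \<partial>mu q) = ennreal (mu_const q * P)"
  proof -
    have "(\<integral>\<^sup>+z\<in>{0<..}. ennreal (exp (a * z)) * indicator {..- x} z \<partial>mu q)
      = (\<integral>\<^sup>+z. ennreal (mu_const q) * (ennreal (exp (k * z)) * indicator {0..- x} z) \<partial>lborel)"
    proof (subst nn_integral_mu_positive[OF q])
      show "(\<integral>\<^sup>+z\<in>{0<..}. ennreal (mu_const q * exp (- kappa q * z)) * (ennreal (exp (a * z)) * indicator {..- x} z) \<partial>lborel)
        = (\<integral>\<^sup>+z. ennreal (mu_const q) * (ennreal (exp (k * z)) * indicator {0..- x} z) \<partial>lborel)"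
      proof (rule nn_integral_cong_AE)
        show "AE z in lborel. ennreal (mu_const q * exp (- kappa q * z)) * (ennreal (exp (a * z)) * indicator {..- x} z) * indicator {0<..} z
          = ennreal (mu_const q) * (ennreal (exp (k * z)) * indicator {0..- x} z)"
          using AE_lborel_singleton[of 0]
        proof eventually_elim
          case (elim z)
          have "exp (- kappa q * z) * exp (a * z) = exp (k * z)"
            by (simp add: k_def exp_add[symmetric] algebra_simps)
          then show ?case using elim c by (auto simp: indicator_def ennreal_mult[symmetric] mult.assoc)
        qed
      qed
    qed simp
    also have "\<dots> = ennreal (mu_const q) * ennreal P"
      unfolding P_def using x k by (subst nn_integral_exp_Icc[symmetric]) (auto intro!: nn_integral_cmult)
    finally show ?thesis unfolding ennreal_mult[OF less_imp_le[OF c] mono] .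
  qed
  also have "ennreal (exp (a * x)) * ((\<integral>\<^sup>+z\<in>{..0}. ennreal (exp (a * z)) \<partial>mu q) + ennreal (mu_const q * P))
    = ennreal (exp (a * x) * (mu_neg q a + mu_const q * P))"
    using c mono mu_neg_bounds[OF q a(1)] unfolding mu_neg[OF q a(1)]
    by (subst ennreal_plus[symmetric]) (auto intro!: mult_nonneg_nonneg simp: ennreal_mult[symmetric] simp del: ennreal_plus)
  also have "exp (a * x) * (mu_neg q a + mu_const q * P)
    = exp (a * x) * mu_neg q a + mu_const q * (exp (kappa q * x) - exp (a * x)) / (a - kappa q)"
  proof -
    have "exp (a * x) * exp (k * (- x)) = exp (kappa q * x)" by (simp add: k_def exp_add[symmetric] algebra_simps)
    then show ?thesis unfolding k_def[symmetric] P_def by (simp add: distrib_left right_diff_distrib mult.left_commute)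
  qed
  finally show ?thesis .
qed

text \<open>For \<open>a < kappa q\<close> this follows by subtracting the positive half-line from the full transform. For \<open>a > kappa q\<close> the
full transform is infinite. First passage still shows that the killed resolvent maps the exponential \<open>a\<close> to \<open>B\<close> times
a difference of two exponentials, with \<open>B\<close> containing the unknown transform. At a larger rate \<open>q2\<close>
both exponentials fall under the first case, and the resolvent equation between \<open>q\<close> and \<open>q2\<close> is a linear equation
for \<open>B\<close>.\<close>

theorem mu_neg_eq:
  assumes q: "0 < q" and a: "0 \<le> a" "a \<noteq> kappa q"
  shows "mu_neg q a = 1 / (q - psi a) + mu_const q / (a - kappa q)"
proof (cases "a < kappa q")
  case True
  have lt: "psi a < q" using psi_less_iff[OF q a(1)] True by simp
  have "ennreal (1 / (q - psi a)) = ennreal (mu_neg q a) + ennreal (mu_const q / (kappa q - a))"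
    using mu_split_at_0[of "\<lambda>z. ennreal (exp (a * z))" q] lt
    by (simp add: mu_exp_eq[OF q a(1)] mu_neg[OF q a(1)] mu_positive_exp[OF q True])
  also have "\<dots> = ennreal (mu_neg q a + mu_const q / (kappa q - a))"
    using mu_neg_bounds[OF q a(1)] mu_const_pos[OF q] True by (subst ennreal_plus) auto
  finally have "1 / (q - psi a) = mu_neg q a + mu_const q / (kappa q - a)"
    using lt mu_neg_bounds[OF q a(1)] mu_const_pos[OF q] True by (subst (asm) ennreal_inj) (auto intro!: add_nonneg_nonneg)
  moreover have "mu_const q / (kappa q - a) = - (mu_const q / (a - kappa q))"
    by (metis minus_diff_eq minus_divide_right)
  ultimately show ?thesis by simp
next
  case False
  then have gt: "kappa q < a" using a by simp
  then have A: "q < psi a" by (rule psi_greater[OF q])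
  \<comment> \<open>any rate above \<open>psi a\<close> would do\<close>
  define q2 where "q2 = psi a + 1"
  have q2: "0 < q2" "q < q2" "psi a < q2" using A q by (auto simp: q2_def)
  have a2: "a < kappa q2" using psi_less_iff[OF q2(1) a(1)] q2 by simp
  define B where "B = mu_const q / (a - kappa q) - mu_neg q a"
  have K: "potential (unhit_weight q) (\<lambda>z. ennreal (exp (a * z))) x = ennreal (B * (exp (kappa q * x) - exp (a * x)))" if x: "x \<le> 0" for x
  proof -
    let ?\<phi> = "\<lambda>z. ennreal (exp (a * z)) * indicator {..0} z"
    have "exp (a * x) \<le> exp (kappa q * x)" using gt x by (simp add: mult_right_mono_neg)
    have U0: "potential (free_weight q) ?\<phi> 0 = ennreal (mu_neg q a)"
      using free_exp_below[OF q a order_refl] by simp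
    have "potential (unhit_weight q) (\<lambda>z. ennreal (exp (a * z))) x = potential (unhit_weight q) ?\<phi> x"
      by (rule unhit_potential_cong) simp
    also have "\<dots> = potential (free_weight q) ?\<phi> x - ennreal (exp (kappa q * x)) * ennreal (mu_neg q a)"
      using free_potential_first_passage[OF q x, of ?\<phi>] unfolding U0 by (simp add: ennreal_mult_eq_top_iff)
    also have "\<dots> = ennreal (exp (a * x) * mu_neg q a + mu_const q * (exp (kappa q * x) - exp (a * x)) / (a - kappa q) - exp (kappa q * x) * mu_neg q a)"
      unfolding free_exp_below[OF q a x] using mu_neg_bounds[OF q a(1)] by (simp add: ennreal_mult[symmetric] ennreal_minus)
    also have "exp (a * x) * mu_neg q a + mu_const q * (exp (kappa q * x) - exp (a * x)) / (a - kappa q) - exp (kappa q * x) * mu_neg q a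
      = B * (exp (kappa q * x) - exp (a * x))"
    proof -
      define D where "D = mu_const q / (a - kappa q)"
      have e: "mu_const q * y / (a - kappa q) = D * y" for y by (simp add: D_def)
      show ?thesis unfolding e B_def D_def[symmetric] by (simp add: algebra_simps)
    qed
    finally show ?thesis .
  qed
  have K2: "potential (unhit_weight q2) (\<lambda>z. ennreal (exp (b * z))) (- 1) = ennreal ((exp (- b) - exp (- kappa q2)) / (q2 - psi b))"
    if "0 \<le> b" "b < kappa q2" for b
    using unhit_exp_small[OF q2(1) that, of "- 1"] by simp
  have Kc: "potential (unhit_weight q2) (\<lambda>z. ennreal c * ennreal (exp (b * z))) (- 1) = ennreal (c * ((exp (- b) - exp (- kappa q2)) / (q2 - psi b)))"
    if "0 \<le> b" "b < kappa q2" "0 \<le> c" for b c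
  proof -
    have "potential (unhit_weight q2) (\<lambda>z. ennreal c * ennreal (exp (b * z))) (- 1)
      = ennreal c * ennreal ((exp (- b) - exp (- kappa q2)) / (q2 - psi b))"
      unfolding K2[OF that(1,2), symmetric] by (rule potential_cmult[OF weights_measurable(3)]) simp
    then show ?thesis using that psi_less_iff[OF q2(1) that(1)] by (simp add: ennreal_mult[symmetric])
  qed
  have klt: "kappa q < kappa q2" using gt a2 by simp
  have k0: "0 \<le> kappa q" using kappa_pos[OF q] by simp
  define d where "d = q2 - q"
  have d: "0 < d" using q2 by (simp add: d_def)
  \<comment> \<open>only \<open>B \<ge> 0\<close> is meaningful for extended nonnegative potentials; the equation derived below excludes \<open>B < 0\<close>\<close>
  define B' where "B' = max 0 B"
  have B': "0 \<le> B'" by (simp add: B'_def)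
  have Keq: "potential (unhit_weight q) (\<lambda>z. ennreal (exp (a * z))) y = ennreal (B' * (exp (kappa q * y) - exp (a * y)))" if y: "y \<le> 0" for y
  proof (cases "0 \<le> B")
    case False
    have "exp (a * y) \<le> exp (kappa q * y)" using gt y by (simp add: mult_right_mono_neg)
    then have "B * (exp (kappa q * y) - exp (a * y)) \<le> 0" using False by (intro mult_nonpos_nonneg) auto
    then show ?thesis using K[OF y] False by (simp add: B'_def ennreal_neg)
  qed (simp add: K[OF y] B'_def)
  define Ka where "Ka = (exp (- a) - exp (- kappa q2)) / (q2 - psi a)"
  define Kk where "Kk = (exp (- kappa q) - exp (- kappa q2)) / d"
  have Ka: "0 \<le> Ka" using a2 q2 by (auto simp: Ka_def)
  have Kk: "0 \<le> Kk" using klt d by (auto simp: Kk_def)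
  have add: "potential (unhit_weight q2) (\<lambda>y. ennreal d * potential (unhit_weight q) (\<lambda>z. ennreal (exp (a * z))) y) (- 1)
      + ennreal (d * B' * Ka) = ennreal (d * B' * Kk)"
  proof -
    have "potential (unhit_weight q2) (\<lambda>y. ennreal d * potential (unhit_weight q) (\<lambda>z. ennreal (exp (a * z))) y) (- 1)
      + ennreal (d * B' * Ka)
      = potential (unhit_weight q2) (\<lambda>y. ennreal d * potential (unhit_weight q) (\<lambda>z. ennreal (exp (a * z))) y + ennreal (d * B') * ennreal (exp (a * y))) (- 1)"
      using Kc[OF a(1) a2, of "d * B'"] d B' unfolding Ka_def[symmetric]
      by (subst potential_add) (auto simp: weights_measurable intro!: borel_measurable_times_ennreal measurable_potential)
    also have "\<dots> = potential (unhit_weight q2) (\<lambda>y. ennreal (d * B') * ennreal (exp (kappa q * y))) (- 1)"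
    proof (rule unhit_potential_cong)
      fix y :: real assume y: "y \<le> 0"
      have le: "exp (a * y) \<le> exp (kappa q * y)" using gt y by (simp add: mult_right_mono_neg)
      have "ennreal d * ennreal (B' * (exp (kappa q * y) - exp (a * y))) + ennreal (d * B') * ennreal (exp (a * y))
        = ennreal (d * (B' * (exp (kappa q * y) - exp (a * y))) + d * B' * exp (a * y))"
        using d B' le by (simp add: ennreal_mult[symmetric] ennreal_plus[symmetric] del: ennreal_plus)
      also have "d * (B' * (exp (kappa q * y) - exp (a * y))) + d * B' * exp (a * y) = d * B' * exp (kappa q * y)"
        by (simp add: algebra_simps)
      finally show "ennreal d * potential (unhit_weight q) (\<lambda>z. ennreal (exp (a * z))) y + ennreal (d * B') * ennreal (exp (a * y))
        = ennreal (d * B') * ennreal (exp (kappa q * y))"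
        unfolding Keq[OF y] using d B' by (simp add: ennreal_mult)
    qed
    also have "\<dots> = ennreal (d * B' * Kk)"
      using Kc[OF k0 klt, of "d * B'"] d B' by (simp add: psi_kappa[OF q] Kk_def d_def)
    finally show ?thesis .
  qed
  have "ennreal (B' * (exp (- kappa q) - exp (- a))) = ennreal Ka
      + potential (unhit_weight q2) (\<lambda>y. ennreal d * potential (unhit_weight q) (\<lambda>z. ennreal (exp (a * z))) y) (- 1)"
    using unhit_resolvent[OF q q2(2), of "\<lambda>z. ennreal (exp (a * z))" "- 1"] Keq[of "- 1"] K2[OF a(1) a2]
    by (simp add: d_def[symmetric] Ka_def)
  then have "ennreal (B' * (exp (- kappa q) - exp (- a))) + ennreal (d * B' * Ka) = ennreal Ka + ennreal (d * B' * Kk)"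
    unfolding add[symmetric] by (simp add: add.assoc)
  then have "ennreal (B' * (exp (- kappa q) - exp (- a)) + d * B' * Ka) = ennreal (Ka + d * B' * Kk)"
    using gt B' d Ka Kk by (simp add: ennreal_plus)
  then have E: "B' * (exp (- kappa q) - exp (- a)) + d * B' * Ka = Ka + d * B' * Kk"
    using gt B' d Ka Kk by (subst (asm) ennreal_inj) (auto intro!: add_nonneg_nonneg)
  define w where "w = exp (- a) - exp (- kappa q2)"
  have w: "0 < w" using a2 by (simp add: w_def)
  have "d * B' * Kk = B' * (exp (- kappa q) - exp (- kappa q2))" using d by (simp add: Kk_def)
  then have "d * B' * Ka = Ka + B' * w" using E by (simp add: w_def algebra_simps)
  moreover have "Ka = w / (q2 - psi a)" by (simp add: Ka_def w_def)
  ultimately have "d * B' * (w / (q2 - psi a)) = w / (q2 - psi a) + B' * w" by simp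
  then have "d * B' * w = w + B' * w * (q2 - psi a)" using q2(3) by (simp add: field_simps)
  then have "w * (B' * (psi a - q) - 1) = 0" by (simp add: d_def algebra_simps)
  then have "B' * (psi a - q) = 1" using w by simp
  then have Bv: "B' = 1 / (psi a - q)" using A by (simp add: field_simps)
  then have "0 < B'" using A by simp
  then have "B = 1 / (psi a - q)" using Bv by (simp add: B'_def max_def split: if_splits)
  moreover have "1 / (q - psi a) = - (1 / (psi a - q))" by (metis minus_diff_eq minus_divide_right)
  ultimately show ?thesis by (simp add: B_def)
qed

end

section \<open>Resolvents and scale functions\<close>

lemma set_integral_eq_nn_integral:
  fixes f :: "real \<Rightarrow> real"
  assumes "f \<in> borel_measurable borel" "A \<in> sets borel" "\<And>x. x \<in> A \<Longrightarrow> 0 \<le> f x"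
  shows "(LBINT x:A. f x) = enn2real (\<integral>\<^sup>+x\<in>A. ennreal (f x) \<partial>lborel)"
proof -
  have "(LBINT x:A. f x) = enn2real (\<integral>\<^sup>+x. ennreal (indicator A x *\<^sub>R f x) \<partial>lborel)"
    unfolding set_lebesgue_integral_def using assms
    by (intro integral_eq_nn_integral) (auto simp: indicator_def)
  also have "(\<integral>\<^sup>+x. ennreal (indicator A x *\<^sub>R f x) \<partial>lborel) = (\<integral>\<^sup>+x\<in>A. ennreal (f x) \<partial>lborel)"
    by (intro nn_integral_cong) (auto simp: indicator_def)
  finally show ?thesis .
qed

lemma set_integral_exp_Icc:
  fixes k :: real assumes "k \<noteq> 0" "0 \<le> x"
  shows "(LBINT y:{0..x}. exp (k * y)) = (exp (k * x) - 1) / k"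
proof -
  have "0 \<le> (exp (k * x) - exp (k * 0)) / k"
  proof (cases "0 < k")
    case False then show ?thesis using assms by (intro divide_nonpos_neg) (auto simp: mult_nonpos_nonneg)
  qed (use assms in auto)
  then show ?thesis
    using nn_integral_exp_Icc[OF assms] by (subst set_integral_eq_nn_integral) simp_all
qed

context spectrally_negative_levy
begin

lemma scale_function_nonneg: "is_scale_function psi q w \<Longrightarrow> 0 \<le> w x"
  unfolding is_scale_function_def by (cases "0 \<le> x") auto

lemma scale_function_measurable:
  assumes q: "0 < q" and w: "is_scale_function psi q w" shows "w \<in> borel_measurable borel"
proof -
  define b where "b = kappa q + 1"
  have b_gt: "kappa q < b" by (simp add: b_def)
  have "set_integrable lborel {0..} (\<lambda>x. exp (- b * x) * w x)"
    using w b_gt unfolding is_scale_function_def right_inverse_psi[OF q] by blast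
  then have "(\<lambda>x. indicator {0..} x *\<^sub>R (exp (- b * x) * w x)) \<in> borel_measurable borel"
    unfolding set_integrable_def by (auto dest: borel_measurable_integrable)
  then have "(\<lambda>x. exp (b * x) * (indicator {0..} x *\<^sub>R (exp (- b * x) * w x))) \<in> borel_measurable borel"
    by measurable
  also have "(\<lambda>x. exp (b * x) * (indicator {0..} x *\<^sub>R (exp (- b * x) * w x))) = w"
  proof
    fix x
    have "exp (b * x) * exp (- b * x) = 1" by (simp add: exp_add[symmetric])
    moreover have "x < 0 \<Longrightarrow> w x = 0" using w by (simp add: is_scale_function_def)
    ultimately show "exp (b * x) * (indicator {0..} x *\<^sub>R (exp (- b * x) * w x)) = w x"
      by (cases "0 \<le> x") (auto simp: mult.assoc[symmetric])
  qed
  finally show ?thesis .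
qed

lemma scale_function_laplace:
  assumes q: "0 < q" and w: "is_scale_function psi q w" and b: "kappa q < b"
  shows "(\<integral>\<^sup>+y\<in>{0..}. ennreal (exp (- b * y) * w y) \<partial>lborel) = ennreal (1 / (psi b - q))"
proof -
  note [measurable] = scale_function_measurable[OF q w]
  have int: "set_integrable lborel {0..} (\<lambda>y. exp (- b * y) * w y)"
    and val: "(LBINT y:{0..}. exp (- b * y) * w y) = 1 / (psi b - q)"
    using w b unfolding is_scale_function_def by (auto simp: right_inverse_psi[OF q])
  have "(\<integral>\<^sup>+y\<in>{0..}. ennreal (exp (- b * y) * w y) \<partial>lborel) = (\<integral>\<^sup>+y. ennreal (indicator {0..} y *\<^sub>R (exp (- b * y) * w y)) \<partial>lborel)"
    by (intro nn_integral_cong) (auto simp: indicator_def)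
  also have "\<dots> = ennreal (LBINT y:{0..}. exp (- b * y) * w y)"
    unfolding set_lebesgue_integral_def
    using int scale_function_nonneg[OF w] by (intro nn_integral_eq_integral) (auto simp: set_integrable_def)
  finally show ?thesis unfolding val .
qed

text \<open>The identity says that the reflected resolvent measure on \<open>[0,x]\<close>, the scale function, and the
exponential of rate \<open>kappa q\<close> are linearly related. Their Laplace transforms are known from \<open>mu_neg_eq\<close>, from the definition
of the scale function and explicitly. After tilting by \<open>exp (b z)\<close> and the substitution \<open>exp z\<close> the transforms at
\<open>b + n\<close> become moments of finite measures on the unit interval, which determine them.\<close>

theorem mu_scale_function:
  assumes q: "0 < q" and w: "is_scale_function psi q w" and x: "0 \<le> x"
  shows "enn2real (\<integral>\<^sup>+z\<in>{- x..0}. ennreal (exp (a * z)) \<partial>mu q) + (LBINT y:{0..x}. exp (- a * y) * w y)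
    = mu_const q * (LBINT y:{0..x}. exp ((kappa q - a) * y))"
proof -
  note [measurable] = scale_function_measurable[OF q w]
  note w0 = scale_function_nonneg[OF w]
  note c = mu_const_pos[OF q] and k = kappa_pos[OF q]
  define b where "b = kappa q + 1"
  define v where "v = exp (- x)"
  have v: "0 < v" "v \<le> 1" using x by (auto simp: v_def)
  \<comment> \<open>the factor \<open>exp ((a - b) z)\<close> in the variable \<open>u = exp z\<close>, made continuous by cutting at \<open>v = exp (- x)\<close>\<close>
  define h where "h u = exp ((a - b) * ln (max u v))" for u
  \<comment> \<open>continuous approximations from above of the indicator of \<open>{v..}\<close>\<close>
  define g where "g n u = h u * max 0 (min 1 (1 + real n * (u - v)))" for n u
  define G where "G u = h u * (if v \<le> u then 1 else 0)" for u
  define N1 where "N1 = density (mu q) (\<lambda>z. ennreal (exp (b * z)) * indicator {..0} z)"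
  define N2 where "N2 = density lborel (\<lambda>y. ennreal (exp (- b * y) * w y) * indicator {0..} y)"
  define N3 where "N3 = density lborel (\<lambda>y. ennreal (mu_const q * exp (- y)) * indicator {0..} y)"
  have I1: "(\<integral>z. F (exp z) \<partial>N1) = enn2real (\<integral>\<^sup>+z\<in>{..0}. ennreal (exp (b * z) * F (exp z)) \<partial>mu q)"
    if [measurable]: "F \<in> borel_measurable borel" and F: "\<And>u. 0 \<le> F u" for F
  proof -
    have "(\<integral>z. F (exp z) \<partial>N1) = enn2real (\<integral>\<^sup>+z. ennreal (F (exp z)) \<partial>N1)"
      using F by (intro integral_eq_nn_integral) (auto simp: N1_def)
    also have "(\<integral>\<^sup>+z. ennreal (F (exp z)) \<partial>N1) = (\<integral>\<^sup>+z\<in>{..0}. ennreal (exp (b * z) * F (exp z)) \<partial>mu q)"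
      unfolding N1_def using F by (subst nn_integral_density) (auto intro!: nn_integral_cong simp: ennreal_mult mult_ac)
    finally show ?thesis .
  qed
  have I2: "(\<integral>y. F (exp (- y)) \<partial>N2) = enn2real (\<integral>\<^sup>+y\<in>{0..}. ennreal (exp (- b * y) * w y * F (exp (- y))) \<partial>lborel)"
    if [measurable]: "F \<in> borel_measurable borel" and F: "\<And>u. 0 \<le> F u" for F
  proof -
    have "(\<integral>y. F (exp (- y)) \<partial>N2) = enn2real (\<integral>\<^sup>+y. ennreal (F (exp (- y))) \<partial>N2)"
      using F by (intro integral_eq_nn_integral) (auto simp: N2_def)
    also have "(\<integral>\<^sup>+y. ennreal (F (exp (- y))) \<partial>N2) = (\<integral>\<^sup>+y\<in>{0..}. ennreal (exp (- b * y) * w y * F (exp (- y))) \<partial>lborel)"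
      unfolding N2_def using F w0 by (subst nn_integral_density) (auto intro!: nn_integral_cong simp: ennreal_mult mult_ac)
    finally show ?thesis .
  qed
  have I3: "(\<integral>y. F (exp (- y)) \<partial>N3) = enn2real (\<integral>\<^sup>+y\<in>{0..}. ennreal (mu_const q * exp (- y) * F (exp (- y))) \<partial>lborel)"
    if [measurable]: "F \<in> borel_measurable borel" and F: "\<And>u. 0 \<le> F u" for F
  proof -
    have "(\<integral>y. F (exp (- y)) \<partial>N3) = enn2real (\<integral>\<^sup>+y. ennreal (F (exp (- y))) \<partial>N3)"
      using F by (intro integral_eq_nn_integral) (auto simp: N3_def)
    also have "(\<integral>\<^sup>+y. ennreal (F (exp (- y))) \<partial>N3) = (\<integral>\<^sup>+y\<in>{0..}. ennreal (mu_const q * exp (- y) * F (exp (- y))) \<partial>lborel)"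
      unfolding N3_def using F c by (subst nn_integral_density) (auto intro!: nn_integral_cong simp: ennreal_mult mult_ac)
    finally show ?thesis .
  qed
  have m1: "(\<integral>\<^sup>+z\<in>{..0}. ennreal (exp (b * z) * exp z ^ n) \<partial>mu q) = ennreal (mu_neg q (b + real n))" for n
    using k mu_neg[OF q, of "b + real n"] by (simp add: b_def exp_add exp_of_nat_mult distrib_right)
  have m2: "(\<integral>\<^sup>+y\<in>{0..}. ennreal (exp (- b * y) * w y * exp (- y) ^ n) \<partial>lborel) = ennreal (1 / (psi (b + real n) - q))" for n
  proof -
    have eq: "exp (- b * y) * w y * exp (- y) ^ n = exp (- (b + real n) * y) * w y" for y
    proof -
      have "exp (- y) ^ n = exp (real n * - y)" by (simp only: exp_of_nat_mult)
      moreover have "exp (- b * y) * exp (real n * - y) = exp (- (b + real n) * y)"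
        by (simp only: exp_add[symmetric]) (simp add: algebra_simps)
      ultimately show ?thesis by (simp only: mult_ac)
    qed
    show ?thesis unfolding eq by (rule scale_function_laplace[OF q w]) (simp add: b_def)
  qed
  have m3: "(\<integral>\<^sup>+y\<in>{0..}. ennreal (mu_const q * exp (- y) * exp (- y) ^ n) \<partial>lborel) = ennreal (mu_const q / (1 + real n))" for n
  proof -
    have "(\<integral>\<^sup>+y\<in>{0..}. ennreal (mu_const q * exp (- y) * exp (- y) ^ n) \<partial>lborel)
      = (\<integral>\<^sup>+y. ennreal (mu_const q) * (ennreal (exp (- (1 + real n) * y)) * indicator {0..} y) \<partial>lborel)"
    proof (rule nn_integral_cong)
      fix y
      have "exp (- y) ^ n = exp (real n * - y)" by (simp only: exp_of_nat_mult)
      moreover have "exp (- y) * exp (real n * - y) = exp (- (1 + real n) * y)"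
        by (simp only: exp_add[symmetric]) (simp add: algebra_simps)
      ultimately have "mu_const q * exp (- y) * exp (- y) ^ n = mu_const q * exp (- (1 + real n) * y)"
        by (simp only: mult.assoc)
      then show "ennreal (mu_const q * exp (- y) * exp (- y) ^ n) * indicator {0..} y
        = ennreal (mu_const q) * (ennreal (exp (- (1 + real n) * y)) * indicator {0..} y)"
        using c by (simp only: ennreal_mult[OF less_imp_le[OF c] exp_ge_zero] mult.assoc)
    qed
    also have "\<dots> = ennreal (mu_const q) * ennreal (exp (- (1 + real n) * 0) / (1 + real n))"
      by (subst nn_integral_exp_atLeast[symmetric]) (auto intro!: nn_integral_cmult)
    finally show ?thesis using c by (simp add: ennreal_mult[symmetric])
  qed
  have N1: "finite_measure N1" "exp \<in> borel_measurable N1" "AE z in N1. exp z \<in> {0..1::real}"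
  proof -
    show "finite_measure N1"
      using m1[of 0] by (intro finite_measureI) (simp add: N1_def emeasure_density)
    show "exp \<in> borel_measurable N1" by (simp add: N1_def)
    show "AE z in N1. exp z \<in> {0..1::real}" unfolding N1_def
      by (subst AE_density) (auto simp: indicator_def)
  qed
  have N2: "finite_measure N2" "(\<lambda>y. exp (- y)) \<in> borel_measurable N2" "AE y in N2. exp (- y) \<in> {0..1::real}"
  proof -
    show "finite_measure N2"
      using m2[of 0] by (intro finite_measureI) (simp add: N2_def emeasure_density)
    show "(\<lambda>y. exp (- y)) \<in> borel_measurable N2" by (simp add: N2_def)
    show "AE y in N2. exp (- y) \<in> {0..1::real}" unfolding N2_def
      by (subst AE_density) (auto simp: indicator_def)
  qed
  have N3: "finite_measure N3" "(\<lambda>y. exp (- y)) \<in> borel_measurable N3" "AE y in N3. exp (- y) \<in> {0..1::real}"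
  proof -
    show "finite_measure N3"
      using m3[of 0] by (intro finite_measureI) (simp add: N3_def emeasure_density)
    show "(\<lambda>y. exp (- y)) \<in> borel_measurable N3" by (simp add: N3_def)
    show "AE y in N3. exp (- y) \<in> {0..1::real}" unfolding N3_def
      by (subst AE_density) (auto simp: indicator_def)
  qed
  have moments: "(\<integral>z. exp z ^ n \<partial>N1) + (\<integral>y. exp (- y) ^ n \<partial>N2) = (\<integral>y. exp (- y) ^ n \<partial>N3)" for n
  proof -
    define b' where "b' = b + real n"
    define F where "F u = max 0 u ^ n" for u :: real
    have "F \<in> borel_measurable borel" unfolding F_def by measurable
    then have F: "F \<in> borel_measurable borel" "\<And>u. 0 \<le> F u" "\<And>u. F (exp u) = exp u ^ n" by (auto simp: F_def)
    have b': "kappa q < b'" "0 \<le> b'" using k by (auto simp: b'_def b_def)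
    have "0 < psi b' - q" using psi_greater[OF q b'(1)] by simp
    have bk: "b' - kappa q = 1 + real n" by (simp add: b'_def b_def)
    have "(\<integral>z. exp z ^ n \<partial>N1) = mu_neg q b'"
      using I1[OF F(1,2)] mu_neg_bounds[OF q b'(2)] unfolding F(3) m1 b'_def[symmetric] by simp
    moreover have "(\<integral>y. exp (- y) ^ n \<partial>N2) = 1 / (psi b' - q)"
      using I2[OF F(1,2)] \<open>0 < psi b' - q\<close> unfolding F(3) m2 b'_def[symmetric] by simp
    moreover have "(\<integral>y. exp (- y) ^ n \<partial>N3) = mu_const q / (b' - kappa q)"
      using I3[OF F(1,2)] c unfolding F(3) m3 bk by simp
    moreover have "mu_neg q b' = 1 / (q - psi b') + mu_const q / (b' - kappa q)"
      using b' by (intro mu_neg_eq[OF q]) auto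
    moreover have "1 / (q - psi b') = - (1 / (psi b' - q))" by (metis minus_diff_eq minus_divide_right)
    ultimately show ?thesis by simp
  qed
  have "0 < max u v" for u using v by (simp add: less_max_iff_disj)
  then have "max u v \<noteq> 0" for u by (metis less_irrefl)
  then have hc: "continuous_on UNIV h" unfolding h_def by (intro continuous_intros) blast
  have h0: "0 \<le> h u" for u by (simp add: h_def)
  have eqG: "(\<integral>z. G (exp z) \<partial>N1) + (\<integral>y. G (exp (- y)) \<partial>N2) = (\<integral>y. G (exp (- y)) \<partial>N3)"
  proof (rule integral_limit_eq_of_moments[OF N1 N2 N3 moments])
    show "continuous_on UNIV (g n)" for n unfolding g_def by (intro continuous_intros hc)
    show "\<bar>g n u\<bar> \<le> exp (\<bar>a - b\<bar> * x)" if u: "u \<in> {0..1}" for n u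
    proof -
      have mv: "v \<le> max u v" "max u v \<le> 1" using u v by auto
      then have "ln v \<le> ln (max u v)" "ln (max u v) \<le> ln 1" using v by (auto intro!: ln_mono simp del: ln_one)
      then have "- x \<le> ln (max u v)" "ln (max u v) \<le> 0" by (simp_all add: v_def)
      then have "\<bar>ln (max u v)\<bar> \<le> x" by simp
      then have "\<bar>(a - b) * ln (max u v)\<bar> \<le> \<bar>a - b\<bar> * x" unfolding abs_mult by (intro mult_left_mono) auto
      then have "h u \<le> exp (\<bar>a - b\<bar> * x)" unfolding h_def by (subst exp_le_cancel_iff) linarith
      moreover have "\<bar>g n u\<bar> \<le> h u * 1" unfolding g_def abs_mult using h0[of u] by (intro mult_mono) auto
      ultimately show ?thesis by linarith
    qed
    show "(\<lambda>n. g n u) \<longlonglongrightarrow> G u" for u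
    proof (cases "v \<le> u")
      case True
      then show ?thesis by (simp add: g_def G_def)
    next
      case False
      obtain N :: nat where N: "1 < real N * (v - u)" using False ex_less_of_nat_mult[of "v - u" 1] by auto
      have "\<forall>\<^sub>F n in sequentially. g n u = G u"
      proof (rule eventually_sequentiallyI)
        fix n assume "N \<le> n"
        then have "real N * (v - u) \<le> real n * (v - u)" using False by (intro mult_right_mono) auto
        then have "1 + real n * (u - v) \<le> 0" using N by (simp add: algebra_simps)
        then show "g n u = G u" using False by (simp add: g_def G_def)
      qed
      then show ?thesis by (rule tendsto_eventually)
    qed
  qed
  have G: "G \<in> borel_measurable borel" "\<And>u. 0 \<le> G u"
    unfolding G_def using h0 borel_measurable_continuous_onI[OF hc] by auto
  have G_exp: "G (exp z) = (if - x \<le> z then exp ((a - b) * z) else 0)" for z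
  proof (cases "- x \<le> z")
    case True
    then have "max (exp z) v = exp z" by (simp add: v_def)
    then show ?thesis using True by (simp add: G_def h_def v_def)
  qed (simp add: G_def v_def)
  have "enn2real (\<integral>\<^sup>+z\<in>{..0}. ennreal (exp (b * z) * G (exp z)) \<partial>mu q)
      + enn2real (\<integral>\<^sup>+y\<in>{0..}. ennreal (exp (- b * y) * w y * G (exp (- y))) \<partial>lborel)
      = enn2real (\<integral>\<^sup>+y\<in>{0..}. ennreal (mu_const q * exp (- y) * G (exp (- y))) \<partial>lborel)"
    using eqG unfolding I1[OF G] I2[OF G] I3[OF G] .
  moreover have "(\<integral>\<^sup>+z\<in>{..0}. ennreal (exp (b * z) * G (exp z)) \<partial>mu q) = (\<integral>\<^sup>+z\<in>{- x..0}. ennreal (exp (a * z)) \<partial>mu q)"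
    by (intro nn_integral_cong) (auto simp: indicator_def G_exp exp_add[symmetric] algebra_simps)
  moreover have "(\<integral>\<^sup>+y\<in>{0..}. ennreal (exp (- b * y) * w y * G (exp (- y))) \<partial>lborel) = (\<integral>\<^sup>+y\<in>{0..x}. ennreal (exp (- a * y) * w y) \<partial>lborel)"
  proof (rule nn_integral_cong)
    fix y
    have "exp (- b * y) * exp ((a - b) * - y) = exp (- a * y)" by (simp add: exp_add[symmetric] algebra_simps)
    then have "exp (- b * y) * w y * exp ((a - b) * - y) = exp (- a * y) * w y" by (metis mult.assoc mult.commute)
    then have eq: "exp (- b * y) * w y * exp ((a - b) * - y) = exp (- a * y) * w y" .
    show "ennreal (exp (- b * y) * w y * G (exp (- y))) * indicator {0..} y = ennreal (exp (- a * y) * w y) * indicator {0..x} y"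
    proof (cases "0 \<le> y \<and> y \<le> x")
      case True
      then have i: "indicator {0..} y = (1 :: ennreal)" "indicator {0..x} y = (1 :: ennreal)" by auto
      have "G (exp (- y)) = exp ((a - b) * - y)" using True unfolding G_exp by simp
      then show ?thesis unfolding i by (simp only: eq)
    next
      case False
      then show ?thesis by (cases "0 \<le> y") (simp_all add: G_exp)
    qed
  qed
  moreover have "(\<integral>\<^sup>+y\<in>{0..}. ennreal (mu_const q * exp (- y) * G (exp (- y))) \<partial>lborel) = (\<integral>\<^sup>+y\<in>{0..x}. ennreal (mu_const q * exp ((kappa q - a) * y)) \<partial>lborel)"
  proof (rule nn_integral_cong)
    fix y
    have "exp (- y) * exp ((a - b) * - y) = exp ((kappa q - a) * y)" by (simp add: exp_add[symmetric] b_def algebra_simps)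
    then have "mu_const q * exp (- y) * exp ((a - b) * - y) = mu_const q * exp ((kappa q - a) * y)" by (simp add: mult.assoc)
    then have eq: "mu_const q * exp (- y) * exp ((a - b) * - y) = mu_const q * exp ((kappa q - a) * y)" .
    show "ennreal (mu_const q * exp (- y) * G (exp (- y))) * indicator {0..} y = ennreal (mu_const q * exp ((kappa q - a) * y)) * indicator {0..x} y"
    proof (cases "0 \<le> y \<and> y \<le> x")
      case True
      then have i: "indicator {0..} y = (1 :: ennreal)" "indicator {0..x} y = (1 :: ennreal)" by auto
      have "G (exp (- y)) = exp ((a - b) * - y)" using True unfolding G_exp by simp
      then show ?thesis unfolding i by (simp only: eq)
    next
      case False
      then show ?thesis by (cases "0 \<le> y") (simp_all add: G_exp)
    qed
  qed
  moreover have "(LBINT y:{0..x}. exp (- a * y) * w y) = enn2real (\<integral>\<^sup>+y\<in>{0..x}. ennreal (exp (- a * y) * w y) \<partial>lborel)"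
    using w0 by (intro set_integral_eq_nn_integral) auto
  moreover have "(LBINT y:{0..x}. mu_const q * exp ((kappa q - a) * y)) = enn2real (\<integral>\<^sup>+y\<in>{0..x}. ennreal (mu_const q * exp ((kappa q - a) * y)) \<partial>lborel)"
    using c by (intro set_integral_eq_nn_integral) auto
  moreover have "(LBINT y:{0..x}. mu_const q * exp ((kappa q - a) * y)) = mu_const q * (LBINT y:{0..x}. exp ((kappa q - a) * y))"
    by (rule set_integral_mult_right)
  ultimately show ?thesis by simp
qed

text \<open>On the negative half-line an atom would make the sum of the distribution function and the integral of the scale
function jump, whereas that sum is continuous by \<open>mu_scale_function\<close>.\<close>

lemma mu_no_atoms:
  assumes q: "0 < q" and w: "is_scale_function psi q w"
  shows "emeasure (mu q) {z} = 0"
proof (cases "0 < z")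
  case True
  then show ?thesis by (rule mu_positive_null[OF q])
next
  case False
  interpret mu: finite_measure "mu q" using q by (rule finite_measure_mu)
  note c = mu_const_pos[OF q] and k = kappa_pos[OF q]
  note [measurable] = scale_function_measurable[OF q w]
  define x where "x = - z"
  have x: "0 \<le> x" using False by (simp add: x_def)
  define C where "C y = mu_const q * ((exp (kappa q * y) - 1) / kappa q)" for y
  have F: "measure (mu q) {- y..0} + (LBINT s:{0..y}. w s) = C y" if "0 \<le> y" for y
  proof -
    have 1: "enn2real (\<integral>\<^sup>+z\<in>{- y..0}. ennreal (exp (0 * z)) \<partial>mu q) = measure (mu q) {- y..0}"
      by (simp add: mu.emeasure_eq_measure)
    have 2: "(LBINT s:{0..y}. exp (- 0 * s) * w s) = (LBINT s:{0..y}. w s)" by simp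
    have 3: "(LBINT s:{0..y}. exp ((kappa q - 0) * s)) = (exp (kappa q * y) - 1) / kappa q"
      using set_integral_exp_Icc[of "kappa q" y] k that by simp
    show ?thesis using mu_scale_function[OF q w that, of 0] unfolding 1 2 3 C_def .
  qed
  have "measure (mu q) {z} \<le> 0"
  proof (cases "x = 0")
    case True
    moreover have "0 \<le> (LBINT s:{0..0}. w s)"
      unfolding set_lebesgue_integral_def using scale_function_nonneg[OF w] by (intro integral_nonneg_AE) auto
    ultimately show ?thesis using F[of 0] by (simp add: C_def x_def)
  next
    case False
    then have x: "0 < x" using x by simp
    have bd: "measure (mu q) {z} \<le> C x - C y" if y: "0 \<le> y" "y < x" for y
    proof -
      have "(LBINT s:{0..y}. w s) \<le> (LBINT s:{0..x}. w s)"
      proof -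
        define D where "D s = min (w s) (w x)" for s
        have D: "D \<in> borel_measurable borel" "\<And>s. 0 \<le> D s" "\<And>s. D s \<le> w x"
          using scale_function_nonneg[OF w] by (auto simp: D_def[abs_def])
        have "w s \<le> w x" if "0 \<le> s" "s \<le> x" for s
          using w that by (auto simp: is_scale_function_def mono_on_def)
        then have wD: "(LBINT s:{0..t}. w s) = (LBINT s:{0..t}. D s)" if "t \<le> x" for t
          using that by (intro set_lebesgue_integral_cong) (auto simp: D_def)
        show ?thesis
          using LBINT_Icc_split[OF D, of y x] LBINT_Icc_bounds(1)[OF D, of y x] y by (simp add: wD)
      qed
      moreover have "measure (mu q) ({z} \<union> {- y..0}) = measure (mu q) {z} + measure (mu q) {- y..0}"
        using y by (intro mu.finite_measure_Union) (auto simp: x_def)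
      moreover have "measure (mu q) ({z} \<union> {- y..0}) \<le> measure (mu q) {- x..0}"
        using y x by (intro mu.finite_measure_mono) (auto simp: x_def)
      ultimately show ?thesis using F[OF y(1)] F[of x] x by linarith
    qed
    have "isCont C x" unfolding C_def using k by (intro continuous_intros) auto
    then have "((\<lambda>y. C x - C y) \<longlongrightarrow> C x - C x) (at_left x)"
      by (intro tendsto_intros) (simp add: isCont_def filterlim_at_split)
    moreover have "\<forall>\<^sub>F y in at_left x. measure (mu q) {z} \<le> C x - C y"
      unfolding eventually_at_left[OF x] using bd x by (intro exI[of _ 0]) auto
    ultimately have "measure (mu q) {z} \<le> C x - C x" by (intro tendsto_lowerbound) auto
    then show ?thesis by simp
  qed
  then show ?thesis using measure_nonneg[of "mu q" "{z}"] by (simp add: mu.emeasure_eq_measure)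
qed

lemma exponent_quotient_eq:
  "0 < q \<Longrightarrow> a \<noteq> kappa q \<Longrightarrow> exponent_quotient psi q a = (q - psi a) / (kappa q - a)"
  by (simp add: exponent_quotient_def right_inverse_psi Let_def)

lemma exponent_quotient_mu_neg:
  assumes q: "0 < q" and a: "0 \<le> a" "a \<noteq> kappa q"
  shows "mu_const q * ((q - psi a) / (kappa q - a)) = 1 - (q - psi a) * mu_neg q a"
proof -
  have "q - psi a \<noteq> 0" using psi_less_iff[OF q a(1)] psi_greater[OF q, of a] a by (cases "a < kappa q") auto
  moreover have "mu_const q * ((q - psi a) / (kappa q - a)) = - ((q - psi a) * (mu_const q / (a - kappa q)))"
  proof -
    have "kappa q - a = - (a - kappa q)" by simp
    then show ?thesis by (simp only: divide_minus_right mult_minus_right times_divide_eq_right mult.commute)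
  qed
  ultimately show ?thesis unfolding mu_neg_eq[OF q a] by (simp add: distrib_left)
qed

text \<open>Near \<open>kappa q\<close> the transform \<open>mu_neg q\<close> stays bounded, so the formula for \<open>a \<noteq> kappa q\<close> has a limit.\<close>

lemma exponent_quotient_kappa:
  assumes q: "0 < q" shows "mu_const q * exponent_quotient psi q (kappa q) = 1"
proof -
  note c = mu_const_pos[OF q] and k = kappa_pos[OF q]
  let ?f = "\<lambda>z. (q - psi z) / (kappa q - z)"
  have near: "\<forall>\<^sub>F z in at (kappa q). 0 < z"
    using k by (intro order_tendstoD(1)[OF tendsto_ident_at])
  have "((\<lambda>z. (q - psi z) * mu_neg q z) \<longlongrightarrow> 0) (at (kappa q))"
  proof (rule Lim_null_comparison)
    show "\<forall>\<^sub>F z in at (kappa q). norm ((q - psi z) * mu_neg q z) \<le> \<bar>q - psi z\<bar> * (1 / q)"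
      using near
    proof eventually_elim
      case (elim z)
      then have "\<bar>mu_neg q z\<bar> \<le> 1 / q" using mu_neg_bounds[OF q, of z] by simp
      then show ?case unfolding real_norm_def abs_mult by (intro mult_left_mono) auto
    qed
    have "((\<lambda>z. \<bar>q - psi z\<bar> * (1 / q)) \<longlongrightarrow> \<bar>q - psi (kappa q)\<bar> * (1 / q)) (at (kappa q))"
      using isCont_psi[OF k] by (intro tendsto_intros) (simp_all add: isCont_def)
    then show "((\<lambda>z. \<bar>q - psi z\<bar> * (1 / q)) \<longlongrightarrow> 0) (at (kappa q))" by (simp add: psi_kappa[OF q])
  qed
  then have "((\<lambda>z. (1 - (q - psi z) * mu_neg q z) / mu_const q) \<longlongrightarrow> (1 - 0) / mu_const q) (at (kappa q))"
    using c by (intro tendsto_intros) auto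
  moreover have "\<forall>\<^sub>F z in at (kappa q). (1 - (q - psi z) * mu_neg q z) / mu_const q = ?f z"
  proof -
    have "\<forall>\<^sub>F z in at (kappa q). z \<noteq> kappa q" by (simp add: eventually_at_filter)
    with near show ?thesis
    proof eventually_elim
      case (elim z)
      then show ?case using exponent_quotient_mu_neg[OF q, of z] c by (simp add: field_simps)
    qed
  qed
  ultimately have "(?f \<longlongrightarrow> (1 - 0) / mu_const q) (at (kappa q))" by (rule Lim_transform_eventually)
  then have "Lim (at (kappa q)) ?f = (1 - 0) / mu_const q" by (intro tendsto_Lim) auto
  then show ?thesis using c by (simp add: exponent_quotient_def right_inverse_psi[OF q] Let_def)
qed

lemma mu_interval_finite: "0 < q \<Longrightarrow> (\<integral>\<^sup>+z\<in>{- x..0}. ennreal (exp (a * z)) \<partial>mu q) < top"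
proof -
  assume q: "0 < q"
  have "(\<integral>\<^sup>+z\<in>{- x..0}. ennreal (exp (a * z)) \<partial>mu q) \<le> (\<integral>\<^sup>+z. ennreal (exp (\<bar>a\<bar> * \<bar>x\<bar>)) \<partial>mu q)"
  proof (rule nn_integral_mono)
    fix z
    have "a * z \<le> \<bar>a\<bar> * \<bar>x\<bar>" if "- x \<le> z" "z \<le> 0"
    proof -
      have "a * z \<le> \<bar>a\<bar> * \<bar>z\<bar>" by (metis abs_ge_self abs_mult)
      also have "\<dots> \<le> \<bar>a\<bar> * \<bar>x\<bar>" using that by (intro mult_left_mono) auto
      finally show ?thesis .
    qed
    then show "ennreal (exp (a * z)) * indicator {- x..0} z \<le> ennreal (exp (\<bar>a\<bar> * \<bar>x\<bar>))"
      by (auto simp: indicator_def intro!: ennreal_leI)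
  qed
  also have "\<dots> < top" using q by (simp add: emeasure_mu_UNIV ennreal_mult_less_top)
  finally show ?thesis .
qed

definition potential_neg_exp :: "real \<Rightarrow> real \<Rightarrow> real \<Rightarrow> real" where
  "potential_neg_exp q a x = enn2real (potential (free_weight q) (\<lambda>z. ennreal (exp (a * z)) * indicator {..<0} z) x)"

text \<open>The integral over \<open>{..<- x}\<close> is the full transform on the negative half-line minus the part on \<open>{- x..0}\<close>, which the
scale function describes; the former is absorbed in the quotient \<open>exponent_quotient\<close>.\<close>

theorem potential_neg_exp_eq:
  assumes q: "0 < q" and W: "is_scale_function psi q (W q)" and a: "0 \<le> a" and x: "0 \<le> x"
  shows "(q - psi a) * potential_neg_exp q a x = scale_Z psi W q x a - mu_const q * exponent_quotient psi q a * exp (kappa q * x)"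
proof (cases "a = kappa q")
  case True
  then show ?thesis using x exponent_quotient_kappa[OF q] by (simp add: psi_kappa[OF q] scale_Z_def)
next
  case False
  define A where "A = (\<integral>\<^sup>+z\<in>{..<- x}. ennreal (exp (a * z)) \<partial>mu q)"
  define B where "B = (\<integral>\<^sup>+z\<in>{- x..0}. ennreal (exp (a * z)) \<partial>mu q)"
  have AB: "ennreal (mu_neg q a) = A + B"
    unfolding mu_neg[OF q a, symmetric] A_def B_def
    using x by (subst nn_integral_add[symmetric]) (auto intro!: nn_integral_cong simp: indicator_def)
  have "A + B < top" unfolding AB[symmetric] by simp
  then have fin: "A < top" "B < top"
    by (rule le_less_trans[OF add_increasing2[OF zero_le order_refl]], rule le_less_trans[OF add_increasing[OF zero_le order_refl]])
  have r: "mu_neg q a = enn2real A + enn2real B"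
    unfolding enn2real_plus[OF fin, symmetric] AB[symmetric] using mu_neg_bounds[OF q a] by simp
  have "potential (free_weight q) (\<lambda>z. ennreal (exp (a * z)) * indicator {..<0} z) x
    = (\<integral>\<^sup>+z. ennreal (exp (a * x)) * (ennreal (exp (a * z)) * indicator {..<- x} z) \<partial>mu q)"
    by (subst free_potential_eq) (auto simp: distrib_left exp_add ennreal_mult indicator_def mult.assoc intro!: nn_integral_cong)
  also have "\<dots> = ennreal (exp (a * x)) * A" unfolding A_def by (rule nn_integral_cmult) simp
  finally have V: "potential_neg_exp q a x = exp (a * x) * enn2real A"
    by (simp add: potential_neg_exp_def enn2real_mult)
  define I where "I = (LBINT y:{0..x}. exp (- a * y) * W q y)"
  have B: "enn2real B + I = mu_const q * ((exp ((kappa q - a) * x) - 1) / (kappa q - a))"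
    using mu_scale_function[OF q W x, of a] False x unfolding B_def I_def by (subst (asm) set_integral_exp_Icc) auto
  define e where "e = mu_const q * ((q - psi a) / (kappa q - a))"
  have e: "e = 1 - (q - psi a) * mu_neg q a" unfolding e_def by (rule exponent_quotient_mu_neg[OF q a False])
  have "(q - psi a) * enn2real B = e * (exp ((kappa q - a) * x) - 1) - (q - psi a) * I"
  proof -
    have "(q - psi a) * (enn2real B + I) = e * (exp ((kappa q - a) * x) - 1)" unfolding B e_def by simp
    then show ?thesis by (simp add: distrib_left)
  qed
  moreover have "e * (exp ((kappa q - a) * x) - 1) = e * exp ((kappa q - a) * x) - e"
    by (simp only: right_diff_distrib mult_1_right)
  moreover have "(q - psi a) * enn2real A = 1 - e - (q - psi a) * enn2real B"
    using e unfolding r distrib_left by linarith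
  ultimately have "(q - psi a) * enn2real A = 1 + (q - psi a) * I - e * exp ((kappa q - a) * x)"
    by linarith
  then have "(q - psi a) * potential_neg_exp q a x = exp (a * x) * (1 + (q - psi a) * I - e * exp ((kappa q - a) * x))"
    unfolding V by (simp only: mult.left_commute)
  also have "\<dots> = exp (a * x) * (1 + (q - psi a) * I) - e * exp (kappa q * x)"
  proof -
    have "exp (a * x) * exp ((kappa q - a) * x) = exp (kappa q * x)" by (simp add: exp_add[symmetric] algebra_simps)
    then show ?thesis by (simp add: right_diff_distrib mult.left_commute)
  qed
  finally show ?thesis
    using x by (simp add: scale_Z_def I_def e_def exponent_quotient_eq[OF q False])
qed

text \<open>The part of the resolvent measure on \<open>{- x..0}\<close> is given by the scale function, the rest is exponential.\<close>

lemma potential_pos_exp_eq: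
  assumes q: "0 < q" and w: "is_scale_function psi q w" and \<theta>: "0 < \<theta>" and x: "0 \<le> x"
  shows "enn2real (potential (free_weight q) (\<lambda>z. ennreal (exp (- \<theta> * z)) * indicator {0..} z) x)
    = mu_const q * exp (kappa q * x) / (\<theta> + kappa q) - (LBINT y:{0..x}. exp (- \<theta> * y) * w (x - y))"
proof -
  note c = mu_const_pos[OF q] and k = kappa_pos[OF q]
  define B where "B = (\<integral>\<^sup>+z\<in>{- x..0}. ennreal (exp (- \<theta> * z)) \<partial>mu q)"
  define C where "C = (\<integral>\<^sup>+z\<in>{0<..}. ennreal (exp (- \<theta> * z)) \<partial>mu q)"
  have Bf: "B < top" unfolding B_def by (rule mu_interval_finite[OF q])
  have C: "C = ennreal (mu_const q / (kappa q + \<theta>))"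
    unfolding C_def using mu_positive_exp[OF q, of "- \<theta>"] \<theta> k by simp
  have "potential (free_weight q) (\<lambda>z. ennreal (exp (- \<theta> * z)) * indicator {0..} z) x
    = (\<integral>\<^sup>+z. ennreal (exp (- \<theta> * x)) * (ennreal (exp (- \<theta> * z)) * indicator {- x..} z) \<partial>mu q)"
    by (subst free_potential_eq) (auto simp: ennreal_mult[symmetric] exp_add[symmetric] distrib_left indicator_def intro!: nn_integral_cong)
  also have "\<dots> = ennreal (exp (- \<theta> * x)) * (\<integral>\<^sup>+z. ennreal (exp (- \<theta> * z)) * indicator {- x..} z \<partial>mu q)"
    by (rule nn_integral_cmult) simp
  also have "(\<integral>\<^sup>+z. ennreal (exp (- \<theta> * z)) * indicator {- x..} z \<partial>mu q) = B + C"
    unfolding B_def C_def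
    using x by (subst nn_integral_add[symmetric]) (auto intro!: nn_integral_cong simp: indicator_def)
  finally have 1: "enn2real (potential (free_weight q) (\<lambda>z. ennreal (exp (- \<theta> * z)) * indicator {0..} z) x)
    = exp (- \<theta> * x) * (enn2real B + mu_const q / (kappa q + \<theta>))"
    using Bf c k \<theta> by (simp add: enn2real_mult C enn2real_plus)
  define I where "I = (LBINT y:{0..x}. exp (\<theta> * y) * w y)"
  have B: "enn2real B + I = mu_const q * ((exp ((kappa q + \<theta>) * x) - 1) / (kappa q + \<theta>))"
    using mu_scale_function[OF q w x, of "- \<theta>"] x k \<theta> set_integral_exp_Icc[of "kappa q + \<theta>" x] unfolding B_def I_def by simp
  have I: "(LBINT y:{0..x}. exp (- \<theta> * y) * w (x - y)) = exp (- \<theta> * x) * I"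
  proof -
    have "(LBINT y:{0..x}. exp (- \<theta> * y) * w (x - y))
      = \<bar>- 1\<bar> *\<^sub>R (\<integral>y. indicator {0..x} (x + (- 1) * y) *\<^sub>R (exp (- \<theta> * (x + (- 1) * y)) * w (x - (x + (- 1) * y))) \<partial>lborel)"
      unfolding set_lebesgue_integral_def by (rule lborel_integral_real_affine) simp
    also have "\<dots> = (\<integral>y. exp (- \<theta> * x) * (indicator {0..x} y *\<^sub>R (exp (\<theta> * y) * w y)) \<partial>lborel)"
    proof -
      have eq: "indicator {0..x} (x + (- 1) * y) *\<^sub>R (exp (- \<theta> * (x + (- 1) * y)) * w (x - (x + (- 1) * y)))
        = exp (- \<theta> * x) * (indicator {0..x} y *\<^sub>R (exp (\<theta> * y) * w y))" for y
      proof -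
        have "exp (- \<theta> * (x + (- 1) * y)) = exp (- \<theta> * x) * exp (\<theta> * y)" by (simp add: exp_add[symmetric] algebra_simps)
        then show ?thesis by (auto simp: indicator_def)
      qed
      show ?thesis unfolding eq by simp
    qed
    also have "\<dots> = exp (- \<theta> * x) * I" unfolding I_def set_lebesgue_integral_def by simp
    finally show ?thesis .
  qed
  have s: "0 < kappa q + \<theta>" using k \<theta> by simp
  have "exp (- \<theta> * x) * exp ((kappa q + \<theta>) * x) = exp (kappa q * x)" by (simp add: exp_add[symmetric] algebra_simps)
  then have e: "exp (- \<theta> * x) * (mu_const q * (exp ((kappa q + \<theta>) * x) / (kappa q + \<theta>))) = mu_const q * exp (kappa q * x) / (kappa q + \<theta>)"
    by (simp add: mult.left_commute[of "exp (- \<theta> * x)"])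
  have "enn2real B + mu_const q / (kappa q + \<theta>) = mu_const q * (exp ((kappa q + \<theta>) * x) / (kappa q + \<theta>)) - I"
    using B s by (simp add: diff_divide_distrib right_diff_distrib)
  then show ?thesis unfolding 1 I using e by (simp add: right_diff_distrib add.commute)
qed

end

section \<open>Discounting by the time spent above zero\<close>

text \<open>With \<open>\<Theta> t\<close> the integral of \<open>D\<close> along the path, the integrand is \<open>exp (s * \<Theta> t)\<close> times the speed of \<open>\<Theta>\<close>, so the
time change reduces it to an elementary integral.\<close>

lemma path_exp_time_integral:
  assumes f: "f \<in> path_set" and [measurable]: "D \<in> borel_measurable borel" and D: "\<And>y. 0 \<le> D y" "\<And>y. D y \<le> C"
    and s: "s \<noteq> 0" and u: "0 \<le> u"
  shows "(\<integral>\<^sup>+t\<in>{0..u}. ennreal (D (f t)) * ennreal (exp (s * (LBINT r:{0..t}. D (f r)))) \<partial>lborel)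
    = ennreal ((exp (s * (LBINT r:{0..u}. D (f r))) - 1) / s)"
proof -
  have Df: "(\<lambda>r. D (f r)) \<in> borel_measurable borel"
    by (rule measurable_compose[OF path_measurable[OF f]]) simp
  have "0 \<le> (LBINT r:{0..u}. D (f r))" by (rule LBINT_Icc_bounds(1)[OF Df D order_refl u])
  then show ?thesis
    using nn_integral_time_change[OF Df D u, of "\<lambda>v. ennreal (exp (s * v))"] nn_integral_exp_Icc[OF s, of 0 "LBINT r:{0..u}. D (f r)"]
    by simp
qed

text \<open>Duhamel's formula: up to time \<open>t\<close> the constant rate \<open>a\<close> is applied, afterwards the perturbed one. The sign of \<open>s\<close> is
left open so that the perturbation may add or remove killing.\<close>

lemma kill_duhamel:
  fixes a s :: real
  assumes f: "f \<in> path_set" and D[measurable]: "D \<in> borel_measurable borel" and bd: "\<And>y. 0 \<le> D y" "\<And>y. D y \<le> C"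
    and s: "s \<noteq> 0" and nonneg: "\<And>y. 0 \<le> a + s * D y" and u: "0 \<le> u"
  shows "(\<integral>\<^sup>+t\<in>{0..u}. ennreal (exp (- a * t)) * ennreal (D (f t)) * ennreal (kill (\<lambda>y. a + s * D y) (u - t) (shift_path t f)) \<partial>lborel)
    = ennreal ((exp (- a * u) - kill (\<lambda>y. a + s * D y) u f) / s)"
proof -
  define \<omega> where "\<omega> = (\<lambda>y. a + s * D y)"
  have [measurable]: "\<omega> \<in> borel_measurable borel" unfolding \<omega>_def by measurable
  have Df: "(\<lambda>r. D (f r)) \<in> borel_measurable borel"
    by (rule measurable_compose[OF path_measurable[OF f] D])
  define \<Theta> where "\<Theta> t = (LBINT r:{0..t}. D (f r))" for t
  have k: "kill \<omega> t f = exp (- (a * t + s * \<Theta> t))" if "0 \<le> t" for t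
  proof -
    have c: "set_integrable lborel {0..t} (\<lambda>_. a)" "(LBINT r:{0..t}. a) = a * t"
      using that by (auto simp: set_lebesgue_integral_def intro!: borel_integrable_atLeastAtMost')
    have i: "set_integrable lborel {0..t} (\<lambda>r. s * D (f r))"
      by (intro set_integrable_mult_right set_integrable_bounded_Icc[OF Df bd])
    show ?thesis unfolding kill_def \<omega>_def \<Theta>_def set_integral_add(2)[OF c(1) i] c(2) by simp
  qed
  have \<omega>_le: "\<omega> y \<le> a + \<bar>s\<bar> * C" for y
  proof -
    have "s * D y \<le> \<bar>s\<bar> * D y" using bd by (intro mult_right_mono) auto
    also have "\<dots> \<le> \<bar>s\<bar> * C" using bd by (intro mult_left_mono) auto
    finally show ?thesis by (simp add: \<omega>_def)
  qed
  have shift: "kill \<omega> (u - t) (shift_path t f) = kill \<omega> u f * exp (a * t + s * \<Theta> t)" if t: "0 \<le> t" "t \<le> u" for t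
  proof -
    have "kill \<omega> u f = kill \<omega> t f * kill \<omega> (u - t) (shift_path t f)"
      using nonneg \<omega>_le t by (intro kill_shift_path[OF f, where C="a + \<bar>s\<bar> * C"]) (auto simp: \<omega>_def)
    moreover have "kill \<omega> t f * exp (a * t + s * \<Theta> t) = 1" unfolding k[OF t(1)]
      by (simp only: exp_add[symmetric] left_minus exp_zero)
    ultimately show ?thesis by (metis mult.assoc mult.commute mult_1)
  qed
  have exp_\<Theta>: "exp (s * \<Theta> t) = exp (- a * t) / kill \<omega> t f" if "0 \<le> t" for t
  proof -
    have "exp (s * \<Theta> t) * kill \<omega> t f = exp (- a * t)"
      unfolding k[OF that] by (simp only: exp_add[symmetric]) simp
    then show ?thesis by (simp add: eq_divide_eq kill_def)
  qed
  have meas: "(\<lambda>t. ennreal (D (f t)) * ennreal (exp (s * \<Theta> t)) * indicator {0..u} t) \<in> borel_measurable lborel"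
  proof -
    have [measurable]: "(\<lambda>t. kill \<omega> t f) \<in> borel_measurable borel"
      using f by (intro measurable_kill) simp_all
    have "(\<lambda>t. ennreal (D (f t)) * ennreal (exp (- a * t) / kill \<omega> t f) * indicator {0..u} t) \<in> borel_measurable borel"
      using Df by measurable
    also have "(\<lambda>t. ennreal (D (f t)) * ennreal (exp (- a * t) / kill \<omega> t f) * indicator {0..u} t)
      = (\<lambda>t. ennreal (D (f t)) * ennreal (exp (s * \<Theta> t)) * indicator {0..u} t)"
    proof
      fix t
      show "ennreal (D (f t)) * ennreal (exp (- a * t) / kill \<omega> t f) * indicator {0..u} t
        = ennreal (D (f t)) * ennreal (exp (s * \<Theta> t)) * indicator {0..u} t"
        by (cases "0 \<le> t") (simp_all add: exp_\<Theta>)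
    qed
    finally show ?thesis by simp
  qed
  have "(\<integral>\<^sup>+t\<in>{0..u}. ennreal (exp (- a * t)) * ennreal (D (f t)) * ennreal (kill \<omega> (u - t) (shift_path t f)) \<partial>lborel)
    = (\<integral>\<^sup>+t. ennreal (kill \<omega> u f) * (ennreal (D (f t)) * ennreal (exp (s * \<Theta> t)) * indicator {0..u} t) \<partial>lborel)"
  proof (rule nn_integral_cong)
    fix t :: real
    show "ennreal (exp (- a * t)) * ennreal (D (f t)) * ennreal (kill \<omega> (u - t) (shift_path t f)) * indicator {0..u} t
      = ennreal (kill \<omega> u f) * (ennreal (D (f t)) * ennreal (exp (s * \<Theta> t)) * indicator {0..u} t)"
    proof (cases "t \<in> {0..u}")
      case True
      then have t: "0 \<le> t" "t \<le> u" by auto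
      have "exp (- a * t) * exp (a * t + s * \<Theta> t) = exp (s * \<Theta> t)" by (simp add: exp_add[symmetric])
      then have "exp (- a * t) * D (f t) * kill \<omega> (u - t) (shift_path t f) = kill \<omega> u f * (D (f t) * exp (s * \<Theta> t))"
        unfolding shift[OF t] by (metis mult.assoc mult.commute)
      then have "ennreal (exp (- a * t)) * ennreal (D (f t)) * ennreal (kill \<omega> (u - t) (shift_path t f))
        = ennreal (kill \<omega> u f) * (ennreal (D (f t)) * ennreal (exp (s * \<Theta> t)))"
        using bd by (simp add: ennreal_mult[symmetric] kill_def)
      then show ?thesis using True by simp
    qed simp
  qed
  also have "\<dots> = ennreal (kill \<omega> u f) * ennreal ((exp (s * \<Theta> u) - 1) / s)"
    unfolding \<Theta>_def path_exp_time_integral[OF f D bd s u, symmetric]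
    using meas by (intro nn_integral_cmult) (simp add: \<Theta>_def)
  also have "\<dots> = ennreal ((exp (- a * u) - kill \<omega> u f) / s)"
  proof -
    have "0 \<le> \<Theta> u" unfolding \<Theta>_def by (rule LBINT_Icc_bounds(1)[OF Df bd order_refl u])
    then have nn: "0 \<le> (exp (s * \<Theta> u) - 1) / s"
      using s by (cases "0 < s") (auto intro!: divide_nonpos_neg mult_nonpos_nonneg)
    have eq: "kill \<omega> u f * ((exp (s * \<Theta> u) - 1) / s) = (exp (- a * u) - kill \<omega> u f) / s"
    proof -
      have "kill \<omega> u f * exp (s * \<Theta> u) = exp (- a * u)"
        unfolding exp_\<Theta>[OF u] by (simp add: kill_def)
      then show ?thesis by (simp add: right_diff_distrib)
    qed
    show ?thesis unfolding ennreal_mult''[OF nn, symmetric] eq ..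
  qed
  finally show ?thesis unfolding \<omega>_def .
qed

definition occ_rate :: "real \<Rightarrow> real \<Rightarrow> real \<Rightarrow> real" where
  "occ_rate p q y = p + q * indicator {0..} y"

definition occ_weight :: "real \<Rightarrow> real \<Rightarrow> real \<Rightarrow> (real \<Rightarrow> real) \<Rightarrow> ennreal" where
  "occ_weight p q t f = ennreal (kill (occ_rate p q) t f)"

lemma occ_rate_measurable [measurable]: "occ_rate p q \<in> borel_measurable borel"
  unfolding occ_rate_def[abs_def] by measurable

lemma occ_weight_measurable: "case_prod (occ_weight p q) \<in> borel_measurable (borel \<Otimes>\<^sub>M path_space)"
  unfolding occ_weight_def[abs_def] split_beta' by measurable

lemma occ_rate_above: "occ_rate p q = (\<lambda>y. p + 1 * (q * indicator {0..} y))"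
  and occ_rate_below: "occ_rate p q = (\<lambda>y. (p + q) + - 1 * (q * indicator {..<0} y))"
  by (auto simp: occ_rate_def fun_eq_iff indicator_def)

lemma
  assumes f: "f \<in> path_set" and p: "0 \<le> p" and q: "0 \<le> q" and u: "0 \<le> u"
  shows kill_occ_le: "kill (occ_rate p q) u f \<le> exp (- p * u)"
    and kill_occ_ge: "exp (- (p + q) * u) \<le> kill (occ_rate p q) u f"
proof -
  have m: "(\<lambda>r. occ_rate p q (f r)) \<in> borel_measurable borel"
    by (rule measurable_compose[OF path_measurable[OF f]]) simp
  have int: "set_integrable lborel {0..u} (\<lambda>r. occ_rate p q (f r))"
    by (rule set_integrable_bounded_Icc[OF m, where C="p + q"]) (use p q in \<open>auto simp: occ_rate_def indicator_def\<close>)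
  have c: "set_integrable lborel {0..u} (\<lambda>_. a :: real)" "(LBINT r:{0..u}. a) = a * u" for a
    using u by (auto simp: set_lebesgue_integral_def intro!: borel_integrable_atLeastAtMost')
  have "(LBINT r:{0..u}. p) \<le> (LBINT r:{0..u}. occ_rate p q (f r))"
    by (rule set_integral_mono[OF c(1) int]) (use q in \<open>auto simp: occ_rate_def\<close>)
  moreover have "(LBINT r:{0..u}. occ_rate p q (f r)) \<le> (LBINT r:{0..u}. p + q)"
    by (rule set_integral_mono[OF int c(1)]) (use q in \<open>auto simp: occ_rate_def indicator_def\<close>)
  ultimately show "kill (occ_rate p q) u f \<le> exp (- p * u)" "exp (- (p + q) * u) \<le> kill (occ_rate p q) u f"
    unfolding kill_def c(2) exp_le_cancel_iff by (simp_all only: mult_minus_left neg_le_iff_le)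
qed

context spectrally_negative_levy
begin

lemma occ_potential_below:
  assumes p: "0 < p" and q: "0 < q" and [measurable]: "\<phi> \<in> borel_measurable borel"
  shows "potential (occ_weight p q) \<phi> x = potential (free_weight (p + q)) \<phi> x
    + potential (free_weight (p + q)) (\<lambda>y. ennreal (q * indicator {..<0} y) * potential (occ_weight p q) \<phi> y) x"
proof (rule potential_perturbation)
  fix u :: real and f assume u: "0 \<le> u" and f: "f \<in> path_set"
  have "(\<integral>\<^sup>+t\<in>{0..u}. free_weight (p + q) t f * ennreal (q * indicator {..<0} (f t)) * occ_weight p q (u - t) (shift_path t f) \<partial>lborel)
    = ennreal ((exp (- (p + q) * u) - kill (occ_rate p q) u f) / (- 1))"
    unfolding free_weight_def occ_weight_def occ_rate_below using p q
    by (intro kill_duhamel[OF f _ _ _ _ _ u, where C=q]) (auto simp: indicator_def)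
  then show "occ_weight p q u f = free_weight (p + q) u f
    + (\<integral>\<^sup>+t\<in>{0..u}. free_weight (p + q) t f * ennreal (q * indicator {..<0} (f t)) * occ_weight p q (u - t) (shift_path t f) \<partial>lborel)"
    using kill_occ_ge[OF f _ _ u, of p q] p q
    by (simp add: occ_weight_def free_weight_def ennreal_plus[symmetric] del: ennreal_plus)
next
  show "free_weight (p + q) t (stop_path t f) = free_weight (p + q) t f" for t f by (simp add: free_weight_def)
qed (simp_all add: weights_measurable occ_weight_measurable)

lemma occ_potential_above:
  assumes p: "0 < p" and q: "0 < q" and [measurable]: "\<phi> \<in> borel_measurable borel"
  shows "potential (free_weight p) \<phi> x = potential (occ_weight p q) \<phi> x
    + potential (free_weight p) (\<lambda>y. ennreal (q * indicator {0..} y) * potential (occ_weight p q) \<phi> y) x"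
proof (rule potential_perturbation)
  fix u :: real and f assume u: "0 \<le> u" and f: "f \<in> path_set"
  have "(\<integral>\<^sup>+t\<in>{0..u}. free_weight p t f * ennreal (q * indicator {0..} (f t)) * occ_weight p q (u - t) (shift_path t f) \<partial>lborel)
    = ennreal ((exp (- p * u) - kill (occ_rate p q) u f) / 1)"
    unfolding free_weight_def occ_weight_def occ_rate_above using p q
    by (intro kill_duhamel[OF f _ _ _ _ _ u, where C=q]) (auto simp: indicator_def)
  then show "free_weight p u f = occ_weight p q u f
    + (\<integral>\<^sup>+t\<in>{0..u}. free_weight p t f * ennreal (q * indicator {0..} (f t)) * occ_weight p q (u - t) (shift_path t f) \<partial>lborel)"
    using kill_occ_le[OF f _ _ u, of p q] p q
    by (simp add: occ_weight_def free_weight_def ennreal_plus[symmetric] kill_def del: ennreal_plus)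
next
  show "free_weight p t (stop_path t f) = free_weight p t f" for t f by (simp add: free_weight_def)
qed (simp_all add: weights_measurable occ_weight_measurable)

lemma occ_potential_le:
  assumes p: "0 < p" and q: "0 < q" and \<phi>: "\<And>y. \<phi> y \<le> ennreal B"
  shows "potential (occ_weight p q) \<phi> x \<le> ennreal B * ennreal (1 / p)"
proof -
  have "potential (occ_weight p q) \<phi> x \<le> potential (free_weight p) (\<lambda>_. ennreal B) x"
    using kill_occ_le p q \<phi>
    by (intro potential_mono mult_mono) (auto simp: occ_weight_def free_weight_def intro!: ennreal_leI)
  then show ?thesis by (simp only: free_potential_one[OF p])
qed

text \<open>Up to the first passage above \<open>0\<close> the occupation time does not grow. Instead of applying the strong Markov
property to the discounted process, its potential is written as a difference of free potentials, for which first
passage is known.\<close>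

lemma occ_potential_first_passage:
  assumes p: "0 < p" and q: "0 < q" and x: "x \<le> 0" and [measurable]: "\<phi> \<in> borel_measurable borel"
    and bd: "\<And>y. \<phi> y \<le> ennreal B"
  shows "potential (occ_weight p q) \<phi> x = potential (unhit_weight p) \<phi> x + ennreal (exp (kappa p * x)) * potential (occ_weight p q) \<phi> 0"
proof -
  define \<eta> where "\<eta> y = ennreal (q * indicator {0..} y) * potential (occ_weight p q) \<phi> y" for y
  have [measurable]: "\<eta> \<in> borel_measurable borel"
    unfolding \<eta>_def by (intro borel_measurable_times_ennreal measurable_potential occ_weight_measurable) simp_all
  \<comment> \<open>\<open>\<eta>\<close> vanishes on the negative half-line, to which the killed process is confined\<close>
  have K0: "potential (unhit_weight p) \<eta> x = 0"
  proof -
    have "potential (unhit_weight p) \<eta> x = potential (unhit_weight p) (\<lambda>y. \<eta> y * indicator {..<0} y) x"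
      by (rule unhit_potential_indicator[OF p x, symmetric]) simp
    also have "(\<lambda>y. \<eta> y * indicator {..<0} y) = (\<lambda>_. 0)" by (auto simp: \<eta>_def indicator_def fun_eq_iff)
    finally show ?thesis by (simp add: potential_def)
  qed
  have above: "potential (free_weight p) \<phi> y = potential (occ_weight p q) \<phi> y + potential (free_weight p) \<eta> y" for y
    unfolding \<eta>_def by (rule occ_potential_above[OF p q]) simp
  define e where "e = ennreal (exp (kappa p * x))"
  have c: "potential (free_weight p) \<eta> x = e * potential (free_weight p) \<eta> 0"
    using free_potential_first_passage[OF p x, of \<eta>] K0 by (simp add: e_def)
  have "potential (occ_weight p q) \<phi> x + e * potential (free_weight p) \<eta> 0
    = potential (unhit_weight p) \<phi> x + e * (potential (occ_weight p q) \<phi> 0 + potential (free_weight p) \<eta> 0)"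
    using free_potential_first_passage[OF p x, of \<phi>] unfolding above c e_def by simp
  then have "e * potential (free_weight p) \<eta> 0 + potential (occ_weight p q) \<phi> x
    = e * potential (free_weight p) \<eta> 0 + (potential (unhit_weight p) \<phi> x + e * potential (occ_weight p q) \<phi> 0)"
    by (simp add: distrib_left ac_simps)
  moreover have "e * potential (free_weight p) \<eta> 0 \<noteq> top"
  proof -
    have "potential (free_weight p) \<eta> 0 \<le> potential (free_weight p) \<phi> 0" unfolding above by simp
    also have "\<dots> \<le> potential (free_weight p) (\<lambda>_. ennreal B) 0" by (rule potential_mono) (intro mult_left_mono bd, simp)
    also have "\<dots> < top" by (simp only: free_potential_one[OF p]) (simp add: ennreal_mult_less_top)
    finally show ?thesis by (simp add: e_def ennreal_mult_eq_top_iff)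
  qed
  ultimately show ?thesis unfolding ennreal_add_left_cancel e_def by simp
qed

text \<open>First passage expresses the killed resolvent through \<open>mu_neg\<close>, and \<open>mu_neg_eq\<close> makes the coefficients of the two
exponentials opposite.\<close>

lemma unhit_exp:
  assumes q: "0 < q" and a: "0 \<le> a" "a \<noteq> kappa q" and x: "x \<le> 0"
  shows "potential (unhit_weight q) (\<lambda>z. ennreal (exp (a * z)) * indicator {..<0} z) x = ennreal ((exp (a * x) - exp (kappa q * x)) / (q - psi a))"
proof -
  let ?\<phi> = "\<lambda>z. ennreal (exp (a * z)) * indicator {..0} z"
  have U0: "potential (free_weight q) ?\<phi> 0 = ennreal (mu_neg q a)"
    using free_exp_below[OF q a order_refl] by simp
  have "potential (unhit_weight q) (\<lambda>z. ennreal (exp (a * z)) * indicator {..<0} z) x = potential (unhit_weight q) (\<lambda>z. ennreal (exp (a * z))) x"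
    by (rule unhit_potential_indicator[OF q x]) simp
  also have "\<dots> = potential (unhit_weight q) ?\<phi> x"
    by (rule unhit_potential_cong) simp
  also have "\<dots> = potential (free_weight q) ?\<phi> x - ennreal (exp (kappa q * x)) * ennreal (mu_neg q a)"
    using free_potential_first_passage[OF q x, of ?\<phi>] unfolding U0 by (simp add: ennreal_mult_eq_top_iff)
  also have "\<dots> = ennreal (exp (a * x) * mu_neg q a + mu_const q * (exp (kappa q * x) - exp (a * x)) / (a - kappa q) - exp (kappa q * x) * mu_neg q a)"
    unfolding free_exp_below[OF q a x] using mu_neg_bounds[OF q a(1)] by (simp add: ennreal_mult[symmetric] ennreal_minus)
  also have "exp (a * x) * mu_neg q a + mu_const q * (exp (kappa q * x) - exp (a * x)) / (a - kappa q) - exp (kappa q * x) * mu_neg q a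
    = (exp (a * x) - exp (kappa q * x)) / (q - psi a)"
  proof -
    define D where "D = mu_const q / (a - kappa q)"
    have e: "mu_const q * y / (a - kappa q) = D * y" for y by (simp add: D_def)
    have m: "mu_neg q a = 1 / (q - psi a) + D" unfolding D_def by (rule mu_neg_eq[OF q a])
    show ?thesis unfolding e m by (simp add: algebra_simps diff_divide_distrib)
  qed
  finally show ?thesis .
qed

lemma free_potential_real:
  assumes [measurable]: "h \<in> borel_measurable borel" and h: "\<And>y. 0 \<le> h y"
  shows "enn2real (potential (free_weight q) (\<lambda>y. ennreal (h y)) x) = (\<integral>z. h (x + z) \<partial>mu q)"
  using h by (subst integral_eq_nn_integral) (simp_all add: free_potential_eq)

text \<open>On the negative half-line the potential is known up to its value at \<open>0\<close>, by first passage. The perturbation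
equation at rate \<open>p + q\<close> involves the potential only on the negative half-line, so it expresses the potential everywhere
through this value, and at \<open>x = 0\<close> it is a linear equation for it.\<close>

theorem occ_potential_neg_exp:
  assumes p: "0 < p" and q: "0 < q" and W: "is_scale_function psi (p + q) (W (p + q))" and a: "0 \<le> a"
  defines "\<phi> \<equiv> \<lambda>z. ennreal (exp (a * z)) * indicator {..<0} z"
  shows "(p - psi a) * enn2real (potential (occ_weight p q) \<phi> x)
    = scale_Z psi W (p + q) x a
      - 1 / q * (kappa (p + q) - kappa p) * exponent_quotient psi (p + q) a * scale_Z psi W (p + q) x (kappa p)"
proof -
  define q' where "q' = p + q"
  have q': "0 < q'" "p < q'" using p q by (auto simp: q'_def)
  note W' = W[folded q'_def]
  note k = kappa_pos[OF p]
  have kk: "kappa p < kappa q'" using psi_less_iff[OF q'(1), of "kappa p"] psi_kappa[OF p] k q' by simp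
  define EQ where "EQ b = exponent_quotient psi q' b" for b
  have EQk: "EQ (kappa p) = q / (kappa q' - kappa p)"
    using kk unfolding EQ_def by (subst exponent_quotient_eq[OF q'(1)]) (auto simp: psi_kappa[OF p] q'_def)
  show ?thesis
  proof (cases "a = kappa p")
    case True
    have "1 / q * (kappa q' - kappa p) * EQ (kappa p) = 1" unfolding EQk using kk q by simp
    then show ?thesis using True unfolding EQ_def q'_def by (simp add: psi_kappa[OF p])
  next
    case False
    have pne: "p - psi a \<noteq> 0"
      using psi_less_iff[OF p a] psi_greater[OF p, of a] False by (cases "a < kappa p") auto
    have [measurable]: "\<phi> \<in> borel_measurable borel" unfolding \<phi>_def by measurable
    have \<phi>1: "\<phi> y \<le> ennreal 1" for y
      using a by (auto simp: \<phi>_def indicator_def ennreal_le_1 mult_nonneg_nonpos)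
    define g where "g y = enn2real (potential (occ_weight p q) \<phi> y)" for y
    have fin: "potential (occ_weight p q) \<phi> y < top" for y
      using occ_potential_le[where \<phi>=\<phi> and x=y, OF p q \<phi>1] by (auto simp: le_less_trans)
    have R_g: "potential (occ_weight p q) \<phi> y = ennreal (g y)" for y
      unfolding g_def using fin[of y] by (intro ennreal_enn2real[symmetric])
    have [measurable]: "g \<in> borel_measurable borel"
      unfolding g_def by (intro measurable_compose[OF measurable_potential[OF occ_weight_measurable]]) simp_all
    have g0: "0 \<le> g y" for y by (simp add: g_def)
    define G0 where "G0 = (p - psi a) * g 0"
    have below: "(p - psi a) * g y = exp (a * y) + (G0 - 1) * exp (kappa p * y)" if y: "y \<le> 0" for y
    proof -
      have "0 \<le> (exp (a * y) - exp (kappa p * y)) / (p - psi a)"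
      proof (cases "a < kappa p")
        case True
        then have "0 < p - psi a" using psi_less_iff[OF p a] by simp
        then show ?thesis using True y by (intro divide_nonneg_pos) (auto simp: mult_right_mono_neg)
      next
        case F: False
        then have "p - psi a < 0" using psi_greater[OF p, of a] False by simp
        then show ?thesis using F y by (intro divide_nonpos_neg) (auto simp: mult_right_mono_neg)
      qed
      define A where "A = (exp (a * y) - exp (kappa p * y)) / (p - psi a)"
      have "ennreal (g y) = ennreal A + ennreal (exp (kappa p * y)) * ennreal (g 0)"
        unfolding R_g[symmetric] A_def unhit_exp[OF p a False y, folded \<phi>_def, symmetric]
        by (rule occ_potential_first_passage[where \<phi>=\<phi>, OF p q y _ \<phi>1]) simp
      also have "\<dots> = ennreal (A + exp (kappa p * y) * g 0)"
        using \<open>0 \<le> (exp (a * y) - exp (kappa p * y)) / (p - psi a)\<close>[folded A_def] g0[of 0] by (simp add: ennreal_mult[symmetric])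
      finally have "g y = (exp (a * y) - exp (kappa p * y)) / (p - psi a) + exp (kappa p * y) * g 0"
        using \<open>0 \<le> (exp (a * y) - exp (kappa p * y)) / (p - psi a)\<close>[folded A_def] g0[of 0] g0[of y]
        unfolding A_def[symmetric] by (subst (asm) ennreal_inj) (auto intro!: add_nonneg_nonneg)
      then have "(p - psi a) * g y = exp (a * y) - exp (kappa p * y) + exp (kappa p * y) * G0"
        using pne by (simp add: distrib_left G0_def mult.left_commute)
      then show ?thesis by (simp add: algebra_simps)
    qed
    define V where "V b x = (\<integral>z. exp (b * (x + z)) * indicator {..<0} (x + z) \<partial>mu q')" for b x
    have V: "V b x = potential_neg_exp q' b x" for b x
    proof -
      have "(\<lambda>z. ennreal (exp (b * z)) * indicator {..<0} z) = (\<lambda>z. ennreal (exp (b * z) * indicator {..<0} z))"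
        by (auto simp: fun_eq_iff indicator_def)
      then show ?thesis
        using free_potential_real[of "\<lambda>z. exp (b * z) * indicator {..<0} z" q' x] by (simp add: potential_neg_exp_def V_def)
    qed
    interpret mu: finite_measure "mu q'" using q'(1) by (rule finite_measure_mu)
    have Vint: "integrable (mu q') (\<lambda>z. exp (b * (x + z)) * indicator {..<0} (x + z))" if "0 \<le> b" for b x
      using that by (intro mu.integrable_const_bound[where B=1]) (auto simp: indicator_def mult_nonneg_nonpos)
    \<comment> \<open>the perturbation equation at rate \<open>p + q\<close>, in which the values below \<open>0\<close> have been inserted\<close>
    have gx: "g x = V a x + q * ((V a x + (G0 - 1) * V (kappa p) x) / (p - psi a))" for x
    proof -
      have "potential (free_weight q') \<phi> x < top"
      proof -
        have "potential (free_weight q') \<phi> x \<le> potential (free_weight q') (\<lambda>_. ennreal 1) x"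
          by (rule potential_mono) (intro mult_left_mono \<phi>1, simp)
        also have "\<dots> < top" by (simp only: free_potential_one[OF q'(1)]) (simp add: ennreal_mult_less_top)
        finally show ?thesis .
      qed
      moreover have U2: "ennreal (g x) = potential (free_weight q') \<phi> x + potential (free_weight q') (\<lambda>y. ennreal (q * indicator {..<0} y) * ennreal (g y)) x"
        using occ_potential_below[OF p q, of \<phi> x] unfolding R_g q'_def by simp
      then have "potential (free_weight q') (\<lambda>y. ennreal (q * indicator {..<0} y) * ennreal (g y)) x < top"
        by (metis ennreal_add_eq_top ennreal_neq_top less_top)
      ultimately have "g x = enn2real (potential (free_weight q') \<phi> x) + enn2real (potential (free_weight q') (\<lambda>y. ennreal (q * indicator {..<0} y) * ennreal (g y)) x)"
        using arg_cong[OF U2, of enn2real] g0[of x] by (simp add: enn2real_plus)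
      also have "enn2real (potential (free_weight q') \<phi> x) = V a x" by (simp add: V potential_neg_exp_def \<phi>_def)
      also have "enn2real (potential (free_weight q') (\<lambda>y. ennreal (q * indicator {..<0} y) * ennreal (g y)) x)
        = (\<integral>z. q * indicator {..<0} (x + z) * g (x + z) \<partial>mu q')"
        using q g0 by (subst free_potential_real[symmetric]) (auto simp: ennreal_mult)
      also have "\<dots> = (\<integral>z. q * ((exp (a * (x + z)) * indicator {..<0} (x + z) + (G0 - 1) * (exp (kappa p * (x + z)) * indicator {..<0} (x + z))) / (p - psi a)) \<partial>mu q')"
      proof (rule Bochner_Integration.integral_cong[OF refl])
        fix z
        show "q * indicator {..<0} (x + z) * g (x + z)
          = q * ((exp (a * (x + z)) * indicator {..<0} (x + z) + (G0 - 1) * (exp (kappa p * (x + z)) * indicator {..<0} (x + z))) / (p - psi a))"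
        proof (cases "x + z < 0")
          case True
          have "g (x + z) = (exp (a * (x + z)) + (G0 - 1) * exp (kappa p * (x + z))) / (p - psi a)"
            using below[of "x + z"] True pne by (simp add: eq_divide_eq mult.commute)
          then show ?thesis using True by simp
        qed simp
      qed
      also have "\<dots> = q * ((V a x + (G0 - 1) * V (kappa p) x) / (p - psi a))"
        using Vint[OF a, of x] Vint[of "kappa p" x] k unfolding V_def by simp
      finally show ?thesis .
    qed
    have G: "(p - psi a) * g x = (q' - psi a) * V a x + (G0 - 1) * ((q' - psi (kappa p)) * V (kappa p) x)" for x
    proof -
      have "(p - psi a) * g x = (p - psi a) * V a x + q * (V a x + (G0 - 1) * V (kappa p) x)"
      proof -
        have e: "(p - psi a) * (q * (y / (p - psi a))) = q * y" for y using pne by simp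
        show ?thesis unfolding gx[of x] distrib_left[of "p - psi a"] e ..
      qed
      then show ?thesis unfolding psi_kappa[OF p] q'_def by (simp add: algebra_simps)
    qed
    define c where "c = mu_const q'"
    have c: "0 < c" unfolding c_def by (rule mu_const_pos[OF q'(1)])
    define Z where "Z b x = scale_Z psi W q' x b" for b x
    have Y: "(q' - psi b) * V b x = Z b x - c * EQ b * exp (kappa q' * x)" if "0 \<le> b" "0 \<le> x" for b x
      unfolding V Z_def c_def EQ_def by (rule potential_neg_exp_eq[where W=W, OF q'(1) W' that])
    have Z0: "Z b 0 = 1" for b
    proof -
      have "(LBINT y:{0..0}. exp (- b * y) * W q' y) = 0"
        unfolding set_lebesgue_integral_def
        by (rule integral_eq_zero_AE) (use AE_lborel_singleton[of 0] in \<open>eventually_elim, simp\<close>)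
      then show ?thesis by (simp add: Z_def scale_Z_def)
    qed
    \<comment> \<open>the equation at \<open>x = 0\<close> is linear in the unknown \<open>G0\<close>\<close>
    have "G0 = (1 - c * EQ a) + (G0 - 1) * (1 - c * EQ (kappa p))"
      using G[of 0] Y[OF a order_refl] Y[OF less_imp_le[OF k] order_refl] unfolding G0_def[symmetric] Z0 by simp
    then have "c * (EQ a + (G0 - 1) * EQ (kappa p)) = 0" by (simp add: algebra_simps)
    then have E: "EQ a + (G0 - 1) * EQ (kappa p) = 0" using c by simp
    then have G01: "G0 - 1 = - (1 / q * (kappa q' - kappa p) * EQ a)"
      unfolding EQk using kk q by (simp add: field_simps)
    have "(p - psi a) * g x = Z a x + (G0 - 1) * Z (kappa p) x"
    proof (cases "0 \<le> x")
      case True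
      have "(p - psi a) * g x = Z a x + (G0 - 1) * Z (kappa p) x - c * exp (kappa q' * x) * (EQ a + (G0 - 1) * EQ (kappa p))"
        unfolding G[of x] Y[OF a True] Y[OF less_imp_le[OF k] True] by (simp add: algebra_simps)
      then show ?thesis unfolding E by simp
    next
      case False
      then show ?thesis using below[of x] by (simp add: Z_def scale_Z_def)
    qed
    then show ?thesis unfolding g_def Z_def G01 EQ_def q'_def by simp
  qed
qed

text \<open>As before, with \<open>\<phi>\<close> vanishing on the negative half-line: below \<open>0\<close> the potential is \<open>exp (kappa p * x)\<close> times its
value at \<open>0\<close>, and the value at \<open>0\<close> is fixed by the condition that the terms growing like \<open>exp (kappa (p + q) * x)\<close>
cancel.\<close>

theorem occ_potential_pos_exp:
  assumes p: "0 < p" and q: "0 < q" and W: "is_scale_function psi (p + q) (W (p + q))" and \<theta>: "0 < \<theta>"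
  defines "\<phi> \<equiv> \<lambda>z. ennreal (exp (- \<theta> * z)) * indicator {0..} z"
  shows "enn2real (potential (occ_weight p q) \<phi> x)
    = 1 / q * ((kappa (p + q) - kappa p) / (\<theta> + kappa (p + q))) * scale_Z psi W (p + q) x (kappa p)
      - (LBINT y:{0..x}. exp (- \<theta> * y) * W (p + q) (x - y))"
proof -
  define q' where "q' = p + q"
  have q': "0 < q'" "p < q'" using p q by (auto simp: q'_def)
  note W' = W[folded q'_def]
  note k = kappa_pos[OF p] and k' = kappa_pos[OF q'(1)]
  have kk: "kappa p < kappa q'" using psi_less_iff[OF q'(1), of "kappa p"] psi_kappa[OF p] k q' by simp
  have [measurable]: "\<phi> \<in> borel_measurable borel" unfolding \<phi>_def by measurable
  have \<phi>1: "\<phi> y \<le> ennreal 1" for y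
    using \<theta> by (auto simp: \<phi>_def indicator_def ennreal_le_1 mult_nonneg_nonneg)
  define g where "g y = enn2real (potential (occ_weight p q) \<phi> y)" for y
  have fin: "potential (occ_weight p q) \<phi> y < top" for y
    using occ_potential_le[where \<phi>=\<phi> and x=y, OF p q \<phi>1] by (auto simp: le_less_trans)
  have R_g: "potential (occ_weight p q) \<phi> y = ennreal (g y)" for y
    unfolding g_def using fin[of y] by (intro ennreal_enn2real[symmetric])
  have g0: "0 \<le> g y" for y by (simp add: g_def)
  have below_e: "potential (occ_weight p q) \<phi> y = ennreal (exp (kappa p * y) * g 0)" if y: "y \<le> 0" for y
  proof -
    have "potential (unhit_weight p) \<phi> y = potential (unhit_weight p) (\<lambda>z. \<phi> z * indicator {..<0} z) y"
      by (rule unhit_potential_indicator[OF p y, symmetric]) simp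
    also have "(\<lambda>z. \<phi> z * indicator {..<0} z) = (\<lambda>_. 0)" by (auto simp: \<phi>_def indicator_def fun_eq_iff)
    finally have "potential (unhit_weight p) \<phi> y = 0" by (simp add: potential_def)
    moreover have "potential (occ_weight p q) \<phi> y = potential (unhit_weight p) \<phi> y + ennreal (exp (kappa p * y)) * potential (occ_weight p q) \<phi> 0"
      by (rule occ_potential_first_passage[where \<phi>=\<phi>, OF p q y _ \<phi>1]) simp
    ultimately show ?thesis using g0[of 0] by (simp add: R_g[of 0] ennreal_mult)
  qed
  then have below: "g y = exp (kappa p * y) * g 0" if "y \<le> 0" for y
    using that g0[of 0] by (simp add: g_def[of y])
  define c where "c = mu_const q'"
  have c: "0 < c" unfolding c_def by (rule mu_const_pos[OF q'(1)])
  define EQ where "EQ = q / (kappa q' - kappa p)"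
  have EQ: "EQ = exponent_quotient psi q' (kappa p)"
    using kk unfolding EQ_def by (subst exponent_quotient_eq[OF q'(1)]) (auto simp: psi_kappa[OF p] q'_def)
  define Z where "Z x = scale_Z psi W q' x (kappa p)" for x
  define I where "I x = (LBINT y:{0..x}. exp (- \<theta> * y) * W q' (x - y))" for x
  have above: "g x = (c * exp (kappa q' * x) / (\<theta> + kappa q') - I x) + g 0 * (Z x - c * EQ * exp (kappa q' * x))" if x: "0 \<le> x" for x
  proof -
    define A where "A = potential (free_weight q') \<phi> x"
    define B where "B = potential (free_weight q') (\<lambda>y. ennreal (q * indicator {..<0} y) * potential (occ_weight p q) \<phi> y) x"
    have AB: "ennreal (g x) = A + B"
      using occ_potential_below[OF p q, of \<phi> x] unfolding A_def B_def q'_def R_g by simp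
    have "A + B < top" unfolding AB[symmetric] by simp
    then have ABf: "A < top" "B < top"
      by (rule le_less_trans[OF add_increasing2[OF zero_le order_refl]], rule le_less_trans[OF add_increasing[OF zero_le order_refl]])
    have "g x = enn2real A + enn2real B"
      unfolding enn2real_plus[OF ABf, symmetric] AB[symmetric] using g0 by simp
    also have "enn2real A = c * exp (kappa q' * x) / (\<theta> + kappa q') - I x"
      unfolding A_def \<phi>_def c_def I_def by (rule potential_pos_exp_eq[OF q'(1) W' \<theta> x])
    also have "enn2real B = q * g 0 * potential_neg_exp q' (kappa p) x"
    proof -
      have "B = potential (free_weight q') (\<lambda>z. ennreal (q * g 0) * (ennreal (exp (kappa p * z)) * indicator {..<0} z)) x"
        unfolding B_def
      proof (rule arg_cong[where f="\<lambda>h. potential (free_weight q') h x"], rule ext)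
        fix y
        show "ennreal (q * indicator {..<0} y) * potential (occ_weight p q) \<phi> y = ennreal (q * g 0) * (ennreal (exp (kappa p * y)) * indicator {..<0} y)"
          using q g0 by (cases "y < 0") (simp_all add: below_e ennreal_mult[symmetric] mult_ac)
      qed
      also have "\<dots> = ennreal (q * g 0) * potential (free_weight q') (\<lambda>z. ennreal (exp (kappa p * z)) * indicator {..<0} z) x"
        by (rule potential_cmult[OF weights_measurable(1)]) simp
      finally show ?thesis using q g0 by (simp add: enn2real_mult potential_neg_exp_def)
    qed
    also have "q * g 0 * potential_neg_exp q' (kappa p) x = g 0 * (Z x - c * EQ * exp (kappa q' * x))"
      using potential_neg_exp_eq[where W=W, OF q'(1) W' less_imp_le[OF k] x]
      unfolding psi_kappa[OF p] Z_def c_def EQ by (simp add: q'_def)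
    finally show ?thesis .
  qed
  have Z0: "Z 0 = 1"
  proof -
    have "(LBINT y:{0..0}. exp (- kappa p * y) * W q' y) = 0"
      unfolding set_lebesgue_integral_def
      by (rule integral_eq_zero_AE) (use AE_lborel_singleton[of 0] in \<open>eventually_elim, simp\<close>)
    then show ?thesis by (simp add: Z_def scale_Z_def)
  qed
  have I0: "I 0 = 0"
    unfolding I_def set_lebesgue_integral_def
    by (rule integral_eq_zero_AE) (use AE_lborel_singleton[of 0] in \<open>eventually_elim, simp\<close>)
  \<comment> \<open>the value at \<open>0\<close> makes the exponentially growing terms in \<open>above\<close> cancel\<close>
  have "c * (1 / (\<theta> + kappa q') - g 0 * EQ) = 0"
    using above[OF order_refl] unfolding Z0 I0 by (simp add: algebra_simps)
  then have gE: "g 0 * EQ = 1 / (\<theta> + kappa q')" using c by simp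
  then have g_0: "g 0 = 1 / q * ((kappa q' - kappa p) / (\<theta> + kappa q'))"
  proof -
    have "g 0 = g 0 * EQ * ((kappa q' - kappa p) / q)" unfolding EQ_def using kk q by simp
    then show ?thesis unfolding gE by simp
  qed
  have "g x = g 0 * Z x - I x"
  proof (cases "0 \<le> x")
    case True
    have "c * EQ * exp (kappa q' * x) * g 0 = c * exp (kappa q' * x) * (g 0 * EQ)" by simp
    also have "\<dots> = c * exp (kappa q' * x) / (\<theta> + kappa q')" unfolding gE by simp
    finally show ?thesis using above[OF True] by (simp add: right_diff_distrib mult.commute)
  next
    case False
    then have "I x = 0" by (simp add: I_def set_lebesgue_integral_def)
    then show ?thesis using below[of x] False by (simp add: Z_def scale_Z_def)
  qed
  then show ?thesis unfolding g_0 unfolding g_def Z_def I_def q'_def .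
qed

end

section \<open>Windows after the last positive time\<close>

lemma last_positive_time_constant:
  assumes "last_positive_time f u < t" "t \<le> u"
  shows "last_positive_time f t = last_positive_time f u"
proof (rule antisym)
  show "last_positive_time f t \<le> last_positive_time f u"
    unfolding last_positive_time_le_iff[OF last_positive_time_nonneg[of f u]]
  proof (intro allI impI)
    fix s assume "last_positive_time f u < s" "s \<le> t"
    then show "f s \<le> 0" using assms by (intro nonpos_after_last_positive_time[of f u s]) auto
  qed
  show "last_positive_time f u \<le> last_positive_time f t"
    unfolding last_positive_time_le_iff[OF last_positive_time_nonneg[of f t]]
  proof (intro allI impI)
    fix s assume s: "last_positive_time f t < s" "s \<le> u"
    show "f s \<le> 0"
    proof (cases "s \<le> t")
      case True then show ?thesis using s by (intro nonpos_after_last_positive_time[of f t s]) auto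
    next
      case False then show ?thesis using s assms by (intro nonpos_after_last_positive_time[of f u s]) auto
    qed
  qed
qed

text \<open>Having been at or below \<open>0\<close> for a while at time \<open>u\<close> splits at any time \<open>t\<close> inside that stretch into a condition on
the past of \<open>t\<close> and the event that the shifted path does not become positive.\<close>

lemma last_positive_time_less_iff:
  assumes t: "0 \<le> t" "t \<le> u" and u: "f u \<le> 0"
  shows "last_positive_time f u < t \<longleftrightarrow> last_positive_time f t < t \<and> \<not> hits (shift_path t f) (u - t)"
proof
  assume lt: "last_positive_time f u < t"
  then have eq: "last_positive_time f t = last_positive_time f u" using t by (intro last_positive_time_constant)
  have "\<not> hits (shift_path t f) (u - t)"
  proof
    assume "hits (shift_path t f) (u - t)"
    then obtain s where s: "0 \<le> s" "s < u - t" "0 < f (t + s)" using t by (auto simp: hits_def shift_path_eq)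
    then have "f (t + s) \<le> 0" using lt by (intro nonpos_after_last_positive_time[of f u]) auto
    then show False using s by simp
  qed
  then show "last_positive_time f t < t \<and> \<not> hits (shift_path t f) (u - t)" using lt eq by simp
next
  assume *: "last_positive_time f t < t \<and> \<not> hits (shift_path t f) (u - t)"
  have "last_positive_time f u \<le> last_positive_time f t"
    unfolding last_positive_time_le_iff[OF last_positive_time_nonneg[of f t]]
  proof (intro allI impI)
    fix s assume s: "last_positive_time f t < s" "s \<le> u"
    consider "s \<le> t" | "t < s" "s < u" | "s = u" using s by linarith
    then show "f s \<le> 0"
    proof cases
      case 1 then show ?thesis using s by (intro nonpos_after_last_positive_time[of f t s]) auto
    next
      case 2
      show ?thesis
      proof (rule ccontr)
        assume "\<not> f s \<le> 0"
        then have "hits (shift_path t f) (u - t)"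
          unfolding hits_def using 2 t by (intro exI[of _ "s - t"]) (simp add: shift_path_eq)
        then show False using * by simp
      qed
    qed (use u in simp)
  qed
  then show "last_positive_time f u < t" using * by simp
qed

text \<open>At an exceptional time the path is negative although it has been positive arbitrarily shortly before, so it has just
jumped into the negative half-line. Right continuity gives every such time its own interval on which the
path is negative, and these intervals are disjoint, so there are only countably many.\<close>

lemma last_positive_time_less_of_negative:
  assumes f: "f \<in> path_set"
  shows "AE u in lborel. 0 < u \<longrightarrow> f u < 0 \<longrightarrow> last_positive_time f u < u"
proof -
  define S where "S = {u. 0 < u \<and> f u < 0 \<and> \<not> last_positive_time f u < u}"
  have "\<exists>b>u. \<forall>v. u < v \<longrightarrow> v < b \<longrightarrow> f v < 0" if "u \<in> S" for u
  proof -
    have "\<forall>\<^sub>F v in at_right u. f v < 0" using path_setD(1)[OF f, of u] that by (intro order_tendstoD) (auto simp: S_def)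
    then show ?thesis using eventually_at_right[of u "u + 1"] by auto
  qed
  then obtain b where b: "\<And>u. u \<in> S \<Longrightarrow> u < b u" "\<And>u v. u \<in> S \<Longrightarrow> u < v \<Longrightarrow> v < b u \<Longrightarrow> f v < 0"
    by metis
  have sep: "b u \<le> u'" if S: "u \<in> S" "u' \<in> S" and lt: "u < u'" for u u'
  proof (rule ccontr)
    assume c: "\<not> b u \<le> u'"
    have "last_positive_time f u' \<le> u"
    proof (subst last_positive_time_le_iff)
      show "0 \<le> u" using S by (simp add: S_def)
      show "\<forall>s. u < s \<longrightarrow> s \<le> u' \<longrightarrow> f s \<le> 0"
      proof (intro allI impI)
        fix s assume "u < s" "s \<le> u'"
        then have "f s < 0" using b(2)[OF S(1)] c by auto
        then show "f s \<le> 0" by simp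
      qed
    qed
    then show False using S lt by (simp add: S_def)
  qed
  define I where "I u = {u<..<b u}" for u
  have disj: "I u \<inter> I u' = {}" if "u \<in> S" "u' \<in> S" "u \<noteq> u'" for u u'
    using that sep[of u u'] sep[of u' u] by (cases "u < u'") (auto simp: I_def)
  have ne: "I u \<noteq> {}" if "u \<in> S" for u using b(1)[OF that] by (simp add: I_def)
  have "inj_on I S"
  proof (rule inj_onI, rule ccontr)
    fix u u' assume "u \<in> S" "u' \<in> S" "I u = I u'" "u \<noteq> u'"
    then show False using disj[of u u'] ne[of u] by simp
  qed
  moreover have "countable (I ` S)"
  proof (rule countable_disjoint_open_subsets)
    show "pairwise disjnt (I ` S)" using disj by (fastforce simp: pairwise_def disjnt_def)
  qed (auto simp: I_def)
  ultimately have "countable S" by (rule countable_image_inj_on[rotated])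
  then have "S \<in> null_sets lborel" by (rule countable_imp_null_set_lborel)
  then have "AE u in lborel. u \<notin> S" by (rule AE_not_in)
  then show ?thesis by eventually_elim (auto simp: S_def)
qed

lemma kill_occ_right_continuous:
  assumes f: "f \<in> path_set" and p: "0 \<le> p" and q: "0 \<le> q" and a: "0 \<le> a"
  shows "((\<lambda>t. kill (occ_rate p q) t f) \<longlongrightarrow> kill (occ_rate p q) a f) (at_right a)"
proof -
  have "((\<lambda>t. kill (occ_rate p q) (t - a) (shift_path a f)) \<longlongrightarrow> 1) (at_right a)"
  proof (rule tendsto_sandwich)
    have ev: "\<forall>\<^sub>F t in at_right a. a < t" by (simp add: eventually_at_filter)
    show "\<forall>\<^sub>F t in at_right a. exp (- (p + q) * (t - a)) \<le> kill (occ_rate p q) (t - a) (shift_path a f)"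
      using ev by eventually_elim (intro kill_occ_ge shift_path_in_path_set f p q, simp)
    show "\<forall>\<^sub>F t in at_right a. kill (occ_rate p q) (t - a) (shift_path a f) \<le> exp (- p * (t - a))"
      using ev by eventually_elim (intro kill_occ_le shift_path_in_path_set f p q, simp)
    have "((\<lambda>t. exp (c * (t - a))) \<longlongrightarrow> exp (c * (a - a))) (at_right a)" for c :: real by (intro tendsto_intros)
    then show "((\<lambda>t. exp (- (p + q) * (t - a))) \<longlongrightarrow> 1) (at_right a)" "((\<lambda>t. exp (- p * (t - a))) \<longlongrightarrow> 1) (at_right a)"
      by (metis diff_self exp_zero mult_zero_right)+
  qed
  then have "((\<lambda>t. kill (occ_rate p q) a f * kill (occ_rate p q) (t - a) (shift_path a f)) \<longlongrightarrow> kill (occ_rate p q) a f * 1) (at_right a)"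
    by (intro tendsto_intros)
  moreover have "\<forall>\<^sub>F t in at_right a. kill (occ_rate p q) a f * kill (occ_rate p q) (t - a) (shift_path a f) = kill (occ_rate p q) t f"
  proof -
    have "\<forall>\<^sub>F t in at_right a. a < t" by (simp add: eventually_at_filter)
    then show ?thesis
    proof eventually_elim
      case (elim t)
      then show ?case
        using p q a by (intro kill_shift_path[OF f, where C="p + q", symmetric]) (auto simp: occ_rate_def indicator_def)
    qed
  qed
  ultimately show ?thesis by (simp add: Lim_transform_eventually)
qed

lemma kill_occ_eq:
  assumes f: "f \<in> path_set" and t: "0 \<le> t"
  shows "kill (occ_rate p q) t f = exp (- p * t - q * occupation_time f t)"
proof -
  have m: "(\<lambda>s. indicator {0..} (f s) :: real) \<in> borel_measurable borel"
    by (rule measurable_compose[OF path_measurable[OF f]]) simp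
  have c: "set_integrable lborel {0..t} (\<lambda>_. p)" "(LBINT s:{0..t}. p) = p * t"
    using t by (auto simp: set_lebesgue_integral_def intro!: borel_integrable_atLeastAtMost')
  have i: "set_integrable lborel {0..t} (\<lambda>s. q * indicator {0..} (f s))"
    by (intro set_integrable_mult_right set_integrable_bounded_Icc[OF m, where C=1]) simp_all
  show ?thesis
    unfolding kill_def occ_rate_def occupation_time_def set_integral_add(2)[OF c(1) i] c(2) by simp
qed

lemma kill_occ_add_rate:
  assumes "f \<in> path_set" "0 \<le> t"
  shows "kill (occ_rate (p + r) q) t f = exp (- r * t) * kill (occ_rate p q) t f"
  unfolding kill_occ_eq[OF assms] exp_add[symmetric] by (simp add: algebra_simps)

text \<open>After the last positive time the path is negative at almost all times, so only the constant rate \<open>p\<close> acts.\<close>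

lemma kill_occ_last_positive_time:
  assumes f: "f \<in> path_set" and nz: "AE t in lborel. 0 \<le> t \<longrightarrow> f t \<noteq> 0" and T: "last_positive_time f u \<le> u"
  shows "kill (occ_rate p q) (last_positive_time f u) f * exp (- p * (u - last_positive_time f u)) = kill (occ_rate p q) u f"
proof -
  define T where "T = last_positive_time f u"
  have T0: "0 \<le> T" "T \<le> u" using T by (simp_all add: T_def last_positive_time_nonneg)
  have m[measurable]: "(\<lambda>s. indicator {0..} (f s) :: real) \<in> borel_measurable borel"
    by (rule measurable_compose[OF path_measurable[OF f]]) simp
  have "occupation_time f u = occupation_time f T + (LBINT s:{T..u}. indicator {0..} (f s))"
    unfolding occupation_time_def using T0 by (intro LBINT_Icc_split[OF m, where C=1]) (auto simp: indicator_def)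
  moreover have "(LBINT s:{T..u}. indicator {0..} (f s)) = (LBINT s:{T..u}. 0 :: real)"
  proof (rule set_lebesgue_integral_cong_AE)
    have "AE s in lborel. s \<noteq> T" by (rule AE_lborel_singleton)
    with nz show "AE s\<in>{T..u} in lborel. indicator {0..} (f s) = (0 :: real)"
    proof eventually_elim
      case (elim s)
      show ?case
      proof
        assume "s \<in> {T..u}"
        then have "f s \<le> 0" using elim by (intro nonpos_after_last_positive_time[of f u]) (auto simp: T_def)
        then show "indicator {0..} (f s) = (0 :: real)" using elim \<open>s \<in> {T..u}\<close> T0 by (auto simp: indicator_def)
      qed
    qed
  qed auto
  ultimately have "occupation_time f u = occupation_time f T" by simp
  then show ?thesis
    unfolding T_def[symmetric] kill_occ_eq[OF f T0(1)] kill_occ_eq[OF f order_trans[OF T0]] exp_add[symmetric]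
    by (simp add: right_diff_distrib)
qed

context spectrally_negative_levy
begin

text \<open>The resolvent measure has no atoms, so the path spends no time at \<open>0\<close>.\<close>

lemma AE_path_nonzero:
  assumes q: "0 < q" and w: "is_scale_function psi q w"
  shows "AE f in path_law x. AE t in lborel. 0 \<le> t \<longrightarrow> f t \<noteq> 0"
proof -
  have "potential (free_weight q) (indicator {0}) x = (\<integral>\<^sup>+z. indicator {- x} z \<partial>mu q)"
  proof -
    have "indicator {0} (x + z) = (indicator {- x} z :: ennreal)" for z by (auto simp: indicator_def)
    then show ?thesis by (subst free_potential_eq) simp_all
  qed
  also have "\<dots> = 0" using mu_no_atoms[OF q w] by simp
  finally have "(\<integral>\<^sup>+f. (\<integral>\<^sup>+t\<in>{0..}. free_weight q t f * indicator {0} (f t) \<partial>lborel) \<partial>path_law x) = 0"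
    by (simp add: potential_def)
  then have "AE f in path_law x. (\<integral>\<^sup>+t\<in>{0..}. free_weight q t f * indicator {0} (f t) \<partial>lborel) = 0"
    by (subst (asm) nn_integral_0_iff_AE) measurable
  then show ?thesis using AE_space
  proof eventually_elim
    case (elim f)
    then have f: "f \<in> path_set" by simp
    have [measurable]: "(\<lambda>t. indicator {0} (f t) :: ennreal) \<in> borel_measurable borel"
      by (rule measurable_compose[OF path_measurable[OF f]]) simp
    have "(\<lambda>t. ennreal (exp (- q * t)) * indicator {0} (f t) * indicator {0..} t) \<in> borel_measurable lborel"
      by (intro borel_measurable_times_ennreal borel_measurable_indicator) simp_all
    from nn_integral_0_iff_AE[OF this] have "AE t in lborel. ennreal (exp (- q * t)) * indicator {0} (f t) * indicator {0..} t = 0"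
      using elim(1) unfolding free_weight_def by simp
    then show ?case by eventually_elim (auto simp: indicator_def split: if_splits)
  qed
qed

abbreviation "exit_value p q \<theta> f u \<equiv>
  kill (occ_rate p q) (last_positive_time f u) f * exp (\<theta> * f (last_positive_time f u))"

text \<open>The normalised indicator of the window of length \<open>1 / (n + 1)\<close> after the last positive time. At time \<open>t\<close> the window is
described by the last positive time before \<open>t\<close>, so the weight is a functional of the path up to \<open>t\<close>.\<close>

definition exit_weight :: "nat \<Rightarrow> real \<Rightarrow> real \<Rightarrow> real \<Rightarrow> (real \<Rightarrow> real) \<Rightarrow> ennreal" where
  "exit_weight n p q t f =
     (if last_positive_time f t < t \<and> t \<le> last_positive_time f t + 1 / real (Suc n)
      then ennreal (real (Suc n)) * ennreal (kill (occ_rate p q) t f) else 0)"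

lemma exit_weight_measurable: "case_prod (exit_weight n p q) \<in> borel_measurable (borel \<Otimes>\<^sub>M path_space)"
  unfolding exit_weight_def[abs_def] split_beta' by measurable

lemmas exit_weight_measurable_raw [measurable (raw)] = measurable_case_prod_comp[OF exit_weight_measurable]

lemma exit_weight_stop_path: "exit_weight n p q t (stop_path t f) = exit_weight n p q t f"
  unfolding exit_weight_def last_positive_time_stop_path kill_stop_path ..

lemma exit_weight_positive: "0 < f t \<Longrightarrow> exit_weight n p q t f = 0"
  using nonpos_after_last_positive_time[of f t t] by (auto simp: exit_weight_def)

text \<open>The Markov property at the window time \<open>t\<close> turns the left side into an integral over \<open>u\<close> and \<open>t \<le> u\<close>. For \<open>f u < 0\<close>, the
time \<open>t\<close> is in a window and the path does not become positive between \<open>t\<close> and \<open>u\<close> exactly if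
\<open>t\<close> lies in the window after \<open>T\<close>, the last positive time before \<open>u\<close>. Averages over this window converge to the
value at \<open>T\<close> by right continuity.\<close>

lemma exit_potential_limit:
  assumes a: "0 < a" "a \<le> p" and q: "0 \<le> q" and \<theta>: "0 \<le> \<theta>"
    and \<phi>[measurable]: "\<phi> \<in> borel_measurable borel" and \<phi>_le: "\<And>y. \<phi> y \<le> 1" and \<phi>_0: "\<And>y. 0 \<le> y \<Longrightarrow> \<phi> y = 0"
  shows "(\<lambda>n. potential (exit_weight n p q) (\<lambda>y. ennreal (exp (\<theta> * y)) * potential (unhit_weight a) \<phi> y) x)
    \<longlonglongrightarrow> (\<integral>\<^sup>+f. (\<integral>\<^sup>+u\<in>{0..}. (if last_positive_time f u < u
        then ennreal (exit_value p q \<theta> f u * exp (- a * (u - last_positive_time f u))) * \<phi> (f u)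
        else 0) \<partial>lborel) \<partial>path_law x)"
proof -
  define \<Psi> where "\<Psi> n t f = exit_weight n p q t f * ennreal (exp (\<theta> * f t))" for n t and f :: "real \<Rightarrow> real"
  have \<Psi>: "case_prod (\<Psi> n) \<in> borel_measurable (borel \<Otimes>\<^sub>M path_space)" for n
    unfolding \<Psi>_def split_beta' by measurable
  note [measurable (raw)] = measurable_case_prod_comp[OF \<Psi>]
  define w where "w n f u = (\<integral>\<^sup>+t\<in>{0..u}. \<Psi> n t f * (unhit_weight a (u - t) (shift_path t f) * \<phi> (shift_path t f (u - t))) \<partial>lborel)" for n f u
  have w: "case_prod (w n) \<in> borel_measurable (path_space \<Otimes>\<^sub>M borel)" for n
    unfolding w_def split_beta' by measurable
  have eq: "potential (exit_weight n p q) (\<lambda>y. ennreal (exp (\<theta> * y)) * potential (unhit_weight a) \<phi> y) x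
    = (\<integral>\<^sup>+f. (\<integral>\<^sup>+u\<in>{0..}. w n f u \<partial>lborel) \<partial>path_law x)" for n
  proof -
    have "potential (exit_weight n p q) (\<lambda>y. ennreal (exp (\<theta> * y)) * potential (unhit_weight a) \<phi> y) x
      = (\<integral>\<^sup>+f. (\<integral>\<^sup>+t\<in>{0..}. \<Psi> n t f * (\<integral>\<^sup>+g. (\<integral>\<^sup>+v\<in>{0..}. unhit_weight a v g * \<phi> (g v) \<partial>lborel) \<partial>path_law (f t)) \<partial>lborel) \<partial>path_law x)"
      by (simp add: potential_def \<Psi>_def mult.assoc)
    also have "\<dots> = (\<integral>\<^sup>+f. (\<integral>\<^sup>+u\<in>{0..}. w n f u \<partial>lborel) \<partial>path_law x)"
      unfolding w_def
    proof (rule markov_integrated)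
      show "\<Psi> n t (stop_path t f) = \<Psi> n t f" for t f
        by (simp add: \<Psi>_def exit_weight_stop_path stop_path_eq)
      show "(\<lambda>(v, g). unhit_weight a v g * \<phi> (g v)) \<in> borel_measurable (borel \<Otimes>\<^sub>M path_space)"
        unfolding split_beta' by measurable
    qed (rule \<Psi>)
    finally show ?thesis .
  qed
  \<comment> \<open>the cut-off at \<open>1\<close> is inactive in the windows, where \<open>f t \<le> 0\<close>, and keeps \<open>h\<close> bounded elsewhere\<close>
  define h where "h f u t = ennreal (kill (occ_rate p q) t f * min 1 (exp (\<theta> * f t)) * exp (- a * (u - t))) * indicator {0..u} t" for f u t
  have h_meas: "h f u \<in> borel_measurable borel" if f: "f \<in> path_set" for f u
  proof -
    have [measurable]: "(\<lambda>t. kill (occ_rate p q) t f) \<in> borel_measurable borel"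
      using f by (intro measurable_kill) simp_all
    have [measurable]: "(\<lambda>t. exp (\<theta> * f t)) \<in> borel_measurable borel"
      by (rule measurable_compose[OF path_measurable[OF f]]) simp
    show ?thesis unfolding h_def by measurable
  qed
  have h_le: "h f u t \<le> ennreal (exp (- a * u))" if f: "f \<in> path_set" for f u t
  proof (cases "t \<in> {0..u}")
    case True
    have "kill (occ_rate p q) t f \<le> exp (- p * t)" using a q True by (intro kill_occ_le f) auto
    also have "\<dots> \<le> exp (- a * t)" using a True by (auto intro!: mult_right_mono)
    finally have "kill (occ_rate p q) t f * min 1 (exp (\<theta> * f t)) * exp (- a * (u - t)) \<le> exp (- a * t) * 1 * exp (- a * (u - t))"
      by (intro mult_mono) (auto simp: kill_def)
    also have "\<dots> = exp (- a * u)" by (simp add: exp_add[symmetric] algebra_simps)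
    finally show ?thesis using True by (auto simp: h_def intro!: ennreal_leI)
  qed (simp add: h_def)
  have w_eq: "w n f u = \<phi> (f u) * (\<integral>\<^sup>+t. ennreal (real (Suc n)) * h f u t * indicator {last_positive_time f u<..last_positive_time f u + 1 / real (Suc n)} t \<partial>lborel)"
    if f: "f \<in> path_set" for n f u
  proof (cases "f u < 0")
    case True
    have "w n f u = (\<integral>\<^sup>+t. \<phi> (f u) * (ennreal (real (Suc n)) * h f u t * indicator {last_positive_time f u<..last_positive_time f u + 1 / real (Suc n)} t) \<partial>lborel)"
      unfolding w_def
    proof (rule nn_integral_cong)
      fix t
      show "\<Psi> n t f * (unhit_weight a (u - t) (shift_path t f) * \<phi> (shift_path t f (u - t))) * indicator {0..u} t
        = \<phi> (f u) * (ennreal (real (Suc n)) * h f u t * indicator {last_positive_time f u<..last_positive_time f u + 1 / real (Suc n)} t)"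
      proof (cases "t \<in> {0..u}")
        case t: True
        then have s: "shift_path t f (u - t) = f u" by (simp add: shift_path_eq)
        have iff: "last_positive_time f u < t \<longleftrightarrow> last_positive_time f t < t \<and> \<not> hits (shift_path t f) (u - t)"
          using t True by (intro last_positive_time_less_iff) auto
        show ?thesis
        proof (cases "last_positive_time f u < t")
          case lt: True
          have T: "last_positive_time f t = last_positive_time f u" using lt t by (intro last_positive_time_constant) auto
          have "f t \<le> 0" using lt t by (intro nonpos_after_last_positive_time[of f u]) auto
          then have m: "min 1 (exp (\<theta> * f t)) = exp (\<theta> * f t)" using \<theta> by (simp add: mult_nonneg_nonpos)
          have k: "0 \<le> kill (occ_rate p q) t f" by (simp add: kill_def)
          have "\<not> hits (shift_path t f) (u - t)" using iff lt by simp
          then show ?thesis using lt t k unfolding \<Psi>_def exit_weight_def unhit_weight_def h_def s m T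
            by (simp add: ennreal_mult mult_ac indicator_def del: of_nat_Suc)
        next
          case False
          then show ?thesis using iff by (auto simp: \<Psi>_def exit_weight_def unhit_weight_def)
        qed
      qed (simp add: h_def)
    qed
    also have "\<dots> = \<phi> (f u) * (\<integral>\<^sup>+t. ennreal (real (Suc n)) * h f u t * indicator {last_positive_time f u<..last_positive_time f u + 1 / real (Suc n)} t \<partial>lborel)"
    proof (rule nn_integral_cmult)
      have [measurable]: "h f u \<in> borel_measurable borel" by (rule h_meas[OF f])
      show "(\<lambda>t. ennreal (real (Suc n)) * h f u t * indicator {last_positive_time f u<..last_positive_time f u + 1 / real (Suc n)} t) \<in> borel_measurable lborel"
        by (intro borel_measurable_times_ennreal borel_measurable_indicator) simp_all
    qed
    finally show ?thesis .
  next
    case False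
    then have "w n f u = (\<integral>\<^sup>+(t::real). 0 \<partial>lborel)" unfolding w_def
      by (intro nn_integral_cong) (auto simp: indicator_def shift_path_eq \<phi>_0)
    then show ?thesis using False by (simp add: \<phi>_0)
  qed
  show ?thesis
    unfolding eq
  proof (rule path_time_dominated_convergence[OF a(1) w])
    show "(\<lambda>(f, u). if last_positive_time f u < u
        then ennreal (exit_value p q \<theta> f u * exp (- a * (u - last_positive_time f u))) * \<phi> (f u)
        else 0) \<in> borel_measurable (path_space \<Otimes>\<^sub>M borel)"
      unfolding split_beta' by measurable
    show "AE f in path_law x. \<forall>n. AE u in lborel. 0 \<le> u \<longrightarrow> w n f u \<le> ennreal (1 * exp (- a * u))"
      using AE_space
    proof eventually_elim
      case (elim f)
      then have f: "f \<in> path_set" by simp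
      show ?case
      proof (intro allI AE_I2 impI)
        fix n u
        define T where "T = last_positive_time f u"
        have "(\<integral>\<^sup>+t. ennreal (real (Suc n)) * h f u t * indicator {T<..T + 1 / real (Suc n)} t \<partial>lborel)
          \<le> (\<integral>\<^sup>+t. (ennreal (real (Suc n)) * ennreal (exp (- a * u))) * indicator {T<..T + 1 / real (Suc n)} t \<partial>lborel)"
          by (intro nn_integral_mono mult_right_mono mult_left_mono h_le f) simp_all
        also have "\<dots> = ennreal (exp (- a * u))"
          by (subst nn_integral_cmult) (simp_all add: ennreal_mult[symmetric] del: of_nat_Suc)
        finally have "\<phi> (f u) * (\<integral>\<^sup>+t. ennreal (real (Suc n)) * h f u t * indicator {T<..T + 1 / real (Suc n)} t \<partial>lborel)
          \<le> 1 * ennreal (exp (- a * u))"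
          by (intro mult_mono \<phi>_le) simp_all
        then show "w n f u \<le> ennreal (1 * exp (- a * u))" by (simp add: w_eq[OF f] T_def del: of_nat_Suc)
      qed
    qed
    show "AE f in path_law x. AE u in lborel. 0 \<le> u \<longrightarrow> (\<lambda>n. w n f u) \<longlonglongrightarrow> (if last_positive_time f u < u
        then ennreal (exit_value p q \<theta> f u * exp (- a * (u - last_positive_time f u))) * \<phi> (f u)
        else 0)"
      using AE_space
    proof eventually_elim
      case (elim f)
      then have f: "f \<in> path_set" by simp
      show ?case
      proof (intro AE_I2 impI)
        fix u :: real assume u: "0 \<le> u"
        define T where "T = last_positive_time f u"
        have T: "0 \<le> T" by (simp add: T_def last_positive_time_nonneg)
        define l where "l = (if T < u then ennreal (kill (occ_rate p q) T f * exp (\<theta> * f T) * exp (- a * (u - T))) else 0)"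
        have "(h f u \<longlongrightarrow> l) (at_right T)"
        proof (cases "T < u")
          case True
          have ev: "\<forall>\<^sub>F t in at_right T. T < t \<and> t < u" using True unfolding eventually_at_right[OF True] by (intro exI[of _ u]) auto
          have "f T \<le> 0"
          proof (rule tendsto_upperbound[OF path_setD(1)[OF f, of T]])
            show "\<forall>\<^sub>F t in at_right T. f t \<le> 0"
              using ev by eventually_elim (auto intro: nonpos_after_last_positive_time[of f u] simp: T_def)
          qed simp
          then have m: "min 1 (exp (\<theta> * f T)) = exp (\<theta> * f T)" using \<theta> by (simp add: mult_nonneg_nonpos)
          have "((\<lambda>t. ennreal (kill (occ_rate p q) t f * min 1 (exp (\<theta> * f t)) * exp (- a * (u - t))))
            \<longlongrightarrow> ennreal (kill (occ_rate p q) T f * min 1 (exp (\<theta> * f T)) * exp (- a * (u - T)))) (at_right T)"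
            using a q T by (intro tendsto_intros tendsto_ennrealI kill_occ_right_continuous f path_setD(1)[OF f]) auto
          moreover have "\<forall>\<^sub>F t in at_right T. ennreal (kill (occ_rate p q) t f * min 1 (exp (\<theta> * f t)) * exp (- a * (u - t))) = h f u t"
            using ev by eventually_elim (use T in \<open>simp add: h_def\<close>)
          ultimately show ?thesis using True unfolding l_def m by (simp add: Lim_transform_eventually)
        next
          case False
          have "\<forall>\<^sub>F t in at_right T. T < t" by (simp add: eventually_at_filter)
          then have "\<forall>\<^sub>F t in at_right T. 0 = h f u t" by eventually_elim (use False in \<open>simp add: h_def\<close>)
          then show ?thesis using False unfolding l_def by (simp add: Lim_transform_eventually[OF tendsto_const])
        qed
        then have "(\<lambda>n. \<integral>\<^sup>+t. ennreal (real (Suc n)) * h f u t * indicator {T<..T + 1 / real (Suc n)} t \<partial>lborel) \<longlonglongrightarrow> l"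
          by (rule window_average_tendsto[OF h_meas[OF f] h_le[OF f]])
        moreover have "\<phi> (f u) \<noteq> top" "l \<noteq> top"
          using \<phi>_le[of "f u"] by (auto simp: l_def top_unique)
        ultimately have "(\<lambda>n. w n f u) \<longlonglongrightarrow> \<phi> (f u) * l"
          unfolding w_eq[OF f] T_def[symmetric] by (intro tendsto_mult_ennreal tendsto_const) simp_all
        then show "(\<lambda>n. w n f u) \<longlonglongrightarrow> (if last_positive_time f u < u
          then ennreal (exit_value p q \<theta> f u * exp (- a * (u - last_positive_time f u))) * \<phi> (f u)
          else 0)"
          unfolding T_def[symmetric] l_def by (simp add: mult.commute if_distrib cong: if_cong)
      qed
    qed
  qed
qed

end

section \<open>Letting the windows shrink\<close>

context spectrally_negative_levy
begin

definition exit_laplace :: "nat \<Rightarrow> real \<Rightarrow> real \<Rightarrow> real \<Rightarrow> real \<Rightarrow> real" where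
  "exit_laplace n p q x b = (\<integral>z. exp (b * z) \<partial>potential_measure (exit_weight n p q) x)"

lemma finite_measure_exit:
  assumes p: "0 < p" and q: "0 \<le> q"
  shows "finite_measure (potential_measure (exit_weight n p q) x)"
proof (rule finite_measureI)
  have "emeasure (potential_measure (exit_weight n p q) x) UNIV = potential (exit_weight n p q) (\<lambda>_. 1) x"
    using nn_integral_potential_measure[OF exit_weight_measurable, of "\<lambda>_. 1" n p q x] by simp
  also have "\<dots> \<le> potential (free_weight p) (\<lambda>_. ennreal (real (Suc n))) x"
  proof (rule potential_mono)
    fix t f assume t: "0 \<le> (t :: real)" and f: "f \<in> path_set"
    have "exit_weight n p q t f \<le> ennreal (real (Suc n)) * ennreal (kill (occ_rate p q) t f)"
      by (simp add: exit_weight_def)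
    also have "\<dots> \<le> ennreal (real (Suc n)) * free_weight p t f"
      unfolding free_weight_def using p q t by (intro mult_left_mono ennreal_leI kill_occ_le f) auto
    finally show "exit_weight n p q t f * 1 \<le> free_weight p t f * ennreal (real (Suc n))"
      by (simp add: mult.commute)
  qed
  also have "\<dots> < top" unfolding free_potential_one[OF p] by (simp add: ennreal_mult_less_top)
  finally show "emeasure (potential_measure (exit_weight n p q) x) (space (potential_measure (exit_weight n p q) x)) \<noteq> \<infinity>"
    by simp
qed

lemma AE_exit_nonpos: "AE z in potential_measure (exit_weight n p q) x. z \<le> 0"
proof -
  have "emeasure (potential_measure (exit_weight n p q) x) {0<..} = potential (exit_weight n p q) (indicator {0<..}) x"
    using nn_integral_potential_measure[OF exit_weight_measurable, of "indicator {0<..}" n p q x] by simp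
  also have "\<dots> \<le> potential (exit_weight n p q) (\<lambda>_. 0) x"
    by (rule potential_mono) (auto simp: indicator_def exit_weight_positive)
  also have "\<dots> = 0" by (simp add: potential_def)
  finally have "{0<..} \<in> null_sets (potential_measure (exit_weight n p q) x)" by auto
  then have "AE z in potential_measure (exit_weight n p q) x. z \<notin> {0<..}" by (rule AE_not_in)
  then show ?thesis by eventually_elim auto
qed

lemma integrable_exit_exp:
  assumes p: "0 < p" and q: "0 \<le> q" and b: "0 \<le> b"
  shows "integrable (potential_measure (exit_weight n p q) x) (\<lambda>z. exp (b * z))"
proof -
  interpret finite_measure "potential_measure (exit_weight n p q) x" by (rule finite_measure_exit[OF p q])
  show ?thesis
  proof (rule integrable_const_bound)
    show "AE z in potential_measure (exit_weight n p q) x. norm (exp (b * z)) \<le> 1"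
      using AE_exit_nonpos by eventually_elim (use b in \<open>simp add: mult_nonneg_nonpos\<close>)
  qed simp
qed

lemma unhit_exp_nonneg:
  assumes a: "0 < a" and \<alpha>: "0 \<le> \<alpha>" and y: "y \<le> 0"
  shows "0 \<le> (exp (\<alpha> * y) - exp (kappa a * y)) / (a - psi \<alpha>)"
proof (cases "\<alpha> < kappa a")
  case True
  then have "psi \<alpha> < a" "kappa a * y \<le> \<alpha> * y" using a \<alpha> y by (auto simp: psi_less_iff intro: mult_right_mono_neg)
  then show ?thesis by simp
next
  case False
  then have "a \<le> psi \<alpha>" "\<alpha> * y \<le> kappa a * y" using psi_less_iff[OF a \<alpha>] y by (auto intro: mult_right_mono_neg)
  then show ?thesis by (simp add: divide_nonpos_nonpos)
qed

text \<open>Windows lie where the path is at or below \<open>0\<close>, and there the killed resolvent of an exponential is a difference of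
two exponentials.\<close>

lemma exit_unhit_potential:
  fixes x :: real
  assumes p: "0 < p" and q: "0 \<le> q" and a: "0 < a" and \<theta>: "0 \<le> \<theta>" and \<alpha>: "0 \<le> \<alpha>" "\<alpha> \<noteq> kappa a"
  defines "d n \<equiv> (exit_laplace n p q x (\<theta> + \<alpha>) - exit_laplace n p q x (\<theta> + kappa a)) / (a - psi \<alpha>)"
  shows "potential (exit_weight n p q) (\<lambda>y. ennreal (exp (\<theta> * y)) *
      potential (unhit_weight a) (\<lambda>z. ennreal (exp (\<alpha> * z)) * indicator {..<0} z) y) x = ennreal (d n)"
    and "0 \<le> d n"
proof -
  define N where "N = potential_measure (exit_weight n p q) x"
  define g where "g z = (exp ((\<theta> + \<alpha>) * z) - exp ((\<theta> + kappa a) * z)) / (a - psi \<alpha>)" for z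
  have g: "g z = exp (\<theta> * z) * ((exp (\<alpha> * z) - exp (kappa a * z)) / (a - psi \<alpha>))" for z
    by (simp add: g_def exp_add distrib_right right_diff_distrib)
  have neg: "AE z in N. z \<le> 0" unfolding N_def by (rule AE_exit_nonpos)
  have nn: "AE z in N. 0 \<le> g z"
    using neg by eventually_elim (unfold g, intro mult_nonneg_nonneg unhit_exp_nonneg a \<alpha>, simp_all)
  have i: "integrable N (\<lambda>z. exp ((\<theta> + \<alpha>) * z))" "integrable N (\<lambda>z. exp ((\<theta> + kappa a) * z))"
    unfolding N_def using \<theta> \<alpha> kappa_pos[OF a] by (auto intro!: integrable_exit_exp p q)
  have int: "integrable N g" unfolding g_def using i by simp
  have d: "d n = (\<integral>z. g z \<partial>N)" unfolding g_def d_def exit_laplace_def N_def[symmetric] using i by simp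
  have "potential (exit_weight n p q) (\<lambda>y. ennreal (exp (\<theta> * y)) *
      potential (unhit_weight a) (\<lambda>z. ennreal (exp (\<alpha> * z)) * indicator {..<0} z) y) x
    = (\<integral>\<^sup>+y. ennreal (exp (\<theta> * y)) * potential (unhit_weight a) (\<lambda>z. ennreal (exp (\<alpha> * z)) * indicator {..<0} z) y \<partial>N)"
    unfolding N_def by (rule nn_integral_potential_measure[OF exit_weight_measurable, symmetric]) measurable
  also have "\<dots> = (\<integral>\<^sup>+y. ennreal (g y) \<partial>N)"
  proof (rule nn_integral_cong_AE)
    show "AE y in N. ennreal (exp (\<theta> * y)) * potential (unhit_weight a) (\<lambda>z. ennreal (exp (\<alpha> * z)) * indicator {..<0} z) y = ennreal (g y)"
      using neg
    proof eventually_elim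
      case (elim y)
      show ?case unfolding g unhit_exp[OF a \<alpha> elim] by (rule ennreal_mult'[symmetric]) simp
    qed
  qed
  also have "\<dots> = ennreal (d n)" unfolding d by (rule nn_integral_eq_integral[OF int nn])
  finally show "potential (exit_weight n p q) (\<lambda>y. ennreal (exp (\<theta> * y)) *
      potential (unhit_weight a) (\<lambda>z. ennreal (exp (\<alpha> * z)) * indicator {..<0} z) y) x = ennreal (d n)" .
  show "0 \<le> d n" unfolding d by (rule integral_nonneg_AE[OF nn])
qed

text \<open>For \<open>\<theta> = 0\<close> and rate \<open>a = p\<close> the limit of the window integrals is an ordinary potential: the discount up to the last
positive time and the discount at rate \<open>p\<close> afterwards combine to the discount up to \<open>u\<close>.\<close>

lemma occ_potential_by_exit:
  assumes p: "0 < p" and q: "0 < q" and w: "is_scale_function psi (p + q) w" and [measurable]: "\<phi> \<in> borel_measurable borel"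
    and \<phi>_0: "\<And>y. 0 \<le> y \<Longrightarrow> \<phi> y = 0"
  shows "(\<integral>\<^sup>+f. (\<integral>\<^sup>+u\<in>{0..}. (if last_positive_time f u < u
        then ennreal (exit_value p q 0 f u * exp (- p * (u - last_positive_time f u))) * \<phi> (f u)
        else 0) \<partial>lborel) \<partial>path_law x) = potential (occ_weight p q) \<phi> x"
  unfolding potential_def
proof (rule nn_integral_cong_AE)
  have pq: "0 < p + q" using p q by simp
  show "AE f in path_law x. (\<integral>\<^sup>+u\<in>{0..}. (if last_positive_time f u < u
        then ennreal (exit_value p q 0 f u * exp (- p * (u - last_positive_time f u))) * \<phi> (f u)
        else 0) \<partial>lborel) = (\<integral>\<^sup>+u\<in>{0..}. occ_weight p q u f * \<phi> (f u) \<partial>lborel)"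
    using AE_path_nonzero[OF pq w] AE_space
  proof eventually_elim
    case (elim f)
    then have f: "f \<in> path_set" by simp
    show ?case
    proof (rule nn_integral_cong_AE)
      have "AE u in lborel. u \<noteq> (0 :: real)" by (rule AE_lborel_singleton)
      with last_positive_time_less_of_negative[OF f]
      show "AE u in lborel. (if last_positive_time f u < u
        then ennreal (exit_value p q 0 f u * exp (- p * (u - last_positive_time f u))) * \<phi> (f u)
        else 0) * indicator {0..} u = occ_weight p q u f * \<phi> (f u) * indicator {0..} u"
      proof eventually_elim
        case (elim u)
        then show ?case
          using kill_occ_last_positive_time[OF f \<open>AE t in lborel. 0 \<le> t \<longrightarrow> f t \<noteq> 0\<close>, of u p q] \<phi>_0[of "f u"]
          by (cases "last_positive_time f u < u"; cases "0 < u"; cases "f u < 0") (auto simp: occ_weight_def indicator_def)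
      qed
    qed
  qed
qed

text \<open>Both sides vanish at \<open>\<alpha> = kappa p\<close>, the case in which the formula for the killed resolvent is not available.\<close>

lemma exit_laplace_limit:
  assumes p: "0 < p" and q: "0 < q" and w: "is_scale_function psi (p + q) w" and \<alpha>: "0 \<le> \<alpha>"
  shows "(\<lambda>n. exit_laplace n p q x \<alpha> - exit_laplace n p q x (kappa p))
    \<longlonglongrightarrow> (p - psi \<alpha>) * enn2real (potential (occ_weight p q) (\<lambda>z. ennreal (exp (\<alpha> * z)) * indicator {..<0} z) x)"
proof (cases "\<alpha> = kappa p")
  case True
  then show ?thesis using p by (simp add: psi_kappa)
next
  case False
  define \<phi> where "\<phi> z = ennreal (exp (\<alpha> * z)) * indicator {..<0} z" for z
  have [measurable]: "\<phi> \<in> borel_measurable borel" unfolding \<phi>_def by measurable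
  have \<phi>: "\<phi> y \<le> ennreal 1" "0 \<le> y \<Longrightarrow> \<phi> y = 0" for y
    using \<alpha> by (auto simp: \<phi>_def indicator_def mult_nonneg_nonpos)
  define d where "d n = (exit_laplace n p q x (0 + \<alpha>) - exit_laplace n p q x (0 + kappa p)) / (p - psi \<alpha>)" for n
  have e: "potential (exit_weight n p q) (\<lambda>y. ennreal (exp (0 * y)) * potential (unhit_weight p) \<phi> y) x = ennreal (d n)" "0 \<le> d n" for n
    using exit_unhit_potential[where x=x and n=n and p=p and q=q and a=p and \<theta>=0 and \<alpha>=\<alpha>] p q \<alpha> False unfolding \<phi>_def d_def by simp_all
  have "(\<lambda>n. ennreal (d n)) \<longlonglongrightarrow> potential (occ_weight p q) \<phi> x"
    unfolding e(1)[symmetric]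
    by (subst occ_potential_by_exit[OF p q w, symmetric]; (rule exit_potential_limit)?)
       (use p q \<phi> in auto)
  moreover have "potential (occ_weight p q) \<phi> x \<noteq> top"
    using occ_potential_le[OF p q, where \<phi>=\<phi> and B=1 and x=x] \<phi>(1) by (auto simp: top_unique ennreal_mult_eq_top_iff)
  ultimately have "(\<lambda>n. enn2real (ennreal (d n))) \<longlonglongrightarrow> enn2real (potential (occ_weight p q) \<phi> x)"
    by (intro tendsto_enn2real) (auto simp: less_top)
  then have "(\<lambda>n. (p - psi \<alpha>) * d n) \<longlonglongrightarrow> (p - psi \<alpha>) * enn2real (potential (occ_weight p q) \<phi> x)"
    using e(2) by (intro tendsto_intros) simp
  moreover have "psi \<alpha> \<noteq> p"
    using psi_less_iff[OF p \<alpha>] psi_greater[OF p, of \<alpha>] False by (cases "\<alpha> < kappa p") auto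
  ultimately show ?thesis unfolding \<phi>_def d_def by simp
qed

text \<open>The value \<open>\<theta>\<close> is carried to the last positive time by \<open>exp (\<theta> * y)\<close>, and the killed resolvent at rate \<open>r\<close> of the negative
half-line adds the exponent \<open>kappa r\<close>. The resulting difference of exponential moments is compared
with \<open>exit_laplace_limit\<close> at \<open>\<theta>\<close> and at \<open>\<theta> + kappa r\<close>, where the term at \<open>kappa (p + r)\<close> cancels.\<close>

theorem last_exit_potential:
  fixes x :: real
  assumes p: "0 < p" and r: "0 < r" and q: "0 < q" and w: "is_scale_function psi (p + r + q) w" and \<theta>: "0 \<le> \<theta>"
  defines "G \<alpha> \<equiv> (p + r - psi \<alpha>) * enn2real (potential (occ_weight (p + r) q) (\<lambda>z. ennreal (exp (\<alpha> * z)) * indicator {..<0} z) x)"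
  shows "r * enn2real (\<integral>\<^sup>+f. (\<integral>\<^sup>+u\<in>{0..}. (if last_positive_time f u < u
      then ennreal (exit_value p q \<theta> f u * exp (- r * u))
      else 0) \<partial>lborel) \<partial>path_law x) = G \<theta> - G (\<theta> + kappa r)"
proof -
  have pr: "0 < p + r" "0 < p + r + q" using p q r by simp_all
  define \<phi> where "\<phi> z = ennreal (exp (0 * z)) * indicator {..<0} z" for z :: real
  have [measurable]: "\<phi> \<in> borel_measurable borel" unfolding \<phi>_def by measurable
  have \<phi>: "\<phi> y \<le> 1" "0 \<le> y \<Longrightarrow> \<phi> y = 0" for y by (auto simp: \<phi>_def indicator_def)
  define d where "d n = (exit_laplace n (p + r) q x (\<theta> + 0) - exit_laplace n (p + r) q x (\<theta> + kappa r)) / (r - psi 0)" for n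
  have e: "potential (exit_weight n (p + r) q) (\<lambda>y. ennreal (exp (\<theta> * y)) * potential (unhit_weight r) \<phi> y) x = ennreal (d n)" "0 \<le> d n" for n
    using exit_unhit_potential[where x=x and n=n and p="p + r" and q=q and a=r and \<theta>=\<theta> and \<alpha>=0] pr q r \<theta> kappa_pos[OF r] unfolding \<phi>_def d_def by simp_all
  define V where "V = (\<integral>\<^sup>+f. (\<integral>\<^sup>+u\<in>{0..}. (if last_positive_time f u < u
      then ennreal (exit_value p q \<theta> f u * exp (- r * u))
      else 0) \<partial>lborel) \<partial>path_law x)"
  define V' where "V' = (\<integral>\<^sup>+f. (\<integral>\<^sup>+u\<in>{0..}. (if last_positive_time f u < u
        then ennreal (exit_value (p + r) q \<theta> f u * exp (- r * (u - last_positive_time f u))) * \<phi> (f u)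
        else 0) \<partial>lborel) \<partial>path_law x)"
  have "(\<lambda>n. ennreal (d n)) \<longlonglongrightarrow> V'"
    unfolding e(1)[symmetric] V'_def by (rule exit_potential_limit) (use p q r \<theta> \<phi> in auto)
  moreover have "V' = V"
    unfolding V'_def V_def
  proof (rule nn_integral_cong_AE)
    show "AE f in path_law x. (\<integral>\<^sup>+u\<in>{0..}. (if last_positive_time f u < u
        then ennreal (exit_value (p + r) q \<theta> f u * exp (- r * (u - last_positive_time f u))) * \<phi> (f u)
        else 0) \<partial>lborel) = (\<integral>\<^sup>+u\<in>{0..}. (if last_positive_time f u < u
      then ennreal (exit_value p q \<theta> f u * exp (- r * u))
      else 0) \<partial>lborel)"
      using AE_path_nonzero[OF pr(2) w] AE_space
    proof eventually_elim
      case (elim f)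
      then have f: "f \<in> path_set" by simp
      show ?case
      proof (rule nn_integral_cong_AE)
        from elim(1) show "AE u in lborel. (if last_positive_time f u < u
          then ennreal (exit_value (p + r) q \<theta> f u * exp (- r * (u - last_positive_time f u))) * \<phi> (f u)
          else 0) * indicator {0..} u = (if last_positive_time f u < u
          then ennreal (exit_value p q \<theta> f u * exp (- r * u))
          else 0) * indicator {0..} u"
        proof eventually_elim
          case (elim u)
          show ?case
          proof (cases "last_positive_time f u < u")
            case True
            define T where "T = last_positive_time f u"
            have T: "0 \<le> T" by (simp add: T_def last_positive_time_nonneg)
            have "f u \<le> 0" using nonpos_after_last_positive_time[of f u u] True by simp
            then have "f u < 0" using elim True T by (auto simp: T_def)
            then have "\<phi> (f u) = 1" by (simp add: \<phi>_def)
            moreover have "exp (- r * T) * exp (- r * (u - T)) = exp (- r * u)"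
              by (simp add: exp_add[symmetric] algebra_simps)
            then have "kill (occ_rate (p + r) q) T f * exp (\<theta> * f T) * exp (- r * (u - T))
              = kill (occ_rate p q) T f * exp (\<theta> * f T) * exp (- r * u)"
              unfolding kill_occ_add_rate[OF f T] by (metis mult.assoc mult.commute)
            ultimately show ?thesis by (simp only: T_def mult_1_right)
          qed simp
        qed
      qed
    qed
  qed
  ultimately have lim: "(\<lambda>n. ennreal (d n)) \<longlonglongrightarrow> V" by simp
  have G: "(\<lambda>n. exit_laplace n (p + r) q x \<alpha> - exit_laplace n (p + r) q x (kappa (p + r))) \<longlonglongrightarrow> G \<alpha>" if "0 \<le> \<alpha>" for \<alpha>
    unfolding G_def using pr q w that by (intro exit_laplace_limit) auto
  have "(\<lambda>n. ((exit_laplace n (p + r) q x \<theta> - exit_laplace n (p + r) q x (kappa (p + r)))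
      - (exit_laplace n (p + r) q x (\<theta> + kappa r) - exit_laplace n (p + r) q x (kappa (p + r)))) / r)
    \<longlonglongrightarrow> (G \<theta> - G (\<theta> + kappa r)) / r"
    using \<theta> kappa_pos[OF r] r by (intro tendsto_divide tendsto_diff G tendsto_const) auto
  then have d: "d \<longlonglongrightarrow> (G \<theta> - G (\<theta> + kappa r)) / r" by (simp add: d_def[abs_def] psi_0)
  then have "(\<lambda>n. ennreal (d n)) \<longlonglongrightarrow> ennreal ((G \<theta> - G (\<theta> + kappa r)) / r)" by (rule tendsto_ennrealI)
  with lim have "V = ennreal ((G \<theta> - G (\<theta> + kappa r)) / r)" by (rule LIMSEQ_unique)
  moreover have "0 \<le> (G \<theta> - G (\<theta> + kappa r)) / r" using LIMSEQ_le_const[OF d] e(2) by auto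
  ultimately show ?thesis using r unfolding V_def by simp
qed

end

section \<open>Evaluation at an exponential time\<close>

context spectrally_negative_levy
begin

text \<open>Independence of \<open>e\<close> from the process gives a product law for path and clock.\<close>

lemma nn_integral_independent_exponential_time:
  assumes e: "distributed M lborel e (exponential_density r)"
    and indep: "indep_set (var_sigma M e) (path_sigma M X {0..})"
    and F: "case_prod F \<in> borel_measurable (path_space \<Otimes>\<^sub>M borel)"
  shows "(\<integral>\<^sup>+\<omega>. F (\<lambda>t. x + increments 0 \<omega> t) (e \<omega>) \<partial>M)
    = (\<integral>\<^sup>+f. (\<integral>\<^sup>+u\<in>{0..}. F f u * ennreal (r * exp (- r * u)) \<partial>lborel) \<partial>path_law x)"
proof -
  note [measurable (raw)] = measurable_case_prod_comp[OF F]
  define Y where "Y \<omega> = (\<lambda>t. x + increments 0 \<omega> t)" for \<omega>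
  have Y[measurable]: "Y \<in> measurable M path_space" unfolding Y_def by measurable
  have e_meas[measurable]: "e \<in> borel_measurable M" using distributed_measurable[OF e] by simp
  define A where "A = vimage_algebra (space M) (\<lambda>\<omega>. \<lambda>t\<in>{0..}. X t \<omega>) (PiM {0..} (\<lambda>_. borel :: real measure))"
  have A: "sets A = path_sigma M X {0..}" "space A = space M" by (simp_all add: A_def path_sigma_def)
  have "(\<lambda>\<omega>. \<lambda>t\<in>{0..}. X t \<omega>) \<in> measurable A (PiM {0..} (\<lambda>_. borel))"
    unfolding A_def by (rule measurable_vimage_algebra1) (auto simp: space_PiM)
  note A_map = this
  have comp: "X t \<in> borel_measurable A" if "0 \<le> t" for t
    using measurable_compose[OF A_map measurable_component_singleton[of t]] that by simp
  have YA: "Y \<in> measurable A path_space"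
  proof (rule measurable_path_spaceI)
    show "\<omega> \<in> space A \<Longrightarrow> Y \<omega> \<in> path_set" for \<omega>
      using measurable_space[OF Y] by (simp add: A)
    show "(\<lambda>\<omega>. Y \<omega> t) \<in> borel_measurable A" for t
      unfolding Y_def increments_def by (intro borel_measurable_add borel_measurable_diff comp) auto
  qed
  interpret P: prob_space "path_law x" by (rule prob_space_path_law)
  interpret L: prob_space "distr M lborel e" by (rule prob_space_distr) measurable
  have joint: "path_law x \<Otimes>\<^sub>M distr M lborel e = distr M (path_space \<Otimes>\<^sub>M borel) (\<lambda>\<omega>. (Y \<omega>, e \<omega>))"
  proof (rule pair_measure_eqI)
    fix C B assume "C \<in> sets (path_law x)" "B \<in> sets (distr M lborel e)"
    then have C[measurable]: "C \<in> sets path_space" and B[measurable]: "B \<in> sets borel" by auto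
    have "e -` B \<inter> space M \<in> var_sigma M e"
      unfolding var_sigma_def using B by (intro in_vimage_algebra)
    moreover have "Y -` C \<inter> space M \<in> path_sigma M X {0..}"
      using measurable_sets[OF YA C] by (simp add: A)
    ultimately have "prob ((e -` B \<inter> space M) \<inter> (Y -` C \<inter> space M)) = prob (e -` B \<inter> space M) * prob (Y -` C \<inter> space M)"
      using indep by (intro indep_setD)
    then have "emeasure M (Y -` C \<inter> space M) * emeasure M (e -` B \<inter> space M)
      = emeasure M ((e -` B \<inter> space M) \<inter> (Y -` C \<inter> space M))"
      by (simp add: emeasure_eq_measure ennreal_mult[symmetric] mult.commute)
    also have "(e -` B \<inter> space M) \<inter> (Y -` C \<inter> space M) = (\<lambda>\<omega>. (Y \<omega>, e \<omega>)) -` (C \<times> B) \<inter> space M" by auto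
    finally show "emeasure (path_law x) C * emeasure (distr M lborel e) B
      = emeasure (distr M (path_space \<Otimes>\<^sub>M borel) (\<lambda>\<omega>. (Y \<omega>, e \<omega>))) (C \<times> B)"
      unfolding path_law_def Y_def[symmetric] by (simp add: emeasure_distr)
  qed (auto intro: P.sigma_finite_measure_axioms L.sigma_finite_measure_axioms)
  have F': "case_prod F \<in> borel_measurable (path_law x \<Otimes>\<^sub>M distr M lborel e)"
    using F by (simp cong: measurable_cong_sets)
  have "(\<integral>\<^sup>+\<omega>. F (Y \<omega>) (e \<omega>) \<partial>M) = (\<integral>\<^sup>+z. case_prod F z \<partial>distr M (path_space \<Otimes>\<^sub>M borel) (\<lambda>\<omega>. (Y \<omega>, e \<omega>)))"
    using F by (subst nn_integral_distr) auto
  also have "\<dots> = (\<integral>\<^sup>+f. \<integral>\<^sup>+u. F f u \<partial>distr M lborel e \<partial>path_law x)"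
    unfolding joint[symmetric] using L.nn_integral_fst[OF F'] by simp
  also have "\<dots> = (\<integral>\<^sup>+f. (\<integral>\<^sup>+u\<in>{0..}. F f u * ennreal (r * exp (- r * u)) \<partial>lborel) \<partial>path_law x)"
  proof (rule nn_integral_cong)
    fix f assume "f \<in> space (path_law x)"
    then have c: "(\<lambda>_. f) \<in> measurable borel path_space" by simp
    have [measurable]: "F f \<in> borel_measurable borel"
      by (rule measurable_case_prod_comp[OF F c]) simp
    show "(\<integral>\<^sup>+u. F f u \<partial>distr M lborel e) = (\<integral>\<^sup>+u\<in>{0..}. F f u * ennreal (r * exp (- r * u)) \<partial>lborel)"
      unfolding distributed_distr_eq_density[OF e]
      by (subst nn_integral_density)
         (auto intro!: nn_integral_cong simp: exponential_density_def indicator_def mult.commute)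
  qed
  finally show ?thesis by (simp add: Y_def)
qed

text \<open>The process need not start exactly at \<open>0\<close> and is unconstrained at negative times, so it is first replaced
by a path in \<open>path_set\<close> with the same values on \<open>[0,\<infinity>)\<close>; this is why \<open>F\<close> must ignore negative times.\<close>

lemma integral_at_exponential_time:
  assumes e: "distributed M lborel e (exponential_density r)" and r: "0 < r"
    and indep: "indep_set (var_sigma M e) (path_sigma M X {0..})"
    and F: "case_prod F \<in> borel_measurable (path_space \<Otimes>\<^sub>M borel)" and F_nonneg: "\<And>f u. 0 \<le> F f u"
    and F_cong: "\<And>f g u. (\<And>t. 0 \<le> t \<Longrightarrow> f t = g t) \<Longrightarrow> F f u = F g u"
  shows "(\<integral>\<omega>. F (\<lambda>t. x + X t \<omega>) (e \<omega>) \<partial>M)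
    = r * enn2real (\<integral>\<^sup>+f. (\<integral>\<^sup>+u\<in>{0..}. ennreal (F f u * exp (- r * u)) \<partial>lborel) \<partial>path_law x)"
proof -
  note [measurable (raw)] = measurable_case_prod_comp[OF F]
  have e_meas[measurable]: "e \<in> borel_measurable M" using distributed_measurable[OF e] by simp
  have [measurable]: "X 0 \<in> borel_measurable M" by (rule rv) simp
  define Y where "Y \<omega> = (\<lambda>t. (x + X 0 \<omega>) + increments 0 \<omega> t)" for \<omega>
  have Y[measurable]: "Y \<in> measurable M path_space" unfolding Y_def by measurable
  have eq: "F (\<lambda>t. x + X t \<omega>) (e \<omega>) = F (Y \<omega>) (e \<omega>)" for \<omega>
    by (rule F_cong) (simp add: Y_def increments_def)
  have "(\<integral>\<omega>. F (\<lambda>t. x + X t \<omega>) (e \<omega>) \<partial>M) = enn2real (\<integral>\<^sup>+\<omega>. ennreal (F (Y \<omega>) (e \<omega>)) \<partial>M)"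
    unfolding eq by (rule integral_eq_nn_integral) (measurable, simp add: F_nonneg)
  also have "(\<integral>\<^sup>+\<omega>. ennreal (F (Y \<omega>) (e \<omega>)) \<partial>M) = (\<integral>\<^sup>+\<omega>. ennreal (F (\<lambda>t. x + increments 0 \<omega> t) (e \<omega>)) \<partial>M)"
    using start by (intro nn_integral_cong_AE) (auto simp: Y_def elim!: eventually_mono)
  also have "\<dots> = (\<integral>\<^sup>+f. (\<integral>\<^sup>+u\<in>{0..}. ennreal (F f u) * ennreal (r * exp (- r * u)) \<partial>lborel) \<partial>path_law x)"
    by (rule nn_integral_independent_exponential_time[OF e indep]) measurable
  also have "\<dots> = (\<integral>\<^sup>+f. ennreal r * (\<integral>\<^sup>+u\<in>{0..}. ennreal (F f u * exp (- r * u)) \<partial>lborel) \<partial>path_law x)"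
  proof (rule nn_integral_cong)
    fix f assume "f \<in> space (path_law x)"
    then have c: "(\<lambda>_. f) \<in> measurable borel path_space" by simp
    have [measurable]: "F f \<in> borel_measurable borel"
      by (rule measurable_case_prod_comp[OF F c]) simp
    have "(\<integral>\<^sup>+u\<in>{0..}. ennreal (F f u) * ennreal (r * exp (- r * u)) \<partial>lborel)
      = (\<integral>\<^sup>+u. ennreal r * (ennreal (F f u * exp (- r * u)) * indicator {0..} u) \<partial>lborel)"
      using r F_nonneg by (intro nn_integral_cong) (simp add: ennreal_mult mult_ac)
    then show "(\<integral>\<^sup>+u\<in>{0..}. ennreal (F f u) * ennreal (r * exp (- r * u)) \<partial>lborel)
      = ennreal r * (\<integral>\<^sup>+u\<in>{0..}. ennreal (F f u * exp (- r * u)) \<partial>lborel)"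
      by (simp add: nn_integral_cmult)
  qed
  also have "\<dots> = ennreal r * (\<integral>\<^sup>+f. (\<integral>\<^sup>+u\<in>{0..}. ennreal (F f u * exp (- r * u)) \<partial>lborel) \<partial>path_law x)"
    by (rule nn_integral_cmult) measurable
  finally show ?thesis using r by (simp add: enn2real_mult)
qed

lemma start_in_path_set: "\<omega> \<in> space M \<Longrightarrow> (\<lambda>t. x + X (max 0 t) \<omega>) \<in> path_set"
  using translate_in_path_set[OF increments_in_path_set[of \<omega> 0], of "x + X 0 \<omega>"]
  by (simp add: increments_def)

lemma kill_occ_process:
  assumes "\<omega> \<in> space M" "0 \<le> t"
  shows "kill (occ_rate p q) t (\<lambda>t. x + X t \<omega>) = exp (- p * t - q * occupation_time (\<lambda>t. x + X t \<omega>) t)"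
proof -
  have "kill (occ_rate p q) t (\<lambda>t. x + X t \<omega>) = kill (occ_rate p q) t (\<lambda>t. x + X (max 0 t) \<omega>)"
    by (rule kill_cong) simp
  also have "\<dots> = exp (- p * t - q * occupation_time (\<lambda>t. x + X (max 0 t) \<omega>) t)"
    by (rule kill_occ_eq[OF start_in_path_set[OF assms(1)] assms(2)])
  also have "occupation_time (\<lambda>t. x + X (max 0 t) \<omega>) t = occupation_time (\<lambda>t. x + X t \<omega>) t"
    unfolding occupation_time_def by (rule set_lebesgue_integral_cong) auto
  finally show ?thesis .
qed

text \<open>The first expectation is \<open>r\<close> times the last exit potential, whose two terms are given by
\<open>occ_potential_neg_exp\<close> at rate \<open>p + r\<close>.\<close>

theorem last_positive_time_before_exponential_time:
  fixes x :: real
  assumes W: "is_scale_function psi (p + r + q) (W (p + r + q))"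
    and p: "0 < p" and q: "0 < q" and r: "0 < r" and \<theta>: "0 < \<theta>"
    and e: "distributed M lborel e (exponential_density r)"
    and indep: "indep_set (var_sigma M e) (path_sigma M X {0..})"
  defines "Y \<equiv> \<lambda>\<omega> t. x + X t \<omega>" and "T \<equiv> \<lambda>\<omega>. last_positive_time (\<lambda>t. x + X t \<omega>) (e \<omega>)"
    and "Z \<equiv> scale_Z psi W (p + r + q) x" and "Q \<equiv> exponent_quotient psi (p + r + q)"
  shows "(LINT \<omega>:{\<omega> \<in> space M. T \<omega> < e \<omega>}|M.
      exp (- p * T \<omega> + \<theta> * Y \<omega> (T \<omega>) - q * occupation_time (Y \<omega>) (T \<omega>)))
    = 1 / q * (kappa (p + r + q) - kappa (p + r)) * Z (kappa (p + r)) * (Q (\<theta> + kappa r) - Q \<theta>) + Z \<theta> - Z (\<theta> + kappa r)"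
proof -
  define F where "F f u = (if last_positive_time f u < u
    then exit_value p q \<theta> f u else 0)" for f u
  have "(LINT \<omega>:{\<omega> \<in> space M. T \<omega> < e \<omega>}|M.
      exp (- p * T \<omega> + \<theta> * Y \<omega> (T \<omega>) - q * occupation_time (Y \<omega>) (T \<omega>))) = (\<integral>\<omega>. F (\<lambda>t. x + X t \<omega>) (e \<omega>) \<partial>M)"
    unfolding set_lebesgue_integral_def
  proof (rule Bochner_Integration.integral_cong)
    fix \<omega> assume \<omega>: "\<omega> \<in> space M"
    have T: "0 \<le> T \<omega>" by (simp add: T_def last_positive_time_nonneg)
    have k: "kill (occ_rate p q) (T \<omega>) (Y \<omega>) * exp (\<theta> * Y \<omega> (T \<omega>)) =
      exp (- p * T \<omega> + \<theta> * Y \<omega> (T \<omega>) - q * occupation_time (Y \<omega>) (T \<omega>))"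
      unfolding Y_def kill_occ_process[OF \<omega> T] exp_add[symmetric] by simp
    show "indicator {\<omega> \<in> space M. T \<omega> < e \<omega>} \<omega> *\<^sub>R exp (- p * T \<omega> + \<theta> * Y \<omega> (T \<omega>) - q * occupation_time (Y \<omega>) (T \<omega>))
      = F (\<lambda>t. x + X t \<omega>) (e \<omega>)"
      unfolding k[symmetric] unfolding F_def T_def Y_def using \<omega> by (simp add: indicator_def)
  qed simp
  also have "\<dots> = r * enn2real (\<integral>\<^sup>+f. (\<integral>\<^sup>+u\<in>{0..}. ennreal (F f u * exp (- r * u)) \<partial>lborel) \<partial>path_law x)"
  proof (rule integral_at_exponential_time[OF e r indep])
    show "case_prod F \<in> borel_measurable (path_space \<Otimes>\<^sub>M borel)"
      unfolding F_def[abs_def] split_beta' by measurable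
    show "0 \<le> F f u" for f u by (simp add: F_def kill_def)
    show "F f u = F g u" if fg: "\<And>t. 0 \<le> t \<Longrightarrow> f t = g t" for f g u
    proof -
      have T: "last_positive_time f u = last_positive_time g u" by (rule last_positive_time_cong) (rule fg)
      have "kill (occ_rate p q) s f = kill (occ_rate p q) s g" for s by (rule kill_cong) (rule fg)
      then show ?thesis by (simp add: F_def T fg[OF last_positive_time_nonneg])
    qed
  qed
  also have "\<dots> = r * enn2real (\<integral>\<^sup>+f. (\<integral>\<^sup>+u\<in>{0..}. (if last_positive_time f u < u
      then ennreal (exit_value p q \<theta> f u * exp (- r * u))
      else 0) \<partial>lborel) \<partial>path_law x)"
    by (intro arg_cong[where f="\<lambda>z. r * enn2real z"] nn_integral_cong) (simp add: F_def)
  also have "\<dots> = (Z \<theta> - 1 / q * (kappa (p + r + q) - kappa (p + r)) * Q \<theta> * Z (kappa (p + r)))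
     - (Z (\<theta> + kappa r) - 1 / q * (kappa (p + r + q) - kappa (p + r)) * Q (\<theta> + kappa r) * Z (kappa (p + r)))"
    unfolding Z_def Q_def using p q r \<theta> kappa_pos[OF r] W
    by (subst last_exit_potential[OF p r q W]) (simp_all only: occ_potential_neg_exp add_pos_pos less_imp_le)
  also have "\<dots> = 1 / q * (kappa (p + r + q) - kappa (p + r)) * Z (kappa (p + r)) * (Q (\<theta> + kappa r) - Q \<theta>) + Z \<theta> - Z (\<theta> + kappa r)"
  proof -
    have "(z1 - c * q1 * k) - (z2 - c * q2 * k) = c * k * (q2 - q1) + z1 - z2" for z1 z2 c q1 q2 k :: real
      by (simp add: algebra_simps)
    then show ?thesis .
  qed
  finally show ?thesis .
qed

text \<open>The last positive time before \<open>u\<close> equals \<open>u\<close> exactly when \<open>f u \<ge> 0\<close>, for almost all \<open>u\<close> along almost every path.\<close>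

theorem last_positive_time_at_exponential_time:
  fixes x :: real
  assumes W: "is_scale_function psi (p + r + q) (W (p + r + q))"
    and p: "0 < p" and q: "0 < q" and r: "0 < r" and \<theta>: "0 < \<theta>"
    and e: "distributed M lborel e (exponential_density r)"
    and indep: "indep_set (var_sigma M e) (path_sigma M X {0..})"
  defines "Y \<equiv> \<lambda>\<omega> t. x + X t \<omega>" and "T \<equiv> \<lambda>\<omega>. last_positive_time (\<lambda>t. x + X t \<omega>) (e \<omega>)"
  shows "(LINT \<omega>:{\<omega> \<in> space M. T \<omega> = e \<omega>}|M.
      exp (- p * T \<omega> - q * occupation_time (Y \<omega>) (T \<omega>) - \<theta> * Y \<omega> (T \<omega>)))
    = r * (1 / q * ((kappa (p + r + q) - kappa (p + r)) / (\<theta> + kappa (p + r + q))) * scale_Z psi W (p + r + q) x (kappa (p + r))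
      - (LBINT y:{0..x}. exp (- \<theta> * y) * W (p + r + q) (x - y)))"
proof -
  have pr: "0 < p + r" "0 < p + r + q" using p q r by simp_all
  define F where "F f u = (if last_positive_time f u = u then kill (occ_rate p q) u f * exp (- \<theta> * f u) else 0)" for f u
  have "(LINT \<omega>:{\<omega> \<in> space M. T \<omega> = e \<omega>}|M.
      exp (- p * T \<omega> - q * occupation_time (Y \<omega>) (T \<omega>) - \<theta> * Y \<omega> (T \<omega>))) = (\<integral>\<omega>. F (\<lambda>t. x + X t \<omega>) (e \<omega>) \<partial>M)"
    unfolding set_lebesgue_integral_def
  proof (rule Bochner_Integration.integral_cong)
    fix \<omega> assume \<omega>: "\<omega> \<in> space M"
    have T: "0 \<le> T \<omega>" by (simp add: T_def last_positive_time_nonneg)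
    have k: "kill (occ_rate p q) (T \<omega>) (Y \<omega>) * exp (- \<theta> * Y \<omega> (T \<omega>)) =
      exp (- p * T \<omega> - q * occupation_time (Y \<omega>) (T \<omega>) - \<theta> * Y \<omega> (T \<omega>))"
      unfolding Y_def kill_occ_process[OF \<omega> T] exp_add[symmetric] by simp
    show "indicator {\<omega> \<in> space M. T \<omega> = e \<omega>} \<omega> *\<^sub>R exp (- p * T \<omega> - q * occupation_time (Y \<omega>) (T \<omega>) - \<theta> * Y \<omega> (T \<omega>))
      = F (\<lambda>t. x + X t \<omega>) (e \<omega>)"
      unfolding k[symmetric] unfolding F_def T_def Y_def using \<omega> by (simp add: indicator_def)
  qed simp
  also have "\<dots> = r * enn2real (\<integral>\<^sup>+f. (\<integral>\<^sup>+u\<in>{0..}. ennreal (F f u * exp (- r * u)) \<partial>lborel) \<partial>path_law x)"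
  proof (rule integral_at_exponential_time[OF e r indep])
    show "case_prod F \<in> borel_measurable (path_space \<Otimes>\<^sub>M borel)"
      unfolding F_def[abs_def] split_beta' by measurable
    show "0 \<le> F f u" for f u by (simp add: F_def kill_def)
    show "F f u = F g u" if fg: "\<And>t. 0 \<le> t \<Longrightarrow> f t = g t" for f g u
    proof (cases "0 \<le> u")
      case True
      have T: "last_positive_time f u = last_positive_time g u" by (rule last_positive_time_cong) (rule fg)
      have "kill (occ_rate p q) u f = kill (occ_rate p q) u g" by (rule kill_cong) (rule fg)
      then show ?thesis by (simp add: F_def T fg[OF True])
    next
      case False
      then show ?thesis using last_positive_time_nonneg[of f u] last_positive_time_nonneg[of g u] by (auto simp: F_def)
    qed
  qed
  also have "(\<integral>\<^sup>+f. (\<integral>\<^sup>+u\<in>{0..}. ennreal (F f u * exp (- r * u)) \<partial>lborel) \<partial>path_law x)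
    = potential (occ_weight (p + r) q) (\<lambda>z. ennreal (exp (- \<theta> * z)) * indicator {0..} z) x"
    unfolding potential_def
  proof (rule nn_integral_cong_AE)
    show "AE f in path_law x. (\<integral>\<^sup>+u\<in>{0..}. ennreal (F f u * exp (- r * u)) \<partial>lborel)
      = (\<integral>\<^sup>+u\<in>{0..}. occ_weight (p + r) q u f * (ennreal (exp (- \<theta> * f u)) * indicator {0..} (f u)) \<partial>lborel)"
      using AE_path_nonzero[OF pr(2) W] AE_space
    proof eventually_elim
      case (elim f)
      then have f: "f \<in> path_set" by simp
      show ?case
      proof (rule nn_integral_cong_AE)
        have "AE u in lborel. u \<noteq> (0 :: real)" by (rule AE_lborel_singleton)
        with elim(1) last_positive_time_less_of_negative[OF f]
        show "AE u in lborel. ennreal (F f u * exp (- r * u)) * indicator {0..} u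
          = occ_weight (p + r) q u f * (ennreal (exp (- \<theta> * f u)) * indicator {0..} (f u)) * indicator {0..} u"
        proof eventually_elim
          case (elim u)
          show ?case
          proof (cases "0 < u")
            case True
            have "last_positive_time f u \<le> u" using True by (intro last_positive_time_bounds) simp
            moreover have "f u \<le> 0" if "last_positive_time f u < u"
              using nonpos_after_last_positive_time[of f u u] that by simp
            ultimately have "last_positive_time f u = u \<longleftrightarrow> 0 \<le> f u" using elim True by force
            moreover have "ennreal (kill (occ_rate p q) u f * exp (- \<theta> * f u) * exp (- r * u))
              = ennreal (exp (- r * u) * kill (occ_rate p q) u f) * ennreal (exp (- \<theta> * f u))"
              by (simp add: ennreal_mult'[symmetric] mult_ac kill_def)
            ultimately show ?thesis using True
              unfolding F_def occ_weight_def kill_occ_add_rate[OF f less_imp_le[OF True]] by (simp add: indicator_def)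
          qed (use elim in \<open>simp add: indicator_def\<close>)
        qed
      qed
    qed
  qed
  finally show ?thesis unfolding occ_potential_pos_exp[of "p + r" q W \<theta> x, OF pr(1) q W \<theta>] .
qed

end

theorem theorem3p2:
  fixes M :: "'a measure" and X :: "real \<Rightarrow> 'a \<Rightarrow> real" and e :: "'a \<Rightarrow> real"
    and W :: "real \<Rightarrow> real \<Rightarrow> real" and p q r \<theta> x :: real
  assumes "spectrally_negative_levy M X"
    and "\<forall>u\<ge>0. is_scale_function (laplace_exponent M X) u (W u)"
    and "0 < p" and "0 < q" and "0 < r" and "0 < \<theta>"
    and "distributed M lborel e (exponential_density r)"
    and "prob_space.indep_set M (var_sigma M e) (path_sigma M X {0..})"
  shows
    "let \<psi> = laplace_exponent M X;
         \<Phi> = right_inverse \<psi>;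
         Z = scale_Z \<psi> W;
         Y = (\<lambda>\<omega> t. x + X t \<omega>);
         T = (\<lambda>\<omega>. last_positive_time (Y \<omega>) (e \<omega>))
     in
       (LINT \<omega>:{\<omega> \<in> space M. T \<omega> < e \<omega>}|M.
          exp (- p * T \<omega> + \<theta> * Y \<omega> (T \<omega>) - q * occupation_time (Y \<omega>) (T \<omega>)))
       = 1 / q * (\<Phi> (p + q + r) - \<Phi> (p + r)) * Z (p + q + r) x (\<Phi> (p + r))
           * (exponent_quotient \<psi> (p + q + r) (\<theta> + \<Phi> r)
              - exponent_quotient \<psi> (p + q + r) \<theta>)
         + Z (p + q + r) x \<theta> - Z (p + q + r) x (\<theta> + \<Phi> r)
       \<and>
       (LINT \<omega>:{\<omega> \<in> space M. T \<omega> = e \<omega>}|M.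
          exp (- p * T \<omega> - q * occupation_time (Y \<omega>) (T \<omega>) - \<theta> * Y \<omega> (T \<omega>)))
       = r / q * ((\<Phi> (p + q + r) - \<Phi> (p + r)) / (\<theta> + \<Phi> (p + q + r)))
           * Z (p + q + r) x (\<Phi> (p + r))
         - r * (LBINT y:{0..x}. exp (- \<theta> * y) * W (p + q + r) (x - y))"
proof -
  interpret spectrally_negative_levy M X by fact
  have c: "p + q + r = p + r + q" by simp
  have W: "is_scale_function psi (p + r + q) (W (p + r + q))" using assms by simp
  have \<Phi>: "right_inverse psi r = kappa r" "right_inverse psi (p + r) = kappa (p + r)"
    "right_inverse psi (p + r + q) = kappa (p + r + q)"
    using assms by (auto intro!: right_inverse_psi)
  show ?thesis
    unfolding Let_def c \<Phi>
  proof
    show "(LINT \<omega>:{\<omega> \<in> space M. last_positive_time (\<lambda>t. x + X t \<omega>) (e \<omega>) < e \<omega>}|M.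
        exp (- p * last_positive_time (\<lambda>t. x + X t \<omega>) (e \<omega>) + \<theta> * (x + X (last_positive_time (\<lambda>t. x + X t \<omega>) (e \<omega>)) \<omega>)
          - q * occupation_time (\<lambda>t. x + X t \<omega>) (last_positive_time (\<lambda>t. x + X t \<omega>) (e \<omega>))))
      = 1 / q * (kappa (p + r + q) - kappa (p + r)) * scale_Z psi W (p + r + q) x (kappa (p + r))
          * (exponent_quotient psi (p + r + q) (\<theta> + kappa r) - exponent_quotient psi (p + r + q) \<theta>)
        + scale_Z psi W (p + r + q) x \<theta> - scale_Z psi W (p + r + q) x (\<theta> + kappa r)"
      by (rule last_positive_time_before_exponential_time[where W=W, OF W assms(3-8)])
    show "(LINT \<omega>:{\<omega> \<in> space M. last_positive_time (\<lambda>t. x + X t \<omega>) (e \<omega>) = e \<omega>}|M.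
        exp (- p * last_positive_time (\<lambda>t. x + X t \<omega>) (e \<omega>)
          - q * occupation_time (\<lambda>t. x + X t \<omega>) (last_positive_time (\<lambda>t. x + X t \<omega>) (e \<omega>))
          - \<theta> * (x + X (last_positive_time (\<lambda>t. x + X t \<omega>) (e \<omega>)) \<omega>)))
      = r / q * ((kappa (p + r + q) - kappa (p + r)) / (\<theta> + kappa (p + r + q))) * scale_Z psi W (p + r + q) x (kappa (p + r))
        - r * (LBINT y:{0..x}. exp (- \<theta> * y) * W (p + r + q) (x - y))"
      unfolding last_positive_time_at_exponential_time[where W=W, OF W assms(3-8)] by (simp add: right_diff_distrib)
  qed
qed

end
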